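(* Let $\epsilon=\epsilon(n)$ and $p=p(n)$ satisfy $\epsilon^{11} n p^{8} \gg \log^{5} n$. Then for every sufficiently large even integer $n$, every $(\epsilon,p)$-uniform digraph $D$ on $n$ vertices has a collection of pairwise edge-disjoint directed Hamilton cycles whose union contains all edges of $D$ except at most an $\epsilon^{1/8}$-fraction of them.
   Context: Digraphs have no loops and no repeated edges in the same direction, but may contain both $\overrightarrow{ab}$ and $\overrightarrow{ba}$. We write $A=(1\pm\epsilon)B$ for $(1-\epsilon)B\le A\le(1+\epsilon)B$. An $n$-vertex digraph is $(\epsilon,p)$-uniform if: (i) every vertex has out-degree and in-degree $(1\pm\epsilon)np$; (ii) for every pair of distinct vertices $a,b$, the number of common out-neighbours, the number of common in-neighbours, and the number of out-neighbours of $a$ that are in-neighbours of $b$ are each $(1\pm\epsilon)np^2$; (iii) for any four vertices $a,b,c,d$, all distinct except that possibly $b=c$, the number of vertices $x$ such that $\overrightarrow{ax},\overrightarrow{xb},\overrightarrow{cx},\overrightarrow{xd}$ are all edges is $(1\pm\epsilon)np^4$. Here $\epsilon,p$ are functions of $n$, $f\gg g$ means $f/g\to\infty$ as $n\to\infty$, and $\epsilon,p$ are implicitly assumed small (e.g. less than $1/10$). *)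

theory Defs
  imports Complex_Main "Graph_Theory.Graph_Theory"
begin

definition approx_within :: "real \<Rightarrow> real \<Rightarrow> real \<Rightarrow> bool" where
  "approx_within \<epsilon> A B \<longleftrightarrow> (1 - \<epsilon>) * B \<le> A \<and> A \<le> (1 + \<epsilon>) * B"

text \<open>In the last clause \<open>b\<close> and \<open>c\<close> are deliberately not required to be distinct.\<close>

definition uniform_digraph :: "real \<Rightarrow> real \<Rightarrow> ('a, 'b) pre_digraph \<Rightarrow> bool" where
  "uniform_digraph \<epsilon> p G \<longleftrightarrow>
    (let n = real (card (verts G)) in
      (\<forall>v \<in> verts G.
         approx_within \<epsilon> (real (out_degree G v)) (n * p) \<and>
         approx_within \<epsilon> (real (in_degree G v)) (n * p)) \<and>
      (\<forall>a \<in> verts G. \<forall>b \<in> verts G. a \<noteq> b \<longrightarrow>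
         approx_within \<epsilon> (real (card {x \<in> verts G. a \<rightarrow>\<^bsub>G\<^esub> x \<and> b \<rightarrow>\<^bsub>G\<^esub> x})) (n * p ^ 2) \<and>
         approx_within \<epsilon> (real (card {x \<in> verts G. x \<rightarrow>\<^bsub>G\<^esub> a \<and> x \<rightarrow>\<^bsub>G\<^esub> b})) (n * p ^ 2) \<and>
         approx_within \<epsilon> (real (card {x \<in> verts G. a \<rightarrow>\<^bsub>G\<^esub> x \<and> x \<rightarrow>\<^bsub>G\<^esub> b})) (n * p ^ 2)) \<and>
      (\<forall>a \<in> verts G. \<forall>b \<in> verts G. \<forall>c \<in> verts G. \<forall>d \<in> verts G.
         a \<noteq> b \<and> a \<noteq> c \<and> a \<noteq> d \<and> b \<noteq> d \<and> c \<noteq> d \<longrightarrow>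
         approx_within \<epsilon>
           (real (card {x \<in> verts G. a \<rightarrow>\<^bsub>G\<^esub> x \<and> x \<rightarrow>\<^bsub>G\<^esub> b \<and> c \<rightarrow>\<^bsub>G\<^esub> x \<and> x \<rightarrow>\<^bsub>G\<^esub> d}))
           (n * p ^ 4)))"

text \<open>A cycle is given by its list of arcs; the tails of these arcs are exactly the vertices
  it visits. Rotations of the list describe the same cycle, but two of them are never arc-disjoint.\<close>

definition hamilton_cycle :: "('a, 'b) pre_digraph \<Rightarrow> 'b awalk \<Rightarrow> bool" where
  "hamilton_cycle G c \<longleftrightarrow> pre_digraph.cycle G c \<and> tail G ` set c = verts G"

end

theory Submission
  imports Defs "HOL-Computational_Algebra.Primes" "HOL-Real_Asymp.Real_Asymp" "HOL-Analysis.Convex"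
    "HOL-Combinatorics.Permutations" "HOL-Number_Theory.Cong" "HOL-Library.FuncSet"
begin

text \<open>By Hall's theorem and the codegree bounds, a uniform digraph contains a spanning
  \<open>r\<close>-regular subdigraph \<open>F\<close> with almost all of its arcs. Partition the vertices at random into a prime
  number \<open>K\<close> of parts and colour the arcs at random; the arcs of three of the \<open>B\<close> colours are set aside.
  By Koenig's theorem the other arcs of \<open>F\<close> between any two parts decompose into \<open>\<Delta>\<close> almost perfect
  matchings of almost equal size. For \<open>0 < j < K\<close> and \<open>t < \<Delta>\<close>, the \<open>t\<close>-th matchings from part \<open>c\<close> to
  part \<open>c + j\<close> run through all parts cyclically; after deleting those at two consecutive parts,
  they form a system of paths through the other parts. Since there are about as many paths as
  vertices in the two omitted parts, the paths can be arranged in a random cyclic order and linked by single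
  vertices of these parts, along arcs that were set aside: the number of vertices that link two given pairs
  of paths is controlled by the four-arc condition, which gives Hall's condition for the linking.
  No arc set aside is wanted by too many of the \<open>(K - 1) \<Delta>\<close> systems, so the systems can be closed one after another,
  and the resulting Hamilton cycles cover almost all arcs of \<open>F\<close>.\<close>

section \<open>Regular factors\<close>

text \<open>Every tolerance is measured against \<open>d\<close> = (n/K)(p/B)^2, the typical number
  of reserved link vertices between two given vertices inside one part. A vertex and a part occur in
  given roles in about np/K^2 systems, and this usage must stay far below \<open>d\<close>; so
  \<open>K\<close> has to exceed B^2/p by a large constant, and the search for a prime costs one
  more logarithm. The gaps of the matchings of one system add up to order \<tau> n and must also
  stay below \<open>d\<close>, which makes the tolerance \<tau> of order p^2/(K B^2). Degrees of
  order np/K concentrate that sharply only if n p^5 is at least of order K^3 B^4 log n. With K about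
  (B^2/p) log n, this is where p^8 and four of the five logarithms come from; the fifth absorbs the
  constants. Measured in numbers of cycles, the regular factor costs a share of order sqrt
  \<epsilon>, the reserve 3/B and the arcs inside parts 1/K; taking B of order \<epsilon>^(-1/8)
  keeps the total below \<epsilon>^(1/8).\<close>

lemma hall_marriage:
  fixes S :: "'i \<Rightarrow> 'a set"
  assumes "finite I" and "\<And>i. i \<in> I \<Longrightarrow> finite (S i)"
    and "\<And>J. J \<subseteq> I \<Longrightarrow> card J \<le> card (\<Union>i\<in>J. S i)"
  shows "\<exists>f. inj_on f I \<and> (\<forall>i\<in>I. f i \<in> S i)"
  using assms
proof (induction "card I" arbitrary: I S rule: less_induct)
  case less
  note fin = less.prems(1) and finS = less.prems(2) and hall = less.prems(3)
  show ?case
  proof (cases "I = {}")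
    case True
    then show ?thesis by auto
  next
    case False
    then obtain i where i: "i \<in> I" by auto
    \<comment> \<open>The Halmos-Vaughan dichotomy: a tight proper subfamily is matched on its own
      and its union is withheld from the others; if there is none, one element may be given away,
      since every smaller nonempty subfamily has one to spare.\<close>
    show ?thesis
    proof (cases "\<exists>J. J \<subset> I \<and> J \<noteq> {} \<and> card J = card (\<Union>i\<in>J. S i)")
      case True
      then obtain J where J: "J \<subset> I" "J \<noteq> {}" "card J = card (\<Union>i\<in>J. S i)" by auto
      have finJ: "finite J" using J fin finite_subset by blast
      have cJ: "card J < card I" using psubset_card_mono[OF fin J(1)] .
      have "\<exists>f. inj_on f J \<and> (\<forall>i\<in>J. f i \<in> S i)"
      proof (rule less.hyps[OF cJ finJ])
        show "finite (S i)" if "i \<in> J" for i using that J finS by auto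
        show "card L \<le> card (\<Union>i\<in>L. S i)" if "L \<subseteq> J" for L using that J by (intro hall) auto
      qed
      then obtain f where f: "inj_on f J" "\<forall>i\<in>J. f i \<in> S i" by auto
      let ?U = "\<Union>i\<in>J. S i"
      have finU: "finite ?U" using finJ finS J by auto
      have cIJ: "card (I - J) < card I"
        using J fin finJ by (intro psubset_card_mono) auto
      have "\<exists>g. inj_on g (I - J) \<and> (\<forall>i\<in>I - J. g i \<in> S i - ?U)"
      proof (rule less.hyps[OF cIJ])
        show "finite (I - J)" using fin by auto
        show "finite (S i - ?U)" if "i \<in> I - J" for i using that finS by auto
        show "card L \<le> card (\<Union>i\<in>L. S i - ?U)" if L: "L \<subseteq> I - J" for L
        proof -
          have finL: "finite L" using L fin finite_subset by blast
          have "card (L \<union> J) \<le> card (\<Union>i\<in>L \<union> J. S i)" using hall[of "L \<union> J"] L J by auto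
          moreover have "card (L \<union> J) = card L + card J"
            using L finL finJ by (intro card_Un_disjoint) auto
          moreover have "(\<Union>i\<in>L \<union> J. S i) = (\<Union>i\<in>L. S i - ?U) \<union> ?U" by auto
          moreover have "card ((\<Union>i\<in>L. S i - ?U) \<union> ?U) = card (\<Union>i\<in>L. S i - ?U) + card ?U"
            using finL finS L finU by (intro card_Un_disjoint) auto
          ultimately show ?thesis using J(3) by simp
        qed
      qed
      then obtain g where g: "inj_on g (I - J)" "\<forall>i\<in>I - J. g i \<in> S i - ?U" by auto
      let ?h = "\<lambda>i. if i \<in> J then f i else g i"
      have "inj_on ?h I"
      proof (rule inj_onI)
        fix x y assume xy: "x \<in> I" "y \<in> I" "?h x = ?h y"
        show "x = y"
        proof (cases "x \<in> J"; cases "y \<in> J")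
          assume "x \<in> J" "y \<in> J" then show ?thesis using xy f(1) by (simp add: inj_on_def)
        next
          assume "x \<in> J" "y \<notin> J"
          then have "f x \<in> ?U" "g y \<notin> ?U" using xy(1,2) f(2) g(2) by auto
          then show ?thesis using xy \<open>x \<in> J\<close> \<open>y \<notin> J\<close> by simp
        next
          assume "x \<notin> J" "y \<in> J"
          then have "f y \<in> ?U" "g x \<notin> ?U" using xy(1,2) f(2) g(2) by auto
          then show ?thesis using xy \<open>x \<notin> J\<close> \<open>y \<in> J\<close> by simp
        next
          assume "x \<notin> J" "y \<notin> J" then show ?thesis using xy g(1) by (simp add: inj_on_def)
        qed
      qed
      moreover have "\<forall>i\<in>I. ?h i \<in> S i" using f g by auto
      ultimately show ?thesis by (intro exI[of _ ?h] conjI)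
    next
      case noJ: False
      have "card {i} \<le> card (\<Union>i\<in>{i}. S i)" using hall[of "{i}"] i by blast
      then have "S i \<noteq> {}" by auto
      then obtain a where a: "a \<in> S i" by auto
      have cI: "card (I - {i}) < card I" using i fin by (intro psubset_card_mono) auto
      have "\<exists>g. inj_on g (I - {i}) \<and> (\<forall>j\<in>I - {i}. g j \<in> S j - {a})"
      proof (rule less.hyps[OF cI])
        show "finite (I - {i})" using fin by auto
        show "finite (S j - {a})" if "j \<in> I - {i}" for j using that finS by auto
        show "card L \<le> card (\<Union>j\<in>L. S j - {a})" if L: "L \<subseteq> I - {i}" for L
        proof (cases "L = {}")
          case False
          have LI: "L \<subset> I" using L i by auto
          then have "card L \<noteq> card (\<Union>j\<in>L. S j)" "card L \<le> card (\<Union>j\<in>L. S j)"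
            using noJ False hall[of L] by auto
          moreover have eq: "(\<Union>j\<in>L. S j - {a}) = (\<Union>j\<in>L. S j) - {a}" by auto
          moreover have "card (\<Union>j\<in>L. S j) - 1 \<le> card ((\<Union>j\<in>L. S j) - {a})"
            by (simp add: card_Diff_singleton_if)
          ultimately show ?thesis unfolding eq by linarith
        qed auto
      qed
      then obtain g where g: "inj_on g (I - {i})" "\<forall>j\<in>I - {i}. g j \<in> S j - {a}" by auto
      let ?h = "\<lambda>j. if j = i then a else g j"
      have "inj_on ?h I" using g by (auto simp: inj_on_def)
      moreover have "\<forall>j\<in>I. ?h j \<in> S j" using g a by auto
      ultimately show ?thesis by (intro exI[of _ ?h] conjI)
    qed
  qed
qed

text \<open>Hall's theorem with tokens: an arc may claim one of \<open>r\<close> tokens at its head,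
  or one of the surplus tokens at its tail, whose number is the out-degree minus \<open>r\<close>.
  The arcs that claim head tokens form \<open>F\<close>. Head tokens keep the in-degrees at most
  \<open>r\<close>, surplus tokens keep the out-degrees at least \<open>r\<close>, and equal sums
  force equality everywhere.\<close>

lemma regular_factor:
  fixes E :: "('a \<times> 'a) set"
  assumes fV: "finite V" and EV: "E \<subseteq> V \<times> V"
    and cond: "\<And>X Y. X \<subseteq> V \<Longrightarrow> Y \<subseteq> V \<Longrightarrow>
      r * card X + r * card Y \<le> card (E \<inter> X \<times> Y) + r * card V"
  shows "\<exists>F\<subseteq>E. \<forall>v\<in>V. card (F `` {v}) = r \<and> card (F\<inverse> `` {v}) = r"
proof -
  have fE: "finite E" using fV EV finite_subset by blast
  define d where "d x = card (E `` {x})" for x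
  have out: "E \<inter> {x} \<times> V = {x} \<times> E `` {x}" for x using EV by auto
  have dr: "r \<le> d x" if "x \<in> V" for x
    using cond[of "{x}" V] that by (simp add: out d_def card_cartesian_product)
  define S :: "'a \<times> 'a \<Rightarrow> ('a \<times> nat + 'a \<times> nat) set" where
    "S e = Inl ` ({snd e} \<times> {..<r}) \<union> Inr ` ({fst e} \<times> {..<d (fst e) - r})" for e
  have "\<exists>f. inj_on f E \<and> (\<forall>e\<in>E. f e \<in> S e)"
  proof (rule hall_marriage[OF fE])
    show "finite (S e)" for e by (auto simp: S_def)
    fix J assume J: "J \<subseteq> E"
    define X Y where "X = fst ` J" and "Y = snd ` J"
    have fJ: "finite J" using J fE finite_subset by blast
    have XV: "X \<subseteq> V" "Y \<subseteq> V" using J EV by (auto simp: X_def Y_def)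
    have fX: "finite X" "finite Y" using fJ by (auto simp: X_def Y_def)
    have U: "(\<Union>e\<in>J. S e) = Inl ` (Y \<times> {..<r}) \<union> Inr ` (Sigma X (\<lambda>x. {..<d x - r}))"
      by (auto simp: S_def X_def Y_def image_iff)
    have c1: "card (\<Union>e\<in>J. S e) = r * card Y + (\<Sum>x\<in>X. d x - r)"
      unfolding U
      using fX by (subst card_Un_disjoint) (auto simp: card_image card_cartesian_product)
    have c2: "(\<Sum>x\<in>X. d x - r) + r * card X = (\<Sum>x\<in>X. d x)"
    proof -
      have "(\<Sum>x\<in>X. d x) = (\<Sum>x\<in>X. (d x - r) + r)"
        by (intro sum.cong) (use dr XV in auto)
      then show ?thesis by (simp add: sum.distrib)
    qed
    have "(\<Sum>x\<in>X. d x) = card (Sigma X (\<lambda>x. E `` {x}))"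
      using fX fE by (simp add: d_def finite_Image)
    also have "Sigma X (\<lambda>x. E `` {x}) = E \<inter> X \<times> Y \<union> E \<inter> X \<times> (V - Y)" using EV by auto
    also have "card \<dots> = card (E \<inter> X \<times> Y) + card (E \<inter> X \<times> (V - Y))"
      using fE by (intro card_Un_disjoint) auto
    finally have c3: "(\<Sum>x\<in>X. d x) = card (E \<inter> X \<times> Y) + card (E \<inter> X \<times> (V - Y))" .
    have "card J \<le> card (E \<inter> X \<times> Y)"
    proof (rule card_mono)
      show "finite (E \<inter> X \<times> Y)" using fE by auto
      show "J \<subseteq> E \<inter> X \<times> Y" using J by (force simp: X_def Y_def)
    qed
    \<comment> \<open>A deficient set of arcs would leave too few arcs from its tails to the
      vertices that are not among its heads; hence the cut condition is used with
      \<open>V - Y\<close>.\<close>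
    moreover have "r * card X + r * card (V - Y) \<le> card (E \<inter> X \<times> (V - Y)) + r * card V"
      by (rule cond) (use XV in auto)
    moreover have "r * card V = r * card Y + r * card (V - Y)"
      using XV fV fX by (metis add_mult_distrib2 card_Diff_subset card_mono le_add_diff_inverse)
    ultimately show "card J \<le> card (\<Union>e\<in>J. S e)" using c1 c2 c3 by linarith
  qed
  then obtain f where f: "inj_on f E" "\<And>e. e \<in> E \<Longrightarrow> f e \<in> S e" by auto
  define F where "F = {e \<in> E. isl (f e)}"
  have fF: "finite F" "F \<subseteq> E" using fE by (auto simp: F_def)
  have inr: "card (F\<inverse> `` {v}) \<le> r" for v
  proof -
    have "card ((\<lambda>u. f (u, v)) ` (F\<inverse> `` {v})) = card (F\<inverse> `` {v})"
      by (rule card_image) (use f(1) in \<open>auto simp: inj_on_def F_def\<close>)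
    moreover have "(\<lambda>u. f (u, v)) ` (F\<inverse> `` {v}) \<subseteq> Inl ` ({v} \<times> {..<r})"
      using f(2) by (fastforce simp: F_def S_def)
    then have "card ((\<lambda>u. f (u, v)) ` (F\<inverse> `` {v})) \<le> card (Inl ` ({v} \<times> {..<r}) :: ('a \<times> nat + 'a \<times> nat) set)"
      by (intro card_mono) auto
    ultimately show ?thesis by (simp add: card_image card_cartesian_product)
  qed
  have outr: "r \<le> card (F `` {v})" if v: "v \<in> V" for v
  proof -
    let ?D = "{u. (v, u) \<in> E \<and> \<not> isl (f (v, u))}"
    have "?D \<subseteq> snd ` E" by force
    then have fin: "finite ?D" using fE finite_subset by blast
    have "card ((\<lambda>u. f (v, u)) ` ?D) = card ?D"
      by (rule card_image) (use f(1) in \<open>auto simp: inj_on_def\<close>)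
    moreover have "(\<lambda>u. f (v, u)) ` ?D \<subseteq> Inr ` ({v} \<times> {..<d v - r})"
      using f(2) by (fastforce simp: S_def)
    then have "card ((\<lambda>u. f (v, u)) ` ?D) \<le> card (Inr ` ({v} \<times> {..<d v - r}) :: ('a \<times> nat + 'a \<times> nat) set)"
      by (intro card_mono) auto
    ultimately have "card ?D \<le> d v - r" by (simp add: card_image card_cartesian_product)
    moreover have "d v = card (F `` {v}) + card ?D"
    proof -
      have "E `` {v} = F `` {v} \<union> ?D" by (auto simp: F_def)
      moreover have "F `` {v} \<inter> ?D = {}" by (auto simp: F_def)
      moreover have "finite (F `` {v})" using fF by (simp add: finite_Image)
      ultimately show ?thesis unfolding d_def using fin by (simp add: card_Un_disjoint)
    qed
    ultimately show ?thesis using dr[OF v] by linarith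
  qed
  have FV: "F \<subseteq> V \<times> V" using fF EV by auto
  have count: "(\<Sum>v\<in>V. card (G `` {v})) = card G" if "finite G" "G \<subseteq> V \<times> V" for G :: "('a \<times> 'a) set"
  proof -
    have "(\<Sum>v\<in>V. card (G `` {v})) = card (Sigma V (\<lambda>v. G `` {v}))"
      using fV that by (simp add: finite_Image)
    also have "Sigma V (\<lambda>v. G `` {v}) = G" using that by auto
    finally show ?thesis .
  qed
  have s1: "(\<Sum>v\<in>V. card (F `` {v})) = card F" by (rule count) (use fF FV in auto)
  have s2: "(\<Sum>v\<in>V. card (F\<inverse> `` {v})) = card F"
  proof -
    have "F\<inverse> \<subseteq> V \<times> V" using FV by auto
    then show ?thesis using count[of "F\<inverse>"] fF by (simp add: card_inverse)
  qed
  have "(\<Sum>v\<in>V. r) \<le> (\<Sum>v\<in>V. card (F `` {v}))" by (rule sum_mono) (rule outr)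
  moreover have "(\<Sum>v\<in>V. card (F\<inverse> `` {v})) \<le> (\<Sum>v\<in>V. r)" by (rule sum_mono) (rule inr)
  ultimately have eq: "(\<Sum>v\<in>V. card (F `` {v})) = (\<Sum>v\<in>V. r)" "(\<Sum>v\<in>V. card (F\<inverse> `` {v})) = (\<Sum>v\<in>V. r)"
    using s1 s2 by linarith+
  have "card (F `` {v}) = r" if "v \<in> V" for v
    by (rule sum_mono_inv[OF eq(1)[symmetric] outr that fV, symmetric])
  moreover have "card (F\<inverse> `` {v}) = r" if "v \<in> V" for v
    by (rule sum_mono_inv[OF eq(2) inr that fV])
  ultimately show ?thesis using fF(2) by (intro exI[of _ F]) simp
qed

section \<open>Balanced edge colourings\<close>

lemma fill_capacities:
  fixes b :: "'j \<Rightarrow> nat"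
  assumes "finite J" "k \<le> sum b J"
  shows "\<exists>y. (\<forall>j\<in>J. y j \<le> b j) \<and> sum y J = k"
  using assms
proof (induction J arbitrary: k rule: finite_induct)
  case (insert j J)
  have "k - min k (b j) \<le> sum b J" using insert by auto
  then obtain y where y: "\<forall>j\<in>J. y j \<le> b j" "sum y J = k - min k (b j)"
    using insert.IH by blast
  have "sum (y(j := min k (b j))) J = sum y J"
    using insert.hyps by (intro sum.cong) auto
  then show ?case using insert y by (intro exI[of _ "y(j := min k (b j))"]) auto
qed simp

text \<open>Rows are served one after another; the capacity left in the columns suffices because
  total demand does not exceed total capacity. This supplies the multiplicities of the padding edges
  below.\<close>

lemma transport_matrix:
  fixes a :: "'i \<Rightarrow> nat" and b :: "'j \<Rightarrow> nat"
  assumes "finite I" "finite J" "sum a I \<le> sum b J"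
  shows "\<exists>x. (\<forall>i\<in>I. sum (x i) J = a i) \<and> (\<forall>j\<in>J. (\<Sum>i\<in>I. x i j) \<le> b j)"
  using assms(1,3)
proof (induction I rule: finite_induct)
  case empty
  then show ?case by simp
next
  case (insert i I)
  then obtain x where x: "\<forall>i\<in>I. sum (x i) J = a i" "\<forall>j\<in>J. (\<Sum>i\<in>I. x i j) \<le> b j"
    by auto
  let ?c = "\<lambda>j. b j - (\<Sum>i\<in>I. x i j)"
  have "sum ?c J + (\<Sum>j\<in>J. \<Sum>i\<in>I. x i j) = (\<Sum>j\<in>J. ?c j + (\<Sum>i\<in>I. x i j))"
    by (simp add: sum.distrib)
  also have "\<dots> = sum b J" using x(2) by (intro sum.cong) auto
  finally have "sum ?c J + (\<Sum>j\<in>J. \<Sum>i\<in>I. x i j) = sum b J" .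
  moreover have "(\<Sum>j\<in>J. \<Sum>i\<in>I. x i j) = sum a I"
    using x(1) by (subst sum.swap) simp
  ultimately have "a i \<le> sum ?c J" using insert.prems insert.hyps by simp
  from fill_capacities[OF assms(2) this]
  obtain y where y: "\<forall>j\<in>J. y j \<le> ?c j" "sum y J = a i" by blast
  have eq: "(\<Sum>k\<in>I. (x(i := y)) k j) = (\<Sum>k\<in>I. x k j)" for j
    using insert.hyps by (intro sum.cong) auto
  have "(\<Sum>k\<in>insert i I. (x(i := y)) k j) \<le> b j" if "j \<in> J" for j
  proof -
    have "y j \<le> b j - (\<Sum>i\<in>I. x i j)" "(\<Sum>i\<in>I. x i j) \<le> b j" using y(1) x(2) that by auto
    then show ?thesis using insert.hyps by (simp add: eq del: fun_upd_apply) (simp add: fun_upd_same)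
  qed
  moreover have "\<forall>k\<in>insert i I. sum ((x(i := y)) k) J = a k"
    using x(1) y(2) insert.hyps by auto
  ultimately show ?case by (intro exI[of _ "x(i := y)"] conjI ballI) auto
qed

text \<open>The integral form of Birkhoff's theorem, or Koenig's edge colouring of a
  \<open>k\<close>-regular bipartite multigraph: equal line sums give Hall's condition on the
  support, and subtracting the resulting permutation matrix lowers all line sums by one.\<close>

lemma nat_matrix_decomposition:
  fixes N :: "'r \<Rightarrow> 'c \<Rightarrow> nat"
  assumes "finite R" "finite C"
    and "\<And>r. r \<in> R \<Longrightarrow> sum (N r) C = k" and "\<And>c. c \<in> C \<Longrightarrow> (\<Sum>r\<in>R. N r c) = k"
  shows "\<exists>\<sigma>. (\<forall>t<k. inj_on (\<sigma> t) R \<and> \<sigma> t ` R \<subseteq> C) \<and>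
    (\<forall>r\<in>R. \<forall>c\<in>C. N r c = card {t. t < k \<and> \<sigma> t r = c})"
  using assms(3,4)
proof (induction k arbitrary: N)
  case 0
  then show ?case using assms(1,2) by auto
next
  case (Suc k)
  note row = Suc.prems(1) and col = Suc.prems(2)
  have "(\<Sum>r\<in>R. sum (N r) C) = (\<Sum>c\<in>C. \<Sum>r\<in>R. N r c)" by (rule sum.swap)
  also have "(\<Sum>r\<in>R. sum (N r) C) = (\<Sum>r\<in>R. Suc k)" using row by (intro sum.cong) auto
  also have "(\<Sum>c\<in>C. \<Sum>r\<in>R. N r c) = (\<Sum>c\<in>C. Suc k)" using col by (intro sum.cong) auto
  finally have "card R * Suc k = card C * Suc k" by simp
  then have cRC: "card R = card C" unfolding mult_cancel2 by simp
  have "\<exists>f. inj_on f R \<and> (\<forall>r\<in>R. f r \<in> {c\<in>C. N r c > 0})"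
  proof (rule hall_marriage[OF assms(1)])
    show "finite {c\<in>C. N r c > 0}" for r using assms(2) by simp
    fix J assume J: "J \<subseteq> R"
    let ?U = "\<Union>r\<in>J. {c\<in>C. N r c > 0}"
    have fJ: "finite J" using J assms(1) finite_subset by blast
    have fU: "finite ?U" "?U \<subseteq> C" using fJ assms(2) by auto
    have "Suc k * card J = (\<Sum>r\<in>J. sum (N r) C)" using row J by (simp add: subset_iff)
    also have "\<dots> = (\<Sum>r\<in>J. sum (N r) ?U)"
      using fU assms(2) by (intro sum.cong refl sum.mono_neutral_right) auto
    also have "\<dots> = (\<Sum>c\<in>?U. \<Sum>r\<in>J. N r c)" by (rule sum.swap)
    also have "\<dots> \<le> (\<Sum>c\<in>?U. \<Sum>r\<in>R. N r c)"
      using J assms(1) by (intro sum_mono sum_mono2) auto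
    also have "\<dots> = (\<Sum>c\<in>?U. Suc k)" using col fU(2) by (intro sum.cong refl) blast
    also have "\<dots> = Suc k * card ?U" by simp
    finally show "card J \<le> card ?U" by (simp only: mult_le_cancel1)
  qed
  then obtain f where f: "inj_on f R" "\<And>r. r \<in> R \<Longrightarrow> f r \<in> C \<and> N r (f r) > 0" by auto
  have fC: "f ` R = C"
    using f cRC assms(1,2) by (intro card_subset_eq) (auto simp: card_image)
  define N' where "N' r c = N r c - (if f r = c then 1 else 0)" for r c
  have N': "N r c = N' r c + (if f r = c then 1 else 0)" if "r \<in> R" for r c
    using f(2)[OF that] by (auto simp: N'_def)
  have row': "sum (N' r) C = k" if r: "r \<in> R" for r
  proof -
    have "sum (N r) C = sum (N' r) C + (\<Sum>c\<in>C. if f r = c then 1 else 0)"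
      by (simp add: N'[OF r] sum.distrib[symmetric])
    then show ?thesis using row[OF r] f(2)[OF r] assms(2) by (simp add: sum.delta)
  qed
  have col': "(\<Sum>r\<in>R. N' r c) = k" if c: "c \<in> C" for c
  proof -
    obtain r0 where r0: "r0 \<in> R" "f r0 = c" using c fC by auto
    have "(\<Sum>r\<in>R. N r c) = (\<Sum>r\<in>R. N' r c + (if f r = c then 1 else 0))"
      using N' by (intro sum.cong) auto
    also have "\<dots> = (\<Sum>r\<in>R. N' r c) + (\<Sum>r\<in>R. if f r = c then 1 else 0)"
      by (simp add: sum.distrib)
    also have "(\<Sum>r\<in>R. if f r = c then 1 else 0) = (\<Sum>r\<in>R. if r = r0 then 1 else (0::nat))"
      using f(1) r0 by (intro sum.cong) (auto simp: inj_on_def)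
    also have "\<dots> = 1" using r0 assms(1) by simp
    finally show ?thesis using col[OF c] by simp
  qed
  have "\<exists>\<sigma>. (\<forall>t<k. inj_on (\<sigma> t) R \<and> \<sigma> t ` R \<subseteq> C) \<and>
    (\<forall>r\<in>R. \<forall>c\<in>C. N' r c = card {t. t < k \<and> \<sigma> t r = c})"
    by (rule Suc.IH) (fact row' col')+
  then obtain \<sigma> where s0: "\<forall>t<k. inj_on (\<sigma> t) R \<and> \<sigma> t ` R \<subseteq> C"
    "\<forall>r\<in>R. \<forall>c\<in>C. N' r c = card {t. t < k \<and> \<sigma> t r = c}" by (elim exE conjE)
  have s: "inj_on (\<sigma> t) R \<and> \<sigma> t ` R \<subseteq> C" if "t < k" for t using s0(1) that by simp
  have s2: "N' r c = card {t. t < k \<and> \<sigma> t r = c}" if "r \<in> R" "c \<in> C" for r c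
    using s0(2) that by simp
  let ?s = "\<sigma>(k := f)"
  have D: "N r c = card {t. t < Suc k \<and> ?s t r = c}" if "r \<in> R" "c \<in> C" for r c
  proof -
    have "{t. t < Suc k \<and> ?s t r = c} = {t. t < k \<and> \<sigma> t r = c} \<union> (if f r = c then {k} else {})"
      by (auto simp: less_Suc_eq)
    then show ?thesis using s2[OF that] N'[OF that(1), of c] by (simp add: card_insert_if)
  qed
  have I: "inj_on (?s t) R \<and> ?s t ` R \<subseteq> C" if "t < Suc k" for t
  proof (cases "t = k")
    case True
    then show ?thesis using f(1) fC by simp
  next
    case False
    then show ?thesis using s[of t] that by simp
  qed
  show ?case by (intro exI[of _ ?s] conjI[of "\<forall>t<Suc k. _ t"] allI impI ballI) (fact I D)+
qed

text \<open>Padding by dummy vertices that are adjacent to original vertices or to other dummies turns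
  the graph into a regular multigraph; its perfect matchings lose few original vertices because
  there are few dummies.\<close>

lemma balanced_edge_colouring:
  fixes H :: "('a \<times> 'b) set"
  assumes fA: "finite A" and fB: "finite B" and HAB: "H \<subseteq> A \<times> B"
    and dA: "\<And>a. a \<in> A \<Longrightarrow> card (H `` {a}) \<le> k" and dB: "\<And>b. b \<in> B \<Longrightarrow> card (H\<inverse> `` {b}) \<le> k"
    and k: "0 < k" and s: "k * s \<le> card H"
  shows "\<exists>c :: 'a \<times> 'b \<Rightarrow> nat. (\<forall>e\<in>H. c e < k) \<and>
    (\<forall>t. inj_on fst {e\<in>H. c e = t} \<and> inj_on snd {e\<in>H. c e = t}) \<and>
    (\<forall>t<k. s \<le> card {e\<in>H. c e = t})"
proof -
  have fH: "finite H" using fA fB HAB finite_subset by blast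
  have cA: "card H = (\<Sum>a\<in>A. card (H `` {a}))"
  proof -
    have "(\<Sum>a\<in>A. card (H `` {a})) = card (Sigma A (\<lambda>a. H `` {a}))"
      using fA fH by (simp add: finite_Image)
    also have "Sigma A (\<lambda>a. H `` {a}) = H" using HAB by auto
    finally show ?thesis by simp
  qed
  have cB: "card H = (\<Sum>b\<in>B. card (H\<inverse> `` {b}))"
  proof -
    have "(\<Sum>b\<in>B. card (H\<inverse> `` {b})) = card (Sigma B (\<lambda>b. H\<inverse> `` {b}))"
      using fB fH by (simp add: finite_Image)
    also have "Sigma B (\<lambda>b. H\<inverse> `` {b}) = H\<inverse>" using HAB by auto
    finally show ?thesis by (simp add: card_inverse)
  qed
  have "card H \<le> k * card A" using cA sum_mono[of A "\<lambda>a. card (H `` {a})" "\<lambda>_. k"] dA by (simp add: mult.commute)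
  then have "k * s \<le> k * card A" using s by linarith
  then have sA: "s \<le> card A" using k by simp
  have "card H \<le> k * card B" using cB sum_mono[of B "\<lambda>b. card (H\<inverse> `` {b})" "\<lambda>_. k"] dB by (simp add: mult.commute)
  then have "k * s \<le> k * card B" using s by linarith
  then have sB: "s \<le> card B" using k by simp
  \<comment> \<open>With the dummies, both sides have card A + card B - s vertices. A perfect
    matching sends at most \<open>card A - s\<close> vertices of \<open>A\<close> to dummies, so at
    least \<open>s\<close> edges of \<open>H\<close> remain in it; \<open>k * s \<le> card H\<close>
    says that the dummies have room for the missing degrees.\<close>
  define A' B' where "A' = {..<card B - s}" and "B' = {..<card A - s}"
  have "(\<Sum>a\<in>A. k - card (H `` {a})) + card H = k * card A"
    unfolding cA by (subst sum.distrib[symmetric]) (use dA in \<open>simp add: mult.commute\<close>)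
  then have "(\<Sum>a\<in>A. k - card (H `` {a})) \<le> (\<Sum>j\<in>B'. k)"
    using s sA by (simp add: B'_def algebra_simps)
  from transport_matrix[OF fA _ this] obtain X where
    X: "\<forall>a\<in>A. sum (X a) B' = k - card (H `` {a})" "\<forall>j\<in>B'. (\<Sum>a\<in>A. X a j) \<le> k"
    by (auto simp: B'_def)
  have "(\<Sum>b\<in>B. k - card (H\<inverse> `` {b})) + card H = k * card B"
    unfolding cB by (subst sum.distrib[symmetric]) (use dB in \<open>simp add: mult.commute\<close>)
  then have "(\<Sum>b\<in>B. k - card (H\<inverse> `` {b})) \<le> (\<Sum>j\<in>A'. k)"
    using s sB by (simp add: A'_def algebra_simps)
  from transport_matrix[OF fB _ this] obtain Y where
    Y: "\<forall>b\<in>B. sum (Y b) A' = k - card (H\<inverse> `` {b})" "\<forall>j\<in>A'. (\<Sum>b\<in>B. Y b j) \<le> k"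
    by (auto simp: A'_def)
  \<comment> \<open>The degrees still missing at the two sets of dummies have equal sums, so edges
    between dummies can fill them exactly.\<close>
  have tot: "(\<Sum>i\<in>A'. k - (\<Sum>b\<in>B. Y b i)) = (\<Sum>j\<in>B'. k - (\<Sum>a\<in>A. X a j))"
  proof -
    have "(\<Sum>i\<in>A'. k - (\<Sum>b\<in>B. Y b i)) + (\<Sum>i\<in>A'. \<Sum>b\<in>B. Y b i) = k * (card B - s)"
      by (subst sum.distrib[symmetric]) (use Y(2) in \<open>simp add: A'_def mult.commute\<close>)
    moreover have "(\<Sum>i\<in>A'. \<Sum>b\<in>B. Y b i) + card H = k * card B"
      using Y(1) \<open>(\<Sum>b\<in>B. k - card (H\<inverse> `` {b})) + card H = k * card B\<close> by (subst sum.swap) simp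
    moreover have "(\<Sum>j\<in>B'. k - (\<Sum>a\<in>A. X a j)) + (\<Sum>j\<in>B'. \<Sum>a\<in>A. X a j) = k * (card A - s)"
      by (subst sum.distrib[symmetric]) (use X(2) in \<open>simp add: B'_def mult.commute\<close>)
    moreover have "(\<Sum>j\<in>B'. \<Sum>a\<in>A. X a j) + card H = k * card A"
      using X(1) \<open>(\<Sum>a\<in>A. k - card (H `` {a})) + card H = k * card A\<close> by (subst sum.swap) simp
    ultimately show ?thesis using sA sB by (simp add: diff_mult_distrib2)
  qed
  have "\<exists>Z. (\<forall>i\<in>A'. sum (Z i) B' = k - (\<Sum>b\<in>B. Y b i)) \<and> (\<forall>j\<in>B'. (\<Sum>i\<in>A'. Z i j) \<le> k - (\<Sum>a\<in>A. X a j))"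
    by (rule transport_matrix) (auto simp: A'_def B'_def tot[unfolded A'_def B'_def])
  then obtain Z where Z: "\<forall>i\<in>A'. sum (Z i) B' = k - (\<Sum>b\<in>B. Y b i)"
    "\<forall>j\<in>B'. (\<Sum>i\<in>A'. Z i j) \<le> k - (\<Sum>a\<in>A. X a j)"
    by (elim exE conjE)
  have "(\<Sum>j\<in>B'. \<Sum>i\<in>A'. Z i j) = (\<Sum>j\<in>B'. k - (\<Sum>a\<in>A. X a j))"
    using Z(1) tot by (subst sum.swap) simp
  then have Z3: "(\<Sum>i\<in>A'. Z i j) = k - (\<Sum>a\<in>A. X a j)" if "j \<in> B'" for j
    by (rule sum_mono_inv) (use Z(2) that in \<open>auto simp: B'_def\<close>)
  define R :: "('a + nat) set" where "R = Inl ` A \<union> Inr ` A'"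
  define C :: "('b + nat) set" where "C = Inl ` B \<union> Inr ` B'"
  define N where "N r c = (case r of
      Inl a \<Rightarrow> (case c of Inl b \<Rightarrow> (if (a, b) \<in> H then 1 else 0) | Inr j \<Rightarrow> X a j)
    | Inr i \<Rightarrow> (case c of Inl b \<Rightarrow> Y b i | Inr j \<Rightarrow> Z i j))" for r c
  have fin: "finite A'" "finite B'" "finite R" "finite C" using fA fB by (auto simp: A'_def B'_def R_def C_def)
  have sumR: "(\<Sum>r\<in>R. g r) = (\<Sum>a\<in>A. g (Inl a)) + (\<Sum>i\<in>A'. g (Inr i))" for g :: "_ \<Rightarrow> nat"
    unfolding R_def using fA fin by (subst sum.union_disjoint) (auto simp: sum.reindex)
  have sumC: "(\<Sum>c\<in>C. g c) = (\<Sum>b\<in>B. g (Inl b)) + (\<Sum>j\<in>B'. g (Inr j))" for g :: "_ \<Rightarrow> nat"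
    unfolding C_def using fB fin by (subst sum.union_disjoint) (auto simp: sum.reindex)
  have HA: "(\<Sum>b\<in>B. if (a, b) \<in> H then 1 else 0) = card (H `` {a})" for a
  proof -
    have "B \<inter> {b. (a, b) \<in> H} = H `` {a}" using HAB by auto
    then show ?thesis using fB by (simp add: sum.If_cases)
  qed
  have HB: "(\<Sum>a\<in>A. if (a, b) \<in> H then 1 else 0) = card (H\<inverse> `` {b})" for b
  proof -
    have "A \<inter> {a. (a, b) \<in> H} = H\<inverse> `` {b}" using HAB by auto
    then show ?thesis using fA by (simp add: sum.If_cases)
  qed
  have "\<exists>\<sigma>. (\<forall>t<k. inj_on (\<sigma> t) R \<and> \<sigma> t ` R \<subseteq> C) \<and>
    (\<forall>r\<in>R. \<forall>c\<in>C. N r c = card {t. t < k \<and> \<sigma> t r = c})"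
  proof (rule nat_matrix_decomposition[OF fin(3,4)])
    show "sum (N r) C = k" if "r \<in> R" for r
    proof (cases r)
      case (Inl a)
      then have "a \<in> A" using that by (auto simp: R_def)
      then show ?thesis using X(1) dA by (simp add: sumC N_def Inl HA)
    next
      case (Inr i)
      then have "i \<in> A'" using that by (auto simp: R_def)
      then show ?thesis using Z(1) Y(2) by (simp add: sumC N_def Inr)
    qed
    show "(\<Sum>r\<in>R. N r c) = k" if "c \<in> C" for c
    proof (cases c)
      case (Inl b)
      then have "b \<in> B" using that by (auto simp: C_def)
      then show ?thesis using Y(1) dB by (simp add: sumR N_def Inl HB)
    next
      case (Inr j)
      then have "j \<in> B'" using that by (auto simp: C_def)
      then show ?thesis using Z3 X(2) by (simp add: sumR N_def Inr)
    qed
  qed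
  then obtain \<sigma> where \<sigma>: "\<forall>t<k. inj_on (\<sigma> t) R \<and> \<sigma> t ` R \<subseteq> C"
    "\<forall>r\<in>R. \<forall>c\<in>C. N r c = card {t. t < k \<and> \<sigma> t r = c}" by (elim exE conjE)
  have inj: "inj_on (\<sigma> t) R" and im: "\<sigma> t ` R \<subseteq> C" if "t < k" for t
    using \<sigma>(1) that by simp_all
  have N: "N r c = card {t. t < k \<and> \<sigma> t r = c}" if "r \<in> R" "c \<in> C" for r c
    using \<sigma>(2) that by simp
  define col where "col e = (THE t. t < k \<and> \<sigma> t (Inl (fst e)) = Inl (snd e))" for e
  have one: "\<exists>!t. t < k \<and> \<sigma> t (Inl a) = Inl b" if "(a, b) \<in> H" for a b
  proof -
    have "Inl a \<in> R" "Inl b \<in> C" using that HAB by (auto simp: R_def C_def)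
    then have "card {t. t < k \<and> \<sigma> t (Inl a) = Inl b} = 1" using N[of "Inl a" "Inl b"] that by (simp add: N_def)
    then obtain t where "{t. t < k \<and> \<sigma> t (Inl a) = Inl b} = {t}" by (auto simp: card_1_singleton_iff)
    then show ?thesis by (intro ex1I[of _ t]) auto
  qed
  have col: "col (a, b) < k \<and> \<sigma> (col (a, b)) (Inl a) = Inl b" if "(a, b) \<in> H" for a b
    unfolding col_def using theI'[OF one[OF that]] by simp
  have colI: "col (a, b) = t" if "(a, b) \<in> H" "t < k" "\<sigma> t (Inl a) = Inl b" for a b t
    unfolding col_def fst_conv snd_conv using that(2,3) by (intro the1_equality[OF one[OF that(1)]]) simp
  have none: "(a, b) \<in> H" if "t < k" "\<sigma> t (Inl a) = Inl b" "a \<in> A" "b \<in> B" for a b t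
  proof (rule ccontr)
    assume "(a, b) \<notin> H"
    then have "card {t. t < k \<and> \<sigma> t (Inl a) = Inl b} = 0"
      using N[of "Inl a" "Inl b"] that by (simp add: N_def R_def C_def)
    then show False using that by auto
  qed
  have I1: "inj_on fst {e\<in>H. col e = t}" for t
  proof (rule inj_onI)
    fix x y assume a: "x \<in> {e\<in>H. col e = t}" "y \<in> {e\<in>H. col e = t}" "fst x = fst y"
    obtain u v w where x: "x = (u, v)" "y = (u, w)" using a(3) by (cases x; cases y) auto
    then have "\<sigma> t (Inl u) = Inl v" "\<sigma> t (Inl u) = Inl w"
      using a(1,2) col[of u v] col[of u w] by auto
    then show "x = y" using x by simp
  qed
  have I2: "inj_on snd {e\<in>H. col e = t}" for t
  proof (rule inj_onI)
    fix x y assume a: "x \<in> {e\<in>H. col e = t}" "y \<in> {e\<in>H. col e = t}" "snd x = snd y"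
    obtain u v w where x: "x = (u, v)" "y = (w, v)" using a(3) by (cases x; cases y) auto
    then have "t < k" "\<sigma> t (Inl u) = \<sigma> t (Inl w)"
      using a(1,2) col[of u v] col[of w v] by auto
    moreover have "Inl u \<in> R" "Inl w \<in> R" using a x HAB by (auto simp: R_def)
    ultimately have "Inl u = (Inl w :: 'a + nat)" using inj[of t] by (meson inj_onD)
    then show "x = y" using x by simp
  qed
  have I3: "s \<le> card {e\<in>H. col e = t}" if t: "t < k" for t
  proof -
    let ?D = "{a\<in>A. \<sigma> t (Inl a) \<in> Inr ` B'}" and ?E = "{a\<in>A. \<sigma> t (Inl a) \<in> Inl ` B}"
    have "card ((\<lambda>a. \<sigma> t (Inl a)) ` ?D) = card ?D"
      by (rule card_image) (use inj[OF t] in \<open>auto simp: inj_on_def R_def\<close>)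
    moreover have "card ((\<lambda>a. \<sigma> t (Inl a)) ` ?D) \<le> card (Inr ` B' :: ('b + nat) set)"
      using fin by (intro card_mono) auto
    ultimately have D: "card ?D \<le> card A - s" by (simp add: card_image B'_def)
    have "A \<subseteq> ?D \<union> ?E" using im[OF t] by (auto simp: R_def C_def image_subset_iff)
    then have "card A \<le> card (?D \<union> ?E)" using fA by (intro card_mono) auto
    then have "card A \<le> card ?D + card ?E" using card_Un_le[of ?D ?E] by linarith
    then have "s \<le> card ?E" using D sA by linarith
    also have "\<dots> \<le> card (fst ` {e\<in>H. col e = t})"
    proof (rule card_mono)
      show "finite (fst ` {e\<in>H. col e = t})" using fH by simp
      show "?E \<subseteq> fst ` {e\<in>H. col e = t}"
      proof
        fix a assume "a \<in> ?E"
        then obtain b where b: "a \<in> A" "b \<in> B" "\<sigma> t (Inl a) = Inl b" by auto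
        have h: "(a, b) \<in> H" by (rule none[OF t b(3,1,2)])
        have "col (a, b) = t" by (rule colI[OF h t b(3)])
        then show "a \<in> fst ` {e\<in>H. col e = t}" using h by (intro image_eqI[of _ _ "(a, b)"]) simp_all
      qed
    qed
    also have "\<dots> \<le> card {e\<in>H. col e = t}" using fH by (intro card_image_le) simp
    finally show ?thesis .
  qed
  have I0: "col e < k" if "e \<in> H" for e
    using col[of "fst e" "snd e"] that by simp
  show ?thesis by (intro exI[of _ col] conjI ballI allI impI) (fact I0 I1 I2 I3)+
qed

section \<open>Regular factors of uniform relations\<close>

text \<open>Lower bound for the number of edges between \<open>S\<close> and \<open>L\<close>: the degrees into \<open>S\<close>
  have small variance by the codegree bound, and \<open>u\<close> is the fraction of vertices outside \<open>L\<close>.\<close>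

lemma edges_between_lower:
  fixes E :: "('a \<times> 'a) set" and n p \<epsilon> u :: real
  assumes fV: "finite V" and EV: "E \<subseteq> V \<times> V" and SV: "S \<subseteq> V" and LV: "L \<subseteq> V"
    and n: "n = card V" "n > 0" and p: "0 \<le> p" and e: "0 \<le> \<epsilon>" "\<epsilon> \<le> 1"
    and low: "\<And>v. v \<in> S \<Longrightarrow> (1 - \<epsilon>) * (n * p) \<le> card (E `` {v})"
    and up: "\<And>v. v \<in> S \<Longrightarrow> card (E `` {v}) \<le> (1 + \<epsilon>) * (n * p)"
    and codeg: "\<And>a b. a \<in> S \<Longrightarrow> b \<in> S \<Longrightarrow> a \<noteq> b \<Longrightarrow> card (E `` {a} \<inter> E `` {b}) \<le> (1 + \<epsilon>) * (n * p\<^sup>2)"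
    and u: "real (card (V - L)) = u * n"
    and big: "(1 + \<epsilon>) \<le> \<epsilon>\<^sup>2 * (card S * p)"
  shows "card S * n * p * ((1 - u) * (1 - \<epsilon>) - sqrt (3 * \<epsilon> * (u * (1 - u)))) \<le> card (E \<inter> S \<times> L)"
proof -
  have fE: "finite E" using fV EV finite_subset by blast
  have fS: "finite S" and fL: "finite L" using fV SV LV finite_subset by blast+
  define s where "s = real (card S)"
  define f where "f y = real (card (E\<inverse> `` {y} \<inter> S))" for y
  define T where "T = (\<Sum>y\<in>V. f y)"
  have fI: "f y = (\<Sum>a\<in>S. if (a, y) \<in> E then 1 else 0)" for y
  proof -
    have "S \<inter> {a. (a, y) \<in> E} = E\<inverse> `` {y} \<inter> S" by auto
    then show ?thesis using fS by (simp add: sum.If_cases f_def)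
  qed
  have rows: "(\<Sum>y\<in>Y. if (a, y) \<in> E then 1 else 0) = real (card (E `` {a} \<inter> Y))" if "finite Y" for a Y
  proof -
    have "Y \<inter> {y. (a, y) \<in> E} = E `` {a} \<inter> Y" by auto
    then show ?thesis using that by (simp add: sum.If_cases)
  qed
  have sumf: "(\<Sum>y\<in>Y. f y) = (\<Sum>a\<in>S. real (card (E `` {a} \<inter> Y)))" if "finite Y" for Y
    unfolding fI by (subst sum.swap) (simp add: rows that)
  have sub: "E `` {a} \<inter> V = E `` {a}" for a using EV by auto
  have Tlow: "s * ((1 - \<epsilon>) * (n * p)) \<le> T"
    unfolding T_def sumf[OF fV] s_def sub using sum_bounded_below[of S "(1 - \<epsilon>) * (n * p)" "\<lambda>a. real (card (E `` {a}))"] low by simp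
  have eL: "real (card (E \<inter> S \<times> L)) = (\<Sum>y\<in>L. f y)"
  proof -
    have "E \<inter> S \<times> L = Sigma S (\<lambda>a. E `` {a} \<inter> L)" by auto
    then have "card (E \<inter> S \<times> L) = (\<Sum>a\<in>S. card (E `` {a} \<inter> L))"
      using fS fL by simp
    then show ?thesis by (simp add: sumf[OF fL])
  qed
  have sq: "(\<Sum>y\<in>V. (f y)\<^sup>2) \<le> s\<^sup>2 * ((1 + \<epsilon>) * (n * p\<^sup>2)) + s * ((1 + \<epsilon>) * (n * p))"
  proof -
    have "(\<Sum>y\<in>V. (f y)\<^sup>2) = (\<Sum>y\<in>V. \<Sum>a\<in>S. \<Sum>b\<in>S. if (a, y) \<in> E \<and> (b, y) \<in> E then 1 else 0)"
      unfolding fI power2_eq_square sum_product by (intro sum.cong) auto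
    also have "\<dots> = (\<Sum>a\<in>S. \<Sum>y\<in>V. \<Sum>b\<in>S. if (a, y) \<in> E \<and> (b, y) \<in> E then 1 else 0)"
      by (rule sum.swap)
    also have "\<dots> = (\<Sum>a\<in>S. \<Sum>b\<in>S. \<Sum>y\<in>V. if (a, y) \<in> E \<and> (b, y) \<in> E then 1 else 0)"
      by (rule sum.cong[OF refl], rule sum.swap)
    also have "\<dots> = (\<Sum>a\<in>S. \<Sum>b\<in>S. real (card (E `` {a} \<inter> E `` {b})))"
    proof (intro sum.cong refl)
      fix a b
      have "V \<inter> {y. (a, y) \<in> E \<and> (b, y) \<in> E} = E `` {a} \<inter> E `` {b}" using EV by auto
      then show "(\<Sum>y\<in>V. if (a, y) \<in> E \<and> (b, y) \<in> E then 1 else 0) = real (card (E `` {a} \<inter> E `` {b}))"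
        using fV by (simp add: sum.If_cases)
    qed
    also have "\<dots> \<le> (\<Sum>a\<in>S. s * ((1 + \<epsilon>) * (n * p\<^sup>2)) + (1 + \<epsilon>) * (n * p))"
    proof (rule sum_mono)
      fix a assume a: "a \<in> S"
      have nn: "0 \<le> (1 + \<epsilon>) * (n * p\<^sup>2)" using e n by simp
      have c1: "(\<Sum>b\<in>S. real (card (E `` {a} \<inter> E `` {b}))) =
          real (card (E `` {a})) + (\<Sum>b\<in>S - {a}. real (card (E `` {a} \<inter> E `` {b})))"
        using fS a by (subst sum.remove[of _ a]) auto
      have c2: "(\<Sum>b\<in>S - {a}. real (card (E `` {a} \<inter> E `` {b}))) \<le> real (card (S - {a})) * ((1 + \<epsilon>) * (n * p\<^sup>2))"
        by (rule sum_bounded_above) (use codeg a in auto)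
      have c3: "real (card (S - {a})) * ((1 + \<epsilon>) * (n * p\<^sup>2)) \<le> s * ((1 + \<epsilon>) * (n * p\<^sup>2))"
        using fS by (intro mult_right_mono nn) (auto simp: s_def card_mono)
      show "(\<Sum>b\<in>S. real (card (E `` {a} \<inter> E `` {b}))) \<le> s * ((1 + \<epsilon>) * (n * p\<^sup>2)) + (1 + \<epsilon>) * (n * p)"
        using c1 c2 c3 up[OF a] by linarith
    qed
    also have "\<dots> = s\<^sup>2 * ((1 + \<epsilon>) * (n * p\<^sup>2)) + s * ((1 + \<epsilon>) * (n * p))"
      by (simp add: s_def power2_eq_square algebra_simps)
    finally show ?thesis .
  qed
  \<comment> \<open>The deviation from the average degree into \<open>S\<close>. The hypothesis
    \<open>big\<close> makes the diagonal pairs negligible in the second moment, so the variance is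
    at most 3 \<epsilon> (s p)^2.\<close>
  define g where "g y = f y - T / n" for y
  have g0: "(\<Sum>y\<in>V. g y) = 0" unfolding g_def using n by (simp add: sum_subtractf T_def)
  have g2: "(\<Sum>y\<in>V. (g y)\<^sup>2) = (\<Sum>y\<in>V. (f y)\<^sup>2) - T\<^sup>2 / n"
  proof -
    have "(\<Sum>y\<in>V. (g y)\<^sup>2) = (\<Sum>y\<in>V. (f y)\<^sup>2 - (2 * T / n) * f y + (T / n)\<^sup>2)"
      by (intro sum.cong) (auto simp: g_def power2_eq_square algebra_simps)
    also have "\<dots> = (\<Sum>y\<in>V. (f y)\<^sup>2) - (2 * T / n) * T + n * (T / n)\<^sup>2"
      by (simp only: sum.distrib sum_subtractf sum_distrib_left[symmetric] T_def[symmetric] sum_constant n(1))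
    also have "\<dots> = (\<Sum>y\<in>V. (f y)\<^sup>2) - T\<^sup>2 / n" using n by (simp add: power2_eq_square field_simps)
    finally show ?thesis .
  qed
  have spn: "0 \<le> s * n * p" "0 \<le> s" using n p by (simp_all add: s_def)
  have var: "(\<Sum>y\<in>V. (g y)\<^sup>2) \<le> n * (s * p)\<^sup>2 * (3 * \<epsilon>)"
  proof -
    have "(s * ((1 - \<epsilon>) * (n * p)))\<^sup>2 \<le> T\<^sup>2"
      using Tlow spn e by (intro power_mono) (auto simp: p n less_imp_le)
    then have "(s * ((1 - \<epsilon>) * (n * p)))\<^sup>2 / n \<le> T\<^sup>2 / n" using n by (simp add: divide_right_mono)
    moreover have "(s * ((1 - \<epsilon>) * (n * p)))\<^sup>2 / n = n * (s * p)\<^sup>2 * (1 - \<epsilon>)\<^sup>2"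
      using n by (simp add: power2_eq_square)
    moreover have "s * ((1 + \<epsilon>) * (n * p)) \<le> n * (s * p)\<^sup>2 * \<epsilon>\<^sup>2"
    proof -
      have "s * n * p * (1 + \<epsilon>) \<le> s * n * p * (\<epsilon>\<^sup>2 * (s * p))"
        using big spn by (intro mult_left_mono) (auto simp: s_def)
      then show ?thesis by (simp add: power2_eq_square algebra_simps)
    qed
    moreover have "s\<^sup>2 * ((1 + \<epsilon>) * (n * p\<^sup>2)) = n * (s * p)\<^sup>2 * (1 + \<epsilon>)"
      by (simp add: power2_eq_square)
    ultimately have "(\<Sum>y\<in>V. (g y)\<^sup>2) \<le> n * (s * p)\<^sup>2 * (1 + \<epsilon>) + n * (s * p)\<^sup>2 * \<epsilon>\<^sup>2 - n * (s * p)\<^sup>2 * (1 - \<epsilon>)\<^sup>2"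
      using g2 sq by linarith
    also have "\<dots> = n * (s * p)\<^sup>2 * (3 * \<epsilon>)" by (simp add: power2_eq_square algebra_simps)
    finally show ?thesis .
  qed
  have card_VL: "real (card L) = (1 - u) * n"
  proof -
    have "card L + card (V - L) = card V" using LV fV fL by (simp add: card_Diff_subset card_mono)
    then have "real (card L) + real (card (V - L)) = n" using n by (metis of_nat_add)
    then show ?thesis using u by (simp add: algebra_simps)
  qed
  have u01: "0 \<le> u" "0 \<le> 1 - u"
    using u n card_VL by (metis of_nat_0_le_iff zero_le_mult_iff not_le order_less_le)+
  define G where "G = (\<Sum>y\<in>L. g y)"
  have GG: "(\<Sum>y\<in>V - L. g y) = - G"
    using g0 sum.subset_diff[OF LV fV, of g] by (simp add: G_def)
  \<comment> \<open>The deviations sum to zero, so their sum over \<open>L\<close> and over the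
    complement differ only in sign. Cauchy-Schwarz on both sets, weighted with \<open>u\<close> and
    \<open>1 - u\<close>, produces the factor \<open>u * (1 - u)\<close>.\<close>
  have cs1: "G\<^sup>2 \<le> (1 - u) * n * (\<Sum>y\<in>L. (g y)\<^sup>2)"
    using sum_squared_le_sum_of_squares[of g L] card_VL by (simp add: G_def mult.commute)
  have cs2: "G\<^sup>2 \<le> u * n * (\<Sum>y\<in>V - L. (g y)\<^sup>2)"
    using sum_squared_le_sum_of_squares[of g "V - L"] GG u by (simp add: mult.commute)
  have "G\<^sup>2 = u * G\<^sup>2 + (1 - u) * G\<^sup>2" by (simp add: algebra_simps)
  also have "\<dots> \<le> u * ((1 - u) * n * (\<Sum>y\<in>L. (g y)\<^sup>2)) + (1 - u) * (u * n * (\<Sum>y\<in>V - L. (g y)\<^sup>2))"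
    using cs1 cs2 u01 by (intro add_mono mult_left_mono) auto
  also have "\<dots> = u * (1 - u) * n * (\<Sum>y\<in>V. (g y)\<^sup>2)"
    using sum.subset_diff[OF LV fV, of "\<lambda>y. (g y)\<^sup>2"] by (simp add: algebra_simps)
  also have "\<dots> \<le> u * (1 - u) * n * (n * (s * p)\<^sup>2 * (3 * \<epsilon>))"
    using var u01 n by (intro mult_left_mono) auto
  also have "\<dots> = (s * n * p)\<^sup>2 * (3 * \<epsilon> * (u * (1 - u)))" by (simp add: power2_eq_square algebra_simps)
  finally have "sqrt (G\<^sup>2) \<le> sqrt ((s * n * p)\<^sup>2 * (3 * \<epsilon> * (u * (1 - u))))" by (rule real_sqrt_le_mono)
  then have "\<bar>G\<bar> \<le> s * n * p * sqrt (3 * \<epsilon> * (u * (1 - u)))"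
    using spn by (simp add: real_sqrt_mult)
  moreover have "G = (\<Sum>y\<in>L. f y) - (1 - u) * T"
    using n by (simp add: G_def g_def sum_subtractf card_VL)
  moreover have "(1 - u) * (s * ((1 - \<epsilon>) * (n * p))) \<le> (1 - u) * T"
    using Tlow u01 by (intro mult_left_mono) auto
  ultimately have "(1 - u) * (s * ((1 - \<epsilon>) * (n * p))) - s * n * p * sqrt (3 * \<epsilon> * (u * (1 - u))) \<le> (\<Sum>y\<in>L. f y)"
    by linarith
  then show ?thesis unfolding eL s_def[symmetric] by (simp add: algebra_simps)
qed

text \<open>The maximum of u (1 - u)^3 is 27/256, attained at u = 1/4, so the sharp bound would be
  9/16; the factorisation in the proof exhibits the double root there.\<close>

lemma weighted_sqrt_bound:
  fixes u :: real
  assumes "0 \<le> u" "u \<le> 1"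
  shows "(1 - u) * sqrt (3 * (u * (1 - u))) \<le> 57 / 100"
proof -
  have "u * (1 - u)^3 \<le> 27 / 256"
  proof -
    have "27 / 256 - u * (1 - u)^3 = (u - 1/4)\<^sup>2 * (u\<^sup>2 - 5/2 * u + 27/16)"
      by (simp add: power2_eq_square power3_eq_cube field_simps)
    moreover have "u\<^sup>2 - 5/2 * u + 27/16 = (u - 5/4)\<^sup>2 + 1/8"
      by (simp add: power2_eq_square field_simps)
    ultimately show ?thesis by (metis add_nonneg_nonneg diff_ge_0_iff_ge mult_nonneg_nonneg zero_le_divide_1_iff zero_le_numeral zero_le_power2)
  qed
  then have "3 * (u * (1 - u)^3) \<le> (57 / 100)\<^sup>2" by (simp add: power2_eq_square)
  moreover have "((1 - u) * sqrt (3 * (u * (1 - u))))\<^sup>2 = 3 * (u * (1 - u)^3)"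
    using assms by (simp add: power_mult_distrib power2_eq_square power3_eq_cube)
  ultimately have "((1 - u) * sqrt (3 * (u * (1 - u))))\<^sup>2 \<le> (57 / 100)\<^sup>2" by simp
  then show ?thesis by (rule power2_le_imp_le) simp
qed

text \<open>The factor condition after division by n^2 p, with \<open>s\<close> for the square root
  of \<epsilon>, \<open>u\<close> for the share of vertices outside \<open>L\<close> and
  \<open>y\<close> for the share in \<open>S\<close>. Both sides are linear in \<open>y\<close>, and
  \<open>y \<le> 1 - u\<close> holds when \<open>S\<close> is the smaller set, so only y = 1 - u is
  critical. The coefficient 8/5 leaves room for the square root term and for s^2.\<close>

lemma factor_inequality:
  fixes s u y :: real
  assumes s: "0 \<le> s" "s\<^sup>2 \<le> 1/10" and u: "0 \<le> u" "u \<le> y" "y \<le> 1 - u"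
  shows "(1 - 8/5 * s) * (y - u) \<le> y * ((1 - u) * (1 - s\<^sup>2) - sqrt (3 * s\<^sup>2 * (u * (1 - u))))"
proof -
  have u2: "u \<le> 1/2" using u by linarith
  have s1: "s \<le> 1/3" by (rule power2_le_imp_le) (use s in \<open>auto simp: power2_eq_square\<close>)
  have sq: "sqrt (3 * s\<^sup>2 * (u * (1 - u))) = s * sqrt (3 * (u * (1 - u)))"
  proof -
    have "3 * s\<^sup>2 * (u * (1 - u)) = s\<^sup>2 * (3 * (u * (1 - u)))" by simp
    then show ?thesis using s by (simp only: real_sqrt_mult[of "s\<^sup>2"] real_sqrt_abs abs_of_nonneg)
  qed
  define r where "r = sqrt (3 * (u * (1 - u)))"
  define h where "h = (1 - u) * (1 - s\<^sup>2) - s * r - (1 - 8/5 * s)"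
  have r: "(1 - u) * r \<le> 57/100" unfolding r_def by (rule weighted_sqrt_bound) (use u u2 in auto)
  have goal: "0 \<le> y * h + u * (1 - 8/5 * s)"
  proof (cases "0 \<le> h")
    case True
    then show ?thesis using u s1 by (intro add_nonneg_nonneg mult_nonneg_nonneg) auto
  next
    case False
    then have "(1 - u) * h \<le> y * h" using u by (intro mult_right_mono_neg) auto
    moreover have "0 \<le> (1 - u) * h + u * (1 - 8/5 * s)"
    proof -
      have "(1 - u) * h + u * (1 - 8/5 * s) = 8/5 * s * (1 - 2 * u) + u\<^sup>2 - s\<^sup>2 * (1 - u)\<^sup>2 - s * ((1 - u) * r)"
        by (simp add: h_def power2_eq_square field_simps)
      moreover have "s * ((1 - u) * r) \<le> s * (57/100)" using r s by (intro mult_left_mono) auto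
      moreover have "s\<^sup>2 * (1 - u)\<^sup>2 \<le> s * (1/3 * (1 - u)\<^sup>2)"
      proof -
        have "s * (s * (1 - u)\<^sup>2) \<le> s * (1/3 * (1 - u)\<^sup>2)"
          using s s1 by (intro mult_left_mono mult_right_mono) auto
        then show ?thesis by (simp add: power2_eq_square)
      qed
      moreover have "s * (57/100) + s * (1/3 * (1 - u)\<^sup>2) \<le> 8/5 * s * (1 - 2 * u) + u\<^sup>2"
      proof -
        define q where "q = 8/5 * (1 - 2 * u) - 57/100 - 1/3 * (1 - u)\<^sup>2"
        have "0 \<le> s * q + u\<^sup>2"
        proof (cases "0 \<le> q")
          case False
          then have "1/3 * q \<le> s * q" using s1 by (intro mult_right_mono_neg) auto
          moreover have "0 \<le> 1/3 * q + u\<^sup>2"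
          proof -
            have "1/3 * q + u\<^sup>2 = 8/9 * (u - 19/40)\<^sup>2 + (1/3 * (8/5 - 57/100 - 1/3) - 8/9 * (19/40)\<^sup>2)"
              by (simp add: q_def power2_eq_square field_simps)
            then show ?thesis by (simp add: power2_eq_square)
          qed
          ultimately show ?thesis by linarith
        qed (use s in auto)
        then show ?thesis by (simp add: q_def field_simps)
      qed
      ultimately show ?thesis by linarith
    qed
    ultimately show ?thesis by linarith
  qed
  have "y * ((1 - u) * (1 - s\<^sup>2) - s * r) - (1 - 8/5 * s) * (y - u) = y * h + u * (1 - 8/5 * s)"
    by (simp add: h_def field_simps)
  then show ?thesis using goal unfolding sq r_def[symmetric] by linarith
qed

text \<open>Three ranges of \<open>S\<close>. With at most \<open>r\<close> elements, each of them
  keeps all but \<open>card (V - L)\<close> of its at least \<open>r\<close> out-neighbours. If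
  \<open>S\<close> is no larger than the complement of \<open>L\<close>, the inequality is trivial.
  Otherwise \<open>S\<close> has at least order np elements, which is what the variance estimate
  requires.\<close>

lemma factor_condition:
  fixes E :: "('a \<times> 'a) set" and n p \<epsilon> :: real
  assumes fV: "finite V" and EV: "E \<subseteq> V \<times> V" and SV: "S \<subseteq> V" and LV: "L \<subseteq> V"
    and n: "n = card V" and p: "0 < p" and e: "0 < \<epsilon>" "\<epsilon> < 1/10"
    and low: "\<And>v. v \<in> V \<Longrightarrow> (1 - \<epsilon>) * (n * p) \<le> card (E `` {v})"
    and up: "\<And>v. v \<in> V \<Longrightarrow> card (E `` {v}) \<le> (1 + \<epsilon>) * (n * p)"
    and codeg: "\<And>a b. a \<in> V \<Longrightarrow> b \<in> V \<Longrightarrow> a \<noteq> b \<Longrightarrow> card (E `` {a} \<inter> E `` {b}) \<le> (1 + \<epsilon>) * (n * p\<^sup>2)"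
    and big: "3 \<le> \<epsilon>\<^sup>2 * (n * p\<^sup>2)"
    and r: "r = nat \<lfloor>(1 - 8/5 * sqrt \<epsilon>) * (n * p)\<rfloor>"
    and SL: "card S \<le> card L"
  shows "r * card S + r * card L \<le> card (E \<inter> S \<times> L) + r * card V"
proof -
  have fS: "finite S" and fL: "finite L" using fV SV LV finite_subset by blast+
  have n0: "0 < n"
  proof (rule ccontr)
    assume "\<not> 0 < n"
    then have "n = 0" using n by simp
    then show False using big by simp
  qed
  have se: "0 \<le> sqrt \<epsilon>" "(sqrt \<epsilon>)\<^sup>2 = \<epsilon>" using e by auto
  have s1: "sqrt \<epsilon> \<le> 8/25"
    by (rule real_le_lsqrt) (use e in \<open>auto simp: power2_eq_square\<close>)
  have eps_s: "\<epsilon> \<le> sqrt \<epsilon>" 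
  proof -
    have "(sqrt \<epsilon>)\<^sup>2 \<le> sqrt \<epsilon> * 1"
      unfolding power2_eq_square by (intro mult_left_mono) (use s1 se(1) in linarith)+
    then show ?thesis using se(2) by linarith
  qed
  have np: "0 \<le> n * p" using n0 p by simp
  have r0: "0 \<le> (1 - 8/5 * sqrt \<epsilon>) * (n * p)" using s1 np by simp
  have rle: "real r \<le> (1 - 8/5 * sqrt \<epsilon>) * (n * p)" using r0 by (simp add: r)
  have rge: "(1 - 8/5 * sqrt \<epsilon>) * (n * p) < real r + 1" using r0 by (simp add: r)
  have cL: "card L + card (V - L) = card V"
    using LV fV fL by (simp add: card_Diff_subset card_mono)
  have "real (r * card S) \<le> real (card (E \<inter> S \<times> L)) + real r * real (card (V - L))"
  proof (cases "card S \<le> r")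
    case True
    have "E \<inter> S \<times> L = Sigma S (\<lambda>a. E `` {a} \<inter> L)" by auto
    then have "card (E \<inter> S \<times> L) = (\<Sum>a\<in>S. card (E `` {a} \<inter> L))" using fS fL by simp
    then have "real (card (E \<inter> S \<times> L)) = (\<Sum>a\<in>S. real (card (E `` {a} \<inter> L)))" by simp
    moreover have "(\<Sum>a\<in>S. real r - real (card (V - L))) \<le> (\<Sum>a\<in>S. real (card (E `` {a} \<inter> L)))"
    proof (rule sum_mono)
      fix a assume "a \<in> S"
      then have a: "a \<in> V" using SV by auto
      have "real r \<le> real (card (E `` {a}))"
      proof -
        have "(1 - 8/5 * sqrt \<epsilon>) * (n * p) \<le> (1 - \<epsilon>) * (n * p)"
          using eps_s se np by (intro mult_right_mono) auto
        then show ?thesis using low[OF a] rle by linarith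
      qed
      moreover have "card (E `` {a}) \<le> card (E `` {a} \<inter> L \<union> (V - L))"
        using EV fV fL by (intro card_mono) auto
      moreover have "card (E `` {a} \<inter> L \<union> (V - L)) \<le> card (E `` {a} \<inter> L) + card (V - L)"
        by (rule card_Un_le)
      ultimately show "real r - real (card (V - L)) \<le> real (card (E `` {a} \<inter> L))" by linarith
    qed
    moreover have "real (card S) * real (card (V - L)) \<le> real r * real (card (V - L))"
      using True by (intro mult_right_mono) auto
    ultimately show ?thesis by (simp add: algebra_simps)
  next
    case False
    then have Sr: "real r + 1 \<le> real (card S)" by linarith
    show ?thesis
    proof (cases "card S \<le> card (V - L)")
      case True
      have "real r * real (card S) \<le> real r * real (card (V - L))"
        using True by (intro mult_left_mono) auto
      then show ?thesis by simp
    next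
      case False
      define u y where "u = real (card (V - L)) / n" and "y = real (card S) / n"
      have u: "real (card (V - L)) = u * n" and y: "real (card S) = y * n"
        using n0 by (auto simp: u_def y_def)
      have "(1 - u) * n = real (card L)" using cL u n by (simp add: algebra_simps)
      then have "y * n \<le> (1 - u) * n" using SL y by simp
      then have y1: "y \<le> 1 - u" using n0 by simp
      have "u * n \<le> y * n" using False u y by linarith
      then have uy: "u \<le> y" using n0 by simp
      have u0: "0 \<le> u" using n0 by (simp add: u_def)
      have "(1 + \<epsilon>) \<le> \<epsilon>\<^sup>2 * (card S * p)"
      proof -
        have "12/25 * (n * p) \<le> (1 - 8/5 * sqrt \<epsilon>) * (n * p)"
          using s1 np by (intro mult_right_mono) auto
        then have "12/25 * (n * p) \<le> card S" using Sr rge by linarith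
        then have "\<epsilon>\<^sup>2 * (12/25 * (n * p) * p) \<le> \<epsilon>\<^sup>2 * (card S * p)"
          using p by (intro mult_left_mono mult_right_mono) auto
        moreover have "\<epsilon>\<^sup>2 * (12/25 * (n * p) * p) = 12/25 * (\<epsilon>\<^sup>2 * (n * p\<^sup>2))"
          by (simp add: power2_eq_square)
        ultimately show ?thesis using big e by linarith
      qed
      then have "card S * n * p * ((1 - u) * (1 - \<epsilon>) - sqrt (3 * \<epsilon> * (u * (1 - u)))) \<le> card (E \<inter> S \<times> L)"
        using SV e p low up codeg
        by (intro edges_between_lower[OF fV EV SV LV n n0 _ _ _ _ _ _ u]) (auto simp: subset_iff)
      moreover have "(1 - 8/5 * sqrt \<epsilon>) * (y - u) \<le> y * ((1 - u) * (1 - (sqrt \<epsilon>)\<^sup>2) - sqrt (3 * (sqrt \<epsilon>)\<^sup>2 * (u * (1 - u))))"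
        by (rule factor_inequality) (use se e u0 uy y1 in auto)
      then have "(n * n * p) * ((1 - 8/5 * sqrt \<epsilon>) * (y - u)) \<le>
        (n * n * p) * (y * ((1 - u) * (1 - \<epsilon>) - sqrt (3 * \<epsilon> * (u * (1 - u)))))"
        unfolding se using n0 p by (intro mult_left_mono) auto
      moreover have "real r * ((y - u) * n) \<le> ((1 - 8/5 * sqrt \<epsilon>) * (n * p)) * ((y - u) * n)"
        using rle uy n0 by (intro mult_right_mono) auto
      ultimately have "real r * ((y - u) * n) \<le> card (E \<inter> S \<times> L)" by (simp add: y algebra_simps)
      then show ?thesis by (simp add: u y algebra_simps)
    qed
  qed
  then have "real (r * card S) \<le> real (card (E \<inter> S \<times> L) + r * card (V - L))" by simp
  then have "r * card S \<le> card (E \<inter> S \<times> L) + r * card (V - L)" by (simp only: of_nat_le_iff)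
  moreover have "r * card V = r * card L + r * card (V - L)" by (simp add: cL[symmetric] algebra_simps)
  ultimately show ?thesis by linarith
qed

text \<open>The variance estimate works from the smaller of the two sets; when that is
  \<open>Y\<close>, it is applied to the reversed relation, whence the conditions on
  in-neighbours.\<close>

lemma uniform_regular_factor:
  fixes E :: "('a \<times> 'a) set" and n p \<epsilon> :: real
  assumes fV: "finite V" and EV: "E \<subseteq> V \<times> V"
    and n: "n = card V" and p: "0 < p" and e: "0 < \<epsilon>" "\<epsilon> < 1/10"
    and out: "\<And>v. v \<in> V \<Longrightarrow> (1 - \<epsilon>) * (n * p) \<le> card (E `` {v}) \<and> card (E `` {v}) \<le> (1 + \<epsilon>) * (n * p)"
    and inn: "\<And>v. v \<in> V \<Longrightarrow> (1 - \<epsilon>) * (n * p) \<le> card (E\<inverse> `` {v}) \<and> card (E\<inverse> `` {v}) \<le> (1 + \<epsilon>) * (n * p)"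
    and co: "\<And>a b. a \<in> V \<Longrightarrow> b \<in> V \<Longrightarrow> a \<noteq> b \<Longrightarrow> card (E `` {a} \<inter> E `` {b}) \<le> (1 + \<epsilon>) * (n * p\<^sup>2)"
    and ci: "\<And>a b. a \<in> V \<Longrightarrow> b \<in> V \<Longrightarrow> a \<noteq> b \<Longrightarrow> card (E\<inverse> `` {a} \<inter> E\<inverse> `` {b}) \<le> (1 + \<epsilon>) * (n * p\<^sup>2)"
    and big: "3 \<le> \<epsilon>\<^sup>2 * (n * p\<^sup>2)"
    and r: "r = nat \<lfloor>(1 - 8/5 * sqrt \<epsilon>) * (n * p)\<rfloor>"
  shows "\<exists>F\<subseteq>E. \<forall>v\<in>V. card (F `` {v}) = r \<and> card (F\<inverse> `` {v}) = r"
proof (rule regular_factor[OF fV EV])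
  fix X Y assume XY: "X \<subseteq> V" "Y \<subseteq> V"
  show "r * card X + r * card Y \<le> card (E \<inter> X \<times> Y) + r * card V"
  proof (cases "card X \<le> card Y")
    case True
    show ?thesis
      by (rule factor_condition[OF fV EV XY n p e _ _ co big r True]) (use out in auto)
  next
    case False
    then have YX: "card Y \<le> card X" by simp
    have EV': "E\<inverse> \<subseteq> V \<times> V" using EV by auto
    have "r * card Y + r * card X \<le> card (E\<inverse> \<inter> Y \<times> X) + r * card V"
      by (rule factor_condition[OF fV EV' XY(2,1) n p e _ _ ci big r YX]) (use inn in auto)
    moreover have "E\<inverse> \<inter> Y \<times> X = (E \<inter> X \<times> Y)\<inverse>" by auto
    ultimately show ?thesis by (simp add: card_inverse)
  qed
qed

section \<open>Concentration for random colourings\<close>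

text \<open>Colour the elements of a finite set \<open>I\<close> uniformly and independently with \<open>B\<close> colours.
  For a family of disjoint blocks, the number of blocks all of whose elements get an admissible
  colour is a sum of independent indicators; its moment generating function is computed by
  expanding the product over the blocks.\<close>

definition hits :: "('x \<Rightarrow> 'i set) \<Rightarrow> ('i \<Rightarrow> nat set) \<Rightarrow> 'x set \<Rightarrow> ('i \<Rightarrow> nat) \<Rightarrow> nat" where
  "hits b C S \<omega> = card {x\<in>S. \<forall>i\<in>b x. \<omega> i \<in> C i}"

lemma card_colourings_restricted:
  fixes C :: "'i \<Rightarrow> nat set"
  assumes "finite I" "J \<subseteq> I" "\<And>i. i \<in> J \<Longrightarrow> C i \<subseteq> {..<B}" "0 < B"
  shows "real (card {\<omega> \<in> I \<rightarrow>\<^sub>E {..<B}. \<forall>i\<in>J. \<omega> i \<in> C i}) = (\<Prod>i\<in>J. card (C i) / B) * real B ^ card I"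
proof -
  have fJ: "finite J" using assms finite_subset by blast
  have "{\<omega> \<in> I \<rightarrow>\<^sub>E {..<B}. \<forall>i\<in>J. \<omega> i \<in> C i} = (\<Pi>\<^sub>E i\<in>I. if i \<in> J then C i else {..<B})"
  proof (intro set_eqI iffI)
    fix \<omega> assume "\<omega> \<in> {\<omega> \<in> I \<rightarrow>\<^sub>E {..<B}. \<forall>i\<in>J. \<omega> i \<in> C i}"
    then show "\<omega> \<in> (\<Pi>\<^sub>E i\<in>I. if i \<in> J then C i else {..<B})" by (auto simp: PiE_iff)
  next
    fix \<omega> assume r: "\<omega> \<in> (\<Pi>\<^sub>E i\<in>I. if i \<in> J then C i else {..<B})"
    have J: "\<omega> i \<in> C i" if "i \<in> J" for i
    proof -
      have "\<omega> i \<in> (if i \<in> J then C i else {..<B})"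
        using r by (rule PiE_mem) (use that assms(2) in blast)
      then show ?thesis using that by simp
    qed
    have "\<omega> i \<in> {..<B}" if i: "i \<in> I" for i
    proof (cases "i \<in> J")
      case True
      then show ?thesis using J[OF True] assms(3)[OF True] by blast
    next
      case False
      then show ?thesis using r i by (auto simp: PiE_iff)
    qed
    then show "\<omega> \<in> {\<omega> \<in> I \<rightarrow>\<^sub>E {..<B}. \<forall>i\<in>J. \<omega> i \<in> C i}"
      using r J by (auto simp: PiE_iff)
  qed
  then have "card {\<omega> \<in> I \<rightarrow>\<^sub>E {..<B}. \<forall>i\<in>J. \<omega> i \<in> C i} = (\<Prod>i\<in>I. card (if i \<in> J then C i else {..<B}))"
    using assms(1) by (simp add: card_PiE)
  also have "\<dots> = (\<Prod>i\<in>J. card (C i)) * (\<Prod>i\<in>I - J. B)"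
    using assms(1,2) by (subst prod.subset_diff[of J I]) (auto simp: mult.commute intro!: arg_cong2[of _ _ _ _ "(*)"] prod.cong)
  finally have "real (card {\<omega> \<in> I \<rightarrow>\<^sub>E {..<B}. \<forall>i\<in>J. \<omega> i \<in> C i}) = (\<Prod>i\<in>J. real (card (C i))) * real B ^ card (I - J)"
    by simp
  moreover have "real B ^ card I = real B ^ card J * real B ^ card (I - J)"
    using assms(1,2) fJ by (simp add: card_Diff_subset card_mono flip: power_add)
  ultimately show ?thesis using assms(4) by (simp add: prod_dividef)
qed

lemma hits_mgf:
  fixes \<theta> \<pi> :: real
  assumes fI: "finite I" and B: "0 < B" and fS: "finite S"
    and b: "\<And>x. x \<in> S \<Longrightarrow> b x \<subseteq> I" "\<And>x y. x \<in> S \<Longrightarrow> y \<in> S \<Longrightarrow> x \<noteq> y \<Longrightarrow> b x \<inter> b y = {}"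
    and C: "\<And>x i. x \<in> S \<Longrightarrow> i \<in> b x \<Longrightarrow> C i \<subseteq> {..<B}"
    and \<pi>: "\<And>x. x \<in> S \<Longrightarrow> (\<Prod>i\<in>b x. card (C i) / B) = \<pi>"
  shows "(\<Sum>\<omega>\<in>I \<rightarrow>\<^sub>E {..<B}. (1 + \<theta>) ^ hits b C S \<omega>) = (1 + \<theta> * \<pi>) ^ card S * real B ^ card I"
proof -
  let ?\<Omega> = "I \<rightarrow>\<^sub>E {..<B}"
  have f\<Omega>: "finite ?\<Omega>" using fI by (auto intro: finite_PiE)
  define G where "G \<omega> x \<longleftrightarrow> (\<forall>i\<in>b x. \<omega> i \<in> C i)" for \<omega> x
  have 1: "(1 + \<theta>) ^ hits b C S \<omega> = (\<Sum>Z\<in>Pow S. \<theta> ^ card Z * (if \<forall>x\<in>Z. G \<omega> x then 1 else 0))" for \<omega>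
  proof -
    have "(1 + \<theta>) ^ hits b C S \<omega> = (\<Prod>x\<in>S. if G \<omega> x then 1 + \<theta> else 1)"
      using fS by (simp add: prod.If_cases hits_def G_def Int_def)
    also have "\<dots> = (\<Prod>x\<in>S. (if G \<omega> x then \<theta> else 0) + 1)" by (intro prod.cong) auto
    also have "\<dots> = (\<Sum>Z\<in>Pow S. (\<Prod>x\<in>Z. if G \<omega> x then \<theta> else 0) * (\<Prod>x\<in>S - Z. 1))"
      by (rule prod_add[OF fS])
    also have "\<dots> = (\<Sum>Z\<in>Pow S. \<theta> ^ card Z * (if \<forall>x\<in>Z. G \<omega> x then 1 else 0))"
    proof (intro sum.cong refl)
      fix Z assume "Z \<in> Pow S"
      then have "finite Z" using fS finite_subset by blast
      then show "(\<Prod>x\<in>Z. if G \<omega> x then \<theta> else 0) * (\<Prod>x\<in>S - Z. 1) = \<theta> ^ card Z * (if \<forall>x\<in>Z. G \<omega> x then 1 else 0)"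
        by (cases "\<forall>x\<in>Z. G \<omega> x") auto
    qed
    finally show ?thesis .
  qed
  have 2: "(\<Sum>\<omega>\<in>?\<Omega>. if \<forall>x\<in>Z. G \<omega> x then 1 else 0) = \<pi> ^ card Z * real B ^ card I" if Z: "Z \<in> Pow S" for Z
  proof -
    have fZ: "finite Z" using Z fS finite_subset by blast
    let ?J = "\<Union>x\<in>Z. b x"
    have J: "?J \<subseteq> I" using Z b(1) by blast
    have "{\<omega> \<in> ?\<Omega>. \<forall>x\<in>Z. G \<omega> x} = {\<omega> \<in> ?\<Omega>. \<forall>i\<in>?J. \<omega> i \<in> C i}" by (auto simp: G_def)
    moreover have "?\<Omega> \<inter> {\<omega>. \<forall>x\<in>Z. G \<omega> x} = {\<omega> \<in> ?\<Omega>. \<forall>x\<in>Z. G \<omega> x}" by auto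
    ultimately have "(\<Sum>\<omega>\<in>?\<Omega>. if \<forall>x\<in>Z. G \<omega> x then 1 else 0) = real (card {\<omega> \<in> ?\<Omega>. \<forall>i\<in>?J. \<omega> i \<in> C i})"
      using f\<Omega> by (simp add: sum.If_cases)
    also have "\<dots> = (\<Prod>i\<in>?J. card (C i) / B) * real B ^ card I"
      by (rule card_colourings_restricted[OF fI J _ B]) (use C Z in blast)
    also have "(\<Prod>i\<in>?J. card (C i) / B) = (\<Prod>x\<in>Z. \<Prod>i\<in>b x. card (C i) / B)"
    proof (rule prod.UNION_disjoint[OF fZ])
      show "\<forall>x\<in>Z. finite (b x)" using Z b(1) fI finite_subset by blast
      show "\<forall>x\<in>Z. \<forall>y\<in>Z. x \<noteq> y \<longrightarrow> b x \<inter> b y = {}" using Z b(2) by blast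
    qed
    also have "\<dots> = (\<Prod>x\<in>Z. \<pi>)" by (rule prod.cong) (use \<pi> Z in auto)
    finally show ?thesis by simp
  qed
  have "(\<Sum>\<omega>\<in>?\<Omega>. (1 + \<theta>) ^ hits b C S \<omega>) =
    (\<Sum>Z\<in>Pow S. \<theta> ^ card Z * (\<Sum>\<omega>\<in>?\<Omega>. if \<forall>x\<in>Z. G \<omega> x then 1 else 0))"
    unfolding 1 by (subst sum.swap) (simp add: sum_distrib_left)
  also have "\<dots> = (\<Sum>Z\<in>Pow S. (\<Prod>x\<in>Z. \<theta> * \<pi>) * (\<Prod>x\<in>S - Z. 1) * real B ^ card I)"
    by (intro sum.cong refl) (simp add: 2 power_mult_distrib)
  also have "\<dots> = (\<Prod>x\<in>S. \<theta> * \<pi> + 1) * real B ^ card I"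
    unfolding prod_add[OF fS] by (simp add: sum_distrib_right)
  finally show ?thesis by (simp add: add.commute)
qed

lemma exp_le_quadratic:
  fixes s :: real
  assumes "\<bar>s\<bar> \<le> 1/2"
  shows "exp s \<le> 1 + s + s\<^sup>2"
proof (cases "0 \<le> s")
  case True
  then show ?thesis using exp_bound[of s] assms by simp
next
  case False
  define t where "t = - s"
  have t: "0 \<le> t" using False by (simp add: t_def)
  have nn: "0 \<le> 1 - t + t\<^sup>2" using assms t by (simp add: t_def)
  \<comment> \<open>For negative arguments the claim is exp t (1 - t + t^2) \<ge> 1, which already
    holds with exp t replaced by its quadratic Taylor polynomial.\<close>
  have "(1 - t + t\<^sup>2) * (1 + t + t\<^sup>2 / 2) = 1 + (t\<^sup>2 + t\<^sup>2 * t + t\<^sup>2 * t\<^sup>2) / 2"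
    by (simp add: power2_eq_square field_simps)
  then have "1 \<le> (1 - t + t\<^sup>2) * (1 + t + t\<^sup>2 / 2)" using t by simp
  also have "\<dots> \<le> (1 - t + t\<^sup>2) * exp t"
    using exp_lower_Taylor_quadratic[OF t] nn by (intro mult_left_mono) auto
  finally have "exp (- t) \<le> 1 - t + t\<^sup>2" by (simp add: exp_minus divide_simps)
  then show ?thesis by (simp add: t_def)
qed

text \<open>The Chernoff bound: Markov's inequality for exp (s * hits), with s = t/2 for the upper
  and s = -t/2 for the lower tail. Since exp s - 1 is at most s + s^2, the exponent that remains is
  s^2 - t^2/2 = -t^2/4 times \<mu>.\<close>

lemma few_bad_colourings:
  fixes t \<pi> \<mu> :: real
  assumes fI: "finite I" and B: "0 < B" and fS: "finite S"
    and b: "\<And>x. x \<in> S \<Longrightarrow> b x \<subseteq> I" "\<And>x y. x \<in> S \<Longrightarrow> y \<in> S \<Longrightarrow> x \<noteq> y \<Longrightarrow> b x \<inter> b y = {}"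
    and C: "\<And>x i. x \<in> S \<Longrightarrow> i \<in> b x \<Longrightarrow> C i \<subseteq> {..<B}"
    and \<pi>: "\<And>x. x \<in> S \<Longrightarrow> (\<Prod>i\<in>b x. card (C i) / B) = \<pi>"
    and t: "0 \<le> t" "t \<le> 1" and \<mu>: "\<mu> = card S * \<pi>" and \<pi>0: "0 \<le> \<pi>" "\<pi> \<le> 1"
  shows "card {\<omega> \<in> I \<rightarrow>\<^sub>E {..<B}. t * \<mu> < \<bar>hits b C S \<omega> - \<mu>\<bar>} \<le> 2 * exp (- t\<^sup>2 * \<mu> / 4) * real B ^ card I"
proof -
  let ?\<Omega> = "I \<rightarrow>\<^sub>E {..<B}"
  have f\<Omega>: "finite ?\<Omega>" using fI by (auto intro: finite_PiE)
  have \<mu>0: "0 \<le> \<mu>" using \<mu> \<pi>0 by simp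
  have tail: "card {\<omega> \<in> ?\<Omega>. t * \<mu> < \<sigma> * (hits b C S \<omega> - \<mu>)} \<le> exp (- t\<^sup>2 * \<mu> / 4) * real B ^ card I"
    if \<sigma>: "\<sigma> = 1 \<or> \<sigma> = -1" for \<sigma> :: real
  proof -
    define s where "s = \<sigma> * t / 2"
    have s: "\<bar>s\<bar> \<le> 1/2" "s\<^sup>2 = t\<^sup>2 / 4" using \<sigma> t by (auto simp: s_def power2_eq_square)
    let ?bad = "{\<omega> \<in> ?\<Omega>. t * \<mu> < \<sigma> * (hits b C S \<omega> - \<mu>)}"
    have "exp (s * \<mu> + t / 2 * (t * \<mu>)) * card ?bad = (\<Sum>\<omega>\<in>?bad. exp (s * \<mu> + t / 2 * (t * \<mu>)))" by simp
    also have "\<dots> \<le> (\<Sum>\<omega>\<in>?bad. exp s ^ hits b C S \<omega>)"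
    proof (rule sum_mono)
      fix \<omega> assume "\<omega> \<in> ?bad"
      then have "t / 2 * (t * \<mu>) \<le> t / 2 * (\<sigma> * (hits b C S \<omega> - \<mu>))"
        using t by (intro mult_left_mono) auto
      then have "s * \<mu> + t / 2 * (t * \<mu>) \<le> hits b C S \<omega> * s" by (simp add: s_def field_simps)
      then show "exp (s * \<mu> + t / 2 * (t * \<mu>)) \<le> exp s ^ hits b C S \<omega>"
        by (simp add: exp_of_nat_mult[symmetric])
    qed
    also have "\<dots> \<le> (\<Sum>\<omega>\<in>?\<Omega>. (1 + (exp s - 1)) ^ hits b C S \<omega>)"
      using f\<Omega> by (simp, intro sum_mono2) auto
    also have "\<dots> = (1 + (exp s - 1) * \<pi>) ^ card S * real B ^ card I"
      by (rule hits_mgf[OF fI B fS b C \<pi>])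
    also have "\<dots> \<le> exp ((s + s\<^sup>2) * \<mu>) * real B ^ card I"
    proof (rule mult_right_mono)
      have "(exp s - 1) * \<pi> \<le> (s + s\<^sup>2) * \<pi>"
        using exp_le_quadratic[OF s(1)] \<pi>0 by (intro mult_right_mono) auto
      then have le: "1 + (exp s - 1) * \<pi> \<le> exp ((s + s\<^sup>2) * \<pi>)"
        using exp_ge_add_one_self[of "(s + s\<^sup>2) * \<pi>"] by linarith
      have "0 \<le> (1 - \<pi>) + exp s * \<pi>" using \<pi>0 by (intro add_nonneg_nonneg mult_nonneg_nonneg) auto
      then have ge: "0 \<le> 1 + (exp s - 1) * \<pi>" by (simp add: algebra_simps)
      have "(1 + (exp s - 1) * \<pi>) ^ card S \<le> exp ((s + s\<^sup>2) * \<pi>) ^ card S"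
        by (rule power_mono[OF le ge])
      also have "\<dots> = exp ((s + s\<^sup>2) * \<mu>)" by (simp add: exp_of_nat_mult[symmetric] \<mu> mult.assoc mult.left_commute)
      finally show "(1 + (exp s - 1) * \<pi>) ^ card S \<le> exp ((s + s\<^sup>2) * \<mu>)" .
    qed simp
    finally have "exp (s * \<mu> + t / 2 * (t * \<mu>)) * card ?bad \<le> exp ((s + s\<^sup>2) * \<mu>) * real B ^ card I" .
    moreover have "exp ((s + s\<^sup>2) * \<mu>) = exp (s * \<mu> + t / 2 * (t * \<mu>)) * exp (- t\<^sup>2 * \<mu> / 4)"
      unfolding exp_add[symmetric] s(2) by (rule arg_cong[of _ _ exp]) (simp add: power2_eq_square field_simps)
    ultimately show ?thesis by (simp add: mult.assoc)
  qed
  have "{\<omega> \<in> ?\<Omega>. t * \<mu> < \<bar>hits b C S \<omega> - \<mu>\<bar>} \<subseteq>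
    {\<omega> \<in> ?\<Omega>. t * \<mu> < 1 * (hits b C S \<omega> - \<mu>)} \<union> {\<omega> \<in> ?\<Omega>. t * \<mu> < -1 * (hits b C S \<omega> - \<mu>)}"
    by (auto simp: abs_real_def split: if_splits)
  then have "card {\<omega> \<in> ?\<Omega>. t * \<mu> < \<bar>hits b C S \<omega> - \<mu>\<bar>} \<le>
    card ({\<omega> \<in> ?\<Omega>. t * \<mu> < 1 * (hits b C S \<omega> - \<mu>)} \<union> {\<omega> \<in> ?\<Omega>. t * \<mu> < -1 * (hits b C S \<omega> - \<mu>)})"
    using f\<Omega> by (intro card_mono) auto
  also have "\<dots> \<le> card {\<omega> \<in> ?\<Omega>. t * \<mu> < 1 * (hits b C S \<omega> - \<mu>)} + card {\<omega> \<in> ?\<Omega>. t * \<mu> < -1 * (hits b C S \<omega> - \<mu>)}"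
    by (rule card_Un_le)
  finally show ?thesis using tail[OF disjI1[OF refl]] tail[OF disjI2[OF refl]] by linarith
qed

text \<open>Union bound over \<open>Q\<close>. Disjointness is required only among the blocks of one
  member; different members may overlap arbitrarily.\<close>

lemma simultaneous_concentration:
  fixes S :: "'q \<Rightarrow> 'x set" and b :: "'q \<Rightarrow> 'x \<Rightarrow> 'i set" and C :: "'q \<Rightarrow> 'i \<Rightarrow> nat set"
    and t \<pi> :: "'q \<Rightarrow> real"
  assumes fI: "finite I" and B: "0 < B" and fQ: "finite Q"
    and fS: "\<And>q. q \<in> Q \<Longrightarrow> finite (S q)"
    and b: "\<And>q x. q \<in> Q \<Longrightarrow> x \<in> S q \<Longrightarrow> b q x \<subseteq> I"
      "\<And>q x y. q \<in> Q \<Longrightarrow> x \<in> S q \<Longrightarrow> y \<in> S q \<Longrightarrow> x \<noteq> y \<Longrightarrow> b q x \<inter> b q y = {}"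
    and C: "\<And>q x i. q \<in> Q \<Longrightarrow> x \<in> S q \<Longrightarrow> i \<in> b q x \<Longrightarrow> C q i \<subseteq> {..<B}"
    and \<pi>: "\<And>q x. q \<in> Q \<Longrightarrow> x \<in> S q \<Longrightarrow> (\<Prod>i\<in>b q x. card (C q i) / B) = \<pi> q"
    and t: "\<And>q. q \<in> Q \<Longrightarrow> 0 \<le> t q \<and> t q \<le> 1" and \<pi>0: "\<And>q. q \<in> Q \<Longrightarrow> 0 \<le> \<pi> q \<and> \<pi> q \<le> 1"
    and conc: "\<And>q. q \<in> Q \<Longrightarrow> L \<le> (t q)\<^sup>2 * (card (S q) * \<pi> q) / 4"
    and few: "2 * card Q * exp (- L) < 1"
  shows "\<exists>\<omega>\<in>I \<rightarrow>\<^sub>E {..<B}. \<forall>q\<in>Q. \<bar>hits (b q) (C q) (S q) \<omega> - card (S q) * \<pi> q\<bar> \<le> t q * (card (S q) * \<pi> q)"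
proof (rule ccontr)
  let ?\<Omega> = "I \<rightarrow>\<^sub>E {..<B}"
  have f\<Omega>: "finite ?\<Omega>" using fI by (auto intro: finite_PiE)
  define bad where "bad q = {\<omega> \<in> ?\<Omega>. t q * (card (S q) * \<pi> q) < \<bar>hits (b q) (C q) (S q) \<omega> - card (S q) * \<pi> q\<bar>}" for q
  assume "\<not> ?thesis"
  then have "?\<Omega> \<subseteq> (\<Union>q\<in>Q. bad q)" by (fastforce simp: bad_def not_le)
  then have "card ?\<Omega> \<le> card (\<Union>q\<in>Q. bad q)" using f\<Omega> fQ by (intro card_mono) (auto simp: bad_def)
  also have "\<dots> \<le> (\<Sum>q\<in>Q. card (bad q))" by (rule card_UN_le[OF fQ])
  finally have "real (card ?\<Omega>) \<le> (\<Sum>q\<in>Q. real (card (bad q)))" by (metis of_nat_le_iff of_nat_sum)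
  also have "\<dots> \<le> (\<Sum>q\<in>Q. 2 * exp (- L) * real B ^ card I)"
  proof (rule sum_mono)
    fix q assume q: "q \<in> Q"
    have "real (card (bad q)) \<le> 2 * exp (- (t q)\<^sup>2 * (card (S q) * \<pi> q) / 4) * real B ^ card I"
      unfolding bad_def
      by (rule few_bad_colourings[OF fI B fS[OF q] b(1)[OF q] b(2)[OF q] C[OF q] \<pi>[OF q]])
        (use t[OF q] \<pi>0[OF q] in auto)
    also have "\<dots> \<le> 2 * exp (- L) * real B ^ card I"
      using conc[OF q] by (intro mult_right_mono mult_left_mono) auto
    finally show "real (card (bad q)) \<le> 2 * exp (- L) * real B ^ card I" .
  qed
  also have "\<dots> = 2 * card Q * exp (- L) * real B ^ card I" by simp
  also have "\<dots> < 1 * real B ^ card I" using few B by (intro mult_strict_right_mono) auto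
  finally show False using fI by (simp add: card_PiE)
qed

section \<open>Permutations that spread sets\<close>

text \<open>By symmetry under transpositions, among the permutations mapping \<open>Z\<close> into \<open>C\<close> the proportion
  mapping a further point into \<open>C\<close> is \<open>(|C| - |Z|) / (|S| - |Z|)\<close>.\<close>

lemma card_permutations_into:
  assumes fS: "finite S" and CS: "C \<subseteq> S" and ZS: "Z \<subseteq> S"
  shows "real (card {\<sigma>. \<sigma> permutes S \<and> \<sigma> ` Z \<subseteq> C}) \<le> fact (card S) * (card C / card S) ^ card Z"
proof -
  have "finite Z" using ZS fS finite_subset by blast
  then show ?thesis using ZS
  proof (induction Z rule: finite_induct)
    case empty
    then show ?case using fS by (simp add: card_permutations)
  next
    case (insert i Z)
    define T where "T = {\<sigma>. \<sigma> permutes S \<and> \<sigma> ` Z \<subseteq> C}"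
    define T' where "T' k = {\<sigma>\<in>T. \<sigma> k \<in> C}" for k
    have fC: "finite C" using CS fS finite_subset by blast
    have fT: "finite T" unfolding T_def by (rule finite_subset[OF _ finite_permutations[OF fS]]) auto
    have card_eq: "card (T' k) = card (T' i)" if k: "k \<in> S - Z" for k
    proof -
      have i: "i \<in> S - Z" using insert by auto
      have into: "(\<lambda>\<sigma>. \<sigma> \<circ> Transposition.transpose i k) ` T' a \<subseteq> T' b" if ab: "(a = k \<and> b = i) \<or> (a = i \<and> b = k)" for a b
      proof (rule image_subsetI)
        fix \<sigma> assume s: "\<sigma> \<in> T' a"
        have tr: "Transposition.transpose i k z = z" if "z \<in> Z" for z
          using that i k by (intro transpose_apply_other) auto
        have "(\<sigma> \<circ> Transposition.transpose i k) permutes S"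
          using s i k by (intro permutes_compose permutes_swap_id) (auto simp: T'_def T_def)
        moreover have "(\<sigma> \<circ> Transposition.transpose i k) b = \<sigma> a" using ab by auto
        moreover have "\<sigma> a \<in> C" "\<sigma> ` Z \<subseteq> C" using s by (simp_all add: T'_def T_def)
        moreover have "(\<sigma> \<circ> Transposition.transpose i k) ` Z = \<sigma> ` Z"
          unfolding image_comp[symmetric] using tr by (simp cong: image_cong_simp)
        ultimately show "\<sigma> \<circ> Transposition.transpose i k \<in> T' b" unfolding T'_def T_def by simp
      qed
      have inj: "inj_on (\<lambda>\<sigma>. \<sigma> \<circ> Transposition.transpose i k) (T' a)" for a
      proof (rule inj_onI)
        fix \<sigma> \<tau> assume "\<sigma> \<circ> Transposition.transpose i k = \<tau> \<circ> Transposition.transpose i k"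
        then have "\<sigma> \<circ> Transposition.transpose i k \<circ> Transposition.transpose i k
            = \<tau> \<circ> Transposition.transpose i k \<circ> Transposition.transpose i k"
          by (rule arg_cong)
        then show "\<sigma> = \<tau>" by (simp only: comp_assoc transpose_comp_involutory comp_id)
      qed
      have "card (T' k) \<le> card (T' i)"
        by (rule card_inj_on_le[OF inj into]) (use fT in \<open>auto simp: T'_def\<close>)
      moreover have "card (T' i) \<le> card (T' k)"
        by (rule card_inj_on_le[OF inj into]) (use fT in \<open>auto simp: T'_def\<close>)
      ultimately show ?thesis by simp
    qed
    have cnt: "card {k\<in>S - Z. \<sigma> k \<in> C} = card C - card Z" if s: "\<sigma> \<in> T" for \<sigma>
    proof -
      have bij: "bij_betw \<sigma> S S" using s by (auto simp: T_def permutes_imp_bij)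
      have inj: "inj_on \<sigma> S" "\<sigma> ` S = S" using bij by (auto simp: bij_betw_def)
      have eq: "\<sigma> ` {k\<in>S - Z. \<sigma> k \<in> C} = C - \<sigma> ` Z"
      proof (intro set_eqI iffI)
        fix y assume "y \<in> \<sigma> ` {k\<in>S - Z. \<sigma> k \<in> C}"
        then obtain k where k: "k \<in> S" "k \<notin> Z" "y = \<sigma> k" "y \<in> C" by auto
        have "y \<notin> \<sigma> ` Z"
        proof
          assume "y \<in> \<sigma> ` Z"
          then obtain z where "z \<in> Z" "\<sigma> k = \<sigma> z" using k by auto
          then show False using inj_onD[OF inj(1), of k z] k insert.prems by auto
        qed
        then show "y \<in> C - \<sigma> ` Z" using k by simp
      next
        fix y assume y: "y \<in> C - \<sigma> ` Z"
        then have "y \<in> \<sigma> ` S" using CS inj(2) by auto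
        then obtain k where "k \<in> S" "y = \<sigma> k" by auto
        then show "y \<in> \<sigma> ` {k\<in>S - Z. \<sigma> k \<in> C}" using y by auto
      qed
      have "card {k\<in>S - Z. \<sigma> k \<in> C} = card (\<sigma> ` {k\<in>S - Z. \<sigma> k \<in> C})"
        by (rule card_image[symmetric], rule inj_on_subset[OF inj(1)]) auto
      also have "\<dots> = card C - card (\<sigma> ` Z)"
        unfolding eq using s insert.hyps by (intro card_Diff_subset) (auto simp: T_def)
      also have "card (\<sigma> ` Z) = card Z"
        by (rule card_image, rule inj_on_subset[OF inj(1)]) (use insert.prems in auto)
      finally show ?thesis .
    qed
    have "(\<Sum>k\<in>S - Z. card (T' k)) = (\<Sum>k\<in>S - Z. \<Sum>\<sigma>\<in>T. if \<sigma> k \<in> C then 1 else 0)"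
      using fT by (intro sum.cong refl) (simp add: sum.If_cases T'_def Int_def)
    also have "\<dots> = (\<Sum>\<sigma>\<in>T. \<Sum>k\<in>S - Z. if \<sigma> k \<in> C then 1 else 0)" by (rule sum.swap)
    also have "\<dots> = (\<Sum>\<sigma>\<in>T. card C - card Z)"
    proof (intro sum.cong refl)
      fix \<sigma> assume "\<sigma> \<in> T"
      have "(S - Z) \<inter> {k. \<sigma> k \<in> C} = {k\<in>S - Z. \<sigma> k \<in> C}" by auto
      then show "(\<Sum>k\<in>S - Z. if \<sigma> k \<in> C then 1 else 0) = card C - card Z"
        using cnt[OF \<open>\<sigma> \<in> T\<close>] fS by (simp add: sum.If_cases)
    qed
    finally have "(\<Sum>k\<in>S - Z. card (T' k)) = card T * (card C - card Z)" by simp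
    moreover have "(\<Sum>k\<in>S - Z. card (T' k)) = (\<Sum>k\<in>S - Z. card (T' i))"
      by (rule sum.cong[OF refl]) (rule card_eq)
    ultimately have main: "(card S - card Z) * card (T' i) = card T * (card C - card Z)"
      using insert.prems insert.hyps by (simp add: card_Diff_subset)
    have ZltS: "card Z < card S" using insert.prems insert.hyps fS by (intro psubset_card_mono) auto
    have "card (T' i) * real (card S) \<le> card T * real (card C)"
    proof (cases "card C \<le> card Z")
      case True
      then have "card (T' i) = 0" using main ZltS by simp
      then show ?thesis by simp
    next
      case False
      \<comment> \<open>Sampling without replacement only lowers the chance of a further point in
        \<open>C\<close>: (c - z)/(s - z) is at most c/s because c is at most s.\<close>
      define c s z where "c = real (card C)" and "s = real (card S)" and "z = real (card Z)"
      have "c \<le> s" using card_mono[OF fS CS] by (simp add: c_def s_def)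
      have "real ((card S - card Z) * card (T' i)) = real (card T * (card C - card Z))" using main by simp
      then have m: "(s - z) * card (T' i) = card T * (c - z)"
        using ZltS False by (simp add: c_def s_def z_def of_nat_diff)
      have "c * z \<le> s * z" using \<open>c \<le> s\<close> by (rule mult_right_mono) (simp add: z_def)
      then have "s * (c - z) \<le> c * (s - z)" by (simp add: algebra_simps)
      then have "card T * (s * (c - z)) \<le> card T * (c * (s - z))" by (intro mult_left_mono) auto
      moreover have "(s - z) * (card (T' i) * s) = card T * (s * (c - z))"
      proof -
        have "(s - z) * (card (T' i) * s) = (s - z) * card (T' i) * s" by (simp only: mult.assoc)
        then show ?thesis unfolding m by (simp only: mult_ac)
      qed
      moreover have "(s - z) * (card T * c) = card T * (c * (s - z))" by (simp only: mult_ac)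
      ultimately have "(s - z) * (card (T' i) * s) \<le> (s - z) * (card T * c)" by linarith
      moreover have "0 < s - z" using ZltS by (simp add: s_def z_def)
      ultimately show ?thesis by (simp add: c_def s_def)
    qed
    then have "real (card (T' i)) \<le> card T * (card C / card S)" using ZltS by (simp add: field_simps)
    also have "\<dots> \<le> (fact (card S) * (card C / card S) ^ card Z) * (card C / card S)"
      using insert.IH insert.prems by (intro mult_right_mono) (auto simp: T_def)
    finally show ?case using insert.hyps by (simp add: T'_def T_def algebra_simps conj_ac)
  qed
qed

text \<open>Few images in \<open>B\<close> means many in the complement \<open>C\<close>, and for
  those \<open>card_permutations_into\<close> bounds all joint probabilities by the independent
  ones, which is what an upper bound on the generating function needs. With 1 + \<theta> = 1/(1 - s)
  that bound becomes (1 + \<theta>)^a (1 - s b)^a, and the first factor cancels against the trivial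
  part of the exponent in Markov's inequality.\<close>

lemma few_bad_permutations:
  fixes \<eta> :: real
  assumes fS: "finite S" and AS: "A \<subseteq> S" and BS: "B \<subseteq> S" and S0: "S \<noteq> {}" and eta: "0 < \<eta>" "\<eta> \<le> 1"
  shows "real (card {\<sigma>. \<sigma> permutes S \<and> card {i\<in>A. \<sigma> i \<in> B} < (1 - \<eta>) * (card A * card B / card S)})
    \<le> exp (- \<eta>\<^sup>2 * (card A * card B / card S) / 4) * fact (card S)"
proof -
  define q a b where "q = real (card S)" and "a = real (card A)" and "b = real (card B) / q"
  define s where "s = \<eta> / 2"
  define \<theta> where "\<theta> = s / (1 - s)"
  have s: "0 < s" "s \<le> 1/2" using eta by (auto simp: s_def)
  have th: "0 \<le> \<theta>" "1 + \<theta> = 1 / (1 - s)" using s by (auto simp: \<theta>_def field_simps)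
  have th1: "0 < 1 + \<theta>" using th(1) by simp
  have fA: "finite A" using AS fS finite_subset by blast
  have fB: "finite B" using BS fS finite_subset by blast
  have q0: "0 < q" using S0 fS by (simp add: q_def card_gt_0_iff)
  have b01: "0 \<le> b" "b \<le> 1" using q0 card_mono[OF fS BS] by (auto simp: b_def q_def)
  let ?P = "{\<sigma>. \<sigma> permutes S}"
  have fP: "finite ?P" by (rule finite_permutations[OF fS])
  have cP: "real (card ?P) = fact (card S)" using fS by (simp add: card_permutations)
  define C where "C = S - B"
  have cC: "card C / card S = 1 - b"
  proof -
    have "card C + card B = card S" using fS fB BS by (simp add: C_def card_Diff_subset card_mono)
    then have "real (card C) = q - real (card B)" unfolding q_def by linarith
    then show ?thesis using q0 by (simp add: b_def q_def[symmetric] diff_divide_distrib)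
  qed
  define Y where "Y \<sigma> = card {i\<in>A. \<sigma> i \<in> C}" for \<sigma>
  have mgf: "(\<Sum>\<sigma>\<in>?P. (1 + \<theta>) ^ Y \<sigma>) \<le> fact (card S) * (1 + \<theta> * (1 - b)) ^ card A"
  proof -
    have "(1 + \<theta>) ^ Y \<sigma> = (\<Sum>Z\<in>Pow A. \<theta> ^ card Z * (if \<sigma> ` Z \<subseteq> C then 1 else 0))" for \<sigma>
    proof -
      have "(1 + \<theta>) ^ Y \<sigma> = (\<Prod>x\<in>A. if \<sigma> x \<in> C then 1 + \<theta> else 1)"
        using fA by (simp add: prod.If_cases Y_def Int_def)
      also have "\<dots> = (\<Prod>x\<in>A. (if \<sigma> x \<in> C then \<theta> else 0) + 1)" by (intro prod.cong) auto
      also have "\<dots> = (\<Sum>Z\<in>Pow A. (\<Prod>x\<in>Z. if \<sigma> x \<in> C then \<theta> else 0) * (\<Prod>x\<in>A - Z. 1))"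
        by (rule prod_add[OF fA])
      also have "\<dots> = (\<Sum>Z\<in>Pow A. \<theta> ^ card Z * (if \<sigma> ` Z \<subseteq> C then 1 else 0))"
      proof (intro sum.cong refl)
        fix Z assume "Z \<in> Pow A"
        then have "finite Z" using fA finite_subset by blast
        then show "(\<Prod>x\<in>Z. if \<sigma> x \<in> C then \<theta> else 0) * (\<Prod>x\<in>A - Z. 1) = \<theta> ^ card Z * (if \<sigma> ` Z \<subseteq> C then 1 else 0)"
        proof (cases "\<sigma> ` Z \<subseteq> C")
          case True
          then have "(\<Prod>x\<in>Z. if \<sigma> x \<in> C then \<theta> else 0) = (\<Prod>x\<in>Z. \<theta>)" by (intro prod.cong) auto
          then show ?thesis using True by simp
        next
          case False
          then have "(\<Prod>x\<in>Z. if \<sigma> x \<in> C then \<theta> else 0) = 0"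
            using \<open>finite Z\<close> by (intro prod_zero) auto
          then show ?thesis using False by simp
        qed
      qed
      finally show ?thesis .
    qed
    then have "(\<Sum>\<sigma>\<in>?P. (1 + \<theta>) ^ Y \<sigma>) = (\<Sum>Z\<in>Pow A. \<theta> ^ card Z * (\<Sum>\<sigma>\<in>?P. if \<sigma> ` Z \<subseteq> C then 1 else 0))"
      by (simp only: sum_distrib_left) (rule sum.swap)
    also have "\<dots> \<le> (\<Sum>Z\<in>Pow A. \<theta> ^ card Z * (fact (card S) * (1 - b) ^ card Z))"
    proof (rule sum_mono, rule mult_left_mono)
      fix Z assume "Z \<in> Pow A"
      then have ZS: "Z \<subseteq> S" using AS by auto
      have "?P \<inter> {\<sigma>. \<sigma> ` Z \<subseteq> C} = {\<sigma>. \<sigma> permutes S \<and> \<sigma> ` Z \<subseteq> C}" by auto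
      then have "(\<Sum>\<sigma>\<in>?P. if \<sigma> ` Z \<subseteq> C then 1 else 0) = real (card {\<sigma>. \<sigma> permutes S \<and> \<sigma> ` Z \<subseteq> C})"
        using fP by (simp add: sum.If_cases)
      also have "\<dots> \<le> fact (card S) * (1 - b) ^ card Z"
        unfolding cC[symmetric] by (rule card_permutations_into[OF fS _ ZS]) (simp add: C_def)
      finally show "(\<Sum>\<sigma>\<in>?P. if \<sigma> ` Z \<subseteq> C then 1 else 0) \<le> fact (card S) * (1 - b) ^ card Z" .
    qed (use th in auto)
    also have "\<dots> = fact (card S) * (\<Sum>Z\<in>Pow A. (\<Prod>x\<in>Z. \<theta> * (1 - b)) * (\<Prod>x\<in>A - Z. 1))"
      unfolding sum_distrib_left by (intro sum.cong refl) (simp add: power_mult_distrib)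
    also have "\<dots> = fact (card S) * (1 + \<theta> * (1 - b)) ^ card A"
      unfolding prod_add[OF fA, symmetric] by (simp add: add.commute)
    finally show ?thesis .
  qed
  let ?bad = "{\<sigma>. \<sigma> permutes S \<and> card {i\<in>A. \<sigma> i \<in> B} < (1 - \<eta>) * (card A * card B / card S)}"
  have X: "real (card {i\<in>A. \<sigma> i \<in> B}) = a - Y \<sigma>" if "\<sigma> permutes S" for \<sigma>
  proof -
    have "\<sigma> i \<in> S" if "i \<in> A" for i using that AS \<open>\<sigma> permutes S\<close> permutes_in_image by fastforce
    then have "A = {i\<in>A. \<sigma> i \<in> B} \<union> {i\<in>A. \<sigma> i \<in> C}" by (auto simp: C_def)
    then have "card A = card ({i\<in>A. \<sigma> i \<in> B} \<union> {i\<in>A. \<sigma> i \<in> C})" by (rule arg_cong)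
    also have "\<dots> = card {i\<in>A. \<sigma> i \<in> B} + card {i\<in>A. \<sigma> i \<in> C}"
      using fA by (intro card_Un_disjoint) (auto simp: C_def)
    finally show ?thesis by (simp add: a_def Y_def)
  qed
  have mu: "card A * card B / card S = a * b" by (simp add: a_def b_def q_def)
  \<comment> \<open>In terms of \<open>s\<close> this is the inequality -ln (1 - s) \<le> s +
    s^2.\<close>
  have L: "ln (1 + \<theta>) \<le> s + s\<^sup>2" "0 \<le> ln (1 + \<theta>)"
  proof -
    have "1 + \<theta> \<le> exp (s + s\<^sup>2)"
    proof -
      have "1 \<le> (1 + (s + s\<^sup>2) + (s + s\<^sup>2)\<^sup>2 / 2) * (1 - s)"
      proof -
        have "(1 + (s + s\<^sup>2) + (s + s\<^sup>2)\<^sup>2 / 2) * (1 - s) = 1 + s\<^sup>2 / 2 * (1 - s - s\<^sup>2 - s\<^sup>2 * s)"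
          by (simp add: power2_eq_square field_simps)
        moreover have "0 \<le> 1 - s - s\<^sup>2 - s\<^sup>2 * s"
        proof -
          have "s\<^sup>2 \<le> (1/2)\<^sup>2" using s by (intro power_mono) auto
          moreover have "s\<^sup>2 * s \<le> (1/2)\<^sup>2 * (1/2)" using s calculation by (intro mult_mono) auto
          ultimately show ?thesis using s by (simp add: power2_eq_square)
        qed
        ultimately show ?thesis by simp
      qed
      also have "\<dots> \<le> exp (s + s\<^sup>2) * (1 - s)"
        using s by (intro mult_right_mono exp_lower_Taylor_quadratic) auto
      finally show ?thesis using s by (simp add: th field_simps)
    qed
    then show "ln (1 + \<theta>) \<le> s + s\<^sup>2" using th by (metis exp_gt_zero exp_le_cancel_iff exp_ln order_less_le_trans add_pos_nonneg zero_less_one)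
    show "0 \<le> ln (1 + \<theta>)" using th by (intro ln_ge_zero) auto
  qed
  have "card ?bad * (1 + \<theta>) powr (a - (1 - \<eta>) * (a * b)) = (\<Sum>\<sigma>\<in>?bad. (1 + \<theta>) powr (a - (1 - \<eta>) * (a * b)))" by simp
  also have "\<dots> \<le> (\<Sum>\<sigma>\<in>?bad. (1 + \<theta>) ^ Y \<sigma>)"
  proof (rule sum_mono)
    fix \<sigma> assume "\<sigma> \<in> ?bad"
    then have "a - (1 - \<eta>) * (a * b) \<le> Y \<sigma>" using X[of \<sigma>] by (auto simp: mu[symmetric])
    then have "(1 + \<theta>) powr (a - (1 - \<eta>) * (a * b)) \<le> (1 + \<theta>) powr (Y \<sigma>)" using th by (intro powr_mono) auto
    then show "(1 + \<theta>) powr (a - (1 - \<eta>) * (a * b)) \<le> (1 + \<theta>) ^ Y \<sigma>"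
      using powr_realpow[OF th1] by simp
  qed
  also have "\<dots> \<le> (\<Sum>\<sigma>\<in>?P. (1 + \<theta>) ^ Y \<sigma>)" using fP th1 by (intro sum_mono2) auto
  also note mgf
  also have "fact (card S) * (1 + \<theta> * (1 - b)) ^ card A = fact (card S) * ((1 + \<theta>) powr a * (1 - s * b) ^ card A)"
  proof -
    have "1 + \<theta> * (1 - b) = (1 + \<theta>) * (1 - s * b)" using s by (simp add: \<theta>_def field_simps)
    then show ?thesis using powr_realpow[OF th1, of "card A"] by (simp add: power_mult_distrib a_def)
  qed
  finally have "card ?bad * (1 + \<theta>) powr (a - (1 - \<eta>) * (a * b)) \<le> fact (card S) * ((1 + \<theta>) powr a * (1 - s * b) ^ card A)" .
  moreover have "(1 - s * b) ^ card A \<le> exp (- (s * b) * a)"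
  proof -
    have "s * b \<le> 1" using s b01 mult_mono[of s 1 b 1] by simp
    then have "(1 - s * b) ^ card A \<le> exp (- (s * b)) ^ card A"
      using exp_ge_add_one_self[of "- (s * b)"] by (intro power_mono) auto
    then show ?thesis by (simp add: exp_of_nat_mult[symmetric] a_def mult.commute)
  qed
  then have "fact (card S) * ((1 + \<theta>) powr a * (1 - s * b) ^ card A) \<le> fact (card S) * ((1 + \<theta>) powr a * exp (- (s * b) * a))"
    by (intro mult_left_mono) auto
  ultimately have "card ?bad * (1 + \<theta>) powr (a - (1 - \<eta>) * (a * b)) \<le> fact (card S) * ((1 + \<theta>) powr a * exp (- (s * b) * a))"
    by linarith
  moreover have "(1 + \<theta>) powr a = (1 + \<theta>) powr (a - (1 - \<eta>) * (a * b)) * (1 + \<theta>) powr ((1 - \<eta>) * (a * b))"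
    by (simp add: powr_add[symmetric])
  ultimately have "(1 + \<theta>) powr (a - (1 - \<eta>) * (a * b)) * card ?bad \<le>
      (1 + \<theta>) powr (a - (1 - \<eta>) * (a * b)) * (fact (card S) * ((1 + \<theta>) powr ((1 - \<eta>) * (a * b)) * exp (- (s * b) * a)))"
    by (simp add: algebra_simps)
  then have "card ?bad \<le> fact (card S) * ((1 + \<theta>) powr ((1 - \<eta>) * (a * b)) * exp (- (s * b) * a))"
    using th by (subst (asm) mult_le_cancel_left_pos) auto
  also have "\<dots> \<le> fact (card S) * exp (- \<eta>\<^sup>2 * (a * b) / 4)"
  proof (rule mult_left_mono)
    have "(1 + \<theta>) powr ((1 - \<eta>) * (a * b)) * exp (- (s * b) * a) = exp ((1 - \<eta>) * (a * b) * ln (1 + \<theta>) + - (s * b) * a)"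
      unfolding powr_def exp_add using th1 by simp
    also have "\<dots> \<le> exp (- \<eta>\<^sup>2 * (a * b) / 4)"
    proof -
      have ab: "0 \<le> a * b" using b01 by (simp add: a_def)
      have "(1 - \<eta>) * (a * b) * ln (1 + \<theta>) \<le> (1 - \<eta>) * (a * b) * (s + s\<^sup>2)"
        using L eta ab by (intro mult_left_mono) auto
      moreover have "(1 - \<eta>) * (a * b) * (s + s\<^sup>2) - s * b * a = (a * b) * ((1 - \<eta>) * (s + s\<^sup>2) - s)" by (simp add: algebra_simps)
      moreover have "(a * b) * ((1 - \<eta>) * (s + s\<^sup>2) - s) \<le> (a * b) * (- \<eta>\<^sup>2 / 4)"
      proof (rule mult_left_mono[OF _ ab])
        have "(1 - \<eta>) * (s + s\<^sup>2) - s = - \<eta>\<^sup>2 / 4 - \<eta> * \<eta>\<^sup>2 / 4"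
          by (simp add: s_def power2_eq_square field_simps)
        then show "(1 - \<eta>) * (s + s\<^sup>2) - s \<le> - \<eta>\<^sup>2 / 4" using eta by simp
      qed
      ultimately have "(1 - \<eta>) * (a * b) * ln (1 + \<theta>) + - (s * b) * a \<le> - \<eta>\<^sup>2 * (a * b) / 4" by (simp add: algebra_simps)
      then show ?thesis by simp
    qed
    finally show "(1 + \<theta>) powr ((1 - \<eta>) * (a * b)) * exp (- (s * b) * a) \<le> exp (- \<eta>\<^sup>2 * (a * b) / 4)" .
  qed simp
  finally show ?thesis unfolding mu by (simp add: mult.commute)
qed

lemma spreading_permutation:
  fixes \<eta> :: real
  assumes fS: "finite S" "S \<noteq> {}" and fQ: "finite Q"
    and A: "\<And>q. q \<in> Q \<Longrightarrow> A q \<subseteq> S" and B: "\<And>q. q \<in> Q \<Longrightarrow> B q \<subseteq> S" and eta: "0 < \<eta>" "\<eta> \<le> 1"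
    and conc: "\<And>q. q \<in> Q \<Longrightarrow> L \<le> \<eta>\<^sup>2 * (card (A q) * card (B q) / card S) / 4"
    and few: "card Q * exp (- L) < 1"
  shows "\<exists>\<sigma>. \<sigma> permutes S \<and> (\<forall>q\<in>Q. (1 - \<eta>) * (card (A q) * card (B q) / card S) \<le> card {i\<in>A q. \<sigma> i \<in> B q})"
proof (rule ccontr)
  assume no: "\<not> ?thesis"
  let ?P = "{\<sigma>. \<sigma> permutes S}"
  define bad where "bad q = {\<sigma>. \<sigma> permutes S \<and> card {i\<in>A q. \<sigma> i \<in> B q} < (1 - \<eta>) * (card (A q) * card (B q) / card S)}" for q
  have fP: "finite ?P" by (rule finite_permutations[OF fS(1)])
  have cP: "real (card ?P) = fact (card S)" using fS by (simp add: card_permutations)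
  have "?P \<subseteq> (\<Union>q\<in>Q. bad q)" using no by (fastforce simp: bad_def not_le)
  moreover have "finite (bad q)" for q by (rule finite_subset[OF _ fP]) (auto simp: bad_def)
  ultimately have "card ?P \<le> card (\<Union>q\<in>Q. bad q)" using fQ by (intro card_mono) auto
  also have "\<dots> \<le> (\<Sum>q\<in>Q. card (bad q))" by (rule card_UN_le[OF fQ])
  finally have "real (card ?P) \<le> (\<Sum>q\<in>Q. real (card (bad q)))" by (metis of_nat_le_iff of_nat_sum)
  also have "\<dots> \<le> (\<Sum>q\<in>Q. exp (- L) * fact (card S))"
  proof (rule sum_mono)
    fix q assume q: "q \<in> Q"
    have "real (card (bad q)) \<le> exp (- \<eta>\<^sup>2 * (card (A q) * card (B q) / card S) / 4) * fact (card S)"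
      unfolding bad_def by (rule few_bad_permutations[OF fS(1) A[OF q] B[OF q] fS(2) eta])
    also have "\<dots> \<le> exp (- L) * fact (card S)" using conc[OF q] by (intro mult_right_mono) auto
    finally show "real (card (bad q)) \<le> exp (- L) * fact (card S)" .
  qed
  also have "\<dots> = card Q * exp (- L) * fact (card S)" by simp
  also have "\<dots> < 1 * fact (card S)" using few by (intro mult_strict_right_mono) auto
  finally show False using cP by simp
qed

section \<open>Perfect matchings from codegrees\<close>

text \<open>Cauchy-Schwarz as in the Kovari-Sos-Turan argument: the squared degrees count pairs of
  sets with a common point, where a diagonal pair contributes at most \<open>D\<close> and any other
  pair at most \<open>c\<close>.\<close>

lemma codegree_edge_bound:
  fixes N :: "'i \<Rightarrow> 'a set" and D c :: real
  assumes fZ: "finite Z" and fY: "finite Y" and fN: "\<And>i. i \<in> Z \<Longrightarrow> finite (N i)"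
    and D: "\<And>i. i \<in> Z \<Longrightarrow> card (N i) \<le> D" and c0: "0 \<le> c"
    and c: "\<And>i j. i \<in> Z \<Longrightarrow> j \<in> Z \<Longrightarrow> i \<noteq> j \<Longrightarrow> card (N i \<inter> N j) \<le> c"
  shows "(\<Sum>y\<in>Y. real (card {i\<in>Z. y \<in> N i}))\<^sup>2 \<le> card Y * (card Z * (D + card Z * c))"
proof -
  have ind: "real (card {i\<in>Z. y \<in> N i}) = (\<Sum>i\<in>Z. if y \<in> N i then 1 else 0)" for y
    using fZ by (simp add: sum.If_cases Int_def)
  have "(\<Sum>y\<in>Y. (real (card {i\<in>Z. y \<in> N i}))\<^sup>2) = (\<Sum>y\<in>Y. \<Sum>i\<in>Z. \<Sum>j\<in>Z. if y \<in> N i \<and> y \<in> N j then 1 else 0)"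
    unfolding ind power2_eq_square sum_product by (intro sum.cong refl) auto
  also have "\<dots> = (\<Sum>i\<in>Z. \<Sum>y\<in>Y. \<Sum>j\<in>Z. if y \<in> N i \<and> y \<in> N j then 1 else 0)" by (rule sum.swap)
  also have "\<dots> = (\<Sum>i\<in>Z. \<Sum>j\<in>Z. \<Sum>y\<in>Y. if y \<in> N i \<and> y \<in> N j then 1 else 0)"
    by (rule sum.cong[OF refl], rule sum.swap)
  also have "\<dots> \<le> (\<Sum>i\<in>Z. D + card Z * c)"
  proof (rule sum_mono)
    fix i assume i: "i \<in> Z"
    have le: "(\<Sum>y\<in>Y. if y \<in> N i \<and> y \<in> N j then 1 else 0) \<le> real (card (N i \<inter> N j))" if "j \<in> Z" for j
    proof -
      have "(\<Sum>y\<in>Y. if y \<in> N i \<and> y \<in> N j then 1 else 0) = real (card (Y \<inter> {y. y \<in> N i \<and> y \<in> N j}))"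
        using fY by (simp add: sum.If_cases)
      also have "\<dots> \<le> real (card (N i \<inter> N j))"
        using fN[OF i] by (intro of_nat_mono card_mono) auto
      finally show ?thesis .
    qed
    have "(\<Sum>j\<in>Z. \<Sum>y\<in>Y. if y \<in> N i \<and> y \<in> N j then 1 else 0) \<le> (\<Sum>j\<in>Z. real (card (N i \<inter> N j)))"
      by (rule sum_mono) (rule le)
    also have "\<dots> = real (card (N i)) + (\<Sum>j\<in>Z - {i}. real (card (N i \<inter> N j)))"
      using fZ i by (subst sum.remove[of _ i]) auto
    also have "\<dots> \<le> D + (\<Sum>j\<in>Z. c)"
    proof (rule add_mono[OF D[OF i]])
      have "(\<Sum>j\<in>Z - {i}. real (card (N i \<inter> N j))) \<le> (\<Sum>j\<in>Z - {i}. c)"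
        using i by (intro sum_mono c) auto
      also have "\<dots> \<le> (\<Sum>j\<in>Z. c)" using fZ c0 by (intro sum_mono2) auto
      finally show "(\<Sum>j\<in>Z - {i}. real (card (N i \<inter> N j))) \<le> (\<Sum>j\<in>Z. c)" .
    qed
    finally show "(\<Sum>j\<in>Z. \<Sum>y\<in>Y. if y \<in> N i \<and> y \<in> N j then 1 else 0) \<le> D + card Z * c" by simp
  qed
  finally have sq: "(\<Sum>y\<in>Y. (real (card {i\<in>Z. y \<in> N i}))\<^sup>2) \<le> card Z * (D + card Z * c)" by simp
  have "(\<Sum>y\<in>Y. real (card {i\<in>Z. y \<in> N i}))\<^sup>2 \<le> (\<Sum>y\<in>Y. (real (card {i\<in>Z. y \<in> N i}))\<^sup>2) * card Y"
    by (rule sum_squared_le_sum_of_squares)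
  also have "\<dots> \<le> (card Z * (D + card Z * c)) * card Y" using sq by (intro mult_right_mono) auto
  finally show ?thesis by (simp add: mult.commute)
qed

text \<open>Hall's condition for small sets \<open>X\<close> follows from the codegrees; for large \<open>X\<close> the
  codegrees are applied to the complement of \<open>X\<close>, seen from outside the neighbourhood of \<open>X\<close>.\<close>

lemma codegree_perfect_matching:
  fixes N :: "'i \<Rightarrow> 'a set" and D c d d' \<theta> :: real
  assumes fP: "finite P" and fW: "finite W" and PW: "card P = card W"
    and NW: "\<And>i. i \<in> P \<Longrightarrow> N i \<subseteq> W"
    and D: "\<And>i. i \<in> P \<Longrightarrow> card (N i) \<le> D" and d: "\<And>i. i \<in> P \<Longrightarrow> d \<le> card (N i)"
    and c: "\<And>i j. i \<in> P \<Longrightarrow> j \<in> P \<Longrightarrow> i \<noteq> j \<Longrightarrow> card (N i \<inter> N j) \<le> c"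
    and d': "\<And>x. x \<in> W \<Longrightarrow> d' \<le> card {i\<in>P. x \<in> N i}"
    and pos: "0 \<le> c" "0 \<le> D" "0 < d" "0 < d'"
    and small: "D + \<theta> * c \<le> d\<^sup>2" and large: "D + (card P - \<theta>) * c < d'\<^sup>2"
  shows "\<exists>f. inj_on f P \<and> (\<forall>i\<in>P. f i \<in> N i)"
proof (rule hall_marriage[OF fP])
  show fN: "finite (N i)" if "i \<in> P" for i using NW[OF that] fW finite_subset by blast
  fix X assume X: "X \<subseteq> P"
  let ?U = "\<Union>i\<in>X. N i"
  have fX: "finite X" using X fP finite_subset by blast
  have UW: "?U \<subseteq> W" using NW X by blast
  have fU: "finite ?U" using UW fW finite_subset by blast
  have bound: "(\<Sum>y\<in>Y. real (card {i\<in>Z. y \<in> N i}))\<^sup>2 \<le> card Y * (card Z * (D + card Z * c))"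
    if "Z \<subseteq> P" "Y \<subseteq> W" for Z Y
    by (rule codegree_edge_bound)
      (use that fP fW fN D c pos finite_subset in \<open>blast+\<close>)
  show "card X \<le> card ?U"
  proof (rule ccontr)
    assume "\<not> card X \<le> card ?U"
    then have lt: "card ?U < card X" by simp
    define k where "k = real (card X)"
    have k0: "0 < k" using lt by (simp add: k_def)
    show False
    proof (cases "k \<le> \<theta>")
      case True
      have "(\<Sum>y\<in>?U. real (card {i\<in>X. y \<in> N i})) = (\<Sum>i\<in>X. real (card (N i)))"
      proof -
        have "(\<Sum>y\<in>?U. real (card {i\<in>X. y \<in> N i})) = (\<Sum>y\<in>?U. \<Sum>i\<in>X. if y \<in> N i then 1 else 0)"
          using fX by (intro sum.cong refl) (simp add: sum.If_cases Int_def)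
        also have "\<dots> = (\<Sum>i\<in>X. \<Sum>y\<in>?U. if y \<in> N i then 1 else 0)" by (rule sum.swap)
        also have "\<dots> = (\<Sum>i\<in>X. real (card (N i)))"
        proof (intro sum.cong refl)
          fix i assume "i \<in> X"
          then have "?U \<inter> {y. y \<in> N i} = N i" by auto
          then show "(\<Sum>y\<in>?U. if y \<in> N i then 1 else 0) = real (card (N i))"
            using fU by (simp add: sum.If_cases)
        qed
        finally show ?thesis .
      qed
      also have "k * d \<le> \<dots>"
        using sum_mono[of X "\<lambda>_. d" "\<lambda>i. real (card (N i))"] d X by (simp add: k_def subset_iff)
      finally have "(k * d)\<^sup>2 \<le> (\<Sum>y\<in>?U. real (card {i\<in>X. y \<in> N i}))\<^sup>2"
        using k0 pos by (intro power_mono) auto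
      also have "\<dots> \<le> card ?U * (k * (D + k * c))" unfolding k_def by (rule bound[OF X UW])
      also have "\<dots> \<le> card ?U * (k * d\<^sup>2)"
      proof -
        have "k * c \<le> \<theta> * c" using True pos by (intro mult_right_mono) auto
        then show ?thesis using small k0 by (intro mult_left_mono) auto
      qed
      also have "\<dots> < k * (k * d\<^sup>2)" using lt k0 pos by (intro mult_strict_right_mono) (auto simp: k_def)
      finally show False by (simp add: power2_eq_square algebra_simps)
    next
      case False
      \<comment> \<open>Points of \<open>Y\<close> have all their neighbours in \<open>Z\<close>,
        and the violation of Hall's condition makes \<open>Y\<close> strictly larger than
        \<open>Z\<close>.\<close>
      define Y Z where "Y = W - ?U" and "Z = P - X"
      define z y where "z = real (card Z)" and "y = real (card Y)"
      have z: "z = card P - k" using X fP fX by (simp add: z_def Z_def k_def card_Diff_subset card_mono of_nat_diff)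
      have "y = real (card W) - real (card ?U)"
        using UW fW fU by (simp add: y_def Y_def card_Diff_subset card_mono of_nat_diff)
      then have yz: "z < y" using z lt PW by (simp add: k_def)
      have z0: "0 \<le> z" by (simp add: z_def)
      have "y * d' \<le> (\<Sum>x\<in>Y. real (card {i\<in>Z. x \<in> N i}))"
      proof -
        have "d' \<le> real (card {i\<in>Z. x \<in> N i})" if x: "x \<in> Y" for x
        proof -
          have "{i\<in>P. x \<in> N i} = {i\<in>Z. x \<in> N i}" using x by (auto simp: Y_def Z_def)
          then show ?thesis using d'[of x] x by (simp add: Y_def)
        qed
        then show ?thesis using sum_mono[of Y "\<lambda>_. d'" "\<lambda>x. real (card {i\<in>Z. x \<in> N i})"] by (simp add: y_def)
      qed
      then have "(y * d')\<^sup>2 \<le> (\<Sum>x\<in>Y. real (card {i\<in>Z. x \<in> N i}))\<^sup>2"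
        using yz z0 pos by (intro power_mono) auto
      also have "\<dots> \<le> y * (z * (D + z * c))" unfolding y_def z_def by (rule bound) (auto simp: Y_def Z_def)
      also have "\<dots> \<le> y * (z * d'\<^sup>2)"
      proof -
        have "z * c \<le> (card P - \<theta>) * c" using False z pos by (intro mult_right_mono) auto
        then show ?thesis using large z0 yz by (intro mult_left_mono) auto
      qed
      also have "\<dots> < y * (y * d'\<^sup>2)"
        using yz z0 pos by (intro mult_strict_left_mono mult_strict_right_mono) auto
      finally show False by (simp add: power2_eq_square algebra_simps)
    qed
  qed
qed

section \<open>Primes in intervals\<close>

text \<open>The reciprocals of k (m choose k) form Leibniz's harmonic triangle, in which an entry is
  the difference of two neighbours, 1/C = 1/A - 1/B. Hence the products of \<open>L\<close> with the
  entries stay integers when one moves inwards from the edge entries 1/m.\<close>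

lemma mult_binomial_dvd_common_multiple:
  fixes L :: nat
  assumes "L > 0" "\<And>i. 1 \<le> i \<Longrightarrow> i \<le> m \<Longrightarrow> i dvd L" "1 \<le> k" "k \<le> m"
  shows "k * (m choose k) dvd L"
  using assms(2-)
proof (induction m arbitrary: k)
  case (Suc m)
  from \<open>1 \<le> k\<close> \<open>k \<le> Suc m\<close> show ?case
  proof (induction k rule: nat_induct_at_least)
    case base
    then show ?case using Suc.prems(1)[of "Suc m"] by simp
  next
    case (Suc k)
    then have km: "1 \<le> k" "k \<le> m" by auto
    have "k * (Suc m choose k) dvd L" using Suc by simp
    then obtain v where v: "L = k * (Suc m choose k) * v" by (elim dvdE)
    have "k * (m choose k) dvd L" using Suc.IH Suc.prems km \<open>\<And>k. \<lbrakk>\<And>i. 1 \<le> i \<Longrightarrow> i \<le> m \<Longrightarrow> i dvd L; 1 \<le> k; k \<le> m\<rbrakk> \<Longrightarrow> k * (m choose k) dvd L\<close> \<open>\<And>i. 1 \<le> i \<Longrightarrow> i \<le> Suc m \<Longrightarrow> i dvd L\<close> by simp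
    then obtain u where u: "L = k * (m choose k) * u" by (elim dvdE)
    define A B C where "A = real (k * (m choose k))" and "B = real (k * (Suc m choose k))"
      and "C = real (Suc k * (Suc m choose Suc k))"
    have pos: "0 < A" "0 < B" "0 < C" 
      unfolding A_def B_def C_def of_nat_0_less_iff nat_0_less_mult_iff zero_less_binomial_iff using km by auto
    have e1: "C = real (Suc m) * real (m choose k)"
      unfolding C_def of_nat_mult[symmetric] Suc_times_binomial_eq[of m k] by (simp only: mult.commute)
    have e2: "real (Suc m - k) * real (Suc m choose k) = real (Suc m) * real (m choose k)"
      using binomial_absorb_comp[of "Suc m" k] by (simp only: of_nat_mult[symmetric] diff_Suc_1)
    have e3: "real (Suc m - k) = real (Suc m) - real k" using km by (simp add: of_nat_diff)
    have "1 / C = 1 / A - 1 / B"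
    proof -
      define b where "b = real (m choose k)"
      define b' where "b' = real (Suc m choose k)"
      define M where "M = real (Suc m)"
      define K where "K = real k"
      have h: "0 < b" "0 < b'" "0 < M" "0 < K" "(M - K) * b' = M * b" 
        using e2 e3 km by (auto simp: b_def b'_def M_def K_def)
      have "K * (b' * b) * M = (M * b') * (K * b)" by simp
      have "M * b * (b' - b) = b' * K * b"
      proof -
        have "M * b' - M * b = K * b'" using h(5) by (simp add: algebra_simps)
        then have "b * (M * b' - M * b) = b * (K * b')" by simp
        then show ?thesis by (simp add: algebra_simps)
      qed
      then have "1 / (M * b) = 1 / (K * b) - 1 / (K * b')" using h by (simp add: field_simps)
      then show ?thesis by (simp add: e1 A_def B_def b_def b'_def M_def K_def)
    qed
    moreover have LA: "real L = A * real u" and LB: "real L = B * real v"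
      unfolding A_def B_def using u v by (metis of_nat_mult)+
    have "real L / A = real u" using LA pos by simp
    moreover have "real L / B = real v" using LB pos by simp
    ultimately have "real L / C = real u - real v"
      by (metis (no_types, opaque_lifting) divide_inverse inverse_eq_divide right_diff_distrib)
    then have L: "real L = C * (real u - real v)" using pos by (simp add: field_simps)
    have "0 < real u - real v"
    proof (rule ccontr)
      assume "\<not> 0 < real u - real v"
      then have "C * (real u - real v) \<le> 0" using pos by (simp add: mult_le_0_iff)
      then show False using L \<open>L > 0\<close> by simp
    qed
    then have "real L = real (Suc k * (Suc m choose Suc k) * (u - v))"
      using L by (simp add: C_def of_nat_diff)
    then have "L = Suc k * (Suc m choose Suc k) * (u - v)" by (simp only: of_nat_eq_iff)
    then show ?case by (rule dvdI)
  qed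
qed simp

text \<open>The number \<open>L\<close> below is the least common multiple of \<open>1,\<dots>,m\<close>; it is at most \<open>m\<close> to the
  number of primes, and at least \<open>2^(m-1)\<close> because it is divisible by all \<open>m * (m-1 choose k)\<close>.\<close>

lemma two_power_le_primes:
  fixes m :: nat
  assumes m: "1 \<le> m"
  shows "2 ^ (m - 1) \<le> m ^ card {p. prime p \<and> p \<le> m}"
proof -
  let ?P = "{p. prime p \<and> p \<le> m}"
  have fP: "finite ?P" by (rule finite_subset[of _ "{..m}"]) auto
  define e where "e p = Max {k. p ^ k \<le> m}" for p
  have fin: "finite {k. p ^ k \<le> m}" if "p \<in> ?P" for p
  proof (rule finite_subset[of _ "{..m}"])
    have "k \<le> m" if "p ^ k \<le> m" for k
    proof -
      have "2 \<le> p" using \<open>p \<in> ?P\<close> prime_ge_2_nat by auto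
      then have "2 ^ k \<le> p ^ k" by (rule power_mono) simp
      then show ?thesis using that less_exp[of k] by linarith
    qed
    then show "{k. p ^ k \<le> m} \<subseteq> {..m}" by auto
  qed simp
  have pe: "p ^ e p \<le> m" if "p \<in> ?P" for p
  proof -
    have "e p \<in> {k. p ^ k \<le> m}"
      unfolding e_def by (rule Max_in[OF fin[OF that]]) (use m in \<open>auto intro!: exI[of _ 0]\<close>)
    then show ?thesis by simp
  qed
  define L where "L = (\<Prod>p\<in>?P. p ^ e p)"
  have L0: "L > 0" unfolding L_def by (rule prod_pos) (auto simp: prime_gt_0_nat)
  have dvd: "i dvd L" if i: "1 \<le> i" "i \<le> m" for i
  proof (rule multiplicity_le_imp_dvd)
    show "i \<noteq> 0" using i by simp
    fix p :: nat assume p: "prime p"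
    show "multiplicity p i \<le> multiplicity p L"
    proof (cases "p \<le> m")
      case True
      have "p ^ multiplicity p i \<le> i" using i by (intro dvd_imp_le multiplicity_dvd) auto
      then have "multiplicity p i \<le> e p"
        unfolding e_def using i p True by (intro Max_ge fin) auto
      also have "p ^ e p dvd L" unfolding L_def using p True fP by (intro dvd_prodI) auto
      then have "e p \<le> multiplicity p L"
        using L0 p by (intro multiplicity_geI) (auto simp: prime_nat_iff)
      finally show ?thesis .
    next
      case False
      then have "\<not> p dvd i" using i by (auto dest: dvd_imp_le)
      then show ?thesis by (simp add: not_dvd_imp_multiplicity_0)
    qed
  qed
  have bin: "m * (m - 1 choose k) \<le> L" if "k \<le> m - 1" for k
  proof -
    have "Suc k * (m choose Suc k) dvd L"
      by (rule mult_binomial_dvd_common_multiple[OF L0 dvd]) (use that m in auto)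
    moreover have "Suc k * (m choose Suc k) = m * (m - 1 choose k)"
      using Suc_times_binomial_eq[of "m - 1" k] m by simp
    ultimately show ?thesis using L0 by (auto dest: dvd_imp_le)
  qed
  have "m * 2 ^ (m - 1) = (\<Sum>k\<le>m - 1. m * (m - 1 choose k))"
    by (simp add: sum_distrib_left[symmetric] choose_row_sum)
  also have "\<dots> \<le> (\<Sum>k\<le>m - 1. L)" by (rule sum_mono) (use bin in auto)
  also have "\<dots> = m * L" using m by simp
  finally have "2 ^ (m - 1) \<le> L" using m by simp
  also have "L \<le> (\<Prod>p\<in>?P. m)" unfolding L_def by (rule prod_mono) (use pe in auto)
  finally show ?thesis by simp
qed

text \<open>Without such a prime there are at most \<open>y\<close> primes up to \<open>m\<close>,
  which is about 8 y ln y, so 2^(m - 1) \<le> m^y. As m \<le> y^4, the logarithm of the right side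
  is at most 4 y ln y, and the constant 8 is large enough because 8 ln 2 exceeds 4 with room for
  rounding.\<close>

lemma prime_between:
  fixes y :: nat
  assumes y: "3 \<le> y"
  shows "\<exists>q. prime q \<and> y < q \<and> real q \<le> 8 * y * ln y + 1"
proof (rule ccontr)
  assume no: "\<not> ?thesis"
  define m where "m = nat \<lfloor>8 * real y * ln y\<rfloor> + 1"
  have ly: "1 \<le> ln (real y)"
  proof -
    have "exp 1 \<le> (3::real)" by (rule exp_le)
    then have "exp 1 \<le> real y" using y by linarith
    then show ?thesis using ln_ge_iff[of "real y" 1] y by simp
  qed
  have x0: "0 \<le> 8 * real y * ln y" using ly by simp
  have m1: "8 * real y * ln y \<le> real m" "real m \<le> 8 * real y * ln y + 1"
    using x0 unfolding m_def by linarith+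
  have "{p. prime p \<and> p \<le> m} \<subseteq> {1..y}"
  proof
    fix p assume p: "p \<in> {p. prime p \<and> p \<le> m}"
    then have "real p \<le> 8 * y * ln y + 1" using m1 by auto
    then show "p \<in> {1..y}" using no p prime_gt_0_nat[of p] by (auto simp: not_less)
  qed
  then have "card {p. prime p \<and> p \<le> m} \<le> y" using card_mono[of "{1..y}"] by simp
  moreover have m0: "1 \<le> m" by (simp add: m_def)
  ultimately have "m ^ card {p. prime p \<and> p \<le> m} \<le> m ^ y" by (intro power_increasing) auto
  then have "2 ^ (m - 1) \<le> m ^ y" using two_power_le_primes[OF m0] by linarith
  then have "real (2 ^ (m - 1)) \<le> real (m ^ y)" by (simp only: of_nat_le_iff)
  then have "ln (2 ^ (m - 1) :: real) \<le> ln (real m ^ y)" using m0 by (subst ln_le_cancel_iff) auto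
  then have key: "real (m - 1) * ln 2 \<le> real y * ln (real m)" using m0 by (simp add: ln_realpow)
  have "ln (real y) \<le> real y" using ln_le_minus_one[of "real y"] y by simp
  then have "real y * ln y \<le> real y * real y" by (intro mult_left_mono) auto
  then have "8 * real y * ln y + 1 \<le> 8 * (real y * real y) + 1" by simp
  also have "\<dots> \<le> real y ^ 4"
  proof -
    have "9 \<le> real y * real y" using y mult_mono[of 3 "real y" 3 "real y"] by simp
    then have "9 * (real y * real y) \<le> (real y * real y) * (real y * real y)" by (intro mult_right_mono) auto
    moreover have "real y ^ 4 = (real y * real y) * (real y * real y)" by (simp add: power4_eq_xxxx)
    ultimately show ?thesis using \<open>9 \<le> real y * real y\<close> by linarith
  qed
  finally have "real m \<le> real y ^ 4" using m1 by linarith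
  then have "ln (real m) \<le> ln (real y ^ 4)" using m0 y by (subst ln_le_cancel_iff) auto
  then have "ln (real m) \<le> 4 * ln (real y)" using y by (simp add: ln_realpow)
  then have "real y * ln (real m) \<le> real y * (4 * ln (real y))" by (intro mult_left_mono) auto
  moreover have l2: "3/5 \<le> ln (2::real)"
  proof -
    have "exp (3/5 :: real) ^ 5 = exp 1 ^ 3" by (simp flip: exp_of_nat_mult)
    also have "\<dots> \<le> (3::real) ^ 3" using exp_le by (intro power_mono) auto
    also have "\<dots> \<le> 2 ^ 5" by simp
    finally have "exp (3/5 :: real) \<le> 2" by (rule power_mono_iff[THEN iffD1, rotated 3]) simp_all
    then show ?thesis by (subst ln_ge_iff) auto
  qed
  have "(8 * real y * ln y - 1) * (3/5) \<le> real (m - 1) * ln 2"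
  proof (rule mult_mono)
    show "8 * real y * ln y - 1 \<le> real (m - 1)" using m1 m0 by (simp add: of_nat_diff)
  qed (use l2 in auto)
  moreover have "3 \<le> real y * ln y" using y ly mult_mono[of 3 "real y" 1 "ln (real y)"] by simp
  moreover have "(8 * real y * ln y - 1) * (3/5) = 24/5 * (real y * ln y) - 3/5"
    "real y * (4 * ln (real y)) = 4 * (real y * ln y)" by simp_all
  ultimately show False using key by linarith
qed

section \<open>Linking paths to a cycle\<close>

lemma successively_out:
  assumes "successively R p" "a \<in> set p" "a \<noteq> last p"
  shows "\<exists>b\<in>set p. R a b"
  using assms
proof (induction p)
  case (Cons x p)
  then show ?case by (cases p) auto
qed simp

lemma successively_in:
  assumes "successively R p" "a \<in> set p" "a \<noteq> hd p"
  shows "\<exists>b\<in>set p. R b a"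
  using assms
proof (induction p)
  case (Cons x p)
  then show ?case by (cases p) auto
qed simp

lemma successively_rank:
  fixes rk :: "'a \<Rightarrow> nat"
  assumes "successively R p" "p \<noteq> []" "\<And>a b. R a b \<Longrightarrow> rk a < rk b"
  shows "rk (hd p) \<le> rk (last p)"
  using assms(1,2)
proof (induction p)
  case (Cons x p)
  then show ?case
  proof (cases p)
    case (Cons y q)
    then have "R x y" "rk (hd p) \<le> rk (last p)" using Cons.IH Cons.prems \<open>p = y # q\<close> by auto
    then show ?thesis using assms(3)[of x y] Cons by simp
  qed simp
qed simp

text \<open>The last clause makes the paths maximal: no arc of \<open>M\<close> could extend one of
  them. The equation between cardinalities fixes their number, since a path has one vertex more than
  arcs.\<close>

definition path_partition :: "('a \<times> 'a) set \<Rightarrow> 'a set \<Rightarrow> 'a list set \<Rightarrow> bool" where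
  "path_partition M V P \<longleftrightarrow> finite P \<and> card P + card M = card V \<and>
    (\<forall>p\<in>P. p \<noteq> [] \<and> distinct p \<and> successively (\<lambda>a b. (a, b) \<in> M) p) \<and>
    (\<forall>p\<in>P. \<forall>q\<in>P. p \<noteq> q \<longrightarrow> set p \<inter> set q = {}) \<and> (\<Union>p\<in>P. set p) = V \<and>
    (\<forall>p\<in>P. hd p \<notin> snd ` M \<and> last p \<notin> fst ` M)"

text \<open>Arcs are added one at a time. By injectivity a new arc leaves the last vertex of some
  path and enters the first vertex of some path, and because \<open>rk\<close> increases along arcs
  these two paths are different and can be concatenated.\<close>

lemma path_partition_exists:
  fixes rk :: "'a \<Rightarrow> nat"
  assumes fV: "finite V" and M: "M \<subseteq> V \<times> V" "inj_on fst M" "inj_on snd M"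
    and rk: "\<And>a b. (a, b) \<in> M \<Longrightarrow> rk a < rk b"
  shows "\<exists>P. path_partition M V P"
proof -
  have "finite M" using fV M(1) finite_subset by blast
  then show ?thesis using M rk
  proof (induction M rule: finite_induct)
    case empty
    have "path_partition {} V ((\<lambda>v. [v]) ` V)"
      using fV by (auto simp: path_partition_def card_image inj_on_def)
    then show ?case by blast
  next
    case (insert e M)
    obtain a b where e: "e = (a, b)" by (cases e)
    have ab: "a \<in> V" "b \<in> V" "rk a < rk b" using insert.prems e by auto
    have aM: "a \<notin> fst ` M" "b \<notin> snd ` M"
      using insert.prems(2,3) insert.hyps(2) e by (auto simp: inj_on_insert image_iff)
    have "\<exists>P. path_partition M V P"
      by (rule insert.IH) (use insert.prems in \<open>auto simp: inj_on_insert\<close>)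
    then obtain P where P: "path_partition M V P" by (elim exE)
    have fP: "finite P" and cP: "card P + card M = card V"
      and p1: "\<And>p. p \<in> P \<Longrightarrow> p \<noteq> [] \<and> distinct p \<and> successively (\<lambda>a b. (a, b) \<in> M) p"
      and p2: "\<And>p q. p \<in> P \<Longrightarrow> q \<in> P \<Longrightarrow> p \<noteq> q \<Longrightarrow> set p \<inter> set q = {}"
      and p3: "(\<Union>p\<in>P. set p) = V"
      and p4: "\<And>p. p \<in> P \<Longrightarrow> hd p \<notin> snd ` M \<and> last p \<notin> fst ` M"
      using P unfolding path_partition_def by auto
    obtain q r where q: "q \<in> P" "a \<in> set q" and r: "r \<in> P" "b \<in> set r" using ab p3 by blast
    have aq: "a = last q"
    proof (rule ccontr)
      assume "a \<noteq> last q"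
      then obtain c where "(a, c) \<in> M" using successively_out[of _ q a] p1[OF q(1)] q(2) by blast
      then show False using aM(1) by force
    qed
    have br: "b = hd r"
    proof (rule ccontr)
      assume "b \<noteq> hd r"
      then obtain c where "(c, b) \<in> M" using successively_in[of _ r b] p1[OF r(1)] r(2) by blast
      then show False using aM(2) by force
    qed
    have qr: "q \<noteq> r"
    proof
      assume "q = r"
      then have "rk b \<le> rk a"
        unfolding aq br using successively_rank[of "\<lambda>a b. (a, b) \<in> M" r rk] p1[OF r(1)] insert.prems(4) by auto
      then show False using ab by simp
    qed
    have disj: "set q \<inter> set r = {}" by (rule p2[OF q(1) r(1) qr])
    define P' where "P' = insert (q @ r) (P - {q, r})"
    have new: "q @ r \<notin> P"
    proof
      assume h: "q @ r \<in> P"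
      have "q @ r \<noteq> q" using p1[OF r(1)] by simp
      then have "set (q @ r) \<inter> set q = {}" by (rule p2[OF h q(1)])
      then show False using q(2) by auto
    qed
    have "card (P - {q, r}) + 2 = card P"
    proof -
      have "card {q, r} \<le> card P" using fP q(1) r(1) by (intro card_mono) auto
      then show ?thesis using fP q(1) r(1) qr by (simp add: card_Diff_subset)
    qed
    then have c': "card P' + card (insert e M) = card V"
      using cP fP new insert.hyps by (simp add: P'_def)
    have mono: "successively (\<lambda>a b. (a, b) \<in> insert e M) p" if "p \<in> P" for p
      using p1[OF that] by (auto intro: successively_mono)
    have s1: "p \<noteq> [] \<and> distinct p \<and> successively (\<lambda>a b. (a, b) \<in> insert e M) p" if "p \<in> P'" for p
    proof (cases "p = q @ r")
      case True
      then show ?thesis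
        using p1[OF q(1)] p1[OF r(1)] disj mono[OF q(1)] mono[OF r(1)] e aq br
        by (simp add: successively_append_iff)
    next
      case False
      then have "p \<in> P" using that by (simp add: P'_def)
      then show ?thesis using p1 mono by simp
    qed
    have s2: "set p \<inter> set p' = {}" if "p \<in> P'" "p' \<in> P'" "p \<noteq> p'" for p p'
    proof -
      have *: "set (q @ r) \<inter> set s = {}" if "s \<in> P - {q, r}" for s
        using p2[of q s] p2[of r s] q(1) r(1) that by auto
      have **: "s \<in> P - {q, r}" if "s \<in> P'" "s \<noteq> q @ r" for s
        using that by (simp add: P'_def)
      show ?thesis
      proof (cases "p = q @ r")
        case True
        then show ?thesis using *[OF **[OF that(2)]] that(3) by auto
      next
        case pF: False
        show ?thesis
        proof (cases "p' = q @ r")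
          case True
          then show ?thesis using *[OF **[OF that(1) pF]] by auto
        next
          case False
          then show ?thesis using p2[of p p'] **[OF that(1) pF] **[OF that(2) False] that(3) by simp
        qed
      qed
    qed
    have s3: "(\<Union>p\<in>P'. set p) = V"
      unfolding p3[symmetric] P'_def using q(1) r(1) by auto
    have hd': "hd p \<noteq> b" if "p \<in> P" "p \<noteq> r" for p
    proof
      assume "hd p = b"
      then have "b \<in> set p" using hd_in_set[of p] p1[OF that(1)] by simp
      then show False using p2[OF that(1) r(1) that(2)] r(2) by blast
    qed
    have last': "last p \<noteq> a" if "p \<in> P" "p \<noteq> q" for p
    proof
      assume "last p = a"
      then have "a \<in> set p" using last_in_set[of p] p1[OF that(1)] by simp
      then show False using p2[OF that(1) q(1) that(2)] q(2) by blast
    qed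
    have s4: "hd p \<notin> snd ` insert e M \<and> last p \<notin> fst ` insert e M" if "p \<in> P'" for p
    proof (cases "p = q @ r")
      case True
      then have "hd p = hd q" "last p = last r" using p1[OF q(1)] p1[OF r(1)] by auto
      then show ?thesis using p4[OF q(1)] p4[OF r(1)] hd'[OF q(1) qr] last'[OF r(1) qr[symmetric]] e by simp
    next
      case False
      then have "p \<in> P" "p \<noteq> q" "p \<noteq> r" using that by (simp_all add: P'_def)
      then show ?thesis using p4[of p] hd' last' e by simp
    qed
    have "finite P'" using fP by (simp add: P'_def)
    then have "path_partition (insert e M) V P'"
      unfolding path_partition_def using c' s1 s2 s3 s4 by simp
    then show ?case by (rule exI)
  qed
qed

definition cyclic_arcs :: "'a list \<Rightarrow> ('a \<times> 'a) set" where
  "cyclic_arcs c = set (zip c (rotate1 c))"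

lemma cyclic_arcs_inj:
  assumes "distinct c"
  shows "inj_on fst (cyclic_arcs c)" "inj_on snd (cyclic_arcs c)" "card (cyclic_arcs c) = length c"
proof -
  have d: "distinct (map fst (zip c (rotate1 c)))" "distinct (map snd (zip c (rotate1 c)))"
    using assms by (simp_all del: distinct_map)
  show "inj_on fst (cyclic_arcs c)" "inj_on snd (cyclic_arcs c)"
    using d unfolding distinct_map cyclic_arcs_def by simp_all
  show "card (cyclic_arcs c) = length c"
    using d(1) unfolding distinct_map cyclic_arcs_def by (simp add: distinct_card)
qed

lemma cyclic_arcs_nth:
  "cyclic_arcs c = {(c ! i, c ! (Suc i mod length c)) | i. i < length c}"
  unfolding cyclic_arcs_def set_zip by (auto simp: nth_rotate1)

lemma cyclic_arcs_subset:
  assumes "successively (\<lambda>a b. (a, b) \<in> A) c" "c \<noteq> []" "(last c, hd c) \<in> A"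
  shows "cyclic_arcs c \<subseteq> A"
proof
  fix e assume "e \<in> cyclic_arcs c"
  then obtain i where i: "i < length c" "e = (c ! i, c ! (Suc i mod length c))"
    by (auto simp: cyclic_arcs_nth)
  show "e \<in> A"
  proof (cases "Suc i < length c")
    case True
    then show ?thesis using assms(1) i by (simp add: successively_conv_nth)
  next
    case False
    then have "Suc i = length c" using i by simp
    then show ?thesis using assms(2,3) i by (simp add: last_conv_nth hd_conv_nth flip: \<open>Suc i = length c\<close>)
  qed
qed

definition link_paths :: "(nat \<Rightarrow> 'a list) \<Rightarrow> (nat \<Rightarrow> 'a) \<Rightarrow> nat \<Rightarrow> 'a list" where
  "link_paths Q X w = concat (map (\<lambda>i. Q i @ [X i]) [0..<w])"

lemma link_paths_Suc: "link_paths Q X (Suc w) = link_paths Q X w @ Q w @ [X w]"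
  by (simp add: link_paths_def)

lemma set_link_paths: "set (link_paths Q X w) = (\<Union>i<w. set (Q i)) \<union> X ` {..<w}"
  by (auto simp: link_paths_def)

lemma successively_link_paths:
  assumes "\<And>i. i < w \<Longrightarrow> Q i \<noteq> [] \<and> successively (\<lambda>a b. (a, b) \<in> A) (Q i) \<and> (last (Q i), X i) \<in> A"
    and "\<And>i. Suc i < w \<Longrightarrow> (X i, hd (Q (Suc i))) \<in> A" and "0 < w"
  shows "successively (\<lambda>a b. (a, b) \<in> A) (link_paths Q X w) \<and> link_paths Q X w \<noteq> [] \<and>
    hd (link_paths Q X w) = hd (Q 0) \<and> last (link_paths Q X w) = X (w - 1)"
  using assms
proof (induction w)
  case (Suc w)
  have Q: "Q w \<noteq> []" "successively (\<lambda>a b. (a, b) \<in> A) (Q w)" "(last (Q w), X w) \<in> A"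
    using Suc.prems(1)[of w] by auto
  show ?case
  proof (cases "w = 0")
    case True
    then show ?thesis using Q by (simp add: link_paths_def successively_append_iff)
  next
    case False
    then obtain k where k: "w = Suc k" by (cases w) auto
    have IH: "successively (\<lambda>a b. (a, b) \<in> A) (link_paths Q X w) \<and> link_paths Q X w \<noteq> [] \<and>
      hd (link_paths Q X w) = hd (Q 0) \<and> last (link_paths Q X w) = X (w - 1)"
      by (rule Suc.IH) (use Suc.prems False in auto)
    have "(X k, hd (Q w)) \<in> A" using Suc.prems(2)[of k] k by simp
    then show ?thesis
      using IH Q k unfolding link_paths_Suc[of Q X w] by (simp add: successively_append_iff)
  qed
qed simp

lemma distinct_link_paths:
  assumes "\<And>i. i < w \<Longrightarrow> distinct (Q i)" "\<And>i j. i < w \<Longrightarrow> j < w \<Longrightarrow> i \<noteq> j \<Longrightarrow> set (Q i) \<inter> set (Q j) = {}"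
    and "inj_on X {..<w}" "\<And>i j. i < w \<Longrightarrow> j < w \<Longrightarrow> X i \<notin> set (Q j)"
  shows "distinct (link_paths Q X w)"
  using assms
proof (induction w)
  case 0
  then show ?case by (simp add: link_paths_def)
next
  case (Suc w)
  have IH: "distinct (link_paths Q X w)"
    by (rule Suc.IH) (use Suc.prems in \<open>auto intro: inj_on_subset\<close>)
  have "set (Q i) \<inter> set (Q w) = {}" "X w \<notin> set (Q i)" "X i \<notin> set (Q w)" "X i \<noteq> X w" if "i < w" for i
    using Suc.prems(2)[of i w] Suc.prems(4)[of w i] Suc.prems(4)[of i w]
      inj_onD[OF Suc.prems(3), of i w] that by auto
  then have "set (link_paths Q X w) \<inter> set (Q w @ [X w]) = {}"
    unfolding set_link_paths by fastforce
  then show ?case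
    using IH Suc.prems(1)[of w] Suc.prems(4)[of w w] by (simp add: link_paths_Suc)
qed

text \<open>The paths are ordered cyclically as \<open>f1 0, f2 (\<sigma> 0), f1 1, f2 (\<sigma> 1), \<dots>\<close>, followed by the
  remaining ones, where \<open>\<sigma>\<close> is a well-spread permutation. Position \<open>i\<close> of this order and a
  vertex \<open>x\<close> of \<open>W\<close> are compatible if \<open>x\<close> can be inserted between the \<open>i\<close>-th path and its successor; a
  perfect matching of compatible pairs gives the Hamilton cycle. The few positions that are not of
  the regular form are treated first, with the arcs in \<open>A1\<close> and \<open>A2\<close>.\<close>

lemma link_path_system:
  fixes M A0 A1 A2 :: "('a \<times> 'a) set" and \<mu> \<rho> d :: real
  assumes fV: "finite V" and WV: "W \<subseteq> V" and P: "path_partition M (V - W) P" and PW: "card P = card W"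
    and q2: "2 \<le> q"
    and f1: "inj_on f1 {..<q}" "\<And>k. k < q \<Longrightarrow> [f1 k] \<in> P"
    and f2: "inj_on f2 {..<q}" "\<And>k. k < q \<Longrightarrow> f2 k \<in> P"
    and f12: "\<And>k l. k < q \<Longrightarrow> l < q \<Longrightarrow> [f1 k] \<noteq> f2 l"
    and rho: "0 < \<rho>" "\<rho> \<le> 1" and d: "d = \<mu> * \<rho>\<^sup>2" "1000 \<le> d"
    and z: "real (card W) + 1 \<le> 2 * real q + 3/100 * d" and qmu: "real q \<le> 1001/1000 * \<mu>"
    and deg: "\<And>a b. a \<in> V - W \<Longrightarrow> b \<in> V - W \<Longrightarrow> a \<noteq> b \<Longrightarrow>
        7/4 * d \<le> card {x\<in>W. (a, x) \<in> A0 \<and> (x, b) \<in> A0} \<and> card {x\<in>W. (a, x) \<in> A0 \<and> (x, b) \<in> A0} \<le> 9/4 * d"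
    and codeg: "\<And>a b a' b'. a \<in> V - W \<Longrightarrow> b \<in> V - W \<Longrightarrow> a' \<in> V - W \<Longrightarrow> b' \<in> V - W \<Longrightarrow>
        a \<noteq> b \<Longrightarrow> a' \<noteq> b' \<Longrightarrow> a \<noteq> a' \<Longrightarrow> b \<noteq> b' \<Longrightarrow> a \<noteq> b' \<or> b \<noteq> a' \<Longrightarrow>
        card {x\<in>W. (a, x) \<in> A0 \<and> (x, b) \<in> A0 \<and> (a', x) \<in> A0 \<and> (x, b') \<in> A0} \<le> 9/4 * d * \<rho>\<^sup>2"
    and deg': "\<And>a b. a \<in> V - W \<Longrightarrow> b \<in> V - W \<Longrightarrow> a \<noteq> b \<Longrightarrow>
        d \<le> card {x\<in>W. (a, x) \<in> A1 \<and> (x, b) \<in> A2}"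
    and x1: "\<And>x. x \<in> W \<Longrightarrow> 86/100 * (\<mu> * \<rho>) \<le> card {k. k < q \<and> (f1 k, x) \<in> A0}"
    and x2: "\<And>x. x \<in> W \<Longrightarrow> 86/100 * (\<mu> * \<rho>) \<le> card {k. k < q \<and> (x, hd (f2 k)) \<in> A0}"
    and x3: "\<And>x. x \<in> W \<Longrightarrow> 86/100 * (\<mu> * \<rho>) \<le> card {k. k < q \<and> (last (f2 k), x) \<in> A0}"
    and x4: "\<And>x. x \<in> W \<Longrightarrow> 86/100 * (\<mu> * \<rho>) + 1 \<le> card {k. k < q \<and> (x, f1 k) \<in> A0}"
    and few: "2 * card V * exp (- d / 20000) < 1"
  shows "\<exists>c. distinct c \<and> set c = V \<and> cyclic_arcs c \<subseteq> M
    \<union> {(a, x). (a, x) \<in> A0 \<and> x \<in> W \<and> (a \<in> f1 ` {..<q} \<or> a \<in> last ` f2 ` {..<q})}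
    \<union> {(x, b). (x, b) \<in> A0 \<and> x \<in> W \<and> (b \<in> f1 ` {..<q} \<or> b \<in> hd ` f2 ` {..<q})}
    \<union> {(a, x). (a, x) \<in> A1 \<and> x \<in> W \<and> a \<in> last ` P} \<union> {(x, b). (x, b) \<in> A2 \<and> x \<in> W \<and> b \<in> hd ` P}"
    (is "\<exists>c. _ \<and> _ \<and> _ \<subseteq> ?A")
proof -
  define w where "w = card W"
  have fW: "finite W" using WV fV finite_subset by blast
  have fP: "finite P" and P1: "\<And>p. p \<in> P \<Longrightarrow> p \<noteq> [] \<and> distinct p \<and> successively (\<lambda>a b. (a, b) \<in> M) p"
    and P2: "\<And>p p'. p \<in> P \<Longrightarrow> p' \<in> P \<Longrightarrow> p \<noteq> p' \<Longrightarrow> set p \<inter> set p' = {}"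
    and P3: "(\<Union>p\<in>P. set p) = V - W"
    using P unfolding path_partition_def by auto
  have mu0: "0 < \<mu>"
  proof (rule ccontr)
    assume "\<not> 0 < \<mu>"
    then have "d \<le> 0" unfolding d by (intro mult_nonpos_nonneg) auto
    then show False using d by simp
  qed
  have d_le: "d \<le> \<mu> * \<rho>"
    unfolding d power2_eq_square using rho mu0 by (intro mult_left_mono) (auto intro: mult_left_le)
  have d_mu: "d / \<rho>\<^sup>2 = \<mu>" using d rho by simp
  define I1 I2 where "I1 = (\<lambda>k. [f1 k]) ` {..<q}" and "I2 = f2 ` {..<q}"
  have c12: "card I1 = q" "card I2 = q"
    using f1(1) f2(1) by (auto simp: I1_def I2_def card_image inj_on_def)
  have disj12: "I1 \<inter> I2 = {}" using f12 by (auto simp: I1_def I2_def)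
  have sub12: "I1 \<union> I2 \<subseteq> P" using f1 f2 by (auto simp: I1_def I2_def)
  have c12': "card (I1 \<union> I2) = 2 * q" using disj12 c12 by (subst card_Un_disjoint) (auto simp: I1_def I2_def)
  then have qw: "2 * q \<le> w" using card_mono[OF fP sub12] PW by (simp add: w_def)
  have cRest: "card (P - (I1 \<union> I2)) = w - 2 * q"
    using c12' sub12 PW fP by (subst card_Diff_subset) (auto simp: w_def I1_def I2_def)
  obtain f3 where f3: "bij_betw f3 {..<w - 2 * q} (P - (I1 \<union> I2))"
    using ex_bij_betw_nat_finite[of "P - (I1 \<union> I2)"] fP cRest by (auto simp: atLeast0LessThan)
  \<comment> \<open>The flag separates two kinds of gaps: True for the one between
    \<open>f1 k\<close> and \<open>f2 (\<sigma> k)\<close>, False for the one between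
    \<open>f2 (\<sigma> k)\<close> and \<open>f1 (Suc k)\<close>. The second kind is regular only
    for k < q - 1, and the shift skips \<open>f1 0\<close>, for which the summand 1 in
    \<open>x4\<close> pays.\<close>
  define Af Bf :: "'a \<times> bool \<Rightarrow> nat set" where
    "Af = (\<lambda>(x, s). if s then {k. k < q \<and> (f1 k, x) \<in> A0} else {k. k < q - 1 \<and> (x, f1 (Suc k)) \<in> A0})" and
    "Bf = (\<lambda>(x, s). if s then {k. k < q \<and> (x, hd (f2 k)) \<in> A0} else {k. k < q \<and> (last (f2 k), x) \<in> A0})"
  have x4': "86/100 * (\<mu> * \<rho>) \<le> card {k. k < q - 1 \<and> (x, f1 (Suc k)) \<in> A0}" if "x \<in> W" for x
  proof -
    have "{k. k < q \<and> (x, f1 k) \<in> A0} \<subseteq> insert 0 (Suc ` {k. k < q - 1 \<and> (x, f1 (Suc k)) \<in> A0})"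
    proof
      fix k assume "k \<in> {k. k < q \<and> (x, f1 k) \<in> A0}"
      then show "k \<in> insert 0 (Suc ` {k. k < q - 1 \<and> (x, f1 (Suc k)) \<in> A0})" by (cases k) auto
    qed
    then have "card {k. k < q \<and> (x, f1 k) \<in> A0} \<le> card (insert 0 (Suc ` {k. k < q - 1 \<and> (x, f1 (Suc k)) \<in> A0}))"
      by (intro card_mono) auto
    also have "\<dots> \<le> Suc (card {k. k < q - 1 \<and> (x, f1 (Suc k)) \<in> A0})"
      by (simp add: card_insert_if card_image)
    finally show ?thesis using x4[OF that] by linarith
  qed
  have AB: "86/100 * (\<mu> * \<rho>) \<le> card (Af t) \<and> 86/100 * (\<mu> * \<rho>) \<le> card (Bf t)" if "t \<in> W \<times> UNIV" for t
    using that x1 x2 x3 x4' by (auto simp: Af_def Bf_def split: prod.splits)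
  \<comment> \<open>73/100 is (86/100)^2 divided by 1001/1000, rounded down.\<close>
  have prodAB: "73/100 * d \<le> card (Af t) * card (Bf t) / real q" if "t \<in> W \<times> UNIV" for t
  proof -
    have mr: "0 \<le> \<mu> * \<rho>" using mu0 rho by simp
    have "(86/100 * (\<mu> * \<rho>)) * (86/100 * (\<mu> * \<rho>)) \<le> real (card (Af t)) * real (card (Bf t))"
      using AB[OF that] mr by (intro mult_mono) auto
    moreover have "(86/100 * (\<mu> * \<rho>)) * (86/100 * (\<mu> * \<rho>)) = 7396/10000 * (\<mu> * d)"
      by (simp add: d power2_eq_square)
    moreover have "73/100 * d * real q \<le> 73/100 * d * (1001/1000 * \<mu>)"
      using qmu d by (intro mult_left_mono) auto
    moreover have "73/100 * d * (1001/1000 * \<mu>) = 73073/100000 * (\<mu> * d)" by simp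
    moreover have "0 < \<mu> * d" using mu0 d by simp
    ultimately have "73/100 * d * real q \<le> real (card (Af t)) * real (card (Bf t))" by linarith
    then show ?thesis using q2 by (simp add: field_simps)
  qed
  \<comment> \<open>The tolerance 2/100 turns 73/100 into 71/100 for either flag, so a vertex of
    \<open>W\<close> becomes compatible with at least 142/100 d regular positions.\<close>
  have "\<exists>\<sigma>. \<sigma> permutes {..<q} \<and> (\<forall>t\<in>W \<times> (UNIV::bool set).
      (1 - 2/100) * (card (Af t) * card (Bf t) / card {..<q}) \<le> card {i\<in>Af t. \<sigma> i \<in> Bf t})"
  proof (rule spreading_permutation[where L = "d / 20000"])
    show "finite (W \<times> (UNIV::bool set))" using fW by simp
    have "0 \<in> {..<q}" using q2 by simp
    then show "{..<q} \<noteq> {}" by blast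
    show "Af t \<subseteq> {..<q}" "Bf t \<subseteq> {..<q}" for t by (auto simp: Af_def Bf_def split: prod.splits if_splits)
    show "d / 20000 \<le> (2/100)\<^sup>2 * (card (Af t) * card (Bf t) / card {..<q}) / 4" if "t \<in> W \<times> UNIV" for t
    proof -
      define u where "u = real (card (Af t) * card (Bf t)) / real q"
      have "(2/100)\<^sup>2 * u / 4 = u / 10000" by (simp add: power2_eq_square)
      moreover have "73/100 * d \<le> u" using prodAB[OF that] by (simp add: u_def)
      ultimately have "d / 20000 \<le> (2/100)\<^sup>2 * u / 4" using d(2) by linarith
      then show ?thesis unfolding card_lessThan u_def .
    qed
    have "real (card (W \<times> (UNIV::bool set))) \<le> 2 * card V"
      using card_mono[OF fV WV] by (simp add: card_cartesian_product)
    then have "real (card (W \<times> (UNIV::bool set))) * exp (- d / 20000) \<le> 2 * card V * exp (- d / 20000)"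
      by (intro mult_right_mono) auto
    then show "real (card (W \<times> (UNIV::bool set))) * exp (- (d / 20000)) < 1"
      using few unfolding minus_divide_left by linarith
  qed auto
  then obtain \<sigma> where sig: "\<sigma> permutes {..<q}"
    and sp: "\<forall>t\<in>W \<times> (UNIV::bool set).
      (1 - 2/100) * (card (Af t) * card (Bf t) / card {..<q}) \<le> card {i\<in>Af t. \<sigma> i \<in> Bf t}"
    by (elim exE conjE)
  have sp': "71/100 * d \<le> card {i\<in>Af t. \<sigma> i \<in> Bf t}" if "t \<in> W \<times> UNIV" for t
  proof -
    have "71/100 * d \<le> (1 - 2/100) * (73/100 * d)" using d(2) by simp
    also have "\<dots> \<le> (1 - 2/100) * (card (Af t) * card (Bf t) / card {..<q})"
      using prodAB[OF that] by (intro mult_left_mono) auto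
    finally show ?thesis using bspec[OF sp that] by linarith
  qed
  have sigq: "\<sigma> k < q" if "k < q" for k using permutes_in_image[OF sig, of k] that by simp
  define Q where "Q i = (if i < 2 * q then (if even i then [f1 (i div 2)] else f2 (\<sigma> (i div 2))) else f3 (i - 2 * q))" for i
  have Qe: "Q (2 * k) = [f1 k]" if "k < q" for k using that by (simp add: Q_def)
  have Qo: "Q (Suc (2 * k)) = f2 (\<sigma> k)" if "k < q" for k using that by (simp add: Q_def)
  have Q3: "Q i \<in> P - (I1 \<union> I2)" if "2 * q \<le> i" "i < w" for i
    using bij_betwE[OF f3] that by (auto simp: Q_def)
  have Qlow: "(\<exists>k<q. i = 2 * k) \<or> (\<exists>k<q. i = Suc (2 * k))" if "i < 2 * q" for i
  proof (cases "even i")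
    case True
    then show ?thesis using that by (auto elim!: evenE)
  next
    case False
    then show ?thesis using that by (auto elim!: oddE)
  qed
  have QP: "Q i \<in> P" if "i < w" for i
  proof (cases "i < 2 * q")
    case True
    then show ?thesis using Qlow[OF True] Qe Qo f1(2) f2(2) sigq by auto
  next
    case False
    then show ?thesis using Q3[of i] that by simp
  qed
  have surj: "P \<subseteq> Q ` {..<w}"
  proof
    fix p assume "p \<in> P"
    then consider (1) k where "k < q" "p = [f1 k]" | (2) k where "k < q" "p = f2 k" | (3) "p \<in> P - (I1 \<union> I2)"
      by (auto simp: I1_def I2_def)
    then show "p \<in> Q ` {..<w}"
    proof cases
      case 1
      then show ?thesis using Qe qw by (intro image_eqI[of _ _ "2 * k"]) auto
    next
      case 2
      then have "k \<in> \<sigma> ` {..<q}" using permutes_image[OF sig] by simp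
      then obtain l where "l < q" "k = \<sigma> l" by auto
      then show ?thesis using Qo 2 qw by (intro image_eqI[of _ _ "Suc (2 * l)"]) auto
    next
      case 3
      then have "p \<in> f3 ` {..<w - 2 * q}" using f3 by (simp add: bij_betw_def)
      then obtain k where "k < w - 2 * q" "p = f3 k" by auto
      then show ?thesis by (intro image_eqI[of _ _ "k + 2 * q"]) (auto simp: Q_def)
    qed
  qed
  have QimP: "Q ` {..<w} = P" using surj QP by auto
  have Qinj: "inj_on Q {..<w}"
    by (rule eq_card_imp_inj_on) (simp, simp only: QimP card_lessThan, simp only: PW w_def)
  have w2: "2 \<le> w" using qw q2 by simp
  define en where "en i = last (Q i)" for i
  define st where "st i = hd (Q (Suc i mod w))" for i
  have mw: "Suc i mod w < w" for i using w2 by simp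
  have nx: "Suc i mod w \<noteq> i" if "i < w" for i
    using that w2 by (cases "Suc i = w") auto
  have enQ: "en i \<in> set (Q i)" if "i < w" for i using P1[OF QP[OF that]] by (simp add: en_def)
  have stQ: "st i \<in> set (Q (Suc i mod w))" for i using P1[OF QP[OF mw]] by (simp add: st_def)
  have QV: "set (Q i) \<subseteq> V - W" if "i < w" for i using QP[OF that] P3 by auto
  have Qdisj: "set (Q i) \<inter> set (Q j) = {}" if "i < w" "j < w" "i \<noteq> j" for i j
  proof (rule P2[OF QP[OF that(1)] QP[OF that(2)]])
    show "Q i \<noteq> Q j" using inj_onD[OF Qinj, of i j] that by auto
  qed
  have eV: "en i \<in> V - W" "st i \<in> V - W" if "i < w" for i
    using enQ[OF that] QV[OF that] stQ[of i] QV[OF mw] by auto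
  have neq: "en i \<noteq> st i" if "i < w" for i
    using enQ[OF that] stQ[of i] Qdisj[OF that mw nx[OF that, symmetric]] by auto
  have en_neq: "en i \<noteq> en j" if "i < w" "j < w" "i \<noteq> j" for i j
    using enQ[OF that(1)] enQ[OF that(2)] Qdisj[OF that] by auto
  have sinj: "Suc i mod w \<noteq> Suc j mod w" if "i < w" "j < w" "i \<noteq> j" for i j
    using that by (cases "Suc i = w"; cases "Suc j = w") auto
  have st_neq: "st i \<noteq> st j" if "i < w" "j < w" "i \<noteq> j" for i j
    using stQ[of i] stQ[of j] Qdisj[OF mw mw sinj[OF that]] by auto
  \<comment> \<open>If both equalities held, \<open>i\<close> and \<open>j\<close> would be each
    other's successors in the cyclic order, which is impossible as w \<ge> 2 q \<ge> 4. This
    supplies the last premise of \<open>codeg\<close>.\<close>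
  have cross: "en i \<noteq> st j \<or> st i \<noteq> en j" if ij: "i < w" "j < w" "i \<noteq> j" for i j
  proof (rule ccontr)
    assume "\<not> ?thesis"
    then have e: "en i = st j" "st i = en j" by auto
    have a: "i = Suc j mod w" using enQ[OF ij(1)] stQ[of j] Qdisj[OF ij(1) mw, of j] e by (metis disjoint_iff)
    have b: "j = Suc i mod w" using enQ[OF ij(2)] stQ[of i] Qdisj[OF ij(2) mw, of i] e by (metis disjoint_iff)
    have md: "Suc k mod w = Suc k \<or> (Suc k mod w = 0 \<and> Suc k = w)" if "k < w" for k
      using that by (cases "Suc k = w") auto
    show False using md[OF ij(1)] md[OF ij(2)] q2 qw unfolding a[symmetric] b[symmetric] by linarith
  qed
  \<comment> \<open>Positions below \<open>r\<close> are regular on both sides. Position 2 q - 1 is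
    followed by one of the remaining paths, or by the first path if there are none, so it belongs to
    the exceptional positions.\<close>
  define r where "r = 2 * q - 1"
  have rw: "r < w" using qw q2 by (simp add: r_def)
  have zz: "real (w - r) \<le> 3/100 * d" using z qw q2 by (simp add: r_def w_def of_nat_diff)
  define N' where "N' i = {x\<in>W. (en i, x) \<in> A1 \<and> (x, st i) \<in> A2}" for i
  \<comment> \<open>Each exceptional position alone has at least \<open>d\<close> candidates, which
    exceeds the number of these positions, so Hall's condition is immediate.\<close>
  have "\<exists>Y. inj_on Y {r..<w} \<and> (\<forall>i\<in>{r..<w}. Y i \<in> N' i)"
  proof (rule hall_marriage)
    show "finite {r..<w}" by simp
    show fN': "finite (N' i)" for i using fW by (simp add: N'_def)
    fix J assume J: "J \<subseteq> {r..<w}"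
    show "card J \<le> card (\<Union>i\<in>J. N' i)"
    proof (cases "J = {}")
      case False
      then obtain i where i: "i \<in> J" by auto
      then have iw: "i < w" using J by auto
      have fJ: "finite J" using J finite_subset by blast
      have "card J \<le> w - r" using card_mono[OF _ J] by simp
      then have "real (card J) \<le> 3/100 * d" using zz by linarith
      also have "\<dots> \<le> d" using d by simp
      also have "\<dots> \<le> card (N' i)" using deg'[OF eV(1)[OF iw] eV(2)[OF iw] neq[OF iw]] by (simp add: N'_def)
      also have "card (N' i) \<le> card (\<Union>i\<in>J. N' i)" using i fJ fN' by (intro card_mono) auto
      finally show ?thesis by simp
    qed simp
  qed
  then obtain Y where Y: "inj_on Y {r..<w}" "\<forall>i\<in>{r..<w}. Y i \<in> N' i" by (elim exE conjE)
  define W' where "W' = W - Y ` {r..<w}"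
  have YW: "Y ` {r..<w} \<subseteq> W" using Y(2) by (auto simp: N'_def)
  have cY: "card (Y ` {r..<w}) = w - r" using card_image[OF Y(1)] by simp
  have cW': "card W' = r"
    unfolding W'_def using YW fW cY rw by (subst card_Diff_subset) (auto simp: w_def[symmetric])
  define N where "N i = {x\<in>W'. (en i, x) \<in> A0 \<and> (x, st i) \<in> A0}" for i
  have ir: "i < w" if "i < r" for i using that rw by simp
  \<comment> \<open>The threshold 13/10 \<mu> balances the two ranges of Hall's condition. In units
    of d^2, and up to a term linear in \<open>d\<close>, small sets need 1.3 * 2.25 = 2.925 against
    1.72^2 = 2.9584, and large ones less than 1.6 against 1.42^2 = 2.0164.\<close>
  have "\<exists>Z. inj_on Z {..<r} \<and> (\<forall>i\<in>{..<r}. Z i \<in> N i)"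
  proof (rule codegree_perfect_matching[where D = "9/4 * d" and c = "9/4 * d * \<rho>\<^sup>2" and d = "172/100 * d"
        and d' = "142/100 * d" and \<theta> = "13/10 * \<mu>" and W = W'])
    show "finite W'" using fW by (simp add: W'_def)
    show "card {..<r} = card W'" using cW' by simp
    show "N i \<subseteq> W'" for i by (auto simp: N_def)
    show "card (N i) \<le> 9/4 * d" if "i \<in> {..<r}" for i
    proof -
      have iw: "i < w" using that ir by simp
      have "card (N i) \<le> card {x\<in>W. (en i, x) \<in> A0 \<and> (x, st i) \<in> A0}"
        using fW by (intro card_mono) (auto simp: N_def W'_def)
      then show ?thesis using deg[OF eV(1)[OF iw] eV(2)[OF iw] neq[OF iw]] by linarith
    qed
    show "172/100 * d \<le> card (N i)" if "i \<in> {..<r}" for i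
    proof -
      have iw: "i < w" using that ir by simp
      have "{x\<in>W. (en i, x) \<in> A0 \<and> (x, st i) \<in> A0} \<subseteq> N i \<union> Y ` {r..<w}" by (auto simp: N_def W'_def)
      then have "card {x\<in>W. (en i, x) \<in> A0 \<and> (x, st i) \<in> A0} \<le> card (N i \<union> Y ` {r..<w})"
        using fW by (intro card_mono) (auto simp: N_def W'_def)
      also have "\<dots> \<le> card (N i) + (w - r)" using card_Un_le[of "N i" "Y ` {r..<w}"] cY by simp
      finally have "real (card {x\<in>W. (en i, x) \<in> A0 \<and> (x, st i) \<in> A0}) \<le> card (N i) + real (w - r)" by linarith
      then show ?thesis using deg[OF eV(1)[OF iw] eV(2)[OF iw] neq[OF iw]] zz by linarith
    qed
    show "card (N i \<inter> N j) \<le> 9/4 * d * \<rho>\<^sup>2" if "i \<in> {..<r}" "j \<in> {..<r}" "i \<noteq> j" for i j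
    proof -
      have iw: "i < w" and jw: "j < w" using that ir by auto
      have "card (N i \<inter> N j) \<le> card {x\<in>W. (en i, x) \<in> A0 \<and> (x, st i) \<in> A0 \<and> (en j, x) \<in> A0 \<and> (x, st j) \<in> A0}"
        using fW by (intro card_mono) (auto simp: N_def W'_def)
      then show ?thesis
        using codeg[OF eV[OF iw] eV[OF jw] neq[OF iw] neq[OF jw] en_neq[OF iw jw that(3)] st_neq[OF iw jw that(3)]
            cross[OF iw jw that(3)]] by linarith
    qed
    show "142/100 * d \<le> card {i\<in>{..<r}. x \<in> N i}" if x: "x \<in> W'" for x
    proof -
      have xW: "x \<in> W" using x by (simp add: W'_def)
      let ?S1 = "{k\<in>Af (x, True). \<sigma> k \<in> Bf (x, True)}" and ?S2 = "{k\<in>Af (x, False). \<sigma> k \<in> Bf (x, False)}"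
      have stE: "st (2 * k) = hd (f2 (\<sigma> k))" if "k < q" for k
      proof -
        have "Suc (2 * k) < w" using that qw by simp
        then show ?thesis using Qo[OF that] by (simp add: st_def)
      qed
      have stO: "st (Suc (2 * k)) = f1 (Suc k)" if "k < q - 1" for k
      proof -
        have k: "Suc k < q" using that by simp
        then have "Suc (Suc (2 * k)) < w" using qw by simp
        then have "Suc (Suc (2 * k)) mod w = 2 * Suc k" by simp
        then show ?thesis using Qe[OF k] by (simp add: st_def del: mult_Suc_right)
      qed
      have fin: "finite (Af t)" for t by (auto simp: Af_def split: prod.splits)
      have s1: "(\<lambda>k. 2 * k) ` ?S1 \<subseteq> {i\<in>{..<r}. x \<in> N i}"
      proof (rule image_subsetI)
        fix k assume k: "k \<in> ?S1"
        then have kq: "k < q" by (auto simp: Af_def)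
        have "(en (2 * k), x) \<in> A0" using k Qe[OF kq] by (simp add: en_def Af_def)
        moreover have "(x, st (2 * k)) \<in> A0" using k stE[OF kq] by (simp add: Bf_def)
        ultimately show "2 * k \<in> {i\<in>{..<r}. x \<in> N i}" using x kq by (simp add: N_def r_def)
      qed
      have s2: "(\<lambda>k. Suc (2 * k)) ` ?S2 \<subseteq> {i\<in>{..<r}. x \<in> N i}"
      proof (rule image_subsetI)
        fix k assume k: "k \<in> ?S2"
        then have kq: "k < q - 1" by (auto simp: Af_def)
        have kq': "k < q" using kq by simp
        have "(en (Suc (2 * k)), x) \<in> A0" using k Qo[OF kq'] by (simp add: en_def Bf_def)
        moreover have "(x, st (Suc (2 * k))) \<in> A0" using k stO[OF kq] by (simp add: Af_def)
        ultimately show "Suc (2 * k) \<in> {i\<in>{..<r}. x \<in> N i}" using x kq by (simp add: N_def r_def)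
      qed
      have dj: "(\<lambda>k. 2 * k) ` ?S1 \<inter> (\<lambda>k. Suc (2 * k)) ` ?S2 = {}"
      proof (rule ccontr)
        assume "\<not> ?thesis"
        then obtain k l where "2 * k = Suc (2 * l)" by blast
        then show False by presburger
      qed
      have "card ?S1 + card ?S2 = card ((\<lambda>k. 2 * k) ` ?S1) + card ((\<lambda>k. Suc (2 * k)) ` ?S2)"
        by (simp add: card_image inj_on_def)
      also have "\<dots> = card ((\<lambda>k. 2 * k) ` ?S1 \<union> (\<lambda>k. Suc (2 * k)) ` ?S2)"
        using fin dj by (intro card_Un_disjoint[symmetric]) auto
      also have "\<dots> \<le> card {i\<in>{..<r}. x \<in> N i}" using s1 s2 by (intro card_mono) auto
      finally show ?thesis using sp'[of "(x, True)"] sp'[of "(x, False)"] xW by simp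
    qed
    have eq: "9/4 * d * \<rho>\<^sup>2 * \<mu> = 9/4 * (d * d)" by (simp add: d)
    have dd: "1000 * d \<le> d * d" using d(2) by (intro mult_right_mono) auto
    show "9/4 * d + 13/10 * \<mu> * (9/4 * d * \<rho>\<^sup>2) \<le> (172/100 * d)\<^sup>2"
    proof -
      have "13/10 * \<mu> * (9/4 * d * \<rho>\<^sup>2) = 117/40 * (d * d)" by (simp add: d)
      moreover have "(172/100 * d)\<^sup>2 = 29584/10000 * (d * d)" by (simp add: power2_eq_square)
      ultimately show ?thesis using dd d(2) by linarith
    qed
    show "9/4 * d + (card {..<r} - 13/10 * \<mu>) * (9/4 * d * \<rho>\<^sup>2) < (142/100 * d)\<^sup>2"
    proof -
      have "card {..<r} - 13/10 * \<mu> \<le> 703/1000 * \<mu>" using qmu mu0 by (simp add: r_def of_nat_diff)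
      then have "(card {..<r} - 13/10 * \<mu>) * (9/4 * d * \<rho>\<^sup>2) \<le> 703/1000 * \<mu> * (9/4 * d * \<rho>\<^sup>2)"
        using d rho by (intro mult_right_mono) auto
      also have "\<dots> = 6327/4000 * (d * d)" by (simp add: d)
      finally have "(card {..<r} - 13/10 * \<mu>) * (9/4 * d * \<rho>\<^sup>2) \<le> 6327/4000 * (d * d)" .
      moreover have "(142/100 * d)\<^sup>2 = 20164/10000 * (d * d)" by (simp add: power2_eq_square)
      ultimately show ?thesis using dd d by linarith
    qed
  qed (use d rho in auto)
  then obtain Z where Z: "inj_on Z {..<r}" "\<forall>i\<in>{..<r}. Z i \<in> N i" by (elim exE conjE)
  define X where "X i = (if i < r then Z i else Y i)" for i
  have Xinj: "inj_on X {..<w}"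
  proof (rule inj_onI)
    fix i j assume ij: "i \<in> {..<w}" "j \<in> {..<w}" "X i = X j"
    have sep: "Z k \<noteq> Y l" if "k < r" "r \<le> l" "l < w" for k l
    proof -
      have "Y l \<in> Y ` {r..<w}" using that by simp
      moreover have "Z k \<notin> Y ` {r..<w}" using Z(2) that(1) by (simp add: N_def W'_def)
      ultimately show ?thesis by metis
    qed
    show "i = j"
    proof (cases "i < r"; cases "j < r")
      assume "i < r" "j < r"
      then show ?thesis using ij inj_onD[OF Z(1), of i j] by (simp add: X_def)
    next
      assume "i < r" "\<not> j < r"
      then show ?thesis using ij sep[of i j] by (simp add: X_def)
    next
      assume "\<not> i < r" "j < r"
      then show ?thesis using ij sep[of j i] by (simp add: X_def)
    next
      assume "\<not> i < r" "\<not> j < r"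
      then show ?thesis using ij inj_onD[OF Y(1), of i j] by (simp add: X_def)
    qed
  qed
  have XW: "X i \<in> W" if "i < w" for i
    using Z(2) Y(2) that by (cases "i < r") (auto simp: X_def N_def N'_def W'_def)
  have "X ` {..<w} = W"
    using XW Xinj fW by (intro card_subset_eq) (auto simp: card_image w_def)
  define A where "A = ?A"
  have MA: "M \<subseteq> A" unfolding A_def by (intro le_supI1 order_refl)
  have AI1: "(a, x) \<in> A" if "(a, x) \<in> A0" "x \<in> W" "a \<in> f1 ` {..<q} \<or> a \<in> last ` f2 ` {..<q}" for a x
    unfolding A_def Un_iff mem_Collect_eq prod.case using that by blast
  have AI2: "(x, b) \<in> A" if "(x, b) \<in> A0" "x \<in> W" "b \<in> f1 ` {..<q} \<or> b \<in> hd ` f2 ` {..<q}" for b x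
    unfolding A_def Un_iff mem_Collect_eq prod.case using that by blast
  have AI3: "(a, x) \<in> A" if "(a, x) \<in> A1" "x \<in> W" "a \<in> last ` P" for a x
    unfolding A_def Un_iff mem_Collect_eq prod.case using that by blast
  have AI4: "(x, b) \<in> A" if "(x, b) \<in> A2" "x \<in> W" "b \<in> hd ` P" for b x
    unfolding A_def Un_iff mem_Collect_eq prod.case using that by blast
  have arcs: "(en i, X i) \<in> A \<and> (X i, st i) \<in> A" if iw: "i < w" for i
  proof (cases "i < r")
    case True
    then have z: "(en i, X i) \<in> A0" "(X i, st i) \<in> A0" using Z(2) by (auto simp: X_def N_def)
    have i2: "i < 2 * q" using True by (simp add: r_def)
    have "en i \<in> f1 ` {..<q} \<or> en i \<in> last ` f2 ` {..<q}"
      using Qlow[OF i2] Qe Qo sigq by (auto simp: en_def)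
    moreover have "st i \<in> f1 ` {..<q} \<or> st i \<in> hd ` f2 ` {..<q}"
    proof -
      have "Suc i < 2 * q" using True q2 by (simp add: r_def)
      moreover from this have "Suc i mod w = Suc i" using qw by simp
      ultimately show ?thesis using Qlow[of "Suc i"] Qe Qo sigq by (auto simp: st_def)
    qed
    ultimately show ?thesis using AI1[OF z(1) XW[OF iw]] AI2[OF z(2) XW[OF iw]] by blast
  next
    case False
    then have z: "(en i, X i) \<in> A1" "(X i, st i) \<in> A2" using Y(2) iw by (auto simp: X_def N'_def)
    have "en i \<in> last ` P" using QP[OF iw] by (simp add: en_def)
    moreover have "st i \<in> hd ` P" using QP[OF mw[of i]] by (simp add: st_def)
    ultimately show ?thesis using AI3[OF z(1) XW[OF iw]] AI4[OF z(2) XW[OF iw]] by blast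
  qed
  let ?c = "link_paths Q X w"
  have c: "successively (\<lambda>a b. (a, b) \<in> A) ?c \<and> ?c \<noteq> [] \<and> hd ?c = hd (Q 0) \<and> last ?c = X (w - 1)"
  proof (rule successively_link_paths)
    show "Q i \<noteq> [] \<and> successively (\<lambda>a b. (a, b) \<in> A) (Q i) \<and> (last (Q i), X i) \<in> A" if "i < w" for i
    proof (intro conjI)
      have s: "Q i \<noteq> []" "successively (\<lambda>a b. (a, b) \<in> M) (Q i)" using P1[OF QP[OF that]] by auto
      show "Q i \<noteq> []" by (rule s(1))
      show "successively (\<lambda>a b. (a, b) \<in> A) (Q i)" by (rule successively_mono[OF s(2)]) (use MA in blast)
      show "(last (Q i), X i) \<in> A" using conjunct1[OF arcs[OF that]] unfolding en_def .
    qed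
    show "(X i, hd (Q (Suc i))) \<in> A" if "Suc i < w" for i
    proof -
      have "i < w" "Suc i mod w = Suc i" using that by simp_all
      then show ?thesis using conjunct2[OF arcs[of i]] unfolding st_def by simp
    qed
    show "0 < w" using w2 by simp
  qed
  have "(last ?c, hd ?c) \<in> A" 
  proof -
    have "w - 1 < w" "Suc (w - 1) mod w = 0" using w2 by simp_all
    then have "(X (w - 1), hd (Q 0)) \<in> A" using conjunct2[OF arcs[of "w - 1"]] unfolding st_def by simp
    then show ?thesis using c by simp
  qed
  then have "cyclic_arcs ?c \<subseteq> A" using c by (intro cyclic_arcs_subset) auto
  moreover have "distinct ?c"
  proof (rule distinct_link_paths)
    show "distinct (Q i)" if "i < w" for i using P1[OF QP[OF that]] by simp
    show "set (Q i) \<inter> set (Q j) = {}" if "i < w" "j < w" "i \<noteq> j" for i j using Qdisj[OF that] .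
    show "inj_on X {..<w}" by (rule Xinj)
    show "X i \<notin> set (Q j)" if "i < w" "j < w" for i j using XW[OF that(1)] QV[OF that(2)] by auto
  qed
  moreover have "set ?c = V"
  proof -
    have "(\<Union>i<w. set (Q i)) = V - W" using QimP P3 by auto
    then show ?thesis unfolding set_link_paths \<open>X ` {..<w} = W\<close> using WV by auto
  qed
  ultimately show ?thesis unfolding A_def by (intro exI[of _ ?c] conjI)
qed

lemma card_Diff_plus:
  assumes "finite S" "A \<subseteq> S"
  shows "card (S - A) + card A = card S"
  using assms card_mono[OF assms] finite_subset[OF assms(2,1)] by (simp add: card_Diff_subset)

lemma card_enumerated_ge:
  assumes "finite L" "inj_on \<phi> {..<q}" "\<phi> ` {..<q} \<subseteq> L"
  shows "card {a\<in>L. R a} + q \<le> card {k. k < q \<and> R (\<phi> k)} + card L"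
proof -
  let ?I = "\<phi> ` {..<q}"
  have fI: "finite ?I" by simp
  have "card {k. k < q \<and> R (\<phi> k)} = card (\<phi> ` {k. k < q \<and> R (\<phi> k)})"
    by (rule card_image[symmetric], rule inj_on_subset[OF assms(2)]) auto
  also have "\<phi> ` {k. k < q \<and> R (\<phi> k)} = {a\<in>?I. R a}" by auto
  finally have 1: "card {k. k < q \<and> R (\<phi> k)} = card {a\<in>?I. R a}" .
  have "card {a\<in>L. R a} \<le> card ({a\<in>?I. R a} \<union> (L - ?I))"
    using assms(1) by (intro card_mono) auto
  also have "\<dots> \<le> card {a\<in>?I. R a} + card (L - ?I)" by (rule card_Un_le)
  finally have 2: "card {a\<in>L. R a} \<le> card {a\<in>?I. R a} + card (L - ?I)" .
  have "card ?I = q" using card_image[OF assms(2)] by simp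
  then have "card (L - ?I) + q = card L"
    using card_Diff_plus[OF assms(1,3)] by simp
  then show ?thesis using 1 2 by linarith
qed

text \<open>The arcs of \<open>M\<close> form long paths through the levels \<open>2, \<dots>, K - 1\<close>. Removing almost all arcs between
  the levels \<open>2\<close> and \<open>3\<close> makes the number of paths equal to the number of vertices in \<open>W\<close>, that is, in the
  levels \<open>0\<close> and \<open>1\<close>. Almost all paths are then single vertices of level \<open>2\<close> or lead from level \<open>3\<close>
  to level \<open>K - 1\<close>.\<close>

lemma level_system_cycle:
  fixes M A0 A1 A2 :: "('a \<times> 'a) set" and \<mu> \<rho> d s g :: real and lev :: "'a \<Rightarrow> nat"
  defines "W V \<equiv> {v\<in>V. lev v < 2}" and "L V i \<equiv> {v\<in>V. lev v = i}"
  assumes fV: "finite V" and K: "8 \<le> K" and lev: "\<And>v. v \<in> V \<Longrightarrow> lev v < K"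
    and MV: "M \<subseteq> V \<times> V" and Minj: "inj_on fst M" "inj_on snd M"
    and Mlev: "\<And>u v. (u, v) \<in> M \<Longrightarrow> 2 \<le> lev u \<and> lev v = Suc (lev u)"
    and size: "\<And>i. i < K \<Longrightarrow> \<mu> - s \<le> card (L V i) \<and> card (L V i) \<le> \<mu> + s"
    and Msize: "\<And>i. 2 \<le> i \<Longrightarrow> i < K - 1 \<Longrightarrow> card (L V i) - g \<le> card {e\<in>M. lev (fst e) = i}"
    and rho: "0 < \<rho>" "\<rho> \<le> 1" and d: "d = \<mu> * \<rho>\<^sup>2" "1000 \<le> d"
    and s: "1000 * s \<le> d" "0 \<le> s" and g: "0 \<le> g" "1000 * (K * g) \<le> d"
    and deg: "\<And>a b. a \<in> V - W V \<Longrightarrow> b \<in> V - W V \<Longrightarrow> a \<noteq> b \<Longrightarrow>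
        7/4 * d \<le> card {x\<in>W V. (a, x) \<in> A0 \<and> (x, b) \<in> A0} \<and> card {x\<in>W V. (a, x) \<in> A0 \<and> (x, b) \<in> A0} \<le> 9/4 * d"
    and codeg: "\<And>a b a' b'. a \<in> V - W V \<Longrightarrow> b \<in> V - W V \<Longrightarrow> a' \<in> V - W V \<Longrightarrow> b' \<in> V - W V \<Longrightarrow>
        a \<noteq> b \<Longrightarrow> a' \<noteq> b' \<Longrightarrow> a \<noteq> a' \<Longrightarrow> b \<noteq> b' \<Longrightarrow> a \<noteq> b' \<or> b \<noteq> a' \<Longrightarrow>
        card {x\<in>W V. (a, x) \<in> A0 \<and> (x, b) \<in> A0 \<and> (a', x) \<in> A0 \<and> (x, b') \<in> A0} \<le> 9/4 * d * \<rho>\<^sup>2"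
    and deg': "\<And>a b. a \<in> V - W V \<Longrightarrow> b \<in> V - W V \<Longrightarrow> a \<noteq> b \<Longrightarrow>
        d \<le> card {x\<in>W V. (a, x) \<in> A1 \<and> (x, b) \<in> A2}"
    and xin: "\<And>x i. x \<in> W V \<Longrightarrow> i = 2 \<or> i = K - 1 \<Longrightarrow> 88/100 * (\<mu> * \<rho>) \<le> card {a\<in>L V i. (a, x) \<in> A0}"
    and xout: "\<And>x i. x \<in> W V \<Longrightarrow> i = 2 \<or> i = 3 \<Longrightarrow> 88/100 * (\<mu> * \<rho>) \<le> card {b\<in>L V i. (x, b) \<in> A0}"
    and few: "2 * card V * exp (- d / 20000) < 1"
  shows "\<exists>c. distinct c \<and> set c = V \<and> cyclic_arcs c \<subseteq> M
    \<union> {(a, x). (a, x) \<in> A0 \<and> lev x < 2 \<and> (lev a = 2 \<or> lev a = K - 1)}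
    \<union> {(x, b). (x, b) \<in> A0 \<and> lev x < 2 \<and> (lev b = 2 \<or> lev b = 3)}
    \<union> {(a, x). (a, x) \<in> A1 \<and> lev x < 2 \<and> 2 \<le> lev a \<and> (lev a = 2 \<or> lev a = 3 \<or> lev a = K - 1 \<or> a \<notin> fst ` M)}
    \<union> {(x, b). (x, b) \<in> A2 \<and> lev x < 2 \<and> 2 \<le> lev b \<and> (lev b = 2 \<or> lev b = 3 \<or> lev b = 4 \<or> b \<notin> snd ` M)}"
    (is "\<exists>c. _ \<and> _ \<and> _ \<subseteq> M \<union> ?B1 \<union> ?B2 \<union> ?B3 \<union> ?B4")
proof -
  define w where "w = card (W V)"
  have fM: "finite M" using fV MV by (auto intro: finite_subset)
  have WV: "W V \<subseteq> V" and fW: "finite (W V)" using fV by (auto simp: W_def)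
  have fL: "finite (L V i)" for i using fV by (simp add: L_def)
  have mu0: "0 < \<mu>"
  proof (rule ccontr)
    assume "\<not> 0 < \<mu>"
    then have "d \<le> 0" unfolding d by (intro mult_nonpos_nonneg) auto
    then show False using d by simp
  qed
  have rr: "\<rho>\<^sup>2 \<le> \<rho>" unfolding power2_eq_square using rho by (intro mult_left_le) auto
  have d_mr: "d \<le> \<mu> * \<rho>" unfolding d using rr mu0 by (intro mult_left_mono) auto
  have "\<mu> * \<rho> \<le> \<mu> * 1" using rho mu0 by (intro mult_left_mono) auto
  then have d_mu: "d \<le> \<mu>" using d_mr by linarith
  have Mlt: "lev u < K - 1" if "(u, v) \<in> M" for u v
    using Mlev[OF that] lev[of v] MV that by auto
  define Mi where "Mi i = {e\<in>M. lev (fst e) = i}" for i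
  have fMi: "finite (Mi i)" for i using fM by (simp add: Mi_def)
  have Mi_le: "card (Mi i) \<le> card (L V i)" for i
  proof -
    have "card (Mi i) = card (fst ` Mi i)"
      by (rule card_image[symmetric], rule inj_on_subset[OF Minj(1)]) (auto simp: Mi_def)
    also have "\<dots> \<le> card (L V i)" using MV fL by (intro card_mono) (auto simp: Mi_def L_def)
    finally show ?thesis .
  qed
  define Y where "Y = {v\<in>V. 2 \<le> lev v \<and> lev v < K - 1}"
  have fY: "finite Y" using fV by (simp add: Y_def)
  have VW: "V - W V = Y \<union> L V (K - 1)" using lev K by (force simp: W_def L_def Y_def)
  have cVW: "card (V - W V) = card Y + card (L V (K - 1))"
    unfolding VW using fY fL by (intro card_Un_disjoint) (auto simp: Y_def L_def)
  have cw: "w = card (L V 0) + card (L V 1)"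
  proof -
    have "W V = L V 0 \<union> L V 1" by (auto simp: W_def L_def)
    then show ?thesis unfolding w_def using fL by (subst card_Un_disjoint[symmetric]) (auto simp: L_def)
  qed
  have Ysum: "card Y = (\<Sum>i\<in>{2..<K - 1}. card (L V i))"
  proof -
    have "Y = (\<Union>i\<in>{2..<K - 1}. L V i)" by (auto simp: Y_def L_def)
    then show ?thesis using fL by (simp add: card_UN_disjoint L_def disjoint_iff)
  qed
  have Msum: "card M = (\<Sum>i\<in>{2..<K - 1}. card (Mi i))"
  proof -
    have "M = (\<Union>i\<in>{2..<K - 1}. Mi i)" using Mlev Mlt by (fastforce simp: Mi_def)
    then have "card M = card (\<Union>i\<in>{2..<K - 1}. Mi i)" by (rule arg_cong)
    also have "\<dots> = (\<Sum>i\<in>{2..<K - 1}. card (Mi i))"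
      using fMi by (intro card_UN_disjoint) (auto simp: Mi_def)
    finally show ?thesis .
  qed
  have MY: "fst ` M \<subseteq> Y" using Mlev Mlt MV by (fastforce simp: Y_def)
  have cfstM: "card (fst ` M) = card M" by (rule card_image[OF Minj(1)])
  have MleY: "card M \<le> card Y" using card_mono[OF fY MY] cfstM by simp
  \<comment> \<open>The number of vertices on the levels 2 to K - 2 that have no outgoing arc in
    \<open>M\<close>.\<close>
  define D where "D = real (card Y) - real (card M)"
  have D0: "0 \<le> D" using MleY by (simp add: D_def)
  have DKg: "D \<le> K * g"
  proof -
    have "D = (\<Sum>i\<in>{2..<K - 1}. real (card (L V i)) - real (card (Mi i)))"
      by (simp add: D_def Ysum Msum sum_subtractf)
    also have "\<dots> \<le> (\<Sum>i\<in>{2..<K - 1}. g)"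
    proof (rule sum_mono)
      fix i assume "i \<in> {2..<K - 1}"
      then show "real (card (L V i)) - real (card (Mi i)) \<le> g" using Msize[of i] by (simp add: Mi_def)
    qed
    also have "\<dots> = real (K - 1 - 2) * g" by simp
    also have "\<dots> \<le> K * g" using g by (intro mult_right_mono) auto
    finally show ?thesis .
  qed
  have gKg: "g \<le> K * g"
  proof -
    have "1 * g \<le> real K * g" using K g by (intro mult_right_mono) auto
    then show ?thesis by simp
  qed
  have Kg0: "0 \<le> K * g" using gKg g by linarith
  have L0: "\<mu> - s \<le> card (L V 0)" "card (L V 0) \<le> \<mu> + s" using size[of 0] K by auto
  have L1: "\<mu> - s \<le> card (L V 1)" "card (L V 1) \<le> \<mu> + s" using size[of 1] K by auto
  have L2: "\<mu> - s \<le> card (L V 2)" "card (L V 2) \<le> \<mu> + s" using size[of 2] K by auto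
  have L3: "\<mu> - s \<le> card (L V 3)" "card (L V 3) \<le> \<mu> + s" using size[of 3] K by auto
  have LK: "\<mu> - s \<le> card (L V (K - 1))" "card (L V (K - 1)) \<le> \<mu> + s" using size[of "K - 1"] K by auto
  have M2: "\<mu> - s - g \<le> card (Mi 2)" 
  proof -
    have "(2::nat) < K - 1" using K by linarith
    then show ?thesis using Msize[of 2] L2(1) unfolding Mi_def by linarith
  qed
  have M3: "\<mu> - s - g \<le> card (Mi 3)" 
  proof -
    have "(3::nat) < K - 1" using K by linarith
    then show ?thesis using Msize[of 3] L3(1) unfolding Mi_def by linarith
  qed
  have wr: "real w = real (card (L V 0)) + real (card (L V 1))" using cw by simp
  \<comment> \<open>The number of arcs to remove: without \<open>k\<close> arcs of \<open>M\<close>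
    there are card (V - W) - card M + k paths, and this has to be \<open>w\<close>. The paths of
    \<open>M\<close> itself number about one level and \<open>W\<close> has two, so \<open>k\<close>
    is about the size of one level.\<close>
  define k where "k = w + card M - card (V - W V)"
  have "card (V - W V) \<le> w + card M"
  proof -
    have "real (card (V - W V)) = real (card M) + D + real (card (L V (K - 1)))"
      using cVW by (simp add: D_def)
    also have "\<dots> \<le> real w + real (card M)" using DKg LK L0 L1 wr s g d_mu by linarith
    finally show ?thesis by linarith
  qed
  then have kr: "real k = real w - real (card (L V (K - 1))) - D"
    using cVW by (simp add: k_def D_def of_nat_diff)
  have kb: "\<mu> - 3 * s - K * g \<le> real k" "real k \<le> \<mu> + 3 * s"
    using kr wr L0 L1 LK D0 DKg by linarith+
  have dis23: "Mi 2 \<inter> Mi 3 = {}" by (auto simp: Mi_def)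
  \<comment> \<open>Arcs leaving level 2 are removed first; only if they do not suffice are a few
    arcs leaving level 3 added.\<close>
  have "\<exists>C. C \<subseteq> Mi 2 \<union> Mi 3 \<and> card C = k \<and> (C \<subseteq> Mi 2 \<or> Mi 2 \<subseteq> C)"
  proof (cases "k \<le> card (Mi 2)")
    case True
    then obtain C where "C \<subseteq> Mi 2" "card C = k" by (rule obtain_subset_with_card_n)
    then show ?thesis by (intro exI[of _ C]) auto
  next
    case False
    have "card (Mi 2 \<union> Mi 3) = card (Mi 2) + card (Mi 3)" using fMi dis23 by (intro card_Un_disjoint) auto
    then have "real (card (Mi 2 \<union> Mi 3)) = real (card (Mi 2)) + real (card (Mi 3))" by simp
    then have "real k \<le> real (card (Mi 2 \<union> Mi 3))" using M2 M3 kb gKg s g d_mu mu0 by linarith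
    then have "k \<le> card (Mi 2 \<union> Mi 3)" by linarith
    then have "\<exists>C. Mi 2 \<subseteq> C \<and> C \<subseteq> Mi 2 \<union> Mi 3 \<and> card C = k"
      using False fMi by (intro exists_subset_between) auto
    then show ?thesis by (elim exE conjE) (intro exI conjI disjI2)
  qed
  then obtain C where C: "C \<subseteq> Mi 2 \<union> Mi 3" "card C = k" "C \<subseteq> Mi 2 \<or> Mi 2 \<subseteq> C" by (elim exE conjE)
  have fC: "finite C" using C(1) fMi finite_subset by blast
  have CM: "C \<subseteq> M" using C(1) by (auto simp: Mi_def)
  have c2: "card (Mi 2 - C) \<le> 4 * s + K * g"
    using C(3)
  proof
    assume h: "C \<subseteq> Mi 2"
    then have "card (Mi 2 - C) + k = card (Mi 2)" using card_Diff_plus[OF fMi h] C(2) by simp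
    then have "real (card (Mi 2 - C)) + real k = real (card (Mi 2))" by linarith
    then show ?thesis using kb(1) Mi_le[of 2] L2(2) by linarith
  next
    assume "Mi 2 \<subseteq> C"
    then have "card (Mi 2 - C) = 0" by (metis Diff_eq_empty_iff card.empty)
    then show ?thesis using s Kg0 by linarith
  qed
  have c3: "card (C - Mi 2) \<le> 4 * s + K * g"
    using C(3)
  proof
    assume "C \<subseteq> Mi 2"
    then have "card (C - Mi 2) = 0" by (metis Diff_eq_empty_iff card.empty)
    then show ?thesis using s Kg0 by linarith
  next
    assume h: "Mi 2 \<subseteq> C"
    then have "card (C - Mi 2) + card (Mi 2) = k" using card_Diff_plus[OF fC h] C(2) by simp
    then have "real (card (C - Mi 2)) + real (card (Mi 2)) = real k" by linarith
    then show ?thesis using kb(2) M2 gKg by linarith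
  qed
  define M' where "M' = M - C"
  have M'M: "M' \<subseteq> M" by (auto simp: M'_def)
  have "M' \<subseteq> (V - W V) \<times> (V - W V)" using MV Mlev by (fastforce simp: M'_def W_def)
  moreover have "inj_on fst M'" "inj_on snd M'" using Minj M'M by (auto intro: inj_on_subset)
  moreover have M'lev: "lev a < lev b" if "(a, b) \<in> M'" for a b using Mlev M'M that by fastforce
  ultimately have "\<exists>P. path_partition M' (V - W V) P" using fV by (intro path_partition_exists) auto
  then obtain P where P: "path_partition M' (V - W V) P" by (elim exE)
  have fP: "finite P" and cP: "card P + card M' = card (V - W V)"
    and P1: "\<And>p. p \<in> P \<Longrightarrow> p \<noteq> [] \<and> distinct p \<and> successively (\<lambda>a b. (a, b) \<in> M') p"
    and P2: "\<And>p q. p \<in> P \<Longrightarrow> q \<in> P \<Longrightarrow> p \<noteq> q \<Longrightarrow> set p \<inter> set q = {}"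
    and P3: "(\<Union>p\<in>P. set p) = V - W V"
    and P4: "\<And>p. p \<in> P \<Longrightarrow> hd p \<notin> snd ` M' \<and> last p \<notin> fst ` M'"
    using P unfolding path_partition_def by auto
  have "card M' + k = card M" using card_Diff_plus[OF fM CM] C(2) by (simp add: M'_def)
  then have Pw: "card P = card (W V)"
    using cP \<open>card (V - W V) \<le> w + card M\<close> kb(1) unfolding w_def[symmetric] k_def by linarith
  have Pdis: "p = p'" if "p \<in> P" "p' \<in> P" "v \<in> set p" "v \<in> set p'" for p p' v
    using P2[OF that(1,2)] that(3,4) by auto
  have hdV: "hd p \<in> V - W V" "last p \<in> V - W V" "hd p \<in> set p" "last p \<in> set p" if "p \<in> P" for p
  proof -
    show "hd p \<in> set p" "last p \<in> set p" using P1[OF that] by auto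
    then show "hd p \<in> V - W V" "last p \<in> V - W V" using P3 that by blast+
  qed
  have lev_hl: "lev (hd p) \<le> lev (last p)" if "p \<in> P" for p
    using successively_rank[of "\<lambda>a b. (a, b) \<in> M'" p lev] P1[OF that] M'lev by auto
  define T1 where "T1 = {v\<in>L V 2. v \<notin> fst ` M'}"
  have cT1: "\<mu> - 5 * s - K * g \<le> card T1"
  proof -
    have "L V 2 \<subseteq> T1 \<union> fst ` (Mi 2 - C)" by (force simp: T1_def M'_def Mi_def L_def)
    then have "card (L V 2) \<le> card (T1 \<union> fst ` (Mi 2 - C))"
      using fL fMi by (intro card_mono) (auto simp: T1_def)
    also have "\<dots> \<le> card T1 + card (fst ` (Mi 2 - C))" by (rule card_Un_le)
    also have "card (fst ` (Mi 2 - C)) \<le> card (Mi 2 - C)" using fMi by (intro card_image_le) simp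
    finally have "real (card (L V 2)) \<le> real (card T1) + real (card (Mi 2 - C))" by linarith
    then show ?thesis using L2 c2 by linarith
  qed
  have T1P: "[v] \<in> P" if v: "v \<in> T1" for v
  proof -
    have vV: "v \<in> V - W V" using v by (auto simp: T1_def L_def W_def)
    then obtain p where p: "p \<in> P" "v \<in> set p" using P3 by blast
    have "v = last p"
    proof (rule ccontr)
      assume "v \<noteq> last p"
      then obtain b where "(v, b) \<in> M'" using successively_out[of _ p v] P1[OF p(1)] p(2) by blast
      then show False using v by (force simp: T1_def)
    qed
    moreover have "v = hd p"
    proof (rule ccontr)
      assume "v \<noteq> hd p"
      then obtain b where "(b, v) \<in> M'" using successively_in[of _ p v] P1[OF p(1)] p(2) by blast
      then have "2 \<le> lev b" "lev v = Suc (lev b)" using Mlev[of b v] M'M by auto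
      then show False using v by (simp add: T1_def L_def)
    qed
    ultimately have "p = [v]" using P1[OF p(1)] by (cases p) (auto split: if_splits)
    then show ?thesis using p(1) by simp
  qed
  define T3 where "T3 = {p\<in>P. lev (hd p) = 3}"
  define T2 where "T2 = {p\<in>P. lev (hd p) = 3 \<and> lev (last p) = K - 1}"
  have cT3: "\<mu> - 5 * s - K * g \<le> card T3"
  proof -
    have "L V 3 \<subseteq> hd ` T3 \<union> snd ` (Mi 2 - C)"
    proof
      fix v assume v: "v \<in> L V 3"
      then have "v \<in> V - W V" by (auto simp: L_def W_def)
      then obtain p where p: "p \<in> P" "v \<in> set p" using P3 by blast
      show "v \<in> hd ` T3 \<union> snd ` (Mi 2 - C)"
      proof (cases "v = hd p")
        case True
        then show ?thesis using p v by (auto simp: T3_def L_def)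
      next
        case False
        then obtain b where b: "(b, v) \<in> M'" using successively_in[of _ p v] P1[OF p(1)] p(2) by blast
        then have "lev b = 2" using Mlev[of b v] M'M v by (auto simp: L_def)
        then show ?thesis using b by (force simp: M'_def Mi_def)
      qed
    qed
    then have "card (L V 3) \<le> card (hd ` T3 \<union> snd ` (Mi 2 - C))"
      using fP fMi by (intro card_mono) (auto simp: T3_def)
    also have "\<dots> \<le> card (hd ` T3) + card (snd ` (Mi 2 - C))" by (rule card_Un_le)
    also have "\<dots> \<le> card T3 + card (Mi 2 - C)"
      using fMi fP by (intro add_mono card_image_le) (auto simp: T3_def)
    finally have "real (card (L V 3)) \<le> real (card T3) + real (card (Mi 2 - C))" by linarith
    then show ?thesis using L3 c2 by linarith
  qed
  \<comment> \<open>A path that starts on level 3 but stops before level K - 1 ends either at a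
    vertex without outgoing arc in \<open>M\<close> or at the tail of a removed arc of level 3. Last
    vertices of different paths differ, so both kinds are few.\<close>
  have cT2: "\<mu> - 9 * s - 3 * (K * g) \<le> card T2"
  proof -
    have inj: "inj_on last (T3 - T2)"
      by (rule inj_onI) (use Pdis hdV in \<open>auto simp: T3_def; metis\<close>)
    have "card (T3 - T2) = card (last ` (T3 - T2))" by (rule card_image[OF inj, symmetric])
    also have "\<dots> \<le> card ((Y - fst ` M) \<union> fst ` (C - Mi 2))"
    proof (rule card_mono)
      show "finite ((Y - fst ` M) \<union> fst ` (C - Mi 2))" using fY fC by simp
      show "last ` (T3 - T2) \<subseteq> (Y - fst ` M) \<union> fst ` (C - Mi 2)"
      proof (rule image_subsetI)
        fix p assume p: "p \<in> T3 - T2"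
        then have pP: "p \<in> P" and h: "lev (hd p) = 3" "lev (last p) \<noteq> K - 1" by (auto simp: T3_def T2_def)
        have l3: "3 \<le> lev (last p)" using lev_hl[OF pP] h by simp
        have "last p \<in> V" using hdV[OF pP] by simp
        then have "last p \<in> Y" using l3 h lev[of "last p"] by (simp add: Y_def)
        moreover have "last p \<in> fst ` (C - Mi 2)" if f: "last p \<in> fst ` M"
        proof -
          obtain b where "(last p, b) \<in> M" using f by force
          moreover have "(last p, b) \<notin> M'" using P4[OF pP] by force
          ultimately have "(last p, b) \<in> C - Mi 2" using l3 by (auto simp: M'_def Mi_def)
          then show ?thesis by force
        qed
        ultimately show "last p \<in> (Y - fst ` M) \<union> fst ` (C - Mi 2)" by blast
      qed
    qed
    also have "\<dots> \<le> card (Y - fst ` M) + card (fst ` (C - Mi 2))" by (rule card_Un_le)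
    also have "\<dots> \<le> card (Y - fst ` M) + card (C - Mi 2)" using fC by (intro add_left_mono card_image_le) simp
    finally have 1: "real (card (T3 - T2)) \<le> real (card (Y - fst ` M)) + real (card (C - Mi 2))" by linarith
    have "card (Y - fst ` M) + card M = card Y"
      using card_Diff_plus[OF fY MY] cfstM by simp
    then have 2: "real (card (Y - fst ` M)) = D" unfolding D_def by linarith
    have T23: "T2 \<subseteq> T3" by (auto simp: T2_def T3_def)
    have fT3: "finite T3" using fP by (simp add: T3_def)
    have "card (T3 - T2) + card T2 = card T3"
      by (rule card_Diff_plus[OF fT3 T23])
    then have "real (card (T3 - T2)) + real (card T2) = real (card T3)" by linarith
    then show ?thesis using 1 2 cT3 c3 DKg by linarith
  qed
  have fT: "finite T1" "finite T2" using fL fP by (auto simp: T1_def T2_def)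
  define q where "q = min (card T1) (card T2)"
  have qlow: "\<mu> - 9 * s - 3 * (K * g) \<le> q"
    using cT1 cT2 s g gKg by (auto simp: q_def min_def)
  have qL: "q \<le> card (L V 2)"
  proof -
    have "card T1 \<le> card (L V 2)" using fL by (intro card_mono) (auto simp: T1_def)
    then show ?thesis by (simp add: q_def)
  qed
  have qhi: "real q \<le> \<mu> + s" using qL L2 by linarith
  have "q \<le> card T1" "q \<le> card T2" by (auto simp: q_def)
  then obtain T1' T2' where T': "T1' \<subseteq> T1" "card T1' = q" "T2' \<subseteq> T2" "card T2' = q"
    using obtain_subset_with_card_n by metis
  have fT': "finite T1'" "finite T2'" using T' fT finite_subset by blast+
  obtain f1 where f1: "bij_betw f1 {..<q} T1'"
    using ex_bij_betw_nat_finite[OF fT'(1)] T' by (auto simp: atLeast0LessThan)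
  obtain f2 where f2: "bij_betw f2 {..<q} T2'"
    using ex_bij_betw_nat_finite[OF fT'(2)] T' by (auto simp: atLeast0LessThan)
  have f1i: "inj_on f1 {..<q}" "f1 ` {..<q} = T1'" using f1 by (auto simp: bij_betw_def)
  have f2i: "inj_on f2 {..<q}" "f2 ` {..<q} = T2'" using f2 by (auto simp: bij_betw_def)
  have f1L: "f1 ` {..<q} \<subseteq> L V 2" using f1i T' by (auto simp: T1_def)
  have f2T: "f2 k \<in> T2" if "k < q" for k using f2i T' that by auto
  have f2P: "f2 k \<in> P" if "k < q" for k using f2T[OF that] by (simp add: T2_def)
  have f2inj: "k = l" if "k < q" "l < q" "v \<in> set (f2 k)" "v \<in> set (f2 l)" for k l v
    using Pdis[OF f2P[OF that(1)] f2P[OF that(2)] that(3,4)] inj_onD[OF f2i(1), of k l] that(1,2) by simp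
  have hinj: "inj_on (\<lambda>k. hd (f2 k)) {..<q}"
    by (rule inj_onI) (metis f2P f2inj hdV(3) lessThan_iff)
  have linj: "inj_on (\<lambda>k. last (f2 k)) {..<q}"
    by (rule inj_onI) (metis f2P f2inj hdV(4) lessThan_iff)
  have hL: "(\<lambda>k. hd (f2 k)) ` {..<q} \<subseteq> L V 3" using f2T hdV by (auto simp: T2_def L_def)
  have lL: "(\<lambda>k. last (f2 k)) ` {..<q} \<subseteq> L V (K - 1)" using f2T hdV by (auto simp: T2_def L_def)
  \<comment> \<open>A level exceeds \<open>q\<close> by at most 10 s + 3 K g, and \<open>s\<close>
    and K g are at most d/1000 each, whence 13/1000.\<close>
  have enum: "real (card {a\<in>L V i. R a}) - (13/1000) * d \<le> real (card {k. k < q \<and> R (\<phi> k)})"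
    if "inj_on \<phi> {..<q}" "\<phi> ` {..<q} \<subseteq> L V i" "card (L V i) \<le> \<mu> + s" for \<phi> R i
  proof -
    have "card {a\<in>L V i. R a} + q \<le> card {k. k < q \<and> R (\<phi> k)} + card (L V i)"
      by (rule card_enumerated_ge[OF fL that(1,2)])
    then have "real (card {a\<in>L V i. R a}) + real q \<le> real (card {k. k < q \<and> R (\<phi> k)}) + real (card (L V i))"
      by linarith
    then show ?thesis using qlow that(3) s g by linarith
  qed
  have f12: "[f1 k] \<noteq> f2 l" if "k < q" "l < q" for k l
  proof
    assume "[f1 k] = f2 l"
    then have "hd (f2 l) = f1 k" by (metis list.sel(1))
    moreover have "lev (f1 k) = 2" using f1L that by (auto simp: L_def)
    moreover have "lev (hd (f2 l)) = 3" using f2T[OF that(2)] by (simp add: T2_def)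
    ultimately show False by simp
  qed
  have "\<exists>c. distinct c \<and> set c = V \<and> cyclic_arcs c \<subseteq> M'
    \<union> {(a, x). (a, x) \<in> A0 \<and> x \<in> W V \<and> (a \<in> f1 ` {..<q} \<or> a \<in> last ` f2 ` {..<q})}
    \<union> {(x, b). (x, b) \<in> A0 \<and> x \<in> W V \<and> (b \<in> f1 ` {..<q} \<or> b \<in> hd ` f2 ` {..<q})}
    \<union> {(a, x). (a, x) \<in> A1 \<and> x \<in> W V \<and> a \<in> last ` P} \<union> {(x, b). (x, b) \<in> A2 \<and> x \<in> W V \<and> b \<in> hd ` P}"
  proof (rule link_path_system[OF fV WV P Pw _ f1i(1) _ f2i(1) f2P f12 rho d _ _ deg codeg deg' _ _ _ _ few])
    show "2 \<le> q"
    proof -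
      have "2 \<le> real q" using qlow s g d d_mu by linarith
      then show ?thesis by linarith
    qed
    show "[f1 k] \<in> P" if "k < q" for k using T1P T' f1i that by blast
    show "real (card (W V)) + 1 \<le> 2 * real q + 3/100 * d"
      using qlow wr L0 L1 s g d unfolding w_def by linarith
    show "real q \<le> 1001/1000 * \<mu>" using qhi s d_mu by linarith
    fix x assume x: "x \<in> W V"
    have small: "(13/1000) * d \<le> (13/1000) * (\<mu> * \<rho>)" "1 \<le> 1/1000 * (\<mu> * \<rho>)" using d_mr d by linarith+
    show "86/100 * (\<mu> * \<rho>) \<le> card {k. k < q \<and> (f1 k, x) \<in> A0}"
      using enum[OF f1i(1) f1L L2(2), of "\<lambda>a. (a, x) \<in> A0"] xin[OF x, of 2] small by linarith
    show "86/100 * (\<mu> * \<rho>) \<le> card {k. k < q \<and> (x, hd (f2 k)) \<in> A0}"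
      using enum[OF hinj hL L3(2), of "\<lambda>a. (x, a) \<in> A0"] xout[OF x, of 3] small by linarith
    show "86/100 * (\<mu> * \<rho>) \<le> card {k. k < q \<and> (last (f2 k), x) \<in> A0}"
      using enum[OF linj lL LK(2), of "\<lambda>a. (a, x) \<in> A0"] xin[OF x, of "K - 1"] small by linarith
    show "86/100 * (\<mu> * \<rho>) + 1 \<le> card {k. k < q \<and> (x, f1 k) \<in> A0}"
      using enum[OF f1i(1) f1L L2(2), of "\<lambda>a. (x, a) \<in> A0"] xout[OF x, of 2] small by linarith
  qed
  then obtain c where c: "distinct c" "set c = V" and cA: "cyclic_arcs c \<subseteq> M'
    \<union> {(a, x). (a, x) \<in> A0 \<and> x \<in> W V \<and> (a \<in> f1 ` {..<q} \<or> a \<in> last ` f2 ` {..<q})}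
    \<union> {(x, b). (x, b) \<in> A0 \<and> x \<in> W V \<and> (b \<in> f1 ` {..<q} \<or> b \<in> hd ` f2 ` {..<q})}
    \<union> {(a, x). (a, x) \<in> A1 \<and> x \<in> W V \<and> a \<in> last ` P} \<union> {(x, b). (x, b) \<in> A2 \<and> x \<in> W V \<and> b \<in> hd ` P}"
    (is "_ \<subseteq> M' \<union> ?C1 \<union> ?C2 \<union> ?C3 \<union> ?C4")
    by (elim exE conjE)
  have l2: "lev (f1 k) = 2" if "k < q" for k using f1L that by (auto simp: L_def)
  have l3: "lev (hd (f2 k)) = 3" "lev (last (f2 k)) = K - 1" if "k < q" for k using f2T[OF that] by (auto simp: T2_def)
  have B1: "?C1 \<subseteq> ?B1" using l2 l3 by (auto simp: W_def)
  have B2: "?C2 \<subseteq> ?B2" using l2 l3 by (auto simp: W_def)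
  have lastP: "lev (last p) = 2 \<or> lev (last p) = 3 \<or> last p \<notin> fst ` M" if p: "p \<in> P" for p
  proof (cases "last p \<in> fst ` M")
    case True
    then obtain b where "(last p, b) \<in> M" by force
    moreover have "(last p, b) \<notin> M'" using P4[OF p] by force
    ultimately have "(last p, b) \<in> C" by (simp add: M'_def)
    then show ?thesis using C(1) by (auto simp: Mi_def)
  qed simp
  have hdP: "lev (hd p) = 3 \<or> lev (hd p) = 4 \<or> hd p \<notin> snd ` M" if p: "p \<in> P" for p
  proof (cases "hd p \<in> snd ` M")
    case True
    then obtain b where b: "(b, hd p) \<in> M" by force
    moreover have "(b, hd p) \<notin> M'" using P4[OF p] by force
    ultimately have "(b, hd p) \<in> C" by (simp add: M'_def)
    then have "lev b = 2 \<or> lev b = 3" using C(1) by (auto simp: Mi_def)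
    then show ?thesis using Mlev[OF b] by auto
  qed simp
  have ge2: "2 \<le> lev (last p)" "2 \<le> lev (hd p)" if "p \<in> P" for p
    using hdV(1,2)[OF that] by (auto simp: W_def)
  have B3: "?C3 \<subseteq> ?B3" using lastP ge2 by (auto simp: W_def)
  have B4: "?C4 \<subseteq> ?B4" using hdP ge2 by (auto simp: W_def)
  have "cyclic_arcs c \<subseteq> M \<union> ?B1 \<union> ?B2 \<union> ?B3 \<union> ?B4"
    by (rule order_trans[OF cA]) (intro Un_mono M'M B1 B2 B3 B4)
  then show ?thesis using c by (intro exI[of _ c] conjI)
qed

section \<open>Cyclic systems of matchings\<close>

lemma prime_index_eq:
  fixes K j r r' :: nat
  assumes "prime K" "0 < j" "j < K"
  shows "(j * (t + r)) mod K = (j * (t + r')) mod K \<longleftrightarrow> r mod K = r' mod K"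
proof -
  have "coprime j K" using assms by (simp add: coprime_commute prime_imp_coprime nat_dvd_not_less)
  then have "[j * (t + r) = j * (t + r')] (mod K) \<longleftrightarrow> [t + r = t + r'] (mod K)" by (rule cong_mult_lcancel_nat)
  also have "\<dots> \<longleftrightarrow> [r = r'] (mod K)" by (rule cong_add_lcancel_nat)
  finally show ?thesis by (simp add: cong_def)
qed

lemma prime_index_bij:
  fixes K j :: nat
  assumes "prime K" "0 < j" "j < K"
  shows "bij_betw (\<lambda>r. (j * (t + r)) mod K) {..<K} {..<K}"
proof -
  have K: "0 < K" using assms by simp
  have "inj_on (\<lambda>r. (j * (t + r)) mod K) {..<K}"
    by (rule inj_onI) (simp add: prime_index_eq[OF assms])
  moreover have "(\<lambda>r. (j * (t + r)) mod K) ` {..<K} \<subseteq> {..<K}" using K by auto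
  ultimately show ?thesis by (simp add: bij_betw_def card_subset_eq card_image)
qed

text \<open>System \<open>(j, t)\<close> has part j (t + r) mod K on level \<open>r\<close>; the
  level of a part is obtained by inverting this map. The shift by \<open>t\<close> is essential:
  without it, part 0 would have level 0 in every system.\<close>

definition level :: "nat \<Rightarrow> nat \<times> nat \<Rightarrow> nat \<Rightarrow> nat" where
  "level K \<sigma> = the_inv_into {..<K} (\<lambda>r. (fst \<sigma> * (snd \<sigma> + r)) mod K)"

context
  fixes K :: nat and \<sigma> :: "nat \<times> nat"
  assumes K: "prime K" and j: "0 < fst \<sigma>" "fst \<sigma> < K"
begin

lemma level_less: "c < K \<Longrightarrow> level K \<sigma> c < K"
  using the_inv_into_into[OF bij_betw_imp_inj_on[OF prime_index_bij[OF K j]], of c "snd \<sigma>" "{..<K}"]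
    prime_index_bij[OF K j, of "snd \<sigma>"]
  by (simp add: level_def bij_betw_def)

lemma level_index: "c < K \<Longrightarrow> (fst \<sigma> * (snd \<sigma> + level K \<sigma> c)) mod K = c"
  using f_the_inv_into_f_bij_betw[OF prime_index_bij[OF K j, of "snd \<sigma>"], of c] by (simp add: level_def)

lemma level_eq_iff: "c < K \<Longrightarrow> r < K \<Longrightarrow> level K \<sigma> c = r \<longleftrightarrow> (fst \<sigma> * (snd \<sigma> + r)) mod K = c"
  using level_index[of c] level_less[of c] prime_index_eq[OF K j, of "snd \<sigma>" "level K \<sigma> c" r] by auto

lemma level_next:
  assumes "c < K" "level K \<sigma> c < K - 1"
  shows "level K \<sigma> ((c + fst \<sigma>) mod K) = Suc (level K \<sigma> c)"
proof -
  have "(fst \<sigma> * (snd \<sigma> + Suc (level K \<sigma> c))) mod K = (fst \<sigma> * (snd \<sigma> + level K \<sigma> c) + fst \<sigma>) mod K"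
    by (simp add: algebra_simps)
  also have "\<dots> = (c + fst \<sigma>) mod K" using level_index[OF assms(1)] by (metis mod_add_left_eq)
  finally show ?thesis using assms K by (subst level_eq_iff) (auto simp: prime_gt_0_nat)
qed

end

lemma step_unique:
  fixes K c j j' :: nat
  assumes "(c + j) mod K = (c + j') mod K" "j < K" "j' < K"
  shows "j = j'"
proof -
  have "[c + j = c + j'] (mod K)" using assms by (simp add: cong_def)
  then have "[j = j'] (mod K)" by (simp only: cong_add_lcancel_nat)
  then show ?thesis using assms by (simp add: cong_def)
qed

text \<open>The two prescribed levels are linear congruences modulo the prime \<open>K\<close>.
  Their difference determines \<open>j\<close>, because r - r' is invertible, and then either of
  them determines \<open>t\<close> modulo \<open>K\<close>; so there is at most one system for each
  value of \<open>t div K\<close>.\<close>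

lemma card_systems_with_levels:
  fixes K \<Delta> r r' c c' :: nat
  assumes K: "prime K" and r: "r < K" "r' < K" "r \<noteq> r'" and c: "c < K" "c' < K"
  shows "card {\<sigma> \<in> {1..<K} \<times> {..<\<Delta>}. level K \<sigma> c = r \<and> level K \<sigma> c' = r'} \<le> \<Delta> div K + 1"
proof -
  let ?S = "{\<sigma> \<in> {1..<K} \<times> {..<\<Delta>}. level K \<sigma> c = r \<and> level K \<sigma> c' = r'}"
  have "card ?S \<le> card {..\<Delta> div K}"
  proof (rule card_inj_on_le)
    show "(\<lambda>\<sigma>. snd \<sigma> div K) ` ?S \<subseteq> {..\<Delta> div K}" by (auto intro: div_le_mono)
    show "inj_on (\<lambda>\<sigma>. snd \<sigma> div K) ?S"
    proof (rule inj_onI)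
      fix \<sigma> \<tau> assume st: "\<sigma> \<in> ?S" "\<tau> \<in> ?S" "snd \<sigma> div K = snd \<tau> div K"
      obtain j t where s: "\<sigma> = (j, t)" by (cases \<sigma>)
      obtain i u where t: "\<tau> = (i, u)" by (cases \<tau>)
      have ji: "0 < j" "j < K" "0 < i" "i < K" using st s t by auto
      have e1: "(j * (t + r)) mod K = (i * (u + r)) mod K" "(j * (t + r')) mod K = (i * (u + r')) mod K"
        using st s t ji level_eq_iff[OF K, of \<sigma> c r] level_eq_iff[OF K, of \<tau> c r]
          level_eq_iff[OF K, of \<sigma> c' r'] level_eq_iff[OF K, of \<tau> c' r'] r c by auto
      define k where "k = int K"
      have pk: "prime k" using K by (simp add: k_def)
      have d1: "k dvd int (j * (t + r)) - int (i * (u + r))" "k dvd int (j * (t + r')) - int (i * (u + r'))"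
        using e1 unfolding k_def by (metis mod_eq_dvd_iff zmod_int)+
      have small: "x = 0" if "k dvd x" "\<bar>x\<bar> < k" for x
        using that zdvd_not_zless[of "\<bar>x\<bar>" k] by (cases "x = 0") auto
      have "k dvd (int (j * (t + r)) - int (i * (u + r))) - (int (j * (t + r')) - int (i * (u + r')))"
        using d1 by (rule dvd_diff)
      also have "\<dots> = (int j - int i) * (int r - int r')" by (simp add: algebra_simps)
      finally have "k dvd (int j - int i) \<or> k dvd (int r - int r')" using pk by (simp add: prime_dvd_mult_iff)
      moreover have "\<bar>int r - int r'\<bar> < k" "int r - int r' \<noteq> 0"
        using r by (simp_all add: k_def abs_less_iff)
      then have "\<not> k dvd (int r - int r')" using small[of "int r - int r'"] by blast
      ultimately have "k dvd (int j - int i)" by simp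
      then have "int j - int i = 0" using ji by (intro small) (auto simp: k_def)
      then have ji': "j = i" by simp
      have "(j * (r + t)) mod K = (j * (r + u)) mod K" using e1(1) ji' by (simp add: add.commute)
      then have "t mod K = u mod K" using prime_index_eq[OF K ji(1,2)] by simp
      moreover have "t div K = u div K" using st s t by simp
      ultimately have "t = u" by (metis div_mult_mod_eq)
      then show "\<sigma> = \<tau>" using s t ji' by simp
    qed
  qed simp
  then show ?thesis by simp
qed

lemma card_cyclic_arcs_out:
  assumes "distinct c"
  shows "card {x. (a, x) \<in> cyclic_arcs c \<and> R x} \<le> 1" "card {x. (x, a) \<in> cyclic_arcs c \<and> R x} \<le> 1"
proof -
  have "x = y" if "(a, x) \<in> cyclic_arcs c" "(a, y) \<in> cyclic_arcs c" for x y
    using inj_onD[OF cyclic_arcs_inj(1)[OF assms], of "(a, x)" "(a, y)"] that by simp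
  moreover have fin: "finite {x. (a, x) \<in> cyclic_arcs c \<and> R x}"
    by (rule finite_subset[of _ "snd ` cyclic_arcs c"]) (force, simp add: cyclic_arcs_def)
  ultimately show "card {x. (a, x) \<in> cyclic_arcs c \<and> R x} \<le> 1"
    unfolding One_nat_def card_le_Suc0_iff_eq[OF fin] by blast
  have "x = y" if "(x, a) \<in> cyclic_arcs c" "(y, a) \<in> cyclic_arcs c" for x y
    using inj_onD[OF cyclic_arcs_inj(2)[OF assms], of "(x, a)" "(y, a)"] that by simp
  moreover have fin': "finite {x. (x, a) \<in> cyclic_arcs c \<and> R x}"
    by (rule finite_subset[of _ "fst ` cyclic_arcs c"]) (force, simp add: cyclic_arcs_def)
  ultimately show "card {x. (x, a) \<in> cyclic_arcs c \<and> R x} \<le> 1"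
    unfolding One_nat_def card_le_Suc0_iff_eq[OF fin'] by blast
qed

text \<open>The data from which the Hamilton cycles are built: the vertices are partitioned into \<open>K\<close> parts,
  the arcs in \<open>H\<close> between any two parts are partitioned into \<open>\<Delta>\<close> almost perfect matchings by \<open>mc\<close>, and the arcs
  of the colours \<open>0, 1, 2\<close> are reserved for links. Each system \<open>(j, t)\<close> consists of the matchings number \<open>t\<close>
  from part \<open>c\<close> to part \<open>c + j\<close>, for all \<open>c\<close>; the parts are traversed cyclically since \<open>K\<close> is prime.\<close>

locale packing_structure =
  fixes V :: "'a set" and E H :: "('a \<times> 'a) set" and part :: "'a \<Rightarrow> nat" and col mc :: "'a \<times> 'a \<Rightarrow> nat"
    and K \<Delta> h :: nat and \<mu> \<rho> d s g :: real
  assumes fV: "finite V" and EV: "E \<subseteq> V \<times> V"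
    and K: "prime K" "8 \<le> K" and part: "\<And>v. v \<in> V \<Longrightarrow> part v < K"
    and size: "\<And>c. c < K \<Longrightarrow> \<mu> - s \<le> card {v\<in>V. part v = c} \<and> card {v\<in>V. part v = c} \<le> \<mu> + s"
    and HE: "H \<subseteq> E" and Hcol: "\<And>e. e \<in> H \<Longrightarrow> 3 \<le> col e"
    and Hout: "\<And>u v v'. (u, v) \<in> H \<Longrightarrow> (u, v') \<in> H \<Longrightarrow> part v = part v' \<Longrightarrow> mc (u, v) = mc (u, v') \<Longrightarrow> v = v'"
    and Hin: "\<And>u u' v. (u, v) \<in> H \<Longrightarrow> (u', v) \<in> H \<Longrightarrow> part u = part u' \<Longrightarrow> mc (u, v) = mc (u', v) \<Longrightarrow> u = u'"
    and Hsize: "\<And>c c' t. c < K \<Longrightarrow> c' < K \<Longrightarrow> c \<noteq> c' \<Longrightarrow> t < \<Delta> \<Longrightarrow>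
      card {v\<in>V. part v = c} - g \<le> card {e\<in>H. part (fst e) = c \<and> part (snd e) = c' \<and> mc e = t}"
    and Hmiss_out: "\<And>u c. u \<in> V \<Longrightarrow> c < K \<Longrightarrow> c \<noteq> part u \<Longrightarrow>
      card {t. t < \<Delta> \<and> \<not> (\<exists>v. (u, v) \<in> H \<and> part v = c \<and> mc (u, v) = t)} \<le> h"
    and Hmiss_in: "\<And>v c. v \<in> V \<Longrightarrow> c < K \<Longrightarrow> c \<noteq> part v \<Longrightarrow>
      card {t. t < \<Delta> \<and> \<not> (\<exists>u. (u, v) \<in> H \<and> part u = c \<and> mc (u, v) = t)} \<le> h"
    and rho: "0 < \<rho>" "\<rho> \<le> 1" and d: "d = \<mu> * \<rho>\<^sup>2" "1000 \<le> d" and mu: "0 < \<mu>"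
    and s: "1000 * s \<le> d" "0 \<le> s" and g: "0 \<le> g" "1000 * (K * g) \<le> d"
    and links: "\<And>a b c. a \<in> V \<Longrightarrow> b \<in> V \<Longrightarrow> a \<noteq> b \<Longrightarrow> c < K \<Longrightarrow>
        88/100 * d \<le> card {x\<in>V. part x = c \<and> (a, x) \<in> E \<and> col (a, x) = 0 \<and> (x, b) \<in> E \<and> col (x, b) = 0} \<and>
        card {x\<in>V. part x = c \<and> (a, x) \<in> E \<and> col (a, x) = 0 \<and> (x, b) \<in> E \<and> col (x, b) = 0} \<le> 9/8 * d"
    and links2: "\<And>a b a' b' c. a \<in> V \<Longrightarrow> b \<in> V \<Longrightarrow> a' \<in> V \<Longrightarrow> b' \<in> V \<Longrightarrow>
        a \<noteq> b \<Longrightarrow> a' \<noteq> b' \<Longrightarrow> a \<noteq> a' \<Longrightarrow> b \<noteq> b' \<Longrightarrow> a \<noteq> b' \<or> b \<noteq> a' \<Longrightarrow> c < K \<Longrightarrow>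
        card {x\<in>V. part x = c \<and> (a, x) \<in> E \<and> col (a, x) = 0 \<and> (x, b) \<in> E \<and> col (x, b) = 0 \<and>
          (a', x) \<in> E \<and> col (a', x) = 0 \<and> (x, b') \<in> E \<and> col (x, b') = 0} \<le> 9/8 * d * \<rho>\<^sup>2"
    and links': "\<And>a b c. a \<in> V \<Longrightarrow> b \<in> V \<Longrightarrow> a \<noteq> b \<Longrightarrow> c < K \<Longrightarrow>
        88/100 * d \<le> card {x\<in>V. part x = c \<and> (a, x) \<in> E \<and> col (a, x) = 1 \<and> (x, b) \<in> E \<and> col (x, b) = 2}"
    and deg_in: "\<And>x c. x \<in> V \<Longrightarrow> c < K \<Longrightarrow> 881/1000 * (\<mu> * \<rho>) \<le> card {a\<in>V. part a = c \<and> (a, x) \<in> E \<and> col (a, x) = 0}"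
    and deg_out: "\<And>x c. x \<in> V \<Longrightarrow> c < K \<Longrightarrow> 881/1000 * (\<mu> * \<rho>) \<le> card {b\<in>V. part b = c \<and> (x, b) \<in> E \<and> col (x, b) = 0}"
    and usage: "1000 * (8 * (\<Delta> div K + 1) + K * h) \<le> d"
    and few: "2 * card V * exp (- d / 20000) < 1"
begin

definition systems :: "(nat \<times> nat) set" where "systems = {1..<K} \<times> {..<\<Delta>}"

definition lev :: "nat \<times> nat \<Rightarrow> 'a \<Rightarrow> nat" where "lev \<sigma> v = level K \<sigma> (part v)"

definition chain :: "nat \<times> nat \<Rightarrow> ('a \<times> 'a) set" where
  "chain \<sigma> = {(u, v) \<in> H. part v = (part u + fst \<sigma>) mod K \<and> mc (u, v) = snd \<sigma> \<and> 2 \<le> lev \<sigma> u \<and> lev \<sigma> u < K - 1}"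

text \<open>Links at regular positions: the path ends lie on fixed levels there, so the levels of
  tail and head take only boundedly many pairs of values, whatever the system.\<close>

definition ctrl_arcs :: "nat \<times> nat \<Rightarrow> ('a \<times> 'a) set" where
  "ctrl_arcs \<sigma> = {(a, x). (a, x) \<in> E \<and> col (a, x) = 0 \<and>
     (lev \<sigma> x < 2 \<and> (lev \<sigma> a = 2 \<or> lev \<sigma> a = K - 1) \<or> lev \<sigma> a < 2 \<and> (lev \<sigma> x = 2 \<or> lev \<sigma> x = 3))}"

text \<open>Links at exceptional positions, where a path may end at any vertex left unmatched.
  Separate colours for the arcs that enter and that leave a linking vertex allow used arcs to be
  counted at the path ends alone; no bound at the linking vertices is then needed.\<close>

definition in_arcs :: "nat \<times> nat \<Rightarrow> ('a \<times> 'a) set" where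
  "in_arcs \<sigma> = {(a, x). (a, x) \<in> E \<and> col (a, x) = 1 \<and> lev \<sigma> x < 2 \<and> 2 \<le> lev \<sigma> a \<and>
     (lev \<sigma> a = 2 \<or> lev \<sigma> a = 3 \<or> lev \<sigma> a = K - 1 \<or> a \<notin> fst ` chain \<sigma>)}"

definition out_arcs' :: "nat \<times> nat \<Rightarrow> ('a \<times> 'a) set" where
  "out_arcs' \<sigma> = {(x, b). (x, b) \<in> E \<and> col (x, b) = 2 \<and> lev \<sigma> x < 2 \<and> 2 \<le> lev \<sigma> b \<and>
     (lev \<sigma> b = 2 \<or> lev \<sigma> b = 3 \<or> lev \<sigma> b = 4 \<or> b \<notin> snd ` chain \<sigma>)}"

definition system_cycle :: "nat \<times> nat \<Rightarrow> 'a list \<Rightarrow> bool" where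
  "system_cycle \<sigma> c \<longleftrightarrow> distinct c \<and> set c = V \<and>
     cyclic_arcs c \<subseteq> chain \<sigma> \<union> ctrl_arcs \<sigma> \<union> in_arcs \<sigma> \<union> out_arcs' \<sigma>"

lemma system_bounds: "\<sigma> \<in> systems \<Longrightarrow> 0 < fst \<sigma> \<and> fst \<sigma> < K \<and> snd \<sigma> < \<Delta>"
  by (auto simp: systems_def)

lemma finite_systems: "finite systems"
  by (simp add: systems_def)

lemma fE: "finite E"
  using fV EV finite_subset by blast

lemma chain_H: "chain \<sigma> \<subseteq> H"
  by (auto simp: chain_def)

lemma system_cycle_arcs: "system_cycle \<sigma> c \<Longrightarrow> cyclic_arcs c \<subseteq> E"
  using HE chain_H unfolding system_cycle_def ctrl_arcs_def in_arcs_def out_arcs'_def by blast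

lemma chain_disjoint:
  assumes "\<sigma> \<in> systems" "\<tau> \<in> systems" "e \<in> chain \<sigma>" "e \<in> chain \<tau>"
  shows "\<sigma> = \<tau>"
proof -
  obtain u v where e: "e = (u, v)" by (cases e)
  have "(part u + fst \<sigma>) mod K = (part u + fst \<tau>) mod K" "snd \<sigma> = snd \<tau>"
    using assms(3,4) by (auto simp: chain_def e)
  moreover have "fst \<sigma> = fst \<tau>"
    by (rule step_unique[OF calculation(1)]) (use system_bounds assms(1,2) in auto)
  ultimately show ?thesis by (simp add: prod_eq_iff)
qed

lemma lev_less: "\<sigma> \<in> systems \<Longrightarrow> v \<in> V \<Longrightarrow> lev \<sigma> v < K"
  using level_less[OF K(1)] system_bounds part by (simp add: lev_def)

lemma chain_lev:
  assumes "\<sigma> \<in> systems" "(u, v) \<in> chain \<sigma>"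
  shows "2 \<le> lev \<sigma> u \<and> lev \<sigma> v = Suc (lev \<sigma> u)"
proof -
  have u: "u \<in> V" "part v = (part u + fst \<sigma>) mod K" "2 \<le> lev \<sigma> u" "lev \<sigma> u < K - 1"
    using assms(2) HE EV by (auto simp: chain_def)
  then show ?thesis
    using level_next[OF K(1), of \<sigma> "part u"] system_bounds[OF assms(1)] part[OF u(1)] by (simp add: lev_def)
qed

lemma chain_inj:
  assumes "\<sigma> \<in> systems"
  shows "inj_on fst (chain \<sigma>)" "inj_on snd (chain \<sigma>)"
proof -
  show "inj_on fst (chain \<sigma>)"
  proof (rule inj_onI)
    fix x y assume xy: "x \<in> chain \<sigma>" "y \<in> chain \<sigma>" "fst x = fst y"
    obtain u v w where x: "x = (u, v)" "y = (u, w)" using xy(3) by (cases x; cases y) auto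
    then have "v = w" using xy(1,2) by (intro Hout[of u v w]) (auto simp: chain_def)
    then show "x = y" using x by simp
  qed
  show "inj_on snd (chain \<sigma>)"
  proof (rule inj_onI)
    fix x y assume xy: "x \<in> chain \<sigma>" "y \<in> chain \<sigma>" "snd x = snd y"
    obtain u v w where x: "x = (u, v)" "y = (w, v)" using xy(3) by (cases x; cases y) auto
    have uw: "(u, v) \<in> H" "(w, v) \<in> H" "mc (u, v) = mc (w, v)"
      "(part u + fst \<sigma>) mod K = (part w + fst \<sigma>) mod K"
      using xy(1,2) x by (auto simp: chain_def)
    then have "part u < K" "part w < K" using HE EV part by blast+
    then have "part u = part w"
      using step_unique[of "fst \<sigma>" "part u" K "part w"] uw(4) by (simp add: add.commute)
    then have "u = w" using Hin uw by blast
    then show "x = y" using x by simp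
  qed
qed

lemma lev_eq_iff:
  assumes "\<sigma> \<in> systems" "v \<in> V" "i < K"
  shows "lev \<sigma> v = i \<longleftrightarrow> part v = (fst \<sigma> * (snd \<sigma> + i)) mod K"
  using level_eq_iff[OF K(1), of \<sigma> "part v" i] system_bounds[OF assms(1)] part[OF assms(2)] assms(3)
  by (auto simp: lev_def)

lemma level_set:
  assumes "\<sigma> \<in> systems" "i < K"
  shows "{v\<in>V. lev \<sigma> v = i} = {v\<in>V. part v = (fst \<sigma> * (snd \<sigma> + i)) mod K}"
  using lev_eq_iff[OF assms(1) _ assms(2)] by auto

lemma K_pos: "0 < K"
  using K by simp

lemma level_size:
  assumes "\<sigma> \<in> systems" "i < K"
  shows "\<mu> - s \<le> card {v\<in>V. lev \<sigma> v = i} \<and> card {v\<in>V. lev \<sigma> v = i} \<le> \<mu> + s"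
  unfolding level_set[OF assms] using size K_pos by simp

lemma chain_size:
  assumes \<sigma>: "\<sigma> \<in> systems" and i: "2 \<le> i" "i < K - 1"
  shows "card {v\<in>V. lev \<sigma> v = i} - g \<le> card {e\<in>chain \<sigma>. lev \<sigma> (fst e) = i}"
proof -
  define c where "c = (fst \<sigma> * (snd \<sigma> + i)) mod K"
  define c' where "c' = (c + fst \<sigma>) mod K"
  have cK: "c < K" "c' < K" using K_pos by (auto simp: c_def c'_def)
  have "c \<noteq> c'"
  proof
    assume "c = c'"
    then have "(c + 0) mod K = (c + fst \<sigma>) mod K" using cK by (simp add: c'_def)
    then have "0 = fst \<sigma>" by (rule step_unique) (use system_bounds[OF \<sigma>] K_pos in auto)
    then show False using system_bounds[OF \<sigma>] by simp
  qed
  have "{e\<in>H. part (fst e) = c \<and> part (snd e) = c' \<and> mc e = snd \<sigma>} \<subseteq> {e\<in>chain \<sigma>. lev \<sigma> (fst e) = i}"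
  proof
    fix e assume e: "e \<in> {e\<in>H. part (fst e) = c \<and> part (snd e) = c' \<and> mc e = snd \<sigma>}"
    obtain u v where uv: "e = (u, v)" by (cases e)
    have "u \<in> V" using e uv HE EV by auto
    then have "lev \<sigma> u = i" using lev_eq_iff[OF \<sigma>, of u i] e uv i by (simp add: c_def)
    then show "e \<in> {e\<in>chain \<sigma>. lev \<sigma> (fst e) = i}" using e uv i by (simp add: chain_def c'_def)
  qed
  moreover have "{e\<in>chain \<sigma>. lev \<sigma> (fst e) = i} \<subseteq> E" using chain_H HE by blast
  then have "finite {e\<in>chain \<sigma>. lev \<sigma> (fst e) = i}" using fE finite_subset by blast
  ultimately have "card {e\<in>H. part (fst e) = c \<and> part (snd e) = c' \<and> mc e = snd \<sigma>} \<le> card {e\<in>chain \<sigma>. lev \<sigma> (fst e) = i}"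
    by (intro card_mono)
  moreover have "card {v\<in>V. part v = c} - g \<le> card {e\<in>H. part (fst e) = c \<and> part (snd e) = c' \<and> mc e = snd \<sigma>}"
    by (rule Hsize[OF cK \<open>c \<noteq> c'\<close>]) (use system_bounds[OF \<sigma>] in simp)
  moreover have "{v\<in>V. lev \<sigma> v = i} = {v\<in>V. part v = c}"
    unfolding c_def by (rule level_set[OF \<sigma>]) (use i in simp)
  ultimately show ?thesis by simp
qed

lemma card_systems_levels:
  assumes "a \<in> V" "c < K" "r < K" "r' < K" "r \<noteq> r'"
  shows "card {\<sigma>\<in>systems. lev \<sigma> a = r \<and> level K \<sigma> c = r'} \<le> \<Delta> div K + 1"
  unfolding systems_def lev_def
  by (rule card_systems_with_levels[OF K(1) assms(3,4,5) part[OF assms(1)] assms(2)])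

lemma card_systems_pairs:
  assumes a: "a \<in> V" and c: "c < K" and X: "finite X" "\<And>r r'. (r, r') \<in> X \<Longrightarrow> r < K \<and> r' < K \<and> r \<noteq> r'"
  shows "card {\<sigma>\<in>systems. (lev \<sigma> a, level K \<sigma> c) \<in> X} \<le> card X * (\<Delta> div K + 1)"
proof -
  have eq: "{\<sigma>\<in>systems. (lev \<sigma> a, level K \<sigma> c) \<in> X} =
      (\<Union>x\<in>X. {\<sigma>\<in>systems. lev \<sigma> a = fst x \<and> level K \<sigma> c = snd x})" by auto
  have "card {\<sigma>\<in>systems. (lev \<sigma> a, level K \<sigma> c) \<in> X}
      \<le> (\<Sum>x\<in>X. card {\<sigma>\<in>systems. lev \<sigma> a = fst x \<and> level K \<sigma> c = snd x})"
    unfolding eq by (rule card_UN_le[OF X(1)])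
  also have "\<dots> \<le> (\<Sum>x\<in>X. \<Delta> div K + 1)"
  proof (rule sum_mono)
    fix x assume "x \<in> X"
    then have "(fst x, snd x) \<in> X" by simp
    then show "card {\<sigma>\<in>systems. lev \<sigma> a = fst x \<and> level K \<sigma> c = snd x} \<le> \<Delta> div K + 1"
      using X(2)[of "fst x" "snd x"] by (intro card_systems_levels[OF a c]) auto
  qed
  finally show ?thesis by simp
qed

text \<open>For each step \<open>j\<close>, vertex \<open>a\<close> is missed by at most
  \<open>h\<close> of the matchings towards the part at distance \<open>j\<close>, and there are
  fewer than \<open>K\<close> steps.\<close>

lemma card_unmatched_out:
  assumes a: "a \<in> V"
  shows "card {\<sigma>\<in>systems. 2 \<le> lev \<sigma> a \<and> lev \<sigma> a < K - 1 \<and> a \<notin> fst ` chain \<sigma>} \<le> K * h"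
proof -
  let ?T = "\<lambda>j. {t. t < \<Delta> \<and> \<not> (\<exists>v. (a, v) \<in> H \<and> part v = (part a + j) mod K \<and> mc (a, v) = t)}"
  have "{\<sigma>\<in>systems. 2 \<le> lev \<sigma> a \<and> lev \<sigma> a < K - 1 \<and> a \<notin> fst ` chain \<sigma>} \<subseteq> Sigma {1..<K} ?T"
  proof
    fix \<sigma> assume s: "\<sigma> \<in> {\<sigma>\<in>systems. 2 \<le> lev \<sigma> a \<and> lev \<sigma> a < K - 1 \<and> a \<notin> fst ` chain \<sigma>}"
    have "\<not> (\<exists>v. (a, v) \<in> H \<and> part v = (part a + fst \<sigma>) mod K \<and> mc (a, v) = snd \<sigma>)"
    proof
      assume "\<exists>v. (a, v) \<in> H \<and> part v = (part a + fst \<sigma>) mod K \<and> mc (a, v) = snd \<sigma>"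
      then obtain v where "(a, v) \<in> chain \<sigma>" using s by (auto simp: chain_def)
      then show False using s by force
    qed
    then show "\<sigma> \<in> Sigma {1..<K} ?T" using s by (cases \<sigma>) (auto simp: systems_def)
  qed
  then have "card {\<sigma>\<in>systems. 2 \<le> lev \<sigma> a \<and> lev \<sigma> a < K - 1 \<and> a \<notin> fst ` chain \<sigma>} \<le> card (Sigma {1..<K} ?T)"
    by (intro card_mono) auto
  also have "\<dots> = (\<Sum>j\<in>{1..<K}. card (?T j))" by simp
  also have "\<dots> \<le> (\<Sum>j\<in>{1..<K}. h)"
  proof (rule sum_mono)
    fix j assume j: "j \<in> {1..<K}"
    have "(part a + j) mod K \<noteq> part a"
    proof
      assume "(part a + j) mod K = part a"
      then have "(part a + j) mod K = (part a + 0) mod K" using part[OF a] by simp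
      then have "j = 0" by (rule step_unique) (use j in auto)
      then show False using j by simp
    qed
    then show "card (?T j) \<le> h" using K_pos by (intro Hmiss_out[OF a]) auto
  qed
  also have "\<dots> \<le> K * h" by simp
  finally show ?thesis .
qed

lemma card_unmatched_in:
  assumes a: "a \<in> V"
  shows "card {\<sigma>\<in>systems. 3 \<le> lev \<sigma> a \<and> a \<notin> snd ` chain \<sigma>} \<le> K * h"
proof -
  \<comment> \<open>On natural numbers, adding \<open>K - j\<close> stands for subtracting
    \<open>j\<close> modulo \<open>K\<close>.\<close>
  let ?T = "\<lambda>j. {t. t < \<Delta> \<and> \<not> (\<exists>u. (u, a) \<in> H \<and> part u = (part a + (K - j)) mod K \<and> mc (u, a) = t)}"
  have "{\<sigma>\<in>systems. 3 \<le> lev \<sigma> a \<and> a \<notin> snd ` chain \<sigma>} \<subseteq> Sigma {1..<K} ?T"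
  proof
    fix \<sigma> assume s: "\<sigma> \<in> {\<sigma>\<in>systems. 3 \<le> lev \<sigma> a \<and> a \<notin> snd ` chain \<sigma>}"
    then have sS: "\<sigma> \<in> systems" by simp
    note sb = system_bounds[OF sS]
    have "\<not> (\<exists>u. (u, a) \<in> H \<and> part u = (part a + (K - fst \<sigma>)) mod K \<and> mc (u, a) = snd \<sigma>)"
    proof
      assume "\<exists>u. (u, a) \<in> H \<and> part u = (part a + (K - fst \<sigma>)) mod K \<and> mc (u, a) = snd \<sigma>"
      then obtain u where u: "(u, a) \<in> H" "part u = (part a + (K - fst \<sigma>)) mod K" "mc (u, a) = snd \<sigma>" by blast
      have uV: "u \<in> V" using u(1) HE EV by auto
      have pa: "(part u + fst \<sigma>) mod K = part a"
      proof -
        have "(part u + fst \<sigma>) mod K = (part a + (K - fst \<sigma>) + fst \<sigma>) mod K" unfolding u(2) by (rule mod_add_left_eq)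
        also have "part a + (K - fst \<sigma>) + fst \<sigma> = part a + K" using sb by simp
        finally show ?thesis using part[OF a] by simp
      qed
      define l where "l = lev \<sigma> a - 1"
      have l: "Suc l = lev \<sigma> a" "2 \<le> l" "l < K - 1" using s lev_less[OF sS a] by (auto simp: l_def)
      have "(fst \<sigma> * (snd \<sigma> + Suc l)) mod K = (part u + fst \<sigma>) mod K"
        using lev_eq_iff[OF sS a, of "Suc l"] l pa by simp
      then have "(fst \<sigma> + fst \<sigma> * (snd \<sigma> + l)) mod K = (fst \<sigma> + part u) mod K" by (simp add: algebra_simps)
      then have "[fst \<sigma> + fst \<sigma> * (snd \<sigma> + l) = fst \<sigma> + part u] (mod K)" by (simp add: cong_def)
      then have "[fst \<sigma> * (snd \<sigma> + l) = part u] (mod K)" by (simp only: cong_add_lcancel_nat)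
      then have "part u = (fst \<sigma> * (snd \<sigma> + l)) mod K" using part[OF uV] by (simp add: cong_def)
      then have "lev \<sigma> u = l" using lev_eq_iff[OF sS uV, of l] l by simp
      then have "(u, a) \<in> chain \<sigma>" using u l pa by (simp add: chain_def)
      then show False using s by force
    qed
    then show "\<sigma> \<in> Sigma {1..<K} ?T" using s by (cases \<sigma>) (auto simp: systems_def)
  qed
  then have "card {\<sigma>\<in>systems. 3 \<le> lev \<sigma> a \<and> a \<notin> snd ` chain \<sigma>} \<le> card (Sigma {1..<K} ?T)"
    by (intro card_mono) auto
  also have "\<dots> = (\<Sum>j\<in>{1..<K}. card (?T j))" by simp
  also have "\<dots> \<le> (\<Sum>j\<in>{1..<K}. h)"
  proof (rule sum_mono)
    fix j assume j: "j \<in> {1..<K}"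
    have "(part a + (K - j)) mod K \<noteq> part a"
    proof
      assume "(part a + (K - j)) mod K = part a"
      then have "(part a + (K - j)) mod K = (part a + 0) mod K" using part[OF a] by simp
      then have "K - j = 0" by (rule step_unique) (use j in auto)
      then show False using j by simp
    qed
    then show "card (?T j) \<le> h" using K_pos by (intro Hmiss_in[OF a]) auto
  qed
  also have "\<dots> \<le> K * h" by simp
  finally show ?thesis .
qed

end

section \<open>Reserved arcs consumed by earlier cycles\<close>

context packing_structure
begin

text \<open>A Hamilton cycle has only one arc out of \<open>a\<close>, so used arcs at
  \<open>a\<close> are counted by systems; \<open>T\<close> collects the systems whose cycle can use
  an arc with the property \<open>R\<close> there.\<close>

lemma used_bound:
  assumes fS: "finite S" and S: "S \<subseteq> systems" and cyc: "\<And>\<sigma>. \<sigma> \<in> S \<Longrightarrow> system_cycle \<sigma> (cyc \<sigma>)"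
    and T: "\<And>\<sigma> x. \<sigma> \<in> S \<Longrightarrow> (a, x) \<in> cyclic_arcs (cyc \<sigma>) \<Longrightarrow> R x \<Longrightarrow> \<sigma> \<in> T"
    and fT: "finite T" and cT: "card T \<le> b"
  shows "card {x. (a, x) \<in> (\<Union>\<sigma>\<in>S. cyclic_arcs (cyc \<sigma>)) \<and> R x} \<le> b"
proof -
  have "{x. (a, x) \<in> (\<Union>\<sigma>\<in>S. cyclic_arcs (cyc \<sigma>)) \<and> R x} \<subseteq> (\<Union>\<sigma>\<in>S \<inter> T. {x. (a, x) \<in> cyclic_arcs (cyc \<sigma>) \<and> R x})"
    using T by blast
  moreover have fin: "finite {x. (a, x) \<in> cyclic_arcs c \<and> R x}" for c
    by (rule finite_subset[of _ "snd ` cyclic_arcs c"]) (force, simp add: cyclic_arcs_def)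
  ultimately have "card {x. (a, x) \<in> (\<Union>\<sigma>\<in>S. cyclic_arcs (cyc \<sigma>)) \<and> R x}
      \<le> card (\<Union>\<sigma>\<in>S \<inter> T. {x. (a, x) \<in> cyclic_arcs (cyc \<sigma>) \<and> R x})"
    using fS by (intro card_mono) auto
  also have "\<dots> \<le> (\<Sum>\<sigma>\<in>S \<inter> T. card {x. (a, x) \<in> cyclic_arcs (cyc \<sigma>) \<and> R x})"
    by (rule card_UN_le) (use fS in auto)
  also have "\<dots> \<le> (\<Sum>\<sigma>\<in>S \<inter> T. 1)"
    using cyc by (intro sum_mono card_cyclic_arcs_out) (auto simp: system_cycle_def)
  also have "\<dots> = card (S \<inter> T)" by simp
  also have "\<dots> \<le> card T" using fT by (intro card_mono) auto
  finally show ?thesis using cT by linarith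
qed

lemma used_bound':
  assumes fS: "finite S" and S: "S \<subseteq> systems" and cyc: "\<And>\<sigma>. \<sigma> \<in> S \<Longrightarrow> system_cycle \<sigma> (cyc \<sigma>)"
    and T: "\<And>\<sigma> x. \<sigma> \<in> S \<Longrightarrow> (x, a) \<in> cyclic_arcs (cyc \<sigma>) \<Longrightarrow> R x \<Longrightarrow> \<sigma> \<in> T"
    and fT: "finite T" and cT: "card T \<le> b"
  shows "card {x. (x, a) \<in> (\<Union>\<sigma>\<in>S. cyclic_arcs (cyc \<sigma>)) \<and> R x} \<le> b"
proof -
  have "{x. (x, a) \<in> (\<Union>\<sigma>\<in>S. cyclic_arcs (cyc \<sigma>)) \<and> R x} \<subseteq> (\<Union>\<sigma>\<in>S \<inter> T. {x. (x, a) \<in> cyclic_arcs (cyc \<sigma>) \<and> R x})"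
    using T by blast
  moreover have fin: "finite {x. (x, a) \<in> cyclic_arcs c \<and> R x}" for c
    by (rule finite_subset[of _ "fst ` cyclic_arcs c"]) (force, simp add: cyclic_arcs_def)
  ultimately have "card {x. (x, a) \<in> (\<Union>\<sigma>\<in>S. cyclic_arcs (cyc \<sigma>)) \<and> R x}
      \<le> card (\<Union>\<sigma>\<in>S \<inter> T. {x. (x, a) \<in> cyclic_arcs (cyc \<sigma>) \<and> R x})"
    using fS by (intro card_mono) auto
  also have "\<dots> \<le> (\<Sum>\<sigma>\<in>S \<inter> T. card {x. (x, a) \<in> cyclic_arcs (cyc \<sigma>) \<and> R x})"
    by (rule card_UN_le) (use fS in auto)
  also have "\<dots> \<le> (\<Sum>\<sigma>\<in>S \<inter> T. 1)"
    using cyc by (intro sum_mono card_cyclic_arcs_out) (auto simp: system_cycle_def)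
  also have "\<dots> = card (S \<inter> T)" by simp
  also have "\<dots> \<le> card T" using fT by (intro card_mono) auto
  finally show ?thesis using cT by linarith
qed

lemma chain_col: "e \<in> chain \<sigma> \<Longrightarrow> 3 \<le> col e"
  using chain_H Hcol by blast

text \<open>Levels of tail and head of the arcs of colour 0 on a cycle: four pairs for entering the
  omitted parts and four for leaving them. This is the origin of the factor 8 in
  \<open>usage\<close>.\<close>

definition ctrl_levels :: "(nat \<times> nat) set" where
  "ctrl_levels = {2, K - 1} \<times> {0, 1} \<union> {0, 1} \<times> {2, 3}"

lemma ctrl_levels:
  "finite ctrl_levels" "card ctrl_levels \<le> 8" "\<And>r r'. (r, r') \<in> ctrl_levels \<Longrightarrow> r < K \<and> r' < K \<and> r \<noteq> r'"
proof -
  show "finite ctrl_levels" by (simp add: ctrl_levels_def)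
  have "card ctrl_levels \<le> card ({2, K - 1} \<times> {0, 1::nat}) + card ({0, 1::nat} \<times> {2, 3::nat})"
    unfolding ctrl_levels_def by (rule card_Un_le)
  also have "\<dots> \<le> 8" using K(2) by (simp add: card_cartesian_product card_insert_if)
  finally show "card ctrl_levels \<le> 8" .
  show "r < K \<and> r' < K \<and> r \<noteq> r'" if "(r, r') \<in> ctrl_levels" for r r'
    using that K(2) by (auto simp: ctrl_levels_def)
qed

lemma ctrl_arcs_levels:
  assumes "system_cycle \<sigma> c" "(a, x) \<in> cyclic_arcs c" "col (a, x) = 0"
  shows "(lev \<sigma> a, lev \<sigma> x) \<in> ctrl_levels"
proof -
  have "(a, x) \<notin> chain \<sigma>"
  proof
    assume "(a, x) \<in> chain \<sigma>"
    then have "3 \<le> col (a, x)" by (rule chain_col)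
    then show False using assms(3) by simp
  qed
  moreover have "(a, x) \<notin> in_arcs \<sigma>" "(a, x) \<notin> out_arcs' \<sigma>"
    using assms(3) by (simp_all add: in_arcs_def out_arcs'_def)
  moreover have "(a, x) \<in> chain \<sigma> \<union> ctrl_arcs \<sigma> \<union> in_arcs \<sigma> \<union> out_arcs' \<sigma>"
    using assms(1,2) unfolding system_cycle_def by blast
  ultimately have "(a, x) \<in> ctrl_arcs \<sigma>" by blast
  then have "lev \<sigma> x < 2 \<and> (lev \<sigma> a = 2 \<or> lev \<sigma> a = K - 1) \<or> lev \<sigma> a < 2 \<and> (lev \<sigma> x = 2 \<or> lev \<sigma> x = 3)"
    by (simp add: ctrl_arcs_def)
  moreover have "r \<in> {0, 1}" if "r < 2" for r :: nat using that by auto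
  ultimately show ?thesis unfolding ctrl_levels_def by blast
qed

lemma used_ctrl:
  assumes fS: "finite S" and S: "S \<subseteq> systems" and cyc: "\<And>\<sigma>. \<sigma> \<in> S \<Longrightarrow> system_cycle \<sigma> (cyc \<sigma>)"
    and a: "a \<in> V" and c: "c < K"
  shows "card {x. (a, x) \<in> (\<Union>\<sigma>\<in>S. cyclic_arcs (cyc \<sigma>)) \<and> part x = c \<and> col (a, x) = 0} \<le> 8 * (\<Delta> div K + 1) + K * h"
    and "card {x. (x, a) \<in> (\<Union>\<sigma>\<in>S. cyclic_arcs (cyc \<sigma>)) \<and> part x = c \<and> col (x, a) = 0} \<le> 8 * (\<Delta> div K + 1) + K * h"
proof -
  let ?T = "{\<sigma>\<in>systems. (lev \<sigma> a, level K \<sigma> c) \<in> ctrl_levels}"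
  have "card ?T \<le> card ctrl_levels * (\<Delta> div K + 1)"
    by (rule card_systems_pairs[OF a c ctrl_levels(1)]) (rule ctrl_levels(3))
  also have "\<dots> \<le> 8 * (\<Delta> div K + 1)" using ctrl_levels(2) by (intro mult_right_mono) auto
  finally have b: "card ?T \<le> 8 * (\<Delta> div K + 1) + K * h" by linarith
  show "card {x. (a, x) \<in> (\<Union>\<sigma>\<in>S. cyclic_arcs (cyc \<sigma>)) \<and> part x = c \<and> col (a, x) = 0} \<le> 8 * (\<Delta> div K + 1) + K * h"
  proof (rule used_bound[OF fS S cyc _ _ b])
    show "finite ?T" using finite_systems by simp
    show "\<sigma> \<in> ?T" if "\<sigma> \<in> S" "(a, x) \<in> cyclic_arcs (cyc \<sigma>)" "part x = c \<and> col (a, x) = 0" for \<sigma> x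
      using ctrl_arcs_levels[OF cyc[OF that(1)] that(2)] that S by (auto simp: lev_def)
  qed
  let ?X = "prod.swap ` ctrl_levels"
  let ?T' = "{\<sigma>\<in>systems. (lev \<sigma> a, level K \<sigma> c) \<in> ?X}"
  have "card ?T' \<le> card ?X * (\<Delta> div K + 1)"
    by (rule card_systems_pairs[OF a c]) (use ctrl_levels(1,3) in auto)
  also have "\<dots> \<le> 8 * (\<Delta> div K + 1)"
    using card_image_le[OF ctrl_levels(1), of prod.swap] ctrl_levels(2) by (intro mult_right_mono) auto
  finally have b': "card ?T' \<le> 8 * (\<Delta> div K + 1) + K * h" by linarith
  show "card {x. (x, a) \<in> (\<Union>\<sigma>\<in>S. cyclic_arcs (cyc \<sigma>)) \<and> part x = c \<and> col (x, a) = 0} \<le> 8 * (\<Delta> div K + 1) + K * h"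
  proof (rule used_bound'[OF fS S cyc _ _ b'])
    show "finite ?T'" using finite_systems by simp
    show "\<sigma> \<in> ?T'" if h: "\<sigma> \<in> S" "(x, a) \<in> cyclic_arcs (cyc \<sigma>)" "part x = c \<and> col (x, a) = 0" for \<sigma> x
    proof -
      have "(lev \<sigma> x, lev \<sigma> a) \<in> ctrl_levels" by (rule ctrl_arcs_levels[OF cyc[OF h(1)] h(2)]) (use h in simp)
      then have "(lev \<sigma> a, level K \<sigma> c) \<in> ?X"
        using h(3) by (intro image_eqI[of _ _ "(lev \<sigma> x, lev \<sigma> a)"]) (auto simp: lev_def)
      then show ?thesis using h(1) S by blast
    qed
  qed
qed

text \<open>Either \<open>a\<close> is on level 2, 3 or K - 1, which leaves six pairs of levels for
  \<open>a\<close> and the part \<open>c\<close>, or the chain of the system misses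
  \<open>a\<close>, which is counted by \<open>card_unmatched_out\<close>.\<close>

lemma used_in:
  assumes fS: "finite S" and S: "S \<subseteq> systems" and cyc: "\<And>\<sigma>. \<sigma> \<in> S \<Longrightarrow> system_cycle \<sigma> (cyc \<sigma>)"
    and a: "a \<in> V" and c: "c < K"
  shows "card {x. (a, x) \<in> (\<Union>\<sigma>\<in>S. cyclic_arcs (cyc \<sigma>)) \<and> part x = c \<and> col (a, x) = 1} \<le> 8 * (\<Delta> div K + 1) + K * h"
proof -
  let ?X = "{2, 3, K - 1} \<times> {0, 1::nat}"
  let ?T1 = "{\<sigma>\<in>systems. (lev \<sigma> a, level K \<sigma> c) \<in> ?X}"
  let ?T2 = "{\<sigma>\<in>systems. 2 \<le> lev \<sigma> a \<and> lev \<sigma> a < K - 1 \<and> a \<notin> fst ` chain \<sigma>}"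
  have "card ?T1 \<le> card ?X * (\<Delta> div K + 1)"
    by (rule card_systems_pairs[OF a c]) (use K(2) in auto)
  also have "\<dots> \<le> 8 * (\<Delta> div K + 1)"
    using K(2) by (intro mult_right_mono) (auto simp: card_cartesian_product card_insert_if)
  finally have cb: "card (?T1 \<union> ?T2) \<le> 8 * (\<Delta> div K + 1) + K * h"
    using card_Un_le[of ?T1 ?T2] card_unmatched_out[OF a] by linarith
  show ?thesis
  proof (rule used_bound[OF fS S cyc _ _ cb])
    show "finite (?T1 \<union> ?T2)" using finite_systems by simp
    show "\<sigma> \<in> ?T1 \<union> ?T2" if h: "\<sigma> \<in> S" "(a, x) \<in> cyclic_arcs (cyc \<sigma>)" "part x = c \<and> col (a, x) = 1" for \<sigma> x
    proof -
      have sS: "\<sigma> \<in> systems" using h(1) S by auto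
      have "(a, x) \<notin> chain \<sigma>" using chain_col[of "(a, x)" \<sigma>] h(3) by auto
      then have i: "(a, x) \<in> in_arcs \<sigma>"
        using cyc[OF h(1)] h(2,3) by (auto simp: system_cycle_def ctrl_arcs_def out_arcs'_def)
      then have lx: "level K \<sigma> c \<in> {0, 1}" using h(3) by (auto simp: in_arcs_def lev_def)
      have "lev \<sigma> a < K" by (rule lev_less[OF sS a])
      then have "lev \<sigma> a = K - 1 \<or> lev \<sigma> a < K - 1" by linarith
      then show ?thesis using i lx sS by (auto simp: in_arcs_def)
    qed
  qed
qed

lemma used_out:
  assumes fS: "finite S" and S: "S \<subseteq> systems" and cyc: "\<And>\<sigma>. \<sigma> \<in> S \<Longrightarrow> system_cycle \<sigma> (cyc \<sigma>)"
    and a: "a \<in> V" and c: "c < K"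
  shows "card {x. (x, a) \<in> (\<Union>\<sigma>\<in>S. cyclic_arcs (cyc \<sigma>)) \<and> part x = c \<and> col (x, a) = 2} \<le> 8 * (\<Delta> div K + 1) + K * h"
proof -
  let ?X = "{2, 3, 4::nat} \<times> {0, 1::nat}"
  let ?T1 = "{\<sigma>\<in>systems. (lev \<sigma> a, level K \<sigma> c) \<in> ?X}"
  let ?T2 = "{\<sigma>\<in>systems. 3 \<le> lev \<sigma> a \<and> a \<notin> snd ` chain \<sigma>}"
  have "card ?T1 \<le> card ?X * (\<Delta> div K + 1)"
    by (rule card_systems_pairs[OF a c]) (use K(2) in auto)
  also have "\<dots> \<le> 8 * (\<Delta> div K + 1)"
    using K(2) by (intro mult_right_mono) (auto simp: card_cartesian_product card_insert_if)
  finally have cb: "card (?T1 \<union> ?T2) \<le> 8 * (\<Delta> div K + 1) + K * h"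
    using card_Un_le[of ?T1 ?T2] card_unmatched_in[OF a] by linarith
  show ?thesis
  proof (rule used_bound'[OF fS S cyc _ _ cb])
    show "finite (?T1 \<union> ?T2)" using finite_systems by simp
    show "\<sigma> \<in> ?T1 \<union> ?T2" if h: "\<sigma> \<in> S" "(x, a) \<in> cyclic_arcs (cyc \<sigma>)" "part x = c \<and> col (x, a) = 2" for \<sigma> x
    proof -
      have sS: "\<sigma> \<in> systems" using h(1) S by auto
      have "(x, a) \<notin> chain \<sigma>" using chain_col[of "(x, a)" \<sigma>] h(3) by auto
      then have i: "(x, a) \<in> out_arcs' \<sigma>"
        using cyc[OF h(1)] h(2,3) by (auto simp: system_cycle_def ctrl_arcs_def in_arcs_def)
      then have lx: "level K \<sigma> c \<in> {0, 1}" using h(3) by (auto simp: out_arcs'_def lev_def)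
      have "lev \<sigma> a = 2 \<or> 3 \<le> lev \<sigma> a" using i by (auto simp: out_arcs'_def)
      then show ?thesis using i lx sS by (auto simp: out_arcs'_def)
    qed
  qed
qed

lemma two_levels:
  fixes lo :: real
  assumes \<sigma>: "\<sigma> \<in> systems"
    and lo: "\<And>c. c < K \<Longrightarrow> lo \<le> card {x\<in>V. part x = c \<and> R x}"
    and bad: "\<And>c. c < K \<Longrightarrow> card {x\<in>V. part x = c \<and> R x \<and> \<not> R' x} \<le> b"
  shows "2 * lo - 2 * real b \<le> card {x\<in>{v\<in>V. lev \<sigma> v < 2}. R' x}"
proof -
  define U where "U i = {x\<in>V. lev \<sigma> x = i \<and> R' x}" for i
  have fU: "finite (U i)" for i using fV by (simp add: U_def)
  have one: "lo - b \<le> card (U i)" if "i < 2" for i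
  proof -
    have iK: "i < K" using that K by simp
    define c where "c = (fst \<sigma> * (snd \<sigma> + i)) mod K"
    have c: "c < K" using K_pos by (simp add: c_def)
    have lc: "lev \<sigma> x = i \<longleftrightarrow> part x = c" if "x \<in> V" for x
      using lev_eq_iff[OF \<sigma> that iK] by (simp add: c_def)
    have "{x\<in>V. part x = c \<and> R x} \<subseteq> U i \<union> {x\<in>V. part x = c \<and> R x \<and> \<not> R' x}"
      using lc by (auto simp: U_def)
    then have "card {x\<in>V. part x = c \<and> R x} \<le> card (U i \<union> {x\<in>V. part x = c \<and> R x \<and> \<not> R' x})"
      using fU fV by (intro card_mono) auto
    also have "\<dots> \<le> card (U i) + card {x\<in>V. part x = c \<and> R x \<and> \<not> R' x}" by (rule card_Un_le)
    also have "\<dots> \<le> card (U i) + b" using bad[OF c] by simp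
    finally show ?thesis using lo[OF c] by linarith
  qed
  have "{x\<in>{v\<in>V. lev \<sigma> v < 2}. R' x} = U 0 \<union> U 1" by (auto simp: U_def)
  then have "card {x\<in>{v\<in>V. lev \<sigma> v < 2}. R' x} = card (U 0) + card (U 1)"
    using fU by (simp add: card_Un_disjoint U_def disjoint_iff)
  then show ?thesis using one[of 0] one[of 1] by simp
qed

lemma two_levels_upper:
  fixes hi :: real
  assumes \<sigma>: "\<sigma> \<in> systems"
    and hi: "\<And>c. c < K \<Longrightarrow> card {x\<in>V. part x = c \<and> R x} \<le> hi" and R': "\<And>x. R' x \<Longrightarrow> R x"
  shows "card {x\<in>{v\<in>V. lev \<sigma> v < 2}. R' x} \<le> 2 * hi"
proof -
  define U where "U i = {x\<in>V. lev \<sigma> x = i \<and> R' x}" for i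
  have fU: "finite (U i)" for i using fV by (simp add: U_def)
  have one: "card (U i) \<le> hi" if "i < 2" for i
  proof -
    have iK: "i < K" using that K by simp
    define c where "c = (fst \<sigma> * (snd \<sigma> + i)) mod K"
    have c: "c < K" using K_pos by (simp add: c_def)
    have lc: "lev \<sigma> x = i \<longleftrightarrow> part x = c" if "x \<in> V" for x
      using lev_eq_iff[OF \<sigma> that iK] by (simp add: c_def)
    have "U i \<subseteq> {x\<in>V. part x = c \<and> R x}" using lc R' by (auto simp: U_def)
    then have "card (U i) \<le> card {x\<in>V. part x = c \<and> R x}" using fV by (intro card_mono) auto
    then show ?thesis using hi[OF c] by linarith
  qed
  have "{x\<in>{v\<in>V. lev \<sigma> v < 2}. R' x} = U 0 \<union> U 1" by (auto simp: U_def)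
  then have "card {x\<in>{v\<in>V. lev \<sigma> v < 2}. R' x} = card (U 0) + card (U 1)"
    using fU by (simp add: card_Un_disjoint U_def disjoint_iff)
  then show ?thesis using one[of 0] one[of 1] by simp
qed

end

section \<open>Closing the systems one after another\<close>

context packing_structure
begin

text \<open>The earlier cycles have used at most b \<le> d/1000 arcs of the relevant colour and
  direction between a vertex and a part, so all degree conditions for linking survive with slightly
  weaker constants, whatever those cycles are. Upper bounds survive trivially.\<close>

lemma next_cycle:
  assumes fS: "finite S" and S: "S \<subseteq> systems" and cyc: "\<And>\<sigma>. \<sigma> \<in> S \<Longrightarrow> system_cycle \<sigma> (cyc \<sigma>)"
    and \<sigma>: "\<sigma> \<in> systems" "\<sigma> \<notin> S"
  shows "\<exists>c. system_cycle \<sigma> c \<and> cyclic_arcs c \<inter> (\<Union>\<tau>\<in>S. cyclic_arcs (cyc \<tau>)) = {}"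
proof -
  define U where "U = (\<Union>\<tau>\<in>S. cyclic_arcs (cyc \<tau>))"
  define A where "A i = {e\<in>E. col e = i \<and> e \<notin> U}" for i :: nat
  define b where "b = 8 * (\<Delta> div K + 1) + K * h"
  have b: "1000 * real b \<le> d" using usage by (simp add: b_def)
  have lessb: "card Y \<le> b" if "Y \<subseteq> X" "finite X" "card X \<le> b" for X Y :: "'a set"
    using card_mono[OF that(2,1)] that(3) by linarith
  have finU: "finite U"
    using fS unfolding U_def cyclic_arcs_def by simp
  have finx: "finite {x. (a, x) \<in> U \<and> R x}" "finite {x. (x, a) \<in> U \<and> R x}" for a R
    by (rule finite_subset[of _ "snd ` U"], force, simp add: finU)
      (rule finite_subset[of _ "fst ` U"], force, simp add: finU)
  have u0: "card {x. (a, x) \<in> U \<and> part x = c \<and> col (a, x) = 0} \<le> b"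
    and u0': "card {x. (x, a) \<in> U \<and> part x = c \<and> col (x, a) = 0} \<le> b"
    and u1: "card {x. (a, x) \<in> U \<and> part x = c \<and> col (a, x) = 1} \<le> b"
    and u2: "card {x. (x, a) \<in> U \<and> part x = c \<and> col (x, a) = 2} \<le> b" if "a \<in> V" "c < K" for a c
    unfolding U_def b_def
    by (rule used_ctrl[OF fS S cyc that] used_in[OF fS S cyc that] used_out[OF fS S cyc that]; assumption)+
  have mr: "d \<le> \<mu> * \<rho>"
  proof -
    have "\<rho>\<^sup>2 \<le> \<rho>" unfolding power2_eq_square using rho by (intro mult_left_le) auto
    then show ?thesis unfolding d using mu by (intro mult_left_mono) auto
  qed
  define W where "W = {v\<in>V. lev \<sigma> v < 2}"
  have "\<exists>c. distinct c \<and> set c = V \<and> cyclic_arcs c \<subseteq> chain \<sigma>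
    \<union> {(a, x). (a, x) \<in> A 0 \<and> lev \<sigma> x < 2 \<and> (lev \<sigma> a = 2 \<or> lev \<sigma> a = K - 1)}
    \<union> {(x, b). (x, b) \<in> A 0 \<and> lev \<sigma> x < 2 \<and> (lev \<sigma> b = 2 \<or> lev \<sigma> b = 3)}
    \<union> {(a, x). (a, x) \<in> A 1 \<and> lev \<sigma> x < 2 \<and> 2 \<le> lev \<sigma> a \<and> (lev \<sigma> a = 2 \<or> lev \<sigma> a = 3 \<or> lev \<sigma> a = K - 1 \<or> a \<notin> fst ` chain \<sigma>)}
    \<union> {(x, b). (x, b) \<in> A 2 \<and> lev \<sigma> x < 2 \<and> 2 \<le> lev \<sigma> b \<and> (lev \<sigma> b = 2 \<or> lev \<sigma> b = 3 \<or> lev \<sigma> b = 4 \<or> b \<notin> snd ` chain \<sigma>)}"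
  proof (rule level_system_cycle[OF fV K(2) _ _ chain_inj[OF \<sigma>(1)] _ _ _ rho d s g _ _ _ _ _ few])
    show "lev \<sigma> v < K" if "v \<in> V" for v by (rule lev_less[OF \<sigma>(1) that])
    show "chain \<sigma> \<subseteq> V \<times> V" using chain_H HE EV by blast
    show "2 \<le> lev \<sigma> u \<and> lev \<sigma> v = Suc (lev \<sigma> u)" if "(u, v) \<in> chain \<sigma>" for u v
      by (rule chain_lev[OF \<sigma>(1) that])
    show "\<mu> - s \<le> card {v\<in>V. lev \<sigma> v = i} \<and> card {v\<in>V. lev \<sigma> v = i} \<le> \<mu> + s" if "i < K" for i
      by (rule level_size[OF \<sigma>(1) that])
    show "card {v\<in>V. lev \<sigma> v = i} - g \<le> card {e\<in>chain \<sigma>. lev \<sigma> (fst e) = i}" if "2 \<le> i" "i < K - 1" for i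
      by (rule chain_size[OF \<sigma>(1) that])
  next
    fix a b' assume "a \<in> V - {v\<in>V. lev \<sigma> v < 2}" "b' \<in> V - {v\<in>V. lev \<sigma> v < 2}" and ab: "a \<noteq> b'"
    then have a: "a \<in> V" and b': "b' \<in> V" by auto
    let ?R = "\<lambda>x. (a, x) \<in> E \<and> col (a, x) = 0 \<and> (x, b') \<in> E \<and> col (x, b') = 0"
    let ?R' = "\<lambda>x. (a, x) \<in> A 0 \<and> (x, b') \<in> A 0"
    \<comment> \<open>Two parts contribute, and each loses at most \<open>2 * b\<close> candidates,
      \<open>b\<close> for either end of the link: 1.76 d - 4 b is at least 7/4 d.\<close>
    have "2 * (88/100 * d) - 2 * real (2 * b) \<le> card {x\<in>{v\<in>V. lev \<sigma> v < 2}. ?R' x}"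
    proof (rule two_levels[OF \<sigma>(1), where R = ?R])
      fix c assume c: "c < K"
      show "88/100 * d \<le> card {x\<in>V. part x = c \<and> ?R x}" using links[OF a b' ab c] by simp
      have "{x\<in>V. part x = c \<and> ?R x \<and> \<not> ?R' x} \<subseteq>
          {x. (a, x) \<in> U \<and> part x = c \<and> col (a, x) = 0} \<union> {x. (x, b') \<in> U \<and> part x = c \<and> col (x, b') = 0}"
        by (auto simp: A_def)
      then have "card {x\<in>V. part x = c \<and> ?R x \<and> \<not> ?R' x} \<le>
          card ({x. (a, x) \<in> U \<and> part x = c \<and> col (a, x) = 0} \<union> {x. (x, b') \<in> U \<and> part x = c \<and> col (x, b') = 0})"
        using finx by (intro card_mono) auto
      also have "\<dots> \<le> b + b" using card_Un_le add_mono[OF u0[OF a c] u0'[OF b' c]] by (rule order_trans)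
      finally show "card {x\<in>V. part x = c \<and> ?R x \<and> \<not> ?R' x} \<le> 2 * b" by simp
    qed
    then have 1: "7/4 * d \<le> card {x\<in>{v\<in>V. lev \<sigma> v < 2}. ?R' x}" using b by simp
    have "card {x\<in>{v\<in>V. lev \<sigma> v < 2}. ?R' x} \<le> 2 * (9/8 * d)"
    proof (rule two_levels_upper[OF \<sigma>(1), where R = ?R])
      show "card {x\<in>V. part x = c \<and> ?R x} \<le> 9/8 * d" if "c < K" for c using links[OF a b' ab that] by simp
    qed (auto simp: A_def)
    then show "7/4 * d \<le> card {x\<in>{v\<in>V. lev \<sigma> v < 2}. ?R' x} \<and> card {x\<in>{v\<in>V. lev \<sigma> v < 2}. ?R' x} \<le> 9/4 * d"
      using 1 by simp
    let ?S = "\<lambda>x. (a, x) \<in> E \<and> col (a, x) = 1 \<and> (x, b') \<in> E \<and> col (x, b') = 2"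
    let ?S' = "\<lambda>x. (a, x) \<in> A 1 \<and> (x, b') \<in> A 2"
    have "2 * (88/100 * d) - 2 * real (2 * b) \<le> card {x\<in>{v\<in>V. lev \<sigma> v < 2}. ?S' x}"
    proof (rule two_levels[OF \<sigma>(1), where R = ?S])
      fix c assume c: "c < K"
      show "88/100 * d \<le> card {x\<in>V. part x = c \<and> ?S x}" using links'[OF a b' ab c] by simp
      have "{x\<in>V. part x = c \<and> ?S x \<and> \<not> ?S' x} \<subseteq>
          {x. (a, x) \<in> U \<and> part x = c \<and> col (a, x) = 1} \<union> {x. (x, b') \<in> U \<and> part x = c \<and> col (x, b') = 2}"
        by (auto simp: A_def)
      then have "card {x\<in>V. part x = c \<and> ?S x \<and> \<not> ?S' x} \<le>
          card ({x. (a, x) \<in> U \<and> part x = c \<and> col (a, x) = 1} \<union> {x. (x, b') \<in> U \<and> part x = c \<and> col (x, b') = 2})"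
        using finx by (intro card_mono) auto
      also have "\<dots> \<le> b + b" using card_Un_le add_mono[OF u1[OF a c] u2[OF b' c]] by (rule order_trans)
      finally show "card {x\<in>V. part x = c \<and> ?S x \<and> \<not> ?S' x} \<le> 2 * b" by simp
    qed
    then show "d \<le> card {x\<in>{v\<in>V. lev \<sigma> v < 2}. ?S' x}" using b d by simp
  next
    fix a b' a' b'' assume "a \<in> V - {v\<in>V. lev \<sigma> v < 2}" "b' \<in> V - {v\<in>V. lev \<sigma> v < 2}"
      "a' \<in> V - {v\<in>V. lev \<sigma> v < 2}" "b'' \<in> V - {v\<in>V. lev \<sigma> v < 2}"
      and ne: "a \<noteq> b'" "a' \<noteq> b''" "a \<noteq> a'" "b' \<noteq> b''" "a \<noteq> b'' \<or> b' \<noteq> a'"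
    then have v: "a \<in> V" "b' \<in> V" "a' \<in> V" "b'' \<in> V" by auto
    have "card {x\<in>{v\<in>V. lev \<sigma> v < 2}. (a, x) \<in> A 0 \<and> (x, b') \<in> A 0 \<and> (a', x) \<in> A 0 \<and> (x, b'') \<in> A 0} \<le> 2 * (9/8 * d * \<rho>\<^sup>2)"
    proof (rule two_levels_upper[OF \<sigma>(1), where R = "\<lambda>x. (a, x) \<in> E \<and> col (a, x) = 0 \<and> (x, b') \<in> E \<and> col (x, b') = 0 \<and>
          (a', x) \<in> E \<and> col (a', x) = 0 \<and> (x, b'') \<in> E \<and> col (x, b'') = 0"])
      show "card {x\<in>V. part x = c \<and> (a, x) \<in> E \<and> col (a, x) = 0 \<and> (x, b') \<in> E \<and> col (x, b') = 0 \<and>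
          (a', x) \<in> E \<and> col (a', x) = 0 \<and> (x, b'') \<in> E \<and> col (x, b'') = 0} \<le> 9/8 * d * \<rho>\<^sup>2" if "c < K" for c
        by (rule links2[OF v ne that])
    qed (auto simp: A_def)
    then show "card {x\<in>{v\<in>V. lev \<sigma> v < 2}. (a, x) \<in> A 0 \<and> (x, b') \<in> A 0 \<and> (a', x) \<in> A 0 \<and> (x, b'') \<in> A 0} \<le> 9/4 * d * \<rho>\<^sup>2"
      by simp
  next
    fix x i assume "x \<in> {v\<in>V. lev \<sigma> v < 2}" and i: "i = 2 \<or> i = K - 1"
    then have x: "x \<in> V" by simp
    have iK: "i < K" using i K(2) by auto
    define c where "c = (fst \<sigma> * (snd \<sigma> + i)) mod K"
    have c: "c < K" using K_pos by (simp add: c_def)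
    have lc: "lev \<sigma> a = i \<longleftrightarrow> part a = c" if "a \<in> V" for a
      using lev_eq_iff[OF \<sigma>(1) that iK] by (simp add: c_def)
    have "{a\<in>V. part a = c \<and> (a, x) \<in> E \<and> col (a, x) = 0} \<subseteq>
      {a\<in>{v\<in>V. lev \<sigma> v = i}. (a, x) \<in> A 0} \<union> {a. (a, x) \<in> U \<and> part a = c \<and> col (a, x) = 0}"
      using lc by (auto simp: A_def)
    then have "card {a\<in>V. part a = c \<and> (a, x) \<in> E \<and> col (a, x) = 0} \<le>
      card ({a\<in>{v\<in>V. lev \<sigma> v = i}. (a, x) \<in> A 0} \<union> {a. (a, x) \<in> U \<and> part a = c \<and> col (a, x) = 0})"
      using finx fV by (intro card_mono) auto
    also have "\<dots> \<le> card {a\<in>{v\<in>V. lev \<sigma> v = i}. (a, x) \<in> A 0} + b"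
      using card_Un_le add_left_mono[OF u0'[OF x c]] by (rule order_trans)
    finally show "88/100 * (\<mu> * \<rho>) \<le> card {a\<in>{v\<in>V. lev \<sigma> v = i}. (a, x) \<in> A 0}"
      using deg_in[OF x c] b mr by linarith
  next
    fix x i assume "x \<in> {v\<in>V. lev \<sigma> v < 2}" and i: "i = 2 \<or> i = (3::nat)"
    then have x: "x \<in> V" by simp
    have iK: "i < K" using i K(2) by auto
    define c where "c = (fst \<sigma> * (snd \<sigma> + i)) mod K"
    have c: "c < K" using K_pos by (simp add: c_def)
    have lc: "lev \<sigma> a = i \<longleftrightarrow> part a = c" if "a \<in> V" for a
      using lev_eq_iff[OF \<sigma>(1) that iK] by (simp add: c_def)
    have "{a\<in>V. part a = c \<and> (x, a) \<in> E \<and> col (x, a) = 0} \<subseteq>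
      {a\<in>{v\<in>V. lev \<sigma> v = i}. (x, a) \<in> A 0} \<union> {a. (x, a) \<in> U \<and> part a = c \<and> col (x, a) = 0}"
      using lc by (auto simp: A_def)
    then have "card {a\<in>V. part a = c \<and> (x, a) \<in> E \<and> col (x, a) = 0} \<le>
      card ({a\<in>{v\<in>V. lev \<sigma> v = i}. (x, a) \<in> A 0} \<union> {a. (x, a) \<in> U \<and> part a = c \<and> col (x, a) = 0})"
      using finx fV by (intro card_mono) auto
    also have "\<dots> \<le> card {a\<in>{v\<in>V. lev \<sigma> v = i}. (x, a) \<in> A 0} + b"
      using card_Un_le add_left_mono[OF u0[OF x c]] by (rule order_trans)
    finally show "88/100 * (\<mu> * \<rho>) \<le> card {b\<in>{v\<in>V. lev \<sigma> v = i}. (x, b) \<in> A 0}"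
      using deg_out[OF x c] b mr by linarith
  qed
  then obtain c where c: "distinct c" "set c = V" and cA: "cyclic_arcs c \<subseteq> chain \<sigma>
    \<union> {(a, x). (a, x) \<in> A 0 \<and> lev \<sigma> x < 2 \<and> (lev \<sigma> a = 2 \<or> lev \<sigma> a = K - 1)}
    \<union> {(x, b). (x, b) \<in> A 0 \<and> lev \<sigma> x < 2 \<and> (lev \<sigma> b = 2 \<or> lev \<sigma> b = 3)}
    \<union> {(a, x). (a, x) \<in> A 1 \<and> lev \<sigma> x < 2 \<and> 2 \<le> lev \<sigma> a \<and> (lev \<sigma> a = 2 \<or> lev \<sigma> a = 3 \<or> lev \<sigma> a = K - 1 \<or> a \<notin> fst ` chain \<sigma>)}
    \<union> {(x, b). (x, b) \<in> A 2 \<and> lev \<sigma> x < 2 \<and> 2 \<le> lev \<sigma> b \<and> (lev \<sigma> b = 2 \<or> lev \<sigma> b = 3 \<or> lev \<sigma> b = 4 \<or> b \<notin> snd ` chain \<sigma>)}"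
    (is "_ \<subseteq> _ \<union> ?B1 \<union> ?B2 \<union> ?B3 \<union> ?B4")
    by (elim exE conjE)
  have B: "?B1 \<subseteq> ctrl_arcs \<sigma> - U" "?B2 \<subseteq> ctrl_arcs \<sigma> - U" "?B3 \<subseteq> in_arcs \<sigma> - U" "?B4 \<subseteq> out_arcs' \<sigma> - U"
    by (auto simp: A_def ctrl_arcs_def in_arcs_def out_arcs'_def)
  \<comment> \<open>Earlier cycles cannot touch this chain: its colours are not reserved, and an arc
    lying in two chains would have the same step and the same matching number in both.\<close>
  have cU: "chain \<sigma> \<inter> U = {}"
  proof (rule ccontr)
    assume "chain \<sigma> \<inter> U \<noteq> {}"
    then obtain e \<tau> where e: "e \<in> chain \<sigma>" "\<tau> \<in> S" "e \<in> cyclic_arcs (cyc \<tau>)" by (auto simp: U_def)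
    have "3 \<le> col e" using chain_col[OF e(1)] .
    then have "e \<notin> ctrl_arcs \<tau>" "e \<notin> in_arcs \<tau>" "e \<notin> out_arcs' \<tau>"
      by (auto simp: ctrl_arcs_def in_arcs_def out_arcs'_def)
    then have "e \<in> chain \<tau>" using cyc[OF e(2)] e(3) unfolding system_cycle_def by blast
    then have "\<sigma> = \<tau>" using chain_disjoint[OF \<sigma>(1) _ e(1)] e(2) S by blast
    then show False using \<sigma>(2) e(2) by simp
  qed
  have "system_cycle \<sigma> c" unfolding system_cycle_def using c cA B by blast
  moreover have "cyclic_arcs c \<inter> U = {}" using cA B cU by blast
  ultimately show ?thesis unfolding U_def by blast
qed

lemma packing:
  "\<exists>cyc. (\<forall>\<sigma>\<in>systems. distinct (cyc \<sigma>) \<and> set (cyc \<sigma>) = V \<and> cyclic_arcs (cyc \<sigma>) \<subseteq> E) \<and>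
    (\<forall>\<sigma>\<in>systems. \<forall>\<tau>\<in>systems. \<sigma> \<noteq> \<tau> \<longrightarrow> cyclic_arcs (cyc \<sigma>) \<inter> cyclic_arcs (cyc \<tau>) = {})"
proof -
  have "\<exists>cyc. (\<forall>\<sigma>\<in>S. system_cycle \<sigma> (cyc \<sigma>)) \<and>
    (\<forall>\<sigma>\<in>S. \<forall>\<tau>\<in>S. \<sigma> \<noteq> \<tau> \<longrightarrow> cyclic_arcs (cyc \<sigma>) \<inter> cyclic_arcs (cyc \<tau>) = {})" if "S \<subseteq> systems" for S
  proof -
    have "finite S" using that finite_systems finite_subset by blast
    then show ?thesis using that
    proof (induction S rule: finite_induct)
      case (insert \<sigma> S)
      then obtain cyc where cyc: "\<forall>\<sigma>\<in>S. system_cycle \<sigma> (cyc \<sigma>)"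
        "\<forall>\<sigma>\<in>S. \<forall>\<tau>\<in>S. \<sigma> \<noteq> \<tau> \<longrightarrow> cyclic_arcs (cyc \<sigma>) \<inter> cyclic_arcs (cyc \<tau>) = {}" by auto
      have "\<exists>c. system_cycle \<sigma> c \<and> cyclic_arcs c \<inter> (\<Union>\<tau>\<in>S. cyclic_arcs (cyc \<tau>)) = {}"
        by (rule next_cycle[OF insert.hyps(1)]) (use insert cyc(1) in auto)
      then obtain c where c: "system_cycle \<sigma> c" "cyclic_arcs c \<inter> (\<Union>\<tau>\<in>S. cyclic_arcs (cyc \<tau>)) = {}"
        by (elim exE conjE)
      let ?c = "cyc(\<sigma> := c)"
      have "system_cycle \<tau> (?c \<tau>)" if "\<tau> \<in> insert \<sigma> S" for \<tau>
        using that c(1) cyc(1) by (cases "\<tau> = \<sigma>") auto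
      moreover have "cyclic_arcs (?c \<tau>) \<inter> cyclic_arcs (?c \<tau>') = {}"
        if "\<tau> \<in> insert \<sigma> S" "\<tau>' \<in> insert \<sigma> S" "\<tau> \<noteq> \<tau>'" for \<tau> \<tau>'
      proof (cases "\<tau> = \<sigma>")
        case True
        then show ?thesis using that c(2) by auto
      next
        case False
        then show ?thesis using that c(2) cyc(2) by (cases "\<tau>' = \<sigma>") auto
      qed
      ultimately show ?case by (intro exI[of _ ?c] conjI ballI impI)
    qed simp
  qed
  from this[OF order_refl] obtain cyc where cyc: "\<forall>\<sigma>\<in>systems. system_cycle \<sigma> (cyc \<sigma>)"
    "\<forall>\<sigma>\<in>systems. \<forall>\<tau>\<in>systems. \<sigma> \<noteq> \<tau> \<longrightarrow> cyclic_arcs (cyc \<sigma>) \<inter> cyclic_arcs (cyc \<tau>) = {}"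
    by (elim exE conjE)
  have "distinct (cyc \<sigma>) \<and> set (cyc \<sigma>) = V \<and> cyclic_arcs (cyc \<sigma>) \<subseteq> E" if "\<sigma> \<in> systems" for \<sigma>
    using cyc(1) that system_cycle_arcs[of \<sigma> "cyc \<sigma>"] by (simp add: system_cycle_def)
  then have "\<forall>\<sigma>\<in>systems. distinct (cyc \<sigma>) \<and> set (cyc \<sigma>) = V \<and> cyclic_arcs (cyc \<sigma>) \<subseteq> E" by (rule ballI)
  then show ?thesis using cyc(2) by (intro exI[of _ cyc] conjI)
qed

end

section \<open>Random partitions and colourings\<close>

lemma random_partition:
  fixes \<T> :: "('a set \<times> real) set" and K :: nat and L :: real
  assumes fV: "finite V" and K: "0 < K" and fT: "finite \<T>"
    and S: "\<And>S t. (S, t) \<in> \<T> \<Longrightarrow> S \<subseteq> V \<and> 0 \<le> t \<and> t \<le> 1 \<and> L \<le> t\<^sup>2 * (card S / K) / 4"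
    and few: "2 * (real (card \<T>) * real K) * exp (- L) < 1"
  shows "\<exists>f. (\<forall>v\<in>V. f v < K) \<and> (\<forall>(S, t)\<in>\<T>. \<forall>c<K.
    (1 - t) * (card S / K) \<le> card {x\<in>S. f x = c} \<and> card {x\<in>S. f x = c} \<le> (1 + t) * (card S / K))"
proof -
  have "\<exists>f\<in>V \<rightarrow>\<^sub>E {..<K}. \<forall>q\<in>\<T> \<times> {..<K}.
      \<bar>hits (\<lambda>x. {x}) (\<lambda>_. {snd q}) (fst (fst q)) f - card (fst (fst q)) * (1 / K)\<bar>
        \<le> snd (fst q) * (card (fst (fst q)) * (1 / K))"
  proof (rule simultaneous_concentration[OF fV K, where L = L])
    show "finite (\<T> \<times> {..<K})" using fT by simp
    have "real (card (\<T> \<times> {..<K})) = card \<T> * K" by (simp add: card_cartesian_product)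
    then show "real (2 * card (\<T> \<times> {..<K})) * exp (- L) < 1" using few by simp
  next
    fix q assume "q \<in> \<T> \<times> {..<K}"
    then obtain A t c where q: "q = ((A, t), c)" "(A, t) \<in> \<T>" "c < K"
      by (metis SigmaE lessThan_iff prod.collapse)
    note ST = S[OF q(2)]
    show "finite (fst (fst q))" using ST fV finite_subset q by auto
    show "{x} \<subseteq> V" if "x \<in> fst (fst q)" for x using that ST q by auto
    show "{x} \<inter> {y} = {}" if "x \<noteq> y" for x y :: 'a using that by simp
    show "{snd q} \<subseteq> {..<K}" using q by simp
    show "(\<Prod>i\<in>{x}. real (card {snd q}) / real K) = 1 / real K" for x :: 'a by simp
    show "0 \<le> snd (fst q) \<and> snd (fst q) \<le> 1" using ST q by simp
    show "0 \<le> 1 / real K \<and> 1 / real K \<le> 1" using K by simp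
    show "L \<le> (snd (fst q))\<^sup>2 * (real (card (fst (fst q))) * (1 / real K)) / 4" using ST q by simp
  qed
  then obtain f where f: "f \<in> V \<rightarrow>\<^sub>E {..<K}" and h: "\<And>q. q \<in> \<T> \<times> {..<K} \<Longrightarrow>
      \<bar>hits (\<lambda>x. {x}) (\<lambda>_. {snd q}) (fst (fst q)) f - card (fst (fst q)) * (1 / K)\<bar>
        \<le> snd (fst q) * (card (fst (fst q)) * (1 / K))" by blast
  have "(1 - t) * (card A / K) \<le> card {x\<in>A. f x = c} \<and> card {x\<in>A. f x = c} \<le> (1 + t) * (card A / K)"
    if "(A, t) \<in> \<T>" "c < K" for A t c
  proof -
    have "\<bar>real (card {x\<in>A. f x = c}) - card A / K\<bar> \<le> t * (card A / K)"
      using h[of "((A, t), c)"] that by (simp add: hits_def)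
    then show ?thesis by (simp add: abs_le_iff add_divide_distrib diff_divide_distrib algebra_simps)
  qed
  moreover have "f v < K" if "v \<in> V" for v using f that by (auto simp: PiE_iff)
  ultimately show ?thesis by (intro exI[of _ f]) auto
qed

text \<open>A test consists of the index set of a family of disjoint sets of arcs, the family itself, the admissible
  colours, the probability that a member has admissible colours only, and a relative tolerance.\<close>

type_synonym 'a test = "'a set \<times> ('a \<Rightarrow> ('a \<times> 'a) set) \<times> ('a \<times> 'a \<Rightarrow> nat set) \<times> real \<times> real"

fun test_ok :: "('a \<times> 'a) set \<Rightarrow> nat \<Rightarrow> real \<Rightarrow> 'a test \<Rightarrow> bool" where
  "test_ok E B L (S, b, C, \<pi>, t) \<longleftrightarrow> finite S \<and> (\<forall>x\<in>S. b x \<subseteq> E) \<and> (\<forall>x\<in>S. \<forall>y\<in>S. x \<noteq> y \<longrightarrow> b x \<inter> b y = {}) \<and>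
     (\<forall>x\<in>S. \<forall>i\<in>b x. C i \<subseteq> {..<B}) \<and> (\<forall>x\<in>S. (\<Prod>i\<in>b x. real (card (C i)) / real B) = \<pi>) \<and>
     0 \<le> t \<and> t \<le> 1 \<and> 0 \<le> \<pi> \<and> \<pi> \<le> 1 \<and> L \<le> t\<^sup>2 * (real (card S) * \<pi>) / 4"

fun test_passed :: "('a \<times> 'a \<Rightarrow> nat) \<Rightarrow> 'a test \<Rightarrow> bool" where
  "test_passed col (S, b, C, \<pi>, t) \<longleftrightarrow>
     (1 - t) * (real (card S) * \<pi>) \<le> real (card {x\<in>S. \<forall>i\<in>b x. col i \<in> C i}) \<and>
     real (card {x\<in>S. \<forall>i\<in>b x. col i \<in> C i}) \<le> (1 + t) * (real (card S) * \<pi>)"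

lemma random_colouring:
  fixes E :: "('a \<times> 'a) set" and Q :: "'a test set" and B :: nat and L :: real
  assumes fE: "finite E" and B: "0 < B" and fQ: "finite Q" and Q: "\<And>q. q \<in> Q \<Longrightarrow> test_ok E B L q"
    and few: "2 * real (card Q) * exp (- L) < 1"
  shows "\<exists>col. (\<forall>e\<in>E. col e < B) \<and> (\<forall>q\<in>Q. test_passed col q)"
proof -
  define S b C p t where "S = (\<lambda>q :: 'a test. fst q)" and "b = (\<lambda>q :: 'a test. fst (snd q))"
    and "C = (\<lambda>q :: 'a test. fst (snd (snd q)))" and "p = (\<lambda>q :: 'a test. fst (snd (snd (snd q))))"
    and "t = (\<lambda>q :: 'a test. snd (snd (snd (snd q))))"
  note defs = S_def b_def C_def p_def t_def
  have ok: "finite (S q) \<and> (\<forall>x\<in>S q. b q x \<subseteq> E) \<and> (\<forall>x\<in>S q. \<forall>y\<in>S q. x \<noteq> y \<longrightarrow> b q x \<inter> b q y = {}) \<and>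
     (\<forall>x\<in>S q. \<forall>i\<in>b q x. C q i \<subseteq> {..<B}) \<and> (\<forall>x\<in>S q. (\<Prod>i\<in>b q x. real (card (C q i)) / real B) = p q) \<and>
     0 \<le> t q \<and> t q \<le> 1 \<and> 0 \<le> p q \<and> p q \<le> 1 \<and> L \<le> (t q)\<^sup>2 * (card (S q) * p q) / 4" if "q \<in> Q" for q
    using Q[OF that] by (cases q) (simp add: defs)
  have "\<exists>col\<in>E \<rightarrow>\<^sub>E {..<B}. \<forall>q\<in>Q. \<bar>real (hits (b q) (C q) (S q) col) - real (card (S q)) * p q\<bar> \<le> t q * (real (card (S q)) * p q)"
    by (rule simultaneous_concentration[OF fE B fQ, where L = L]) (use ok few in \<open>(blast | simp)+\<close>)
  then obtain col where col: "col \<in> E \<rightarrow>\<^sub>E {..<B}"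
    and h: "\<And>q. q \<in> Q \<Longrightarrow> \<bar>real (hits (b q) (C q) (S q) col) - real (card (S q)) * p q\<bar> \<le> t q * (real (card (S q)) * p q)"
    by blast
  have "test_passed col q" if "q \<in> Q" for q
    using h[OF that] by (cases q) (simp add: defs hits_def abs_le_iff algebra_simps)
  moreover have "col e < B" if "e \<in> E" for e using col that by (auto simp: PiE_iff)
  ultimately show ?thesis by (intro exI[of _ col]) auto
qed

section \<open>Uniform digraphs as relations, with their random partition\<close>

locale uniform_relation =
  fixes V :: "'a set" and E :: "('a \<times> 'a) set" and n p \<epsilon> :: real
  assumes fV: "finite V" and EV: "E \<subseteq> V \<times> V" and irr: "\<And>v. (v, v) \<notin> E" and n: "n = card V"
    and p: "0 < p" "p \<le> 1/10" and e: "0 < \<epsilon>" "\<epsilon> < 1/10"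
    and out: "\<And>v. v \<in> V \<Longrightarrow> (1 - \<epsilon>) * (n * p) \<le> card (E `` {v}) \<and> card (E `` {v}) \<le> (1 + \<epsilon>) * (n * p)"
    and inn: "\<And>v. v \<in> V \<Longrightarrow> (1 - \<epsilon>) * (n * p) \<le> card (E\<inverse> `` {v}) \<and> card (E\<inverse> `` {v}) \<le> (1 + \<epsilon>) * (n * p)"
    and co: "\<And>a b. a \<in> V \<Longrightarrow> b \<in> V \<Longrightarrow> a \<noteq> b \<Longrightarrow> card (E `` {a} \<inter> E `` {b}) \<le> (1 + \<epsilon>) * (n * p\<^sup>2)"
    and ci: "\<And>a b. a \<in> V \<Longrightarrow> b \<in> V \<Longrightarrow> a \<noteq> b \<Longrightarrow> card (E\<inverse> `` {a} \<inter> E\<inverse> `` {b}) \<le> (1 + \<epsilon>) * (n * p\<^sup>2)"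
    and two: "\<And>a b. a \<in> V \<Longrightarrow> b \<in> V \<Longrightarrow> a \<noteq> b \<Longrightarrow>
      (1 - \<epsilon>) * (n * p\<^sup>2) \<le> card {x\<in>V. (a, x) \<in> E \<and> (x, b) \<in> E} \<and>
      card {x\<in>V. (a, x) \<in> E \<and> (x, b) \<in> E} \<le> (1 + \<epsilon>) * (n * p\<^sup>2)"
    and four: "\<And>a b c d. a \<in> V \<Longrightarrow> b \<in> V \<Longrightarrow> c \<in> V \<Longrightarrow> d \<in> V \<Longrightarrow>
      a \<noteq> b \<Longrightarrow> a \<noteq> c \<Longrightarrow> a \<noteq> d \<Longrightarrow> b \<noteq> d \<Longrightarrow> c \<noteq> d \<Longrightarrow>
      (1 - \<epsilon>) * (n * p ^ 4) \<le> card {x\<in>V. (a, x) \<in> E \<and> (x, b) \<in> E \<and> (c, x) \<in> E \<and> (x, d) \<in> E} \<and>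
      card {x\<in>V. (a, x) \<in> E \<and> (x, b) \<in> E \<and> (c, x) \<in> E \<and> (x, d) \<in> E} \<le> (1 + \<epsilon>) * (n * p ^ 4)"
begin

text \<open>Pairs of links to which the four-arc condition applies, possibly after exchanging the
  two links. That condition tolerates equality of the two inner vertices, here \<open>b\<close> and
  \<open>a'\<close>, but requires the outer ones, \<open>a\<close> and \<open>b'\<close>, to be
  distinct; the final disjunction makes this available in one of the two orders.\<close>

definition quads :: "('a \<times> 'a \<times> 'a \<times> 'a) set" where
  "quads = {(a, b, a', b'). a \<in> V \<and> b \<in> V \<and> a' \<in> V \<and> b' \<in> V \<and>
     a \<noteq> b \<and> a' \<noteq> b' \<and> a \<noteq> a' \<and> b \<noteq> b' \<and> (a \<noteq> b' \<or> b \<noteq> a')}"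

definition mid :: "'a \<Rightarrow> 'a \<Rightarrow> 'a set" where
  "mid a b = {x\<in>V. (a, x) \<in> E \<and> (x, b) \<in> E}"

lemma mid_four:
  assumes "(a, b, a', b') \<in> quads"
  shows "9/10 * (n * p ^ 4) \<le> card (mid a b \<inter> mid a' b')" "card (mid a b \<inter> mid a' b') \<le> 11/10 * (n * p ^ 4)"
proof -
  have V: "a \<in> V" "b \<in> V" "a' \<in> V" "b' \<in> V" and ne: "a \<noteq> b" "a' \<noteq> b'" "a \<noteq> a'" "b \<noteq> b'" "a \<noteq> b' \<or> b \<noteq> a'"
    using assms by (auto simp: quads_def)
  have m: "mid a b \<inter> mid a' b' = {x\<in>V. (a, x) \<in> E \<and> (x, b) \<in> E \<and> (a', x) \<in> E \<and> (x, b') \<in> E}"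
    "mid a b \<inter> mid a' b' = {x\<in>V. (a', x) \<in> E \<and> (x, b') \<in> E \<and> (a, x) \<in> E \<and> (x, b) \<in> E}"
    by (auto simp: mid_def)
  have "(1 - \<epsilon>) * (n * p ^ 4) \<le> card (mid a b \<inter> mid a' b') \<and> card (mid a b \<inter> mid a' b') \<le> (1 + \<epsilon>) * (n * p ^ 4)"
    using ne(5)
  proof
    assume "a \<noteq> b'"
    then show ?thesis unfolding m(1) using V ne by (intro four) auto
  next
    assume "b \<noteq> a'"
    then show ?thesis unfolding m(2) using V ne by (intro four) auto
  qed
  moreover have np: "0 \<le> n * p ^ 4" using n p by simp
  have "9/10 * (n * p ^ 4) \<le> (1 - \<epsilon>) * (n * p ^ 4)" "(1 + \<epsilon>) * (n * p ^ 4) \<le> 11/10 * (n * p ^ 4)"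
    using e np by (intro mult_right_mono; simp)+
  ultimately show "9/10 * (n * p ^ 4) \<le> card (mid a b \<inter> mid a' b')" "card (mid a b \<inter> mid a' b') \<le> 11/10 * (n * p ^ 4)"
    by linarith+
qed

lemma mid_two:
  assumes "a \<in> V" "b \<in> V" "a \<noteq> b"
  shows "9/10 * (n * p\<^sup>2) \<le> card (mid a b)" "card (mid a b) \<le> 11/10 * (n * p\<^sup>2)"
proof -
  have np: "0 \<le> n * p\<^sup>2" using n by simp
  have "9/10 * (n * p\<^sup>2) \<le> (1 - \<epsilon>) * (n * p\<^sup>2)" "(1 + \<epsilon>) * (n * p\<^sup>2) \<le> 11/10 * (n * p\<^sup>2)"
    using e np by (intro mult_right_mono; simp)+
  then show "9/10 * (n * p\<^sup>2) \<le> card (mid a b)" "card (mid a b) \<le> 11/10 * (n * p\<^sup>2)"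
    using two[OF assms] unfolding mid_def by linarith+
qed

lemma degrees:
  assumes "v \<in> V"
  shows "9/10 * (n * p) \<le> card (E `` {v})" "9/10 * (n * p) \<le> card (E\<inverse> `` {v})"
proof -
  have np: "0 \<le> n * p" using n p by simp
  have "9/10 * (n * p) \<le> (1 - \<epsilon>) * (n * p)" using e np by (intro mult_right_mono) auto
  then show "9/10 * (n * p) \<le> card (E `` {v})" "9/10 * (n * p) \<le> card (E\<inverse> `` {v})"
    using out[OF assms] inn[OF assms] by linarith+
qed

lemma p_powers: "p ^ 4 \<le> p\<^sup>2" "p\<^sup>2 \<le> p" "p \<le> 1"
  using p power_decreasing[of 2 4 p] power_decreasing[of 1 2 p] by auto

definition pairs :: "('a \<times> 'a) set" where "pairs = {(a, b). a \<in> V \<and> b \<in> V \<and> a \<noteq> b}"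

lemma finite_quads: "finite quads" "card quads \<le> card V ^ 4"
proof -
  have q: "quads \<subseteq> V \<times> V \<times> V \<times> V" by (auto simp: quads_def)
  then show "finite quads" by (rule finite_subset) (simp add: fV)
  have "card quads \<le> card (V \<times> V \<times> V \<times> V)" using q by (intro card_mono) (simp_all add: fV)
  then show "card quads \<le> card V ^ 4" by (simp add: card_cartesian_product power4_eq_xxxx)
qed

lemma finite_pairs: "finite pairs" "card pairs \<le> card V ^ 2"
proof -
  have q: "pairs \<subseteq> V \<times> V" by (auto simp: pairs_def)
  then show "finite pairs" by (rule finite_subset) (simp add: fV)
  have "card pairs \<le> card (V \<times> V)" using q by (intro card_mono) (simp_all add: fV)
  then show "card pairs \<le> card V ^ 2" by (simp add: card_cartesian_product power2_eq_square)
qed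

end

text \<open>Only part sizes and degrees in \<open>F\<close> need the fine tolerance \<tau>, because
  their fluctuations turn into gaps of the matchings. For the neighbourhoods that serve linking,
  1/100 is enough; 9/10 and 11/10 are the constants inherited from uniformity.\<close>

locale partitioned_relation = uniform_relation V E n p \<epsilon>
  for V :: "'a set" and E :: "('a \<times> 'a) set" and n p \<epsilon> :: real +
  fixes F :: "('a \<times> 'a) set" and r K :: nat and \<tau> :: real and part :: "'a \<Rightarrow> nat"
  assumes FE: "F \<subseteq> E" and K: "prime K" "8 \<le> K" and part: "\<And>v. v \<in> V \<Longrightarrow> part v < K"
    and tau: "0 < \<tau>" "\<tau> \<le> 1/100"
    and psize: "\<And>c. c < K \<Longrightarrow> (1 - \<tau>) * (n / K) \<le> card {v\<in>V. part v = c} \<and> card {v\<in>V. part v = c} \<le> (1 + \<tau>) * (n / K)"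
    and pF: "\<And>v c. v \<in> V \<Longrightarrow> c < K \<Longrightarrow>
      (1 - \<tau>) * (r / K) \<le> card {x\<in>F `` {v}. part x = c} \<and> card {x\<in>F `` {v}. part x = c} \<le> (1 + \<tau>) * (r / K) \<and>
      (1 - \<tau>) * (r / K) \<le> card {x\<in>F\<inverse> `` {v}. part x = c} \<and> card {x\<in>F\<inverse> `` {v}. part x = c} \<le> (1 + \<tau>) * (r / K)"
    and pE: "\<And>v c. v \<in> V \<Longrightarrow> c < K \<Longrightarrow>
      99/100 * (9/10) * (n * p / K) \<le> card {x\<in>E `` {v}. part x = c} \<and>
      99/100 * (9/10) * (n * p / K) \<le> card {x\<in>E\<inverse> `` {v}. part x = c}"
    and pmid: "\<And>a b c. a \<in> V \<Longrightarrow> b \<in> V \<Longrightarrow> a \<noteq> b \<Longrightarrow> c < K \<Longrightarrow>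
      99/100 * (9/10) * (n * p\<^sup>2 / K) \<le> card {x\<in>mid a b. part x = c} \<and>
      card {x\<in>mid a b. part x = c} \<le> 101/100 * (11/10) * (n * p\<^sup>2 / K)"
    and pfour: "\<And>a b a' b' c. (a, b, a', b') \<in> quads \<Longrightarrow> c < K \<Longrightarrow>
      99/100 * (9/10) * (n * p ^ 4 / K) \<le> card {x\<in>mid a b \<inter> mid a' b'. part x = c} \<and>
      card {x\<in>mid a b \<inter> mid a' b'. part x = c} \<le> 101/100 * (11/10) * (n * p ^ 4 / K)"

text \<open>The arithmetic of the union bounds: each test fails with an exponent of at least 6 ln n,
  and the number of tests, with its factor 2, is at most 10 n^5.\<close>

lemma six_log_few:
  fixes n :: real
  assumes "20 \<le> n" "m \<le> 10 * n ^ 5"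
  shows "m * exp (- (6 * ln n)) < 1"
proof -
  have "exp (6 * ln n) = n ^ 6" using assms(1) exp_of_nat_mult[of 6 "ln n"] by simp
  then have "exp (- (6 * ln n)) = 1 / n ^ 6" by (simp add: exp_minus field_simps)
  moreover have "m < n ^ 6"
  proof -
    have "10 * n ^ 5 < n * n ^ 5" using assms(1) by (intro mult_strict_right_mono) auto
    also have "\<dots> = n ^ 6" by (simp add: power_Suc[symmetric] del: power_Suc)
    finally show ?thesis using assms(2) by linarith
  qed
  ultimately show ?thesis using assms(1) by simp
qed

context uniform_relation
begin

text \<open>\<open>c1\<close> is for the sharp tests, whose expectation is at least r/K, and
  \<open>c2\<close> for the coarse ones, whose smallest expectation is of order n p^4/K and comes
  from two links with a common vertex.\<close>

lemma partition_exists: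
  fixes r K :: nat and \<tau> :: real
  assumes F: "F \<subseteq> E" "\<And>v. v \<in> V \<Longrightarrow> card (F `` {v}) = r \<and> card (F\<inverse> `` {v}) = r"
    and K: "prime K" "8 \<le> K" "real K \<le> n" and tau: "0 < \<tau>" "\<tau> \<le> 1/100" and n20: "20 \<le> n" and rn: "real r \<le> n"
    and c1: "96 * K * ln n \<le> \<tau>\<^sup>2 * r" and c2: "300000 * K * ln n \<le> n * p ^ 4"
  shows "\<exists>part. partitioned_relation V E n p \<epsilon> F r K \<tau> part"
proof -
  define T where "T = {(V, \<tau>)} \<union> (\<lambda>v. (F `` {v}, \<tau>)) ` V \<union> (\<lambda>v. (F\<inverse> `` {v}, \<tau>)) ` V
    \<union> (\<lambda>v. (E `` {v}, 1/100)) ` V \<union> (\<lambda>v. (E\<inverse> `` {v}, 1/100)) ` V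
    \<union> (\<lambda>(a, b). (mid a b, 1/100)) ` pairs
    \<union> (\<lambda>(a, b, a', b'). (mid a b \<inter> mid a' b', 1/100)) ` quads"
  have K0: "0 < real K" using K by simp
  have L0: "0 \<le> ln n" using n20 by simp
  have t1: "6 * ln n \<le> \<tau>\<^sup>2 * (x / K) / 4" if "real r \<le> x" for x
  proof -
    have "96 * K * ln n \<le> \<tau>\<^sup>2 * x" using c1 mult_left_mono[OF that, of "\<tau>\<^sup>2"] by simp
    moreover have "24 * K * ln n \<le> 96 * K * ln n" using L0 K0 by (intro mult_right_mono) auto
    ultimately have "24 * K * ln n \<le> \<tau>\<^sup>2 * x" by linarith
    then show ?thesis using K0 by (simp add: field_simps)
  qed
  have t2: "6 * ln n \<le> (1/100)\<^sup>2 * (x / K) / 4" if "9/10 * (n * p ^ 4) \<le> x" for x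
  proof -
    have "240000 * K * ln n \<le> 270000 * K * ln n" using L0 K0 by (intro mult_right_mono) auto
    also have "\<dots> = 9/10 * (300000 * K * ln n)" by simp
    also have "\<dots> \<le> 9/10 * (n * p ^ 4)" using c2 by (intro mult_left_mono) auto
    finally have "240000 * K * ln n \<le> x" using that by linarith
    then show ?thesis using K0 by (simp add: field_simps power2_eq_square)
  qed
  have np: "n * p ^ 4 \<le> n * p\<^sup>2" "n * p\<^sup>2 \<le> n * p"
    using p_powers n20 by (intro mult_left_mono; simp)+
  have "\<exists>f. (\<forall>v\<in>V. f v < K) \<and> (\<forall>(S, t)\<in>T. \<forall>c<K.
    (1 - t) * (card S / K) \<le> card {x\<in>S. f x = c} \<and> card {x\<in>S. f x = c} \<le> (1 + t) * (card S / K))"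
  proof (rule random_partition[OF fV, where L = "6 * ln n"])
    show "0 < K" using K by simp
    show "finite T" unfolding T_def by (simp add: fV finite_quads finite_pairs)
    show "S \<subseteq> V \<and> 0 \<le> t \<and> t \<le> 1 \<and> 6 * ln n \<le> t\<^sup>2 * (card S / K) / 4" if ST: "(S, t) \<in> T" for S t
    proof -
      consider (a) "S = V" "t = \<tau>" | (b) v where "v \<in> V" "S = F `` {v} \<or> S = F\<inverse> `` {v}" "t = \<tau>"
        | (c) v where "v \<in> V" "S = E `` {v} \<or> S = E\<inverse> `` {v}" "t = 1/100"
        | (d) a b where "a \<in> V" "b \<in> V" "a \<noteq> b" "S = mid a b" "t = 1/100"
        | (e) a b a' b' where "(a, b, a', b') \<in> quads" "S = mid a b \<inter> mid a' b'" "t = 1/100"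
        using ST by (auto simp: T_def pairs_def)
      then show ?thesis
      proof cases
        case a
        then show ?thesis using tau t1[of n] rn n by simp
      next
        case b
        then have "card S = r" using F(2) by auto
        moreover have "S \<subseteq> V" using b F(1) EV by auto
        ultimately show ?thesis using b tau t1[of r] by simp
      next
        case c
        then have "9/10 * (n * p ^ 4) \<le> card S" using degrees[OF c(1)] np by auto
        moreover have "S \<subseteq> V" using c EV by auto
        ultimately show ?thesis using t2[of "card S"] unfolding c(3) by simp
      next
        case d
        then have "9/10 * (n * p ^ 4) \<le> card S" using mid_two(1)[OF d(1-3)] np by simp
        moreover have "S \<subseteq> V" using d by (auto simp: mid_def)
        ultimately show ?thesis using t2[of "card S"] unfolding d(5) by simp
      next
        case e
        then have "9/10 * (n * p ^ 4) \<le> card S" using mid_four(1)[OF e(1)] by simp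
        moreover have "S \<subseteq> V" using e by (auto simp: mid_def)
        ultimately show ?thesis using t2[of "card S"] unfolding e(3) by simp
      qed
    qed
    have v1: "1 \<le> card V" using n20 n by linarith
    have "card T \<le> 1 + card V + card V + card V + card V + card V ^ 2 + card V ^ 4"
      unfolding T_def
      by (intro order_trans[OF card_Un_le] add_mono order_trans[OF card_image_le] fV finite_quads finite_pairs) auto
    also have "\<dots> \<le> card V + card V + card V + card V + card V + card V ^ 2 + card V ^ 4" using v1 by simp
    finally have "real (card T) \<le> real (card V + card V + card V + card V + card V + card V ^ 2 + card V ^ 4)"
      by (rule of_nat_mono)
    then have ct: "real (card T) \<le> 5 * n + n ^ 2 + n ^ 4" using n by simp
    have "5 * n + n ^ 2 \<le> n ^ 4"
    proof -
      have "n ^ 4 = n ^ 2 * n ^ 2" by (simp flip: power_add)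
      moreover have "20 * 20 \<le> n ^ 2" unfolding power2_eq_square using n20 by (intro mult_mono) auto
      moreover have "2 * n ^ 2 \<le> n ^ 2 * n ^ 2" using calculation by (intro mult_right_mono) auto
      moreover have "5 * n \<le> n ^ 2" unfolding power2_eq_square using n20 by (intro mult_right_mono) auto
      ultimately show ?thesis by linarith
    qed
    then have "real (card T) * real K \<le> (2 * n ^ 4) * n" using ct K n20 by (intro mult_mono) auto
    also have "\<dots> = 2 * n ^ 5" by (simp add: eval_nat_numeral)
    finally have "real (card T) * real K \<le> 2 * n ^ 5" .
    moreover have "0 \<le> n ^ 5" using n20 by simp
    ultimately have "2 * (real (card T) * real K) \<le> 10 * n ^ 5" by linarith
    then show "2 * (real (card T) * real K) * exp (- (6 * ln n)) < 1" by (rule six_log_few[OF n20])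
  qed
  then obtain f where fK: "\<And>v. v \<in> V \<Longrightarrow> f v < K" and fT: "\<forall>(S, t)\<in>T. \<forall>c<K.
    (1 - t) * (card S / K) \<le> card {x\<in>S. f x = c} \<and> card {x\<in>S. f x = c} \<le> (1 + t) * (card S / K)" by blast
  have get: "(1 - t) * (card S / K) \<le> card {x\<in>S. f x = c} \<and> card {x\<in>S. f x = c} \<le> (1 + t) * (card S / K)"
    if "(S, t) \<in> T" "c < K" for S t c using fT that by blast
  have lowK: "99/100 * (9/10) * (x / K) \<le> (1 - 1/100) * (y / K)" if "9/10 * x \<le> y" for x y :: real
  proof -
    have "99/100 * (9/10 * x / K) \<le> 99/100 * (y / K)"
      using that K0 by (intro mult_left_mono divide_right_mono) auto
    then show ?thesis by simp
  qed
  have upK: "(1 + 1/100) * (y / K) \<le> 101/100 * (11/10) * (x / K)" if "y \<le> 11/10 * x" for x y :: real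
  proof -
    have "101/100 * (y / K) \<le> 101/100 * (11/10 * x / K)"
      using that K0 by (intro mult_left_mono divide_right_mono) auto
    then show ?thesis by simp
  qed
  have "partitioned_relation V E n p \<epsilon> F r K \<tau> f"
  proof unfold_locales
    show "F \<subseteq> E" by (rule F(1))
    show "prime K" "8 \<le> K" by (rule K)+
    show "f v < K" if "v \<in> V" for v by (rule fK[OF that])
    show "0 < \<tau>" "\<tau> \<le> 1/100" by (rule tau)+
    show "(1 - \<tau>) * (n / K) \<le> card {v\<in>V. f v = c} \<and> card {v\<in>V. f v = c} \<le> (1 + \<tau>) * (n / K)" if "c < K" for c
      using get[of V \<tau> c] that n by (simp add: T_def)
    show "(1 - \<tau>) * (r / K) \<le> card {x\<in>F `` {v}. f x = c} \<and> card {x\<in>F `` {v}. f x = c} \<le> (1 + \<tau>) * (r / K) \<and>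
      (1 - \<tau>) * (r / K) \<le> card {x\<in>F\<inverse> `` {v}. f x = c} \<and> card {x\<in>F\<inverse> `` {v}. f x = c} \<le> (1 + \<tau>) * (r / K)"
      if "v \<in> V" "c < K" for v c
    proof -
      have "(F `` {v}, \<tau>) \<in> T" "(F\<inverse> `` {v}, \<tau>) \<in> T" using that(1) by (auto simp: T_def)
      then show ?thesis using get[of "F `` {v}" \<tau> c] get[of "F\<inverse> `` {v}" \<tau> c] that F(2)[OF that(1)] by simp
    qed
    show "99/100 * (9/10) * (n * p / K) \<le> card {x\<in>E `` {v}. f x = c} \<and>
      99/100 * (9/10) * (n * p / K) \<le> card {x\<in>E\<inverse> `` {v}. f x = c}" if v: "v \<in> V" and c: "c < K" for v c
    proof -
      have "(E `` {v}, 1/100) \<in> T" "(E\<inverse> `` {v}, 1/100) \<in> T" using v by (auto simp: T_def)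
      then show ?thesis
        using get[OF _ c, of "E `` {v}" "1/100"] get[OF _ c, of "E\<inverse> `` {v}" "1/100"]
          lowK[OF degrees(1)[OF v]] lowK[OF degrees(2)[OF v]] by linarith
    qed
    show "99/100 * (9/10) * (n * p\<^sup>2 / K) \<le> card {x\<in>mid a b. f x = c} \<and>
      card {x\<in>mid a b. f x = c} \<le> 101/100 * (11/10) * (n * p\<^sup>2 / K)"
      if ab: "a \<in> V" "b \<in> V" "a \<noteq> b" and c: "c < K" for a b c
    proof -
      have "(mid a b, 1/100) \<in> T" using ab by (auto simp: T_def pairs_def)
      then show ?thesis
        using get[OF _ c, of "mid a b" "1/100"] lowK[OF mid_two(1)[OF ab]] upK[OF mid_two(2)[OF ab]] by linarith
    qed
    show "99/100 * (9/10) * (n * p ^ 4 / K) \<le> card {x\<in>mid a b \<inter> mid a' b'. f x = c} \<and>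
      card {x\<in>mid a b \<inter> mid a' b'. f x = c} \<le> 101/100 * (11/10) * (n * p ^ 4 / K)"
      if q: "(a, b, a', b') \<in> quads" and c: "c < K" for a b a' b' c
    proof -
      have "(mid a b \<inter> mid a' b', 1/100) \<in> T" 
        unfolding T_def by (rule UnI2, rule image_eqI[OF _ q]) simp
      then show ?thesis
        using get[OF _ c, of "mid a b \<inter> mid a' b'" "1/100"] lowK[OF mid_four(1)[OF q]] upK[OF mid_four(2)[OF q]]
        by linarith
    qed
  qed
  then show ?thesis by (intro exI[of _ f])
qed

end

text \<open>The constants of the partition, degraded by one further tolerance: 0.99^2 * 0.9 exceeds
  0.882 and 1.01^2 * 1.1 is below 9/8; for \<open>F\<close>, (1 - \<tau>)^2 is at least 1 - 2 \<tau>
  and (1 + \<tau>)^2 at most 1 + 3 \<tau>.\<close>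

locale coloured_relation = partitioned_relation V E n p \<epsilon> F r K \<tau> part
  for V :: "'a set" and E :: "('a \<times> 'a) set" and n p \<epsilon> :: real and F :: "('a \<times> 'a) set" and r K :: nat
    and \<tau> :: real and part :: "'a \<Rightarrow> nat" +
  fixes B :: nat and col :: "'a \<times> 'a \<Rightarrow> nat"
  assumes B: "6 \<le> B"
    and cB: "\<And>e. e \<in> E \<Longrightarrow> col e < B"
    and cF: "\<And>v c. v \<in> V \<Longrightarrow> c < K \<Longrightarrow>
      (1 - 2 * \<tau>) * ((1 - 3 / B) * (r / K)) \<le> card {x\<in>F `` {v}. part x = c \<and> 3 \<le> col (v, x)} \<and>
      card {x\<in>F `` {v}. part x = c \<and> 3 \<le> col (v, x)} \<le> (1 + 3 * \<tau>) * ((1 - 3 / B) * (r / K)) \<and>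
      (1 - 2 * \<tau>) * ((1 - 3 / B) * (r / K)) \<le> card {x\<in>F\<inverse> `` {v}. part x = c \<and> 3 \<le> col (x, v)} \<and>
      card {x\<in>F\<inverse> `` {v}. part x = c \<and> 3 \<le> col (x, v)} \<le> (1 + 3 * \<tau>) * ((1 - 3 / B) * (r / K))"
    and cE: "\<And>v c. v \<in> V \<Longrightarrow> c < K \<Longrightarrow>
      881/1000 * (n / K * (p / B)) \<le> card {x\<in>E `` {v}. part x = c \<and> col (v, x) = 0} \<and>
      881/1000 * (n / K * (p / B)) \<le> card {x\<in>E\<inverse> `` {v}. part x = c \<and> col (x, v) = 0}"
    and cmid: "\<And>a b c. a \<in> V \<Longrightarrow> b \<in> V \<Longrightarrow> a \<noteq> b \<Longrightarrow> c < K \<Longrightarrow>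
      88/100 * (n / K * (p / B)\<^sup>2) \<le> card {x\<in>mid a b. part x = c \<and> col (a, x) = 0 \<and> col (x, b) = 0} \<and>
      card {x\<in>mid a b. part x = c \<and> col (a, x) = 0 \<and> col (x, b) = 0} \<le> 9/8 * (n / K * (p / B)\<^sup>2) \<and>
      88/100 * (n / K * (p / B)\<^sup>2) \<le> card {x\<in>mid a b. part x = c \<and> col (a, x) = 1 \<and> col (x, b) = 2}"
    and cfour: "\<And>a b a' b' c. (a, b, a', b') \<in> quads \<Longrightarrow> c < K \<Longrightarrow>
      card {x\<in>mid a b \<inter> mid a' b'. part x = c \<and> col (a, x) = 0 \<and> col (x, b) = 0 \<and> col (a', x) = 0 \<and> col (x, b') = 0}
        \<le> 9/8 * (n / K * (p / B) ^ 4)"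

section \<open>Tests for the random colouring\<close>

context partitioned_relation
begin

definition t_star :: "('a \<times> 'a) set \<Rightarrow> nat set \<Rightarrow> real \<Rightarrow> real \<Rightarrow> 'a \<times> nat \<Rightarrow> 'a test" where
  "t_star G C \<pi> t = (\<lambda>(v, c). ({x\<in>G `` {v}. part x = c}, \<lambda>x. {(v, x)}, \<lambda>_. C, \<pi>, t))"

definition t_costar :: "('a \<times> 'a) set \<Rightarrow> nat set \<Rightarrow> real \<Rightarrow> real \<Rightarrow> 'a \<times> nat \<Rightarrow> 'a test" where
  "t_costar G C \<pi> t = (\<lambda>(v, c). ({x\<in>G\<inverse> `` {v}. part x = c}, \<lambda>x. {(x, v)}, \<lambda>_. C, \<pi>, t))"

text \<open>As there are no loops, blocks of different \<open>x\<close> are disjoint, and the tail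
  \<open>a\<close> distinguishes the first arc of a block from the second.\<close>

definition t_mid :: "nat \<Rightarrow> nat \<Rightarrow> nat \<Rightarrow> ('a \<times> 'a) \<times> nat \<Rightarrow> 'a test" where
  "t_mid B i j = (\<lambda>((a, b), c). ({x\<in>mid a b. part x = c}, \<lambda>x. {(a, x), (x, b)},
     \<lambda>e. if fst e = a then {i} else {j}, 1 / real B ^ 2, 1/100))"

text \<open>The four arcs of a block are distinct because a \<noteq> a', b \<noteq> b' and there are
  no loops, even if b = a'; so the probability is exactly B^(-4).\<close>

definition t_four :: "nat \<Rightarrow> ('a \<times> 'a \<times> 'a \<times> 'a) \<times> nat \<Rightarrow> 'a test" where
  "t_four B = (\<lambda>((a, b, a', b'), c). ({x\<in>mid a b \<inter> mid a' b'. part x = c},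
     \<lambda>x. {(a, x), (x, b), (a', x), (x, b')}, \<lambda>e. {0}, 1 / real B ^ 4, 1/100))"

definition tests :: "nat \<Rightarrow> 'a test set" where
  "tests B = t_star F {3..<B} (1 - 3 / real B) \<tau> ` (V \<times> {..<K}) \<union> t_costar F {3..<B} (1 - 3 / real B) \<tau> ` (V \<times> {..<K})
     \<union> t_star E {0} (1 / real B) (1/100) ` (V \<times> {..<K}) \<union> t_costar E {0} (1 / real B) (1/100) ` (V \<times> {..<K})
     \<union> t_mid B 0 0 ` (pairs \<times> {..<K}) \<union> t_mid B 1 2 ` (pairs \<times> {..<K}) \<union> t_four B ` (quads \<times> {..<K})"

lemma tests_intros:
  assumes "c < K"
  shows "v \<in> V \<Longrightarrow> t_star F {3..<B} (1 - 3 / real B) \<tau> (v, c) \<in> tests B"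
    "v \<in> V \<Longrightarrow> t_costar F {3..<B} (1 - 3 / real B) \<tau> (v, c) \<in> tests B"
    "v \<in> V \<Longrightarrow> t_star E {0} (1 / real B) (1/100) (v, c) \<in> tests B"
    "v \<in> V \<Longrightarrow> t_costar E {0} (1 / real B) (1/100) (v, c) \<in> tests B"
    "z \<in> pairs \<Longrightarrow> t_mid B 0 0 (z, c) \<in> tests B"
    "z \<in> pairs \<Longrightarrow> t_mid B 1 2 (z, c) \<in> tests B"
    "q \<in> quads \<Longrightarrow> t_four B (q, c) \<in> tests B"
  unfolding tests_def using assms by blast+

lemma finite_tests: "finite (tests B)"
  unfolding tests_def by (simp add: fV finite_quads finite_pairs)

lemma card_tests:
  assumes n20: "20 \<le> n" and Kn: "real K \<le> n"
  shows "2 * real (card (tests B)) \<le> 10 * n ^ 5"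
proof -
  have VK: "card (f ` (V \<times> {..<K})) \<le> card V * K" for f :: "'a \<times> nat \<Rightarrow> 'a test"
    using card_image_le[of "V \<times> {..<K}" f] fV by (simp add: card_cartesian_product)
  have PK: "card (f ` (pairs \<times> {..<K})) \<le> card V ^ 2 * K" for f :: "('a \<times> 'a) \<times> nat \<Rightarrow> 'a test"
  proof -
    have "card (f ` (pairs \<times> {..<K})) \<le> card pairs * K"
      using card_image_le[of "pairs \<times> {..<K}" f] finite_pairs(1) by (simp add: card_cartesian_product)
    also have "\<dots> \<le> card V ^ 2 * K" by (intro mult_right_mono finite_pairs(2)) simp
    finally show ?thesis .
  qed
  have QK: "card (f ` (quads \<times> {..<K})) \<le> card V ^ 4 * K" for f :: "('a \<times> 'a \<times> 'a \<times> 'a) \<times> nat \<Rightarrow> 'a test"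
  proof -
    have "card (f ` (quads \<times> {..<K})) \<le> card quads * K"
      using card_image_le[of "quads \<times> {..<K}" f] finite_quads(1) by (simp add: card_cartesian_product)
    also have "\<dots> \<le> card V ^ 4 * K" by (intro mult_right_mono finite_quads(2)) simp
    finally show ?thesis .
  qed
  have un: "card (X \<union> Y) \<le> x + y" if "card X \<le> x" "card Y \<le> y" for X Y :: "'a test set" and x y
    using card_Un_le[of X Y] that by linarith
  have "card (tests B) \<le> card V * K + card V * K + card V * K + card V * K + card V ^ 2 * K + card V ^ 2 * K + card V ^ 4 * K"
    unfolding tests_def by (intro un VK PK QK)
  then have "real (card (tests B)) \<le> real (card V * K + card V * K + card V * K + card V * K + card V ^ 2 * K + card V ^ 2 * K + card V ^ 4 * K)"
    by (rule of_nat_mono)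
  also have "\<dots> = (4 * n + 2 * n ^ 2 + n ^ 4) * K" by (simp add: n algebra_simps)
  also have "\<dots> \<le> (2 * n ^ 4) * n"
  proof (intro mult_mono Kn)
    have "n ^ 4 = n ^ 2 * n ^ 2" by (simp flip: power_add)
    moreover have "20 * 20 \<le> n ^ 2" unfolding power2_eq_square using n20 by (intro mult_mono) auto
    moreover have "3 * n ^ 2 \<le> n ^ 2 * n ^ 2" using calculation by (intro mult_right_mono) auto
    moreover have "4 * n \<le> n ^ 2" unfolding power2_eq_square using n20 by (intro mult_right_mono) auto
    ultimately show "4 * n + 2 * n ^ 2 + n ^ 4 \<le> 2 * n ^ 4" by linarith
  qed (use n20 in auto)
  also have "\<dots> = 2 * n ^ 5" by (simp add: eval_nat_numeral)
  finally have "real (card (tests B)) \<le> 2 * n ^ 5" .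
  moreover have "0 \<le> n ^ 5" using n20 by simp
  ultimately show ?thesis by linarith
qed

lemma mid_noteq: "x \<in> mid a b \<Longrightarrow> x \<noteq> a \<and> x \<noteq> b"
  using irr by (auto simp: mid_def)

lemma finite_mid: "finite (mid a b)"
  using fV by (simp add: mid_def)

lemma finite_neighbours: "G \<subseteq> E \<Longrightarrow> finite (G `` X)" "G \<subseteq> E \<Longrightarrow> finite (G\<inverse> `` X)"
proof -
  assume G: "G \<subseteq> E"
  have "G `` X \<subseteq> V" "G\<inverse> `` X \<subseteq> V" using G EV by auto
  then show "finite (G `` X)" "finite (G\<inverse> `` X)" using fV finite_subset by blast+
qed

lemma tests_ok:
  assumes B: "6 \<le> B" and n20: "20 \<le> n" and c1: "96 * K * ln n \<le> \<tau>\<^sup>2 * r"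
    and c2: "300000 * K * real B ^ 4 * ln n \<le> n * p ^ 4" and q: "q \<in> tests B"
  shows "test_ok E B (6 * ln n) q"
proof -
  have K0: "0 < real K" and B0: "0 < real B" and B1: "1 \<le> real B" using K B by auto
  have L0: "0 \<le> ln n" using n20 by simp
  have pi0: "0 \<le> 1 - 3 / real B" "1 - 3 / real B \<le> 1" "1/2 \<le> 1 - 3 / real B"
    using B by (auto simp: field_simps)
  \<comment> \<open>As \<open>B \<ge> 6\<close>, a colour is unreserved with probability at least
    1/2. The exponent 6 ln n asks for 24 ln n after multiplication by 4, and the constant 96 in
    \<open>c1\<close> covers this half and the loss from the partition.\<close>
  have t1: "6 * ln n \<le> \<tau>\<^sup>2 * (x * (1 - 3 / real B)) / 4" if x: "(1 - \<tau>) * (r / K) \<le> x" for x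
  proof -
    have "99/100 * (r / K) \<le> (1 - \<tau>) * (r / K)" using tau by (intro mult_right_mono) auto
    then have xr: "99/100 * (r / K) \<le> x" using x by linarith
    have "96 * ln n \<le> \<tau>\<^sup>2 * (r / K)" using c1 K0 by (simp add: field_simps)
    then have "99/100 * (96 * ln n) \<le> 99/100 * (\<tau>\<^sup>2 * (r / K))" by (intro mult_left_mono) auto
    also have "\<dots> = \<tau>\<^sup>2 * (99/100 * (r / K))" by simp
    also have "\<dots> \<le> \<tau>\<^sup>2 * x" using xr by (intro mult_left_mono) auto
    finally have a: "95 * ln n \<le> \<tau>\<^sup>2 * x" using L0 by simp
    have "0 \<le> \<tau>\<^sup>2 * x" using a L0 by linarith
    then have "\<tau>\<^sup>2 * x * (1/2) \<le> \<tau>\<^sup>2 * x * (1 - 3 / real B)" by (intro mult_left_mono pi0)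
    then have "24 * ln n \<le> \<tau>\<^sup>2 * x * (1 - 3 / real B)" using a L0 by linarith
    then show ?thesis by (simp add: mult.assoc)
  qed
  have np0: "0 \<le> n * p ^ 4" using n p by simp
  have t2: "6 * ln n \<le> (1/100)\<^sup>2 * (x * \<pi>) / 4"
    if x: "99/100 * (9/10) * (y / K) \<le> x" and y: "n * p ^ 4 \<le> y" and \<pi>: "1 / real B ^ 4 \<le> \<pi>" for x y \<pi>
  proof -
    have "99/100 * (9/10) * (n * p ^ 4 / K) \<le> 99/100 * (9/10) * (y / K)"
      using y K0 by (intro mult_left_mono divide_right_mono) auto
    then have xn: "891/1000 * (n * p ^ 4 / K) \<le> x" using x by simp
    have z: "0 \<le> n * p ^ 4 / K" using np0 K0 by (intro divide_nonneg_pos)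
    have "0 \<le> 891/1000 * (n * p ^ 4 / K)" using z by (intro mult_nonneg_nonneg) auto
    then have x0: "0 \<le> x" using xn by (rule order_trans)
    have "300000 * ln n \<le> n * p ^ 4 / K * (1 / real B ^ 4)" using c2 K0 B0 by (simp add: field_simps)
    then have "891/1000 * (300000 * ln n) \<le> 891/1000 * (n * p ^ 4 / K * (1 / real B ^ 4))"
      by (intro mult_left_mono) auto
    also have "\<dots> = 891/1000 * (n * p ^ 4 / K) * (1 / real B ^ 4)" by simp
    also have "\<dots> \<le> x * (1 / real B ^ 4)" using xn by (intro mult_right_mono) auto
    also have "\<dots> \<le> x * \<pi>" using \<pi> x0 by (intro mult_left_mono) auto
    finally show ?thesis using L0 by (simp add: power2_eq_square)
  qed
  have np: "n * p ^ 4 \<le> n * p\<^sup>2" "n * p ^ 4 \<le> n * p"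
    using p_powers n20 by (intro mult_left_mono; simp)+
  have Bp: "1 / real B ^ 4 \<le> 1 / real B ^ 2" "1 / real B ^ 4 \<le> 1 / real B"
    using B1 power_increasing[of 2 4 "real B"] power_increasing[of 1 4 "real B"]
    by (auto intro!: divide_left_mono simp: B0)
  have pc: "1 / real B ^ k \<le> 1" "0 \<le> 1 / real B ^ k" for k
    using B1 by (auto simp: field_simps)
  have cC: "real (card {3..<B}) / real B = 1 - 3 / real B" using B by (simp add: field_simps of_nat_diff)
  have star: "test_ok E B (6 * ln n) (t_star G C \<pi> t (v, c)) \<and> test_ok E B (6 * ln n) (t_costar G C \<pi> t (v, c))"
    if v: "v \<in> V" "c < K" and G: "G \<subseteq> E" and C: "C \<subseteq> {..<B}" "real (card C) / real B = \<pi>"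
      and t: "0 \<le> t" "t \<le> 1" and pi: "0 \<le> \<pi>" "\<pi> \<le> 1"
      and l: "6 * ln n \<le> t\<^sup>2 * (card {x\<in>G `` {v}. part x = c} * \<pi>) / 4"
        "6 * ln n \<le> t\<^sup>2 * (card {x\<in>G\<inverse> `` {v}. part x = c} * \<pi>) / 4"
    for G C v c and \<pi> t :: real
  proof -
    have f: "finite {x\<in>G `` {v}. part x = c}" "finite {x\<in>G\<inverse> `` {v}. part x = c}"
      using finite_neighbours[OF G, of "{v}"] by (auto intro: finite_subset[rotated])
    show ?thesis unfolding t_star_def t_costar_def case_prod_conv test_ok.simps
    proof (intro conjI ballI impI)
      show "finite {x\<in>G `` {v}. part x = c}" "finite {x\<in>G\<inverse> `` {v}. part x = c}" by (rule f)+
    qed (use G C t pi l in auto)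
  qed
  have mid: "test_ok E B (6 * ln n) (t_mid B i j ((a, b), c))"
    if ab: "(a, b) \<in> pairs" and c: "c < K" and ij: "i < B" "j < B" for a b c i j
  proof -
    let ?S = "{x\<in>mid a b. part x = c}"
    have V: "a \<in> V" "b \<in> V" "a \<noteq> b" using ab by (auto simp: pairs_def)
    have E: "(a, x) \<in> E \<and> (x, b) \<in> E \<and> x \<noteq> a \<and> x \<noteq> b" if "x \<in> ?S" for x
      using that mid_noteq[of x a b] by (auto simp: mid_def)
    have l: "6 * ln n \<le> (1/100)\<^sup>2 * (real (card ?S) * (1 / real B ^ 2)) / 4"
      using pmid[OF V c] np(1) Bp(1) by (intro t2[of "n * p\<^sup>2"]) auto
    have pr: "(\<Prod>i'\<in>{(a, x), (x, b)}. real (card (if fst i' = a then {i} else {j})) / real B) = 1 / real B ^ 2"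
      if "x \<in> ?S" for x using E[OF that] by (simp add: power2_eq_square)
    have dj: "{(a, x), (x, b)} \<inter> {(a, y), (y, b)} = {}" if "x \<in> ?S" "y \<in> ?S" "x \<noteq> y" for x y
      using E[OF that(1)] E[OF that(2)] that(3) by auto
    show ?thesis unfolding t_mid_def case_prod_conv test_ok.simps
    proof (intro conjI ballI impI)
      show "finite ?S" using finite_mid by simp
      show "{(a, x), (x, b)} \<subseteq> E" if "x \<in> ?S" for x using E[OF that] by simp
      show "(if fst e = a then {i} else {j}) \<subseteq> {..<B}" for e using ij by simp
      show "(\<Prod>i'\<in>{(a, x), (x, b)}. real (card (if fst i' = a then {i} else {j})) / real B) = 1 / (real B)\<^sup>2"
        if "x \<in> ?S" for x by (rule pr[OF that])
      show "{(a, x), (x, b)} \<inter> {(a, y), (y, b)} = {}" if "x \<in> ?S" "y \<in> ?S" "x \<noteq> y" for x y by (rule dj[OF that])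
    qed (use l pc in auto)
  qed
  have four: "test_ok E B (6 * ln n) (t_four B ((a, b, a', b'), c))"
    if ab: "(a, b, a', b') \<in> quads" and c: "c < K" for a b a' b' c
  proof -
    let ?S = "{x\<in>mid a b \<inter> mid a' b'. part x = c}"
    let ?b = "\<lambda>x. {(a, x), (x, b), (a', x), (x, b')}"
    have ne: "a \<noteq> a'" "b \<noteq> b'" using ab by (auto simp: quads_def)
    have E: "(a, x) \<in> E \<and> (x, b) \<in> E \<and> (a', x) \<in> E \<and> (x, b') \<in> E \<and> x \<noteq> a \<and> x \<noteq> b \<and> x \<noteq> a' \<and> x \<noteq> b'" if "x \<in> ?S" for x
      using that mid_noteq[of x a b] mid_noteq[of x a' b'] by (auto simp: mid_def)
    have l: "6 * ln n \<le> (1/100)\<^sup>2 * (real (card ?S) * (1 / real B ^ 4)) / 4"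
      using pfour[OF ab c] by (intro t2[of "n * p ^ 4"]) auto
    have pr: "(\<Prod>i'\<in>?b x. real (card {0::nat}) / real B) = 1 / real B ^ 4" if "x \<in> ?S" for x
    proof -
      have "card (?b x) = 4" using E[OF that] ne by simp
      then show ?thesis by (simp add: power_divide)
    qed
    have dj: "?b x \<inter> ?b y = {}" if "x \<in> ?S" "y \<in> ?S" "x \<noteq> y" for x y
      using E[OF that(1)] E[OF that(2)] that(3) by auto
    show ?thesis unfolding t_four_def case_prod_conv test_ok.simps
    proof (intro conjI ballI impI)
      show "finite ?S" using finite_mid by simp
      show "?b x \<subseteq> E" if "x \<in> ?S" for x using E[OF that] by simp
      show "{0} \<subseteq> {..<B}" using B by simp
      show "(\<Prod>i'\<in>?b x. real (card {0::nat}) / real B) = 1 / (real B) ^ 4"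
        if "x \<in> ?S" for x by (rule pr[OF that])
      show "?b x \<inter> ?b y = {}" if "x \<in> ?S" "y \<in> ?S" "x \<noteq> y" for x y by (rule dj[OF that])
    qed (use l pc in auto)
  qed
  have starF: "test_ok E B (6 * ln n) (t_star F {3..<B} (1 - 3 / real B) \<tau> (v, c)) \<and>
      test_ok E B (6 * ln n) (t_costar F {3..<B} (1 - 3 / real B) \<tau> (v, c))" if "v \<in> V" "c < K" for v c
    using pF[OF that] tau pi0 by (intro star that FE cC t1) auto
  have starE: "test_ok E B (6 * ln n) (t_star E {0} (1 / real B) (1/100) (v, c)) \<and>
      test_ok E B (6 * ln n) (t_costar E {0} (1 / real B) (1/100) (v, c))" if "v \<in> V" "c < K" for v c
  proof (intro star that)
    show "6 * ln n \<le> (1/100)\<^sup>2 * (card {x\<in>E `` {v}. part x = c} * (1 / real B)) / 4"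
      "6 * ln n \<le> (1/100)\<^sup>2 * (card {x\<in>E\<inverse> `` {v}. part x = c} * (1 / real B)) / 4"
      using pE[OF that] by (intro t2[OF _ np(2) Bp(2)]; simp)+
  qed (use B in auto)
  have "(\<exists>z\<in>V \<times> {..<K}. q = t_star F {3..<B} (1 - 3 / real B) \<tau> z) \<or>
    (\<exists>z\<in>V \<times> {..<K}. q = t_costar F {3..<B} (1 - 3 / real B) \<tau> z) \<or>
    (\<exists>z\<in>V \<times> {..<K}. q = t_star E {0} (1 / real B) (1/100) z) \<or>
    (\<exists>z\<in>V \<times> {..<K}. q = t_costar E {0} (1 / real B) (1/100) z) \<or>
    (\<exists>z\<in>pairs \<times> {..<K}. q = t_mid B 0 0 z) \<or> (\<exists>z\<in>pairs \<times> {..<K}. q = t_mid B 1 2 z) \<or>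
    (\<exists>z\<in>quads \<times> {..<K}. q = t_four B z)"
    using q unfolding tests_def by blast
  then show ?thesis
    using starF starE mid[of _ _ _ 0 0] mid[of _ _ _ 1 2] four B by (elim disjE bexE) auto
qed

lemma colouring_exists:
  assumes B: "6 \<le> B" and n20: "20 \<le> n" and Kn: "real K \<le> n" and c1: "96 * K * ln n \<le> \<tau>\<^sup>2 * r"
    and c2: "300000 * K * real B ^ 4 * ln n \<le> n * p ^ 4"
  shows "\<exists>col. coloured_relation V E n p \<epsilon> F r K \<tau> part B col"
proof -
  have fE: "finite E" using EV fV finite_subset by blast
  have "\<exists>col. (\<forall>e\<in>E. col e < B) \<and> (\<forall>q\<in>tests B. test_passed col q)"
  proof (rule random_colouring[OF fE _ finite_tests])
    show "0 < B" using B by simp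
    show "test_ok E B (6 * ln n) q" if "q \<in> tests B" for q by (rule tests_ok[OF B n20 c1 c2 that])
    show "2 * real (card (tests B)) * exp (- (6 * ln n)) < 1" by (rule six_log_few[OF n20 card_tests[OF n20 Kn]])
  qed
  then obtain col where cB: "\<And>e. e \<in> E \<Longrightarrow> col e < B" and pass: "\<And>q. q \<in> tests B \<Longrightarrow> test_passed col q"
    by blast
  have K0: "0 < real K" and B0: "0 < real B" using K B by auto
  have pi0: "0 \<le> 1 - 3 / real B" using B by (simp add: field_simps)
  have two: "(1 - 2 * \<tau>) * (\<pi> * z) \<le> k \<and> k \<le> (1 + 3 * \<tau>) * (\<pi> * z)"
    if x: "(1 - \<tau>) * z \<le> x" "x \<le> (1 + \<tau>) * z" and k: "(1 - \<tau>) * (x * \<pi>) \<le> k" "k \<le> (1 + \<tau>) * (x * \<pi>)"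
      and \<pi>: "0 \<le> \<pi>" and z: "0 \<le> z" for x z \<pi> k :: real
  proof
    have pz: "0 \<le> \<pi> * z" using \<pi> z by simp
    have "(1 - 2 * \<tau>) * (\<pi> * z) \<le> ((1 - \<tau>) * (1 - \<tau>)) * (\<pi> * z)"
      using pz by (intro mult_right_mono) (simp_all add: algebra_simps)
    also have "\<dots> = (1 - \<tau>) * ((1 - \<tau>) * z * \<pi>)" by (simp add: algebra_simps)
    also have "\<dots> \<le> (1 - \<tau>) * (x * \<pi>)" using x(1) \<pi> tau by (intro mult_left_mono mult_right_mono) auto
    finally show "(1 - 2 * \<tau>) * (\<pi> * z) \<le> k" using k(1) by linarith
    have "k \<le> (1 + \<tau>) * (x * \<pi>)" by (rule k(2))
    also have "\<dots> \<le> (1 + \<tau>) * ((1 + \<tau>) * z * \<pi>)" using x(2) \<pi> tau by (intro mult_left_mono mult_right_mono) auto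
    also have "\<dots> = (1 + 2 * \<tau> + \<tau> * \<tau>) * (\<pi> * z)" by (simp add: algebra_simps)
    also have "\<dots> \<le> (1 + 3 * \<tau>) * (\<pi> * z)"
    proof (rule mult_right_mono[OF _ pz])
      have "\<tau> * \<tau> \<le> \<tau> * 1" using tau by (intro mult_left_mono) auto
      then show "1 + 2 * \<tau> + \<tau> * \<tau> \<le> 1 + 3 * \<tau>" by simp
    qed
    finally show "k \<le> (1 + 3 * \<tau>) * (\<pi> * z)" .
  qed
  have low: "q * z * \<pi> \<le> k" if "99/100 * (9/10) * z \<le> x" "(1 - 1/100) * (x * \<pi>) \<le> k" "0 \<le> \<pi>" "q \<le> 882/1000" "0 \<le> z"
    for x z \<pi> k q :: real
  proof -
    have "q * z * \<pi> \<le> 882/1000 * z * \<pi>" using that by (intro mult_right_mono) auto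
    also have "\<dots> \<le> 99/100 * (99/100 * (9/10) * z * \<pi>)" using that by (simp add: mult_nonneg_nonneg)
    also have "\<dots> \<le> 99/100 * (x * \<pi>)" using that by (intro mult_left_mono mult_right_mono) auto
    finally show ?thesis using that(2) by simp
  qed
  have up: "k \<le> 9/8 * z * \<pi>" if "x \<le> 101/100 * (11/10) * z" "k \<le> (1 + 1/100) * (x * \<pi>)" "0 \<le> \<pi>" "0 \<le> z"
    for x z \<pi> k :: real
  proof -
    have "k \<le> 101/100 * (x * \<pi>)" using that(2) by simp
    also have "\<dots> \<le> 101/100 * (101/100 * (11/10) * z * \<pi>)" using that by (intro mult_left_mono mult_right_mono) auto
    also have "\<dots> \<le> 9/8 * z * \<pi>" using that by (simp add: mult_nonneg_nonneg)
    finally show ?thesis .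
  qed
  have starF: "{x\<in>{x\<in>F `` {v}. part x = c}. \<forall>i\<in>{(v, x)}. col i \<in> {3..<B}} = {x\<in>F `` {v}. part x = c \<and> 3 \<le> col (v, x)}"
    "{x\<in>{x\<in>F\<inverse> `` {v}. part x = c}. \<forall>i\<in>{(x, v)}. col i \<in> {3..<B}} = {x\<in>F\<inverse> `` {v}. part x = c \<and> 3 \<le> col (x, v)}" for v c
    using cB FE by auto
  have starE: "{x\<in>{x\<in>E `` {v}. part x = c}. \<forall>i\<in>{(v, x)}. col i \<in> {0}} = {x\<in>E `` {v}. part x = c \<and> col (v, x) = 0}"
    "{x\<in>{x\<in>E\<inverse> `` {v}. part x = c}. \<forall>i\<in>{(x, v)}. col i \<in> {0}} = {x\<in>E\<inverse> `` {v}. part x = c \<and> col (x, v) = 0}" for v c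
    by auto
  have mids: "{x\<in>{x\<in>mid a b. part x = c}. \<forall>e\<in>{(a, x), (x, b)}. col e \<in> (if fst e = a then {i} else {j})}
      = {x\<in>mid a b. part x = c \<and> col (a, x) = i \<and> col (x, b) = j}" for a b c i j
    using mid_noteq by auto
  have fours: "{x\<in>{x\<in>mid a b \<inter> mid a' b'. part x = c}. \<forall>e\<in>{(a, x), (x, b), (a', x), (x, b')}. col e \<in> {0}}
      = {x\<in>mid a b \<inter> mid a' b'. part x = c \<and> col (a, x) = 0 \<and> col (x, b) = 0 \<and> col (a', x) = 0 \<and> col (x, b') = 0}" for a b a' b' c
    by auto
  have n0: "0 \<le> n" "0 \<le> p" using n p by auto
  have "coloured_relation V E n p \<epsilon> F r K \<tau> part B col"
  proof unfold_locales
    show "6 \<le> B" by (rule B)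
    show "col e < B" if "e \<in> E" for e by (rule cB[OF that])
    fix c assume c: "c < K"
    note T = tests_intros[OF c, of _ B]
    show "(1 - 2 * \<tau>) * ((1 - 3 / B) * (r / K)) \<le> card {x\<in>F `` {v}. part x = c \<and> 3 \<le> col (v, x)} \<and>
      card {x\<in>F `` {v}. part x = c \<and> 3 \<le> col (v, x)} \<le> (1 + 3 * \<tau>) * ((1 - 3 / B) * (r / K)) \<and>
      (1 - 2 * \<tau>) * ((1 - 3 / B) * (r / K)) \<le> card {x\<in>F\<inverse> `` {v}. part x = c \<and> 3 \<le> col (x, v)} \<and>
      card {x\<in>F\<inverse> `` {v}. part x = c \<and> 3 \<le> col (x, v)} \<le> (1 + 3 * \<tau>) * ((1 - 3 / B) * (r / K))"
      if v: "v \<in> V" for v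
    proof -
      note a = pass[OF T(1)[OF v], unfolded t_star_def case_prod_conv test_passed.simps starF]
      note b = pass[OF T(2)[OF v], unfolded t_costar_def case_prod_conv test_passed.simps starF]
      have z: "0 \<le> r / K" by simp
      show ?thesis using pF[OF v c] a b pi0 z
        two[of "r / K" "real (card {x\<in>F `` {v}. part x = c})" "1 - 3 / real B"]
        two[of "r / K" "real (card {x\<in>F\<inverse> `` {v}. part x = c})" "1 - 3 / real B"] by blast
    qed
    show "881/1000 * (n / K * (p / B)) \<le> card {x\<in>E `` {v}. part x = c \<and> col (v, x) = 0} \<and>
      881/1000 * (n / K * (p / B)) \<le> card {x\<in>E\<inverse> `` {v}. part x = c \<and> col (x, v) = 0}"
      if v: "v \<in> V" for v
    proof -
      note a = pass[OF T(3)[OF v], unfolded t_star_def case_prod_conv test_passed.simps starE]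
      note b = pass[OF T(4)[OF v], unfolded t_costar_def case_prod_conv test_passed.simps starE]
      have z: "0 \<le> n * p / K" using n0 by simp
      have i: "0 \<le> 1 / real B" by simp
      have "881/1000 * (n * p / K) * (1 / B) \<le> card {x\<in>E `` {v}. part x = c \<and> col (v, x) = 0}"
        "881/1000 * (n * p / K) * (1 / B) \<le> card {x\<in>E\<inverse> `` {v}. part x = c \<and> col (x, v) = 0}"
        by (rule low[OF _ conjunct1[OF a] i _ z] low[OF _ conjunct1[OF b] i _ z]; use pE[OF v c] in simp)+
      then show ?thesis by simp
    qed
    show "88/100 * (n / K * (p / B)\<^sup>2) \<le> card {x\<in>mid a b. part x = c \<and> col (a, x) = 0 \<and> col (x, b) = 0} \<and>
      card {x\<in>mid a b. part x = c \<and> col (a, x) = 0 \<and> col (x, b) = 0} \<le> 9/8 * (n / K * (p / B)\<^sup>2) \<and>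
      88/100 * (n / K * (p / B)\<^sup>2) \<le> card {x\<in>mid a b. part x = c \<and> col (a, x) = 1 \<and> col (x, b) = 2}"
      if ab: "a \<in> V" "b \<in> V" "a \<noteq> b" for a b
    proof -
      have pr: "(a, b) \<in> pairs" using ab by (simp add: pairs_def)
      note m = pass[OF tests_intros(5)[OF c pr, of B], unfolded t_mid_def case_prod_conv test_passed.simps mids]
      note m' = pass[OF tests_intros(6)[OF c pr, of B], unfolded t_mid_def case_prod_conv test_passed.simps mids]
      have z: "0 \<le> n * p\<^sup>2 / K" using n0 by simp
      have i: "0 \<le> 1 / real B ^ 2" by simp
      have "88/100 * (n * p\<^sup>2 / K) * (1 / real B ^ 2) \<le> card {x\<in>mid a b. part x = c \<and> col (a, x) = 0 \<and> col (x, b) = 0}"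
        "88/100 * (n * p\<^sup>2 / K) * (1 / real B ^ 2) \<le> card {x\<in>mid a b. part x = c \<and> col (a, x) = 1 \<and> col (x, b) = 2}"
        "card {x\<in>mid a b. part x = c \<and> col (a, x) = 0 \<and> col (x, b) = 0} \<le> 9/8 * (n * p\<^sup>2 / K) * (1 / real B ^ 2)"
        by (rule low[OF _ conjunct1[OF m] i _ z] low[OF _ conjunct1[OF m'] i _ z] up[OF _ conjunct2[OF m] i z];
          use pmid[OF ab c] in simp)+
      then show ?thesis by (simp add: power_divide)
    qed
    show "card {x\<in>mid a b \<inter> mid a' b'. part x = c \<and> col (a, x) = 0 \<and> col (x, b) = 0 \<and> col (a', x) = 0 \<and> col (x, b') = 0}
        \<le> 9/8 * (n / K * (p / B) ^ 4)" if q: "(a, b, a', b') \<in> quads" for a b a' b'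
    proof -
      note m = pass[OF tests_intros(7)[OF c q, of B], unfolded t_four_def case_prod_conv test_passed.simps fours]
      have z: "0 \<le> n * p ^ 4 / K" using n0 by simp
      have i: "0 \<le> 1 / real B ^ 4" by simp
      have "card {x\<in>mid a b \<inter> mid a' b'. part x = c \<and> col (a, x) = 0 \<and> col (x, b) = 0 \<and> col (a', x) = 0 \<and> col (x, b') = 0}
        \<le> 9/8 * (n * p ^ 4 / K) * (1 / real B ^ 4)"
        by (rule up[OF _ conjunct2[OF m] i z]) (use pfour[OF q c] in simp)
      then show ?thesis by (simp add: power_divide)
    qed
  qed
  then show ?thesis by (intro exI[of _ col])
qed

end

section \<open>Hamilton cycles in uniform relations\<close>

text \<open>The relations between the parameters. By \<open>tdef\<close>, 1000 * K * 8 \<tau> \<mu>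
  equals \<open>d\<close>, so the gaps of a system are just small enough. \<open>KB\<close> keeps
  the usage of reserved arcs, of order np/K^2, below \<open>d\<close>. \<open>big\<close> is the
  concentration of the degrees in \<open>F\<close>: it makes \<tau>^2 r/K a large multiple of ln
  n.\<close>

locale packable_relation = coloured_relation V E n p \<epsilon> F r K \<tau> part B col
  for V :: "'a set" and E :: "('a \<times> 'a) set" and n p \<epsilon> :: real and F :: "('a \<times> 'a) set" and r K :: nat
    and \<tau> :: real and part :: "'a \<Rightarrow> nat" and B :: nat and col :: "'a \<times> 'a \<Rightarrow> nat" +
  assumes tdef: "\<tau> = p\<^sup>2 / (8000 * K * real B ^ 2)" and KB: "40000 * real B ^ 2 \<le> K * p"
    and rlo: "n * p / 3 \<le> r" and rhi: "r \<le> n * p" and ln1: "1 \<le> ln n" and n20: "20 \<le> n"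
    and big: "20000000000 * real K ^ 3 * real B ^ 4 * ln n \<le> n * p ^ 5"
begin

text \<open>The expected number of unreserved arcs of \<open>F\<close> from a vertex to a
  part.\<close>

definition D :: real where "D = (1 - 3 / B) * (r / K)"

text \<open>A bound for all degrees between two parts, so that this number of matchings suffices to
  cover every arc.\<close>

definition \<Delta> :: nat where "\<Delta> = nat \<lceil>(1 + 3 * \<tau>) * D\<rceil>"

text \<open>A bound for the difference between \<Delta> and the least degree: (1 + 3 \<tau>) D + 1
  minus (1 - 2 \<tau>) D. A vertex is missed by as many matchings as its degree falls short of
  \<Delta>.\<close>

definition h :: nat where "h = nat \<lfloor>5 * \<tau> * D + 1\<rfloor>"

definition \<mu> :: real where "\<mu> = n / K"

definition d :: real where "d = n / K * (p / B)\<^sup>2"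

lemma K1: "1 \<le> real K" and B1: "1 \<le> real B" and K8: "8 \<le> real K"
  using K B by auto

lemma big': "k \<le> 5 \<Longrightarrow> 20000000000 * real K ^ 3 * real B ^ 4 * ln n \<le> n * p ^ k"
proof -
  assume "k \<le> 5"
  then have "n * p ^ 5 \<le> n * p ^ k" using p n20 by (intro mult_left_mono power_decreasing) auto
  then show ?thesis using big by linarith
qed

lemma big_weak:
  assumes "i \<le> 3" "j \<le> 4" "k \<le> 5" "0 \<le> c" "c \<le> 20000000000"
  shows "c * real K ^ i * real B ^ j * ln n \<le> n * p ^ k" "c * real K ^ i * real B ^ j \<le> n * p ^ k"
proof -
  have KB: "real K ^ i * real B ^ j \<le> real K ^ 3 * real B ^ 4"
  proof (intro mult_mono)
    show "real K ^ i \<le> real K ^ 3" using assms(1) K1 by (rule power_increasing)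
    show "real B ^ j \<le> real B ^ 4" using assms(2) B1 by (rule power_increasing)
  qed auto
  have "c * (real K ^ i * real B ^ j) \<le> 20000000000 * (real K ^ 3 * real B ^ 4)"
    using KB assms by (intro mult_mono[OF _ KB]) auto
  then have "c * (real K ^ i * real B ^ j) * ln n \<le> 20000000000 * (real K ^ 3 * real B ^ 4) * ln n"
    using ln1 by (intro mult_right_mono) auto
  also have "\<dots> \<le> n * p ^ k" using big'[OF assms(3)] by (simp add: mult.assoc)
  finally show a: "c * real K ^ i * real B ^ j * ln n \<le> n * p ^ k" by (simp add: mult.assoc)
  have "c * real K ^ i * real B ^ j * 1 \<le> c * real K ^ i * real B ^ j * ln n"
    using ln1 assms by (intro mult_left_mono) auto
  then show "c * real K ^ i * real B ^ j \<le> n * p ^ k" using a by linarith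
qed

lemma d_eq: "d = n * p\<^sup>2 / (K * real B ^ 2)"
  by (simp add: d_def power_divide)

lemma d_large: "16000 * real K \<le> d" "40000 * ln n \<le> d"
proof -
  have KB0: "0 < real K * real B ^ 2" using K1 B1 by simp
  have "16000 * real K ^ 2 * real B ^ 2 \<le> n * p ^ 2" by (rule big_weak) auto
  then have "16000 * K * (real K * real B ^ 2) \<le> n * p ^ 2" by (simp add: power2_eq_square mult_ac)
  then show "16000 * real K \<le> d" unfolding d_eq using KB0 by (simp add: pos_le_divide_eq)
  have "40000 * real K ^ 1 * real B ^ 2 * ln n \<le> n * p ^ 2" by (rule big_weak) auto
  then have "40000 * ln n * (real K * real B ^ 2) \<le> n * p ^ 2" by (simp add: mult_ac)
  then show "40000 * ln n \<le> d" unfolding d_eq using KB0 by (simp add: pos_le_divide_eq)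
qed

lemma tau_mu: "\<tau> * \<mu> = d / (8000 * K)"
  by (simp add: tdef \<mu>_def d_eq mult_ac)

lemma tau_mu_large: "1 \<le> \<tau> * \<mu>"
  unfolding tau_mu using d_large K1 by (simp add: pos_le_divide_eq)

lemma D_bounds: "n * p / (6 * K) \<le> D" "D \<le> r / K" "0 < D"
proof -
  have B: "1/2 \<le> 1 - 3 / real B" "1 - 3 / real B \<le> 1" using B by (auto simp: field_simps)
  have "n * p / 3 / K \<le> r / K" using rlo K1 by (intro divide_right_mono) auto
  moreover have np: "0 < n * p / K" using n20 p K1 by simp
  ultimately have "1/2 * (n * p / 3 / K) \<le> (1 - 3 / real B) * (r / K)" using B by (intro mult_mono) auto
  then show l: "n * p / (6 * K) \<le> D" by (simp add: D_def)
  show "D \<le> r / K" unfolding D_def using B by (intro mult_left_le_one_le) auto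
  have "0 < n * p / (6 * K)" using np by simp
  then show "0 < D" using l by linarith
qed

lemma tau_D_large: "1 \<le> \<tau> * D"
proof -
  have KB0: "0 < 48000 * real K ^ 2 * real B ^ 2" using K1 B1 by simp
  have "48000 * real K ^ 2 * real B ^ 2 \<le> n * p ^ 3" by (rule big_weak) auto
  then have "1 \<le> n * p ^ 3 / (48000 * real K ^ 2 * real B ^ 2)" using KB0 by (simp add: pos_le_divide_eq)
  also have "\<dots> = \<tau> * (n * p / (6 * K))" by (simp add: tdef power2_eq_square power3_eq_cube mult_ac)
  also have "\<dots> \<le> \<tau> * D" using D_bounds tau by (intro mult_left_mono) auto
  finally show ?thesis .
qed

lemma Delta_bounds: "(1 + 3 * \<tau>) * D \<le> \<Delta>" "\<Delta> \<le> (1 + 3 * \<tau>) * D + 1" "0 < \<Delta>"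
proof -
  have z: "0 < (1 + 3 * \<tau>) * D" using tau D_bounds(3) by (intro mult_pos_pos) auto
  show l: "(1 + 3 * \<tau>) * D \<le> \<Delta>" unfolding \<Delta>_def by (rule real_nat_ceiling_ge)
  show "\<Delta> \<le> (1 + 3 * \<tau>) * D + 1" unfolding \<Delta>_def using z by linarith
  show "0 < \<Delta>" using l z by linarith
qed

text \<open>By \<open>KB\<close>, \<Delta>/K is about np/K^2 and at most about d/40000, so eight
  times this is well below d/1000. The product K h is about 5 \<tau> n p, which is p/1600 times
  \<open>d\<close>. The rounding terms are absorbed by d \<ge> 16000 K.\<close>

lemma usage_bound: "1000 * (8 * (real (\<Delta> div K) + 1) + K * real h) \<le> d"
proof -
  have K0: "0 < real K" using K1 by simp
  have npK: "n * p / K / K \<le> d / 40000"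
  proof -
    have "(n * p / K / K) * 40000 \<le> (n * p / K / K) * (K * p / real B ^ 2)"
      using KB B1 n20 p by (intro mult_left_mono) (auto simp: pos_le_divide_eq)
    also have "\<dots> = d" using K0 by (simp add: d_eq power2_eq_square)
    finally show ?thesis by (simp only: pos_le_divide_eq zero_less_numeral)
  qed
  have rK: "D \<le> n * p / K" using D_bounds(2) rhi K0 divide_right_mono[of "real r" "n * p" "real K"] by linarith
  have "real (\<Delta> div K) \<le> \<Delta> / K" by (rule of_nat_div_le_of_nat)
  also have "\<dots> \<le> ((1 + 3 * \<tau>) * D + 1) / K" using Delta_bounds(2) by (intro divide_right_mono) auto
  also have "\<dots> \<le> (103/100 * (n * p / K) + 1) / K"
  proof (intro divide_right_mono add_right_mono)
    show "(1 + 3 * \<tau>) * D \<le> 103/100 * (n * p / K)" using tau rK D_bounds by (intro mult_mono) auto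
  qed simp
  also have "\<dots> = 103/100 * (n * p / K / K) + 1 / K" by (simp add: add_divide_distrib)
  also have "\<dots> \<le> 103/100 * (n * p / K / K) + 1" using K1 by (intro add_left_mono) simp
  finally have 1: "real (\<Delta> div K) \<le> 103/100 * (d / 40000) + 1" using npK by linarith
  have "0 \<le> 5 * \<tau> * D + 1" using tau D_bounds by simp
  then have "real h \<le> 5 * \<tau> * D + 1" unfolding h_def by linarith
  also have "\<dots> \<le> 5 * \<tau> * (n * p / K) + 1" using rK tau by (intro add_right_mono mult_left_mono) auto
  finally have "K * real h \<le> K * (5 * \<tau> * (n * p / K) + 1)" using K0 by (intro mult_left_mono) auto
  also have "\<dots> = 5 / 8000 * p * d + K" using K0 by (simp add: tdef d_eq power2_eq_square distrib_left mult_ac)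
  also have "\<dots> \<le> 5 / 8000 * (1/10) * d + K"
    using p d_large K0 by (intro add_right_mono mult_right_mono mult_left_mono) auto
  finally have 2: "K * real h \<le> 5 / 80000 * d + K" by simp
  define x z where "x = real (\<Delta> div K)" and "z = K * real h"
  have "1000 * (8 * (x + 1) + z) \<le> d"
    using 1[folded x_def] 2[folded z_def] d_large(1) K8 by (simp add: field_simps)
  then show ?thesis by (simp only: x_def z_def)
qed

lemma few_bound: "real (2 * card V) * exp (- d / 20000) < 1"
proof -
  have n0: "0 < n" using n20 by simp
  have "exp (- d / 20000) \<le> exp (- (2 * ln n))" using d_large by simp
  also have "\<dots> = 1 / n ^ 2"
    using n0 exp_of_nat_mult[of 2 "ln n"] by (simp add: exp_minus field_simps)
  finally have "2 * n * exp (- d / 20000) \<le> 2 * n * (1 / n ^ 2)" using n0 by (intro mult_left_mono) auto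
  also have "\<dots> < 1" using n20 by (simp add: power2_eq_square field_simps)
  finally show ?thesis by (simp add: n)
qed

definition H :: "('a \<times> 'a) set" where "H = {(u, v) \<in> F. 3 \<le> col (u, v) \<and> part u \<noteq> part v}"

definition Hp :: "nat \<Rightarrow> nat \<Rightarrow> ('a \<times> 'a) set" where
  "Hp c c' = {(u, v) \<in> F. 3 \<le> col (u, v) \<and> part u = c \<and> part v = c'}"

lemma FV: "F \<subseteq> V \<times> V" using FE EV by blast

lemma Hp_Image:
  assumes "part u = c"
  shows "Hp c c' `` {u} = {x\<in>F `` {u}. part x = c' \<and> 3 \<le> col (u, x)}"
  using assms by (auto simp: Hp_def)

lemma Hp_Image_converse:
  assumes "part v = c'"
  shows "(Hp c c')\<inverse> `` {v} = {x\<in>F\<inverse> `` {v}. part x = c \<and> 3 \<le> col (x, v)}"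
  using assms by (auto simp: Hp_def)

lemma Hp_degrees:
  assumes "c < K" "c' < K"
  shows "u \<in> V \<Longrightarrow> part u = c \<Longrightarrow> (1 - 2 * \<tau>) * D \<le> card (Hp c c' `` {u}) \<and> card (Hp c c' `` {u}) \<le> \<Delta>"
    "v \<in> V \<Longrightarrow> part v = c' \<Longrightarrow> (1 - 2 * \<tau>) * D \<le> card ((Hp c c')\<inverse> `` {v}) \<and> card ((Hp c c')\<inverse> `` {v}) \<le> \<Delta>"
proof -
  show "(1 - 2 * \<tau>) * D \<le> card (Hp c c' `` {u}) \<and> card (Hp c c' `` {u}) \<le> \<Delta>" if "u \<in> V" "part u = c"
    using cF[OF that(1) assms(2), folded D_def] Delta_bounds(1) unfolding Hp_Image[OF that(2)] by linarith
  show "(1 - 2 * \<tau>) * D \<le> card ((Hp c c')\<inverse> `` {v}) \<and> card ((Hp c c')\<inverse> `` {v}) \<le> \<Delta>" if "v \<in> V" "part v = c'"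
    using cF[OF that(1) assms(1), folded D_def] Delta_bounds(1) unfolding Hp_Image_converse[OF that(2)] by linarith
qed

lemma Hp_card:
  assumes "c < K" "c' < K"
  shows "card {v\<in>V. part v = c} * ((1 - 2 * \<tau>) * D) \<le> card (Hp c c')"
proof -
  let ?A = "{v\<in>V. part v = c}"
  have f: "finite ?A" "finite (Hp c c')"
    using fV finite_subset[OF _ finite_cartesian_product[OF fV fV], of "Hp c c'"] FV by (auto simp: Hp_def)
  have eq: "Hp c c' = Sigma ?A (\<lambda>u. Hp c c' `` {u})" using FV by (auto simp: Hp_def)
  have fi: "finite (Hp c c' `` {u})" for u using f(2) by (rule finite_Image)
  have "card ?A * ((1 - 2 * \<tau>) * D) = (\<Sum>u\<in>?A. (1 - 2 * \<tau>) * D)" by simp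
  also have "\<dots> \<le> (\<Sum>u\<in>?A. real (card (Hp c c' `` {u})))"
    by (rule sum_mono) (use Hp_degrees(1)[OF assms] in blast)
  also have "\<dots> = real (card (Sigma ?A (\<lambda>u. Hp c c' `` {u})))" using f(1) fi by simp
  finally show ?thesis using eq by simp
qed

lemma matchings:
  assumes "c < K" "c' < K"
  shows "\<exists>f :: 'a \<times> 'a \<Rightarrow> nat. (\<forall>e\<in>Hp c c'. f e < \<Delta>) \<and>
    (\<forall>t. inj_on fst {e\<in>Hp c c'. f e = t} \<and> inj_on snd {e\<in>Hp c c'. f e = t}) \<and>
    (\<forall>t<\<Delta>. card {v\<in>V. part v = c} - 8 * (\<tau> * \<mu>) \<le> card {e\<in>Hp c c'. f e = t})"
proof -
  let ?A = "{v\<in>V. part v = c}" and ?B = "{v\<in>V. part v = c'}"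
  define s where "s = nat \<lfloor>card ?A * ((1 - 2 * \<tau>) * D) / \<Delta>\<rfloor>"
  have D0: "0 < real \<Delta>" using Delta_bounds(3) by simp
  have q0: "0 \<le> card ?A * ((1 - 2 * \<tau>) * D) / \<Delta>"
    using tau D_bounds(3) by (intro divide_nonneg_nonneg mult_nonneg_nonneg) auto
  have s: "real s \<le> card ?A * ((1 - 2 * \<tau>) * D) / \<Delta>" "card ?A * ((1 - 2 * \<tau>) * D) / \<Delta> - 1 \<le> real s"
    unfolding s_def using q0 by linarith+
  have "\<exists>f :: 'a \<times> 'a \<Rightarrow> nat. (\<forall>e\<in>Hp c c'. f e < \<Delta>) \<and>
    (\<forall>t. inj_on fst {e\<in>Hp c c'. f e = t} \<and> inj_on snd {e\<in>Hp c c'. f e = t}) \<and>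
    (\<forall>t<\<Delta>. s \<le> card {e\<in>Hp c c'. f e = t})"
  proof (rule balanced_edge_colouring)
    show "finite ?A" "finite ?B" using fV by auto
    show "Hp c c' \<subseteq> ?A \<times> ?B" using FV by (auto simp: Hp_def)
    show "card (Hp c c' `` {a}) \<le> \<Delta>" if "a \<in> ?A" for a using Hp_degrees(1)[OF assms] that by blast
    show "card ((Hp c c')\<inverse> `` {a}) \<le> \<Delta>" if "a \<in> ?B" for a using Hp_degrees(2)[OF assms] that by blast
    show "0 < \<Delta>" by (rule Delta_bounds(3))
    have "real \<Delta> * real s \<le> card ?A * ((1 - 2 * \<tau>) * D)" using s(1) D0 by (simp add: field_simps)
    also have "\<dots> \<le> card (Hp c c')" by (rule Hp_card[OF assms])
    finally show "\<Delta> * s \<le> card (Hp c c')" by (simp flip: of_nat_mult)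
  qed
  moreover have "card ?A - 8 * (\<tau> * \<mu>) \<le> s"
  proof -
    \<comment> \<open>Rounding up in \<Delta> costs at most \<tau> D, so the ratio of least degree
      and number of matchings is at least (1 - 2 \<tau>)/(1 + 4 \<tau>) \<ge> 1 - 6 \<tau>. The part
      size of up to 1.01 \<mu> and the rounding in \<open>s\<close> then enlarge 6 to at most
      8.\<close>
    have "(1 - 6 * \<tau>) * \<Delta> \<le> (1 - 2 * \<tau>) * D"
    proof -
      have "real \<Delta> \<le> (1 + 4 * \<tau>) * D" using Delta_bounds(2) tau_D_large by (simp add: algebra_simps)
      then have "(1 - 6 * \<tau>) * \<Delta> \<le> (1 - 6 * \<tau>) * ((1 + 4 * \<tau>) * D)" using tau by (intro mult_left_mono) auto
      also have "\<dots> = ((1 - 2 * \<tau>) - 24 * \<tau> * \<tau>) * D" by (simp add: algebra_simps)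
      also have "\<dots> \<le> (1 - 2 * \<tau>) * D" using tau D_bounds(3) by (intro mult_right_mono) auto
      finally show ?thesis .
    qed
    then have "(1 - 6 * \<tau>) \<le> (1 - 2 * \<tau>) * D / \<Delta>" using D0 by (simp add: pos_le_divide_eq)
    then have "card ?A * (1 - 6 * \<tau>) \<le> card ?A * ((1 - 2 * \<tau>) * D / \<Delta>)" by (intro mult_left_mono) auto
    then have 1: "card ?A * (1 - 6 * \<tau>) - 1 \<le> s" using s(2) by simp
    have "card ?A \<le> (1 + \<tau>) * \<mu>" using psize[OF assms(1)] by (simp add: \<mu>_def)
    also have "\<dots> \<le> 101/100 * \<mu>" using tau n20 by (intro mult_right_mono) (auto simp: \<mu>_def)
    finally have "6 * \<tau> * card ?A \<le> 6 * \<tau> * (101/100 * \<mu>)" using tau by (intro mult_left_mono) auto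
    then have "6 * \<tau> * card ?A \<le> 606/100 * (\<tau> * \<mu>)" by simp
    then show ?thesis using 1 tau_mu_large by (simp add: algebra_simps)
  qed
  ultimately show ?thesis by (elim exE conjE, intro exI conjI allI impI) (auto intro: order_trans)
qed

end

context packable_relation
begin

definition matching_number :: "nat \<Rightarrow> nat \<Rightarrow> 'a \<times> 'a \<Rightarrow> nat" where
  "matching_number c c' = (SOME f. (\<forall>e\<in>Hp c c'. f e < \<Delta>) \<and>
    (\<forall>t. inj_on fst {e\<in>Hp c c'. f e = t} \<and> inj_on snd {e\<in>Hp c c'. f e = t}) \<and>
    (\<forall>t<\<Delta>. card {v\<in>V. part v = c} - 8 * (\<tau> * \<mu>) \<le> card {e\<in>Hp c c'. f e = t}))"

definition mc :: "'a \<times> 'a \<Rightarrow> nat" where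
  "mc e = matching_number (part (fst e)) (part (snd e)) e"

lemma mc_props:
  assumes "c < K" "c' < K"
  shows "\<And>e. e \<in> Hp c c' \<Longrightarrow> mc e < \<Delta>"
    "\<And>u v v'. (u, v) \<in> Hp c c' \<Longrightarrow> (u, v') \<in> Hp c c' \<Longrightarrow> mc (u, v) = mc (u, v') \<Longrightarrow> v = v'"
    "\<And>u u' v. (u, v) \<in> Hp c c' \<Longrightarrow> (u', v) \<in> Hp c c' \<Longrightarrow> mc (u, v) = mc (u', v) \<Longrightarrow> u = u'"
    "\<And>t. t < \<Delta> \<Longrightarrow> card {v\<in>V. part v = c} - 8 * (\<tau> * \<mu>) \<le> card {e\<in>Hp c c'. mc e = t}"
proof -
  have m: "(\<forall>e\<in>Hp c c'. matching_number c c' e < \<Delta>) \<and>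
    (\<forall>t. inj_on fst {e\<in>Hp c c'. matching_number c c' e = t} \<and> inj_on snd {e\<in>Hp c c'. matching_number c c' e = t}) \<and>
    (\<forall>t<\<Delta>. card {v\<in>V. part v = c} - 8 * (\<tau> * \<mu>) \<le> card {e\<in>Hp c c'. matching_number c c' e = t})"
    unfolding matching_number_def by (rule someI_ex[OF matchings[OF assms]])
  have eq: "mc e = matching_number c c' e" if "e \<in> Hp c c'" for e
    using that by (auto simp: mc_def Hp_def)
  have set_eq: "{e\<in>Hp c c'. mc e = t} = {e\<in>Hp c c'. matching_number c c' e = t}" for t
    using eq by auto
  show "mc e < \<Delta>" if "e \<in> Hp c c'" for e using m eq[OF that] that by simp
  show "v = v'" if e: "(u, v) \<in> Hp c c'" "(u, v') \<in> Hp c c'" "mc (u, v) = mc (u, v')" for u v v'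
  proof -
    have "inj_on fst {e\<in>Hp c c'. mc e = mc (u, v)}" unfolding set_eq using m by blast
    then show ?thesis using e by (auto dest: inj_onD[where x = "(u, v)" and y = "(u, v')"])
  qed
  show "u = u'" if e: "(u, v) \<in> Hp c c'" "(u', v) \<in> Hp c c'" "mc (u, v) = mc (u', v)" for u u' v
  proof -
    have "inj_on snd {e\<in>Hp c c'. mc e = mc (u, v)}" unfolding set_eq using m by blast
    then show ?thesis using e by (auto dest: inj_onD[where x = "(u, v)" and y = "(u', v)"])
  qed
  show "card {v\<in>V. part v = c} - 8 * (\<tau> * \<mu>) \<le> card {e\<in>Hp c c'. mc e = t}" if "t < \<Delta>" for t
    unfolding set_eq using m that by blast
qed

lemma H_Hp:
  assumes "(u, v) \<in> H"
  shows "(u, v) \<in> Hp (part u) (part v)" "part u < K" "part v < K" "part u \<noteq> part v" "(u, v) \<in> E" "3 \<le> col (u, v)"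
  using assms FV FE part by (auto simp: H_def Hp_def)

lemma missing_bound:
  assumes fN: "finite N" and low: "(1 - 2 * \<tau>) * D \<le> card N" and f: "inj_on f N" "\<And>x. x \<in> N \<Longrightarrow> f x < \<Delta>"
  shows "card {t. t < \<Delta> \<and> \<not> (\<exists>x\<in>N. f x = t)} \<le> h"
proof -
  have "{t. t < \<Delta> \<and> \<not> (\<exists>x\<in>N. f x = t)} = {..<\<Delta>} - f ` N" by auto
  moreover have "f ` N \<subseteq> {..<\<Delta>}" using f by auto
  ultimately have "card {t. t < \<Delta> \<and> \<not> (\<exists>x\<in>N. f x = t)} = \<Delta> - card N"
    using fN f by (simp add: card_Diff_subset card_image)
  moreover have "real \<Delta> \<le> 5 * \<tau> * D + 1 + card N"
    using Delta_bounds(2) low by (simp add: algebra_simps)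
  then have "real (\<Delta> - card N) \<le> 5 * \<tau> * D + 1 \<or> \<Delta> - card N = 0" by linarith
  then have "\<Delta> - card N \<le> h" unfolding h_def by linarith
  ultimately show ?thesis by simp
qed

text \<open>The density of one colour is \<open>\<rho> = p / B\<close>; part sizes deviate by at
  most \<open>\<tau> * \<mu>\<close>, and a matching misses at most
  \<open>8 * (\<tau> * \<mu>)\<close> vertices of its first part.\<close>

sublocale packing_structure V E H part col mc K \<Delta> h \<mu> "p / B" d "\<tau> * \<mu>" "8 * (\<tau> * \<mu>)"
proof unfold_locales
  show "finite V" "E \<subseteq> V \<times> V" by (rule fV EV)+
  show "prime K" "8 \<le> K" by (rule K)+
  show "part v < K" if "v \<in> V" for v by (rule part[OF that])
  show "\<mu> - \<tau> * \<mu> \<le> card {v\<in>V. part v = c} \<and> card {v\<in>V. part v = c} \<le> \<mu> + \<tau> * \<mu>" if "c < K" for c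
    using psize[OF that] by (simp add: \<mu>_def algebra_simps add_divide_distrib diff_divide_distrib)
  show "H \<subseteq> E" using H_Hp by auto
  show "3 \<le> col e" if "e \<in> H" for e using that by (auto simp: H_def)
  show "v = v'" if "(u, v) \<in> H" "(u, v') \<in> H" "part v = part v'" "mc (u, v) = mc (u, v')" for u v v'
    using mc_props(2)[OF H_Hp(2,3)[OF that(1)] H_Hp(1)[OF that(1)] _ that(4)] H_Hp(1)[OF that(2)] that(3) by simp
  show "u = u'" if "(u, v) \<in> H" "(u', v) \<in> H" "part u = part u'" "mc (u, v) = mc (u', v)" for u u' v
    using mc_props(3)[OF H_Hp(2,3)[OF that(1)] H_Hp(1)[OF that(1)] _ that(4)] H_Hp(1)[OF that(2)] that(3) by simp
  show "card {v\<in>V. part v = c} - 8 * (\<tau> * \<mu>) \<le> card {e\<in>H. part (fst e) = c \<and> part (snd e) = c' \<and> mc e = t}"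
    if "c < K" "c' < K" "c \<noteq> c'" "t < \<Delta>" for c c' t
  proof -
    have "{e\<in>H. part (fst e) = c \<and> part (snd e) = c' \<and> mc e = t} = {e\<in>Hp c c'. mc e = t}"
      using that(3) by (auto simp: H_def Hp_def)
    then show ?thesis using mc_props(4)[OF that(1,2,4)] by simp
  qed
  show "card {t. t < \<Delta> \<and> \<not> (\<exists>v. (u, v) \<in> H \<and> part v = c \<and> mc (u, v) = t)} \<le> h"
    if u: "u \<in> V" and c: "c < K" "c \<noteq> part u" for u c
  proof -
    let ?N = "Hp (part u) c `` {u}"
    have "card {t. t < \<Delta> \<and> \<not> (\<exists>v\<in>?N. mc (u, v) = t)} \<le> h"
    proof (rule missing_bound)
      have "?N \<subseteq> V" using FV by (auto simp: Hp_def)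
      then show "finite ?N" using fV finite_subset by blast
      show "(1 - 2 * \<tau>) * D \<le> card ?N" using Hp_degrees(1)[OF part[OF u] c(1) u refl] by blast
      show "inj_on (\<lambda>v. mc (u, v)) ?N" using mc_props(2)[OF part[OF u] c(1)] by (intro inj_onI) blast
      show "mc (u, x) < \<Delta>" if "x \<in> ?N" for x using mc_props(1)[OF part[OF u] c(1)] that by blast
    qed
    moreover have "(\<exists>v. (u, v) \<in> H \<and> part v = c \<and> mc (u, v) = t) \<longleftrightarrow> (\<exists>v\<in>?N. mc (u, v) = t)" for t
      using c(2) by (auto simp: H_def Hp_def)
    ultimately show ?thesis by simp
  qed
  show "card {t. t < \<Delta> \<and> \<not> (\<exists>u. (u, v) \<in> H \<and> part u = c \<and> mc (u, v) = t)} \<le> h"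
    if v: "v \<in> V" and c: "c < K" "c \<noteq> part v" for v c
  proof -
    let ?N = "(Hp c (part v))\<inverse> `` {v}"
    have "card {t. t < \<Delta> \<and> \<not> (\<exists>u\<in>?N. mc (u, v) = t)} \<le> h"
    proof (rule missing_bound)
      have "?N \<subseteq> V" using FV by (auto simp: Hp_def)
      then show "finite ?N" using fV finite_subset by blast
      show "(1 - 2 * \<tau>) * D \<le> card ?N" using Hp_degrees(2)[OF c(1) part[OF v] v refl] by blast
      show "inj_on (\<lambda>u. mc (u, v)) ?N" using mc_props(3)[OF c(1) part[OF v]] by (intro inj_onI) blast
      show "mc (x, v) < \<Delta>" if "x \<in> ?N" for x using mc_props(1)[OF c(1) part[OF v]] that by blast
    qed
    moreover have "(\<exists>u. (u, v) \<in> H \<and> part u = c \<and> mc (u, v) = t) \<longleftrightarrow> (\<exists>u\<in>?N. mc (u, v) = t)" for t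
      using c(2) by (auto simp: H_def Hp_def)
    ultimately show ?thesis by simp
  qed
  have B0: "0 < real B" using B1 by simp
  show "0 < p / B" using p B0 by simp
  show "p / B \<le> 1" using p B1 by simp
  show "d = \<mu> * (p / B)\<^sup>2" by (simp add: d_def \<mu>_def)
  show "1000 \<le> d" using d_large(1) K1 by linarith
  show "0 < \<mu>" using n20 K1 by (simp add: \<mu>_def)
  have d0: "0 \<le> d" using d_large(1) K1 by linarith
  show "1000 * (\<tau> * \<mu>) \<le> d"
  proof -
    have "d / (8 * K) \<le> d" using d0 K1 by (simp add: divide_le_eq mult_le_cancel_left1)
    then show ?thesis by (simp add: tau_mu)
  qed
  show "0 \<le> \<tau> * \<mu>" using tau_mu_large by linarith
  then show "0 \<le> 8 * (\<tau> * \<mu>)" by simp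
  show "1000 * (K * (8 * (\<tau> * \<mu>))) \<le> d" using K1 by (simp add: tau_mu)
  have mid_eq: "{x\<in>V. part x = c \<and> (a, x) \<in> E \<and> col (a, x) = i \<and> (x, b) \<in> E \<and> col (x, b) = j} =
      {x\<in>mid a b. part x = c \<and> col (a, x) = i \<and> col (x, b) = j}" for a b c i j
    by (auto simp: mid_def)
  show "88/100 * d \<le> card {x\<in>V. part x = c \<and> (a, x) \<in> E \<and> col (a, x) = 0 \<and> (x, b) \<in> E \<and> col (x, b) = 0} \<and>
      card {x\<in>V. part x = c \<and> (a, x) \<in> E \<and> col (a, x) = 0 \<and> (x, b) \<in> E \<and> col (x, b) = 0} \<le> 9/8 * d"
    if "a \<in> V" "b \<in> V" "a \<noteq> b" "c < K" for a b c
    unfolding mid_eq d_def using cmid[OF that] by blast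
  show "88/100 * d \<le> card {x\<in>V. part x = c \<and> (a, x) \<in> E \<and> col (a, x) = 1 \<and> (x, b) \<in> E \<and> col (x, b) = 2}"
    if "a \<in> V" "b \<in> V" "a \<noteq> b" "c < K" for a b c
    unfolding mid_eq d_def using cmid[OF that] by blast
  show "card {x\<in>V. part x = c \<and> (a, x) \<in> E \<and> col (a, x) = 0 \<and> (x, b) \<in> E \<and> col (x, b) = 0 \<and>
          (a', x) \<in> E \<and> col (a', x) = 0 \<and> (x, b') \<in> E \<and> col (x, b') = 0} \<le> 9/8 * d * (p / B)\<^sup>2"
    if "a \<in> V" "b \<in> V" "a' \<in> V" "b' \<in> V" "a \<noteq> b" "a' \<noteq> b'" "a \<noteq> a'" "b \<noteq> b'" "a \<noteq> b' \<or> b \<noteq> a'" "c < K" for a b a' b' c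
  proof -
    have "{x\<in>V. part x = c \<and> (a, x) \<in> E \<and> col (a, x) = 0 \<and> (x, b) \<in> E \<and> col (x, b) = 0 \<and>
          (a', x) \<in> E \<and> col (a', x) = 0 \<and> (x, b') \<in> E \<and> col (x, b') = 0} =
        {x\<in>mid a b \<inter> mid a' b'. part x = c \<and> col (a, x) = 0 \<and> col (x, b) = 0 \<and> col (a', x) = 0 \<and> col (x, b') = 0}"
      by (auto simp: mid_def)
    moreover have "(a, b, a', b') \<in> quads" using that by (simp add: quads_def)
    moreover have "9/8 * d * (p / B)\<^sup>2 = 9/8 * (n / K * (p / B) ^ 4)"
      by (simp add: d_def power2_eq_square power4_eq_xxxx)
    ultimately show ?thesis using cfour[of a b a' b' c] that(10) by simp
  qed
  have deg: "881/1000 * (\<mu> * (p / B)) \<le> card {x\<in>E `` {v}. part x = c \<and> col (v, x) = 0}"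
    "881/1000 * (\<mu> * (p / B)) \<le> card {x\<in>E\<inverse> `` {v}. part x = c \<and> col (x, v) = 0}" if "v \<in> V" "c < K" for v c
    using cE[OF that] by (simp_all add: \<mu>_def)
  show "881/1000 * (\<mu> * (p / B)) \<le> card {a\<in>V. part a = c \<and> (a, x) \<in> E \<and> col (a, x) = 0}" if "x \<in> V" "c < K" for x c
  proof -
    have "{a\<in>V. part a = c \<and> (a, x) \<in> E \<and> col (a, x) = 0} = {a\<in>E\<inverse> `` {x}. part a = c \<and> col (a, x) = 0}"
      using EV by auto
    then show ?thesis using deg(2)[OF that] by simp
  qed
  show "881/1000 * (\<mu> * (p / B)) \<le> card {b\<in>V. part b = c \<and> (x, b) \<in> E \<and> col (x, b) = 0}" if "x \<in> V" "c < K" for x c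
  proof -
    have "{b\<in>V. part b = c \<and> (x, b) \<in> E \<and> col (x, b) = 0} = {b\<in>E `` {x}. part b = c \<and> col (x, b) = 0}"
      using EV by auto
    then show ?thesis using deg(1)[OF that] by simp
  qed
  show "1000 * (8 * (\<Delta> div K + 1) + K * h) \<le> d"
    using usage_bound by simp
  show "2 * card V * exp (- d / 20000) < 1" by (rule few_bound)
qed

text \<open>Every nonzero step and every matching number yield a cycle. The factor 1 - 1/K is the
  price of the arcs inside parts, 1 - 3/B that of the three reserved colours.\<close>

lemma card_systems: "(1 - 1 / K) * ((1 - 3 / B) * r) \<le> card systems"
proof -
  have "(1 - 1 / K) * ((1 - 3 / B) * r) = (K - 1) * D" using K1 by (simp add: D_def field_simps)
  also have "\<dots> \<le> (K - 1) * real \<Delta>"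
  proof (rule mult_left_mono)
    have "1 * D \<le> (1 + 3 * \<tau>) * D" using tau D_bounds(3) by (intro mult_right_mono) auto
    then show "D \<le> \<Delta>" using Delta_bounds(1) by simp
  qed (use K1 in simp)
  also have "\<dots> = card systems" using K1 by (simp add: systems_def of_nat_diff)
  finally show ?thesis .
qed

end

lemma (in uniform_relation) hamilton_packing:
  fixes K B r :: nat
  assumes K: "prime K" "8 \<le> K" and B: "6 \<le> B" and KB: "40000 * real B ^ 2 \<le> K * p"
    and big: "20000000000 * real K ^ 3 * real B ^ 4 * ln n \<le> n * p ^ 5"
    and ln1: "1 \<le> ln n" and n20: "20 \<le> n" and en: "3 \<le> \<epsilon>\<^sup>2 * (n * p\<^sup>2)"
    and r: "r = nat \<lfloor>(1 - 8/5 * sqrt \<epsilon>) * (n * p)\<rfloor>"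
  shows "\<exists>(S :: (nat \<times> nat) set) cyc. finite S \<and> (1 - 1 / K) * ((1 - 3 / B) * r) \<le> card S \<and>
    (\<forall>\<sigma>\<in>S. distinct (cyc \<sigma>) \<and> set (cyc \<sigma>) = V \<and> cyclic_arcs (cyc \<sigma>) \<subseteq> E) \<and>
    (\<forall>\<sigma>\<in>S. \<forall>\<tau>\<in>S. \<sigma> \<noteq> \<tau> \<longrightarrow> cyclic_arcs (cyc \<sigma>) \<inter> cyclic_arcs (cyc \<tau>) = {})"
proof -
  have K1: "1 \<le> real K" and B1: "1 \<le> real B" using K B by auto
  have npk: "n * p ^ 5 \<le> n * p ^ k" if "k \<le> 5" for k
    using p n20 that by (intro mult_left_mono power_decreasing) auto
  have KB1: "1 \<le> real K ^ 2 * real B ^ 4" using K1 B1 mult_mono[of 1 "real K ^ 2" 1 "real B ^ 4"] by simp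
  have K3: "real K \<le> real K ^ 3 * real B ^ 4"
  proof -
    have "real K * 1 \<le> real K * (real K ^ 2 * real B ^ 4)" using KB1 by (intro mult_left_mono) auto
    then show ?thesis by (simp add: power3_eq_cube power2_eq_square mult_ac)
  qed
  have bigK: "20000000000 * real K \<le> n * p ^ 5"
  proof -
    have "20000000000 * real K * 1 \<le> 20000000000 * (real K ^ 3 * real B ^ 4) * ln n"
      using K3 ln1 K1 by (intro mult_mono) auto
    then show ?thesis using big by (simp add: mult_ac)
  qed
  have np: "20000000000 * real K \<le> n * p" using bigK npk[of 1] by simp
  have np10: "10 \<le> n * p" using np K1 by linarith
  have np0: "0 \<le> n * p" using np10 by linarith
  have npn: "n * p \<le> n" using p n20 by (intro mult_left_le) auto
  have Kn: "real K \<le> n" using np npn K1 by linarith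
  have sq: "sqrt \<epsilon> \<le> 1/3" using e by (intro real_le_lsqrt) (auto simp: power2_eq_square)
  have se: "0 \<le> 1 - 8/5 * sqrt \<epsilon>" "0 \<le> sqrt \<epsilon>" using sq e by auto
  have rhi: "real r \<le> n * p"
  proof -
    have "(1 - 8/5 * sqrt \<epsilon>) * (n * p) \<le> 1 * (n * p)" using se np10 by (intro mult_right_mono) auto
    moreover have "0 \<le> (1 - 8/5 * sqrt \<epsilon>) * (n * p)" using se(1) np0 by (rule mult_nonneg_nonneg)
    ultimately show ?thesis unfolding r by linarith
  qed
  have rlo: "n * p / 3 \<le> r"
  proof -
    have "(1 - 8/5 * (1/3)) * (n * p) \<le> (1 - 8/5 * sqrt \<epsilon>) * (n * p)" using sq np10 by (intro mult_right_mono) auto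
    moreover have "(1 - 8/5 * sqrt \<epsilon>) * (n * p) - 1 \<le> r" unfolding r by linarith
    ultimately show ?thesis using np np10 K1 by simp
  qed
  obtain F where FE: "F \<subseteq> E" and F: "\<And>v. v \<in> V \<Longrightarrow> card (F `` {v}) = r \<and> card (F\<inverse> `` {v}) = r"
    using uniform_regular_factor[OF fV EV n p(1) e out inn co ci en r] by blast
  define \<tau> where "\<tau> = p\<^sup>2 / (8000 * K * real B ^ 2)"
  have KB0: "0 < real K * real B ^ 2" "1 \<le> real K * real B ^ 2"
    using K1 B1 mult_mono[of 1 "real K" 1 "real B ^ 2"] by auto
  have tau: "0 < \<tau>" using p KB0 by (simp add: \<tau>_def)
  have tau': "\<tau> \<le> 1/100"
  proof -
    have "p\<^sup>2 \<le> 1" using p by (simp add: power_le_one)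
    then have "p\<^sup>2 \<le> 1/100 * (8000 * (real K * real B ^ 2))" using KB0 by linarith
    then show ?thesis unfolding \<tau>_def using KB0 by (simp add: divide_le_eq mult_ac)
  qed
  have c1: "96 * K * ln n \<le> \<tau>\<^sup>2 * r"
  proof -
    have t2: "\<tau>\<^sup>2 = p ^ 4 / (64000000 * (real K ^ 2 * real B ^ 4))"
      by (simp add: \<tau>_def power_divide power_mult_distrib flip: power_mult)
    \<comment> \<open>18432000000 = 96 * 8000^2 * 3: the constant in \<open>c1\<close>, the square
      of the constant in the denominator of \<tau>, and the bound r \<ge> n p/3.\<close>
    have "18432000000 * (real K ^ 3 * real B ^ 4 * ln n) \<le> 20000000000 * (real K ^ 3 * real B ^ 4 * ln n)"
      using ln1 by (intro mult_right_mono mult_nonneg_nonneg) auto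
    then have "18432000000 * (real K ^ 3 * real B ^ 4 * ln n) \<le> n * p ^ 5" using big by (simp add: mult_ac)
    then have "96 * K * ln n * (64000000 * (real K ^ 2 * real B ^ 4)) \<le> p ^ 4 * (n * p / 3)"
      by (simp add: eval_nat_numeral mult_ac)
    also have "\<dots> \<le> p ^ 4 * r" using rlo p by (intro mult_left_mono) auto
    finally have "96 * K * ln n \<le> p ^ 4 * r / (64000000 * (real K ^ 2 * real B ^ 4))"
      using KB1 by (subst pos_le_divide_eq) auto
    then show ?thesis by (simp add: t2)
  qed
  have c2: "300000 * K * real B ^ 4 * ln n \<le> n * p ^ 4"
  proof -
    have "real K \<le> real K ^ 3" using K1 power_increasing[of 1 3 "real K"] by simp
    then have "300000 * real K * (real B ^ 4 * ln n) \<le> 20000000000 * real K ^ 3 * (real B ^ 4 * ln n)"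
      using ln1 K1 by (intro mult_right_mono mult_mono mult_nonneg_nonneg) auto
    also have "\<dots> \<le> n * p ^ 4" using big npk[of 4] by (simp add: mult_ac)
    finally show ?thesis by (simp add: mult_ac)
  qed
  have c3: "300000 * K * ln n \<le> n * p ^ 4"
  proof -
    have "300000 * K * ln n * 1 \<le> 300000 * K * ln n * real B ^ 4" using B1 ln1 by (intro mult_left_mono) auto
    then show ?thesis using c2 by (simp add: mult_ac)
  qed
  have rn: "real r \<le> n" using rhi npn by linarith
  obtain part where "partitioned_relation V E n p \<epsilon> F r K \<tau> part"
    using partition_exists[OF FE F K Kn tau tau' n20 rn c1 c3] by blast
  then interpret partitioned_relation V E n p \<epsilon> F r K \<tau> part .
  obtain col where "coloured_relation V E n p \<epsilon> F r K \<tau> part B col"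
    using colouring_exists[OF B n20 Kn c1 c2] by blast
  then interpret coloured_relation V E n p \<epsilon> F r K \<tau> part B col .
  interpret packable_relation V E n p \<epsilon> F r K \<tau> part B col
    by unfold_locales (fact \<tau>_def KB rlo rhi ln1 n20 big)+
  show ?thesis using packing finite_systems card_systems by blast
qed

section \<open>Hamilton cycles in uniform digraphs\<close>

lemma (in digraph) out_degree_arcs_ends: "out_degree G v = card (arcs_ends G `` {v})"
proof -
  have "inj_on (head G) (out_arcs G v)"
    by (intro inj_onI no_multi_arcs) (auto simp: arc_to_ends_def)
  moreover have "head G ` out_arcs G v = arcs_ends G `` {v}"
    by (auto simp: arcs_ends_def arc_to_ends_def image_iff)
  ultimately show ?thesis unfolding out_degree_def using card_image by metis
qed

lemma (in digraph) in_degree_arcs_ends: "in_degree G v = card ((arcs_ends G)\<inverse> `` {v})"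
proof -
  have "inj_on (tail G) (in_arcs G v)"
    by (intro inj_onI no_multi_arcs) (auto simp: arc_to_ends_def)
  moreover have "tail G ` in_arcs G v = (arcs_ends G)\<inverse> `` {v}"
    by (auto simp: arcs_ends_def arc_to_ends_def image_iff)
  ultimately show ?thesis unfolding in_degree_def using card_image by metis
qed

lemma (in digraph) uniform_relation_arcs_ends:
  assumes u: "uniform_digraph \<epsilon> p G" and p: "0 < p" "p < 1/10" and e: "0 < \<epsilon>" "\<epsilon> < 1/10"
  shows "uniform_relation (verts G) (arcs_ends G) (real (card (verts G))) p \<epsilon>"
proof -
  let ?V = "verts G" and ?E = "arcs_ends G" and ?n = "real (card (verts G))"
  have EV: "?E \<subseteq> ?V \<times> ?V" using adj_in_verts by auto
  have u1: "\<And>v. v \<in> ?V \<Longrightarrow> approx_within \<epsilon> (card (?E `` {v})) (?n * p) \<and> approx_within \<epsilon> (card (?E\<inverse> `` {v})) (?n * p)"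
    using u unfolding uniform_digraph_def Let_def out_degree_arcs_ends in_degree_arcs_ends by blast
  have u2: "\<And>a b. a \<in> ?V \<Longrightarrow> b \<in> ?V \<Longrightarrow> a \<noteq> b \<Longrightarrow>
      approx_within \<epsilon> (card {x\<in>?V. (a, x) \<in> ?E \<and> (b, x) \<in> ?E}) (?n * p ^ 2) \<and>
      approx_within \<epsilon> (card {x\<in>?V. (x, a) \<in> ?E \<and> (x, b) \<in> ?E}) (?n * p ^ 2) \<and>
      approx_within \<epsilon> (card {x\<in>?V. (a, x) \<in> ?E \<and> (x, b) \<in> ?E}) (?n * p ^ 2)"
    using u unfolding uniform_digraph_def Let_def by blast
  have u4: "\<And>a b c d. a \<in> ?V \<Longrightarrow> b \<in> ?V \<Longrightarrow> c \<in> ?V \<Longrightarrow> d \<in> ?V \<Longrightarrow>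
      a \<noteq> b \<Longrightarrow> a \<noteq> c \<Longrightarrow> a \<noteq> d \<Longrightarrow> b \<noteq> d \<Longrightarrow> c \<noteq> d \<Longrightarrow>
      approx_within \<epsilon> (card {x\<in>?V. (a, x) \<in> ?E \<and> (x, b) \<in> ?E \<and> (c, x) \<in> ?E \<and> (x, d) \<in> ?E}) (?n * p ^ 4)"
    using u unfolding uniform_digraph_def Let_def by blast
  have sets: "?E `` {a} \<inter> ?E `` {b} = {x\<in>?V. (a, x) \<in> ?E \<and> (b, x) \<in> ?E}"
    "?E\<inverse> `` {a} \<inter> ?E\<inverse> `` {b} = {x\<in>?V. (x, a) \<in> ?E \<and> (x, b) \<in> ?E}" for a b
    using EV by auto
  show ?thesis
  proof unfold_locales
    show "finite ?V" "?E \<subseteq> ?V \<times> ?V" using EV by auto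
    show "(v, v) \<notin> ?E" for v using adj_not_same by blast
    show "0 < p" "p \<le> 1/10" "0 < \<epsilon>" "\<epsilon> < 1/10" using p e by auto
    show "(1 - \<epsilon>) * (?n * p) \<le> card (?E `` {v}) \<and> card (?E `` {v}) \<le> (1 + \<epsilon>) * (?n * p)" if "v \<in> ?V" for v
      using u1[OF that] by (simp only: approx_within_def)
    show "(1 - \<epsilon>) * (?n * p) \<le> card (?E\<inverse> `` {v}) \<and> card (?E\<inverse> `` {v}) \<le> (1 + \<epsilon>) * (?n * p)" if "v \<in> ?V" for v
      using u1[OF that] by (simp only: approx_within_def)
    show "card (?E `` {a} \<inter> ?E `` {b}) \<le> (1 + \<epsilon>) * (?n * p\<^sup>2)" if "a \<in> ?V" "b \<in> ?V" "a \<noteq> b" for a b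
      using u2[OF that] by (simp only: approx_within_def sets)
    show "card (?E\<inverse> `` {a} \<inter> ?E\<inverse> `` {b}) \<le> (1 + \<epsilon>) * (?n * p\<^sup>2)" if "a \<in> ?V" "b \<in> ?V" "a \<noteq> b" for a b
      using u2[OF that] by (simp only: approx_within_def sets)
    show "(1 - \<epsilon>) * (?n * p\<^sup>2) \<le> card {x\<in>?V. (a, x) \<in> ?E \<and> (x, b) \<in> ?E} \<and>
      card {x\<in>?V. (a, x) \<in> ?E \<and> (x, b) \<in> ?E} \<le> (1 + \<epsilon>) * (?n * p\<^sup>2)" if "a \<in> ?V" "b \<in> ?V" "a \<noteq> b" for a b
      using u2[OF that] by (simp only: approx_within_def)
    show "(1 - \<epsilon>) * (?n * p ^ 4) \<le> card {x\<in>?V. (a, x) \<in> ?E \<and> (x, b) \<in> ?E \<and> (c, x) \<in> ?E \<and> (x, d) \<in> ?E} \<and>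
      card {x\<in>?V. (a, x) \<in> ?E \<and> (x, b) \<in> ?E \<and> (c, x) \<in> ?E \<and> (x, d) \<in> ?E} \<le> (1 + \<epsilon>) * (?n * p ^ 4)"
      if "a \<in> ?V" "b \<in> ?V" "c \<in> ?V" "d \<in> ?V" "a \<noteq> b" "a \<noteq> c" "a \<noteq> d" "b \<noteq> d" "c \<noteq> d" for a b c d
      using u4[OF that] by (simp only: approx_within_def)
  qed simp
qed

context wf_digraph
begin

lemma cas_of_ends:
  "xs \<noteq> [] \<Longrightarrow> map (arc_to_ends G) c = zip xs (tl xs @ [v]) \<Longrightarrow> cas (hd xs) c v"
proof (induction xs arbitrary: c)
  case (Cons x xs)
  show ?case
  proof (cases xs)
    case Nil
    then obtain a where "c = [a]" "arc_to_ends G a = (x, v)" using Cons.prems(2) by (auto simp: map_eq_Cons_conv)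
    then show ?thesis by (simp add: arc_to_ends_def)
  next
    case (Cons y ys)
    then obtain a c' where c: "c = a # c'" "arc_to_ends G a = (x, y)" "map (arc_to_ends G) c' = zip xs (tl xs @ [v])"
      using Cons.prems(2) by (auto simp: map_eq_Cons_conv)
    have "cas (hd xs) c' v" using Cons by (intro Cons.IH c(3)) simp
    then show ?thesis using c(1,2) Cons by (simp add: arc_to_ends_def)
  qed
qed simp

end

text \<open>Each pair of cyclically consecutive vertices is replaced by an arc with these ends. The
  tails of the resulting list are \<open>xs\<close> and the heads its rotation, so distinctness of
  \<open>xs\<close> gives what \<open>cycle\<close> demands.\<close>

lemma (in digraph) hamilton_cycle_of_vertices:
  assumes xs: "xs \<noteq> []" "distinct xs" "set xs = verts G" and E: "cyclic_arcs xs \<subseteq> arcs_ends G"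
  shows "\<exists>c. hamilton_cycle G c \<and> set c \<subseteq> arcs G \<and> arc_to_ends G ` set c = cyclic_arcs xs"
proof -
  define f where "f = inv_into (arcs G) (arc_to_ends G)"
  define c where "c = map f (zip xs (rotate1 xs))"
  have f: "f e \<in> arcs G" "arc_to_ends G (f e) = e" if "e \<in> set (zip xs (rotate1 xs))" for e
    using that E unfolding f_def cyclic_arcs_def arcs_ends_def by (auto intro: inv_into_into f_inv_into_f)
  have ends: "map (arc_to_ends G) c = zip xs (rotate1 xs)"
    unfolding c_def map_map by (rule map_idI) (simp add: f(2))
  have rot: "rotate1 xs = tl xs @ [hd xs]" using xs(1) by (cases xs) auto
  have cne: "c \<noteq> []" using xs(1) by (simp add: c_def)
  have arcs: "set c \<subseteq> arcs G" using f(1) by (auto simp: c_def)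
  have img: "arc_to_ends G ` set c = cyclic_arcs xs"
    using arg_cong[OF ends, of set] by (simp add: cyclic_arcs_def)
  have cas: "cas (hd xs) c (hd xs)" using xs(1) ends unfolding rot by (rule cas_of_ends)
  have tails: "map (tail G) c = xs"
    using arg_cong[OF ends, of "map fst"] by (simp add: comp_def arc_to_ends_def)
  have heads: "map (head G) c = rotate1 xs"
    using arg_cong[OF ends, of "map snd"] by (simp add: comp_def arc_to_ends_def)
  have tlv: "tl (awalk_verts (hd xs) c) = rotate1 xs"
    using cas cne heads by (simp add: awalk_verts_conv')
  have "cycle c" unfolding cycle_def
  proof (intro exI[of _ "hd xs"] conjI)
    show "awalk (hd xs) c (hd xs)" using cas arcs xs by (auto simp: awalk_def)
    show "distinct (tl (awalk_verts (hd xs) c))" using tlv xs(2) by simp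
    show "c \<noteq> []" by (rule cne)
  qed
  moreover have "tail G ` set c = verts G" using arg_cong[OF tails, of set] xs(3) by simp
  ultimately show ?thesis using arcs img by (auto simp: hamilton_cycle_def)
qed

section \<open>Counting covered arcs and choosing the parameters\<close>

lemma (in digraph) card_arcs_upper:
  fixes b :: real
  assumes "\<And>v. v \<in> verts G \<Longrightarrow> real (out_degree G v) \<le> b"
  shows "real (card (arcs G)) \<le> card (verts G) * b"
proof -
  have "arcs G = (\<Union>v\<in>verts G. out_arcs G v)" by auto
  then have "card (arcs G) \<le> (\<Sum>v\<in>verts G. out_degree G v)"
    unfolding out_degree_def using card_UN_le[OF finite_verts] by metis
  then have "real (card (arcs G)) \<le> (\<Sum>v\<in>verts G. real (out_degree G v))" by (simp flip: of_nat_sum)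
  also have "\<dots> \<le> (\<Sum>v\<in>verts G. b)" by (rule sum_mono) (rule assms)
  finally show ?thesis by simp
qed

text \<open>Only the number of cycles matters: each covers one arc per vertex and \<open>b\<close>
  bounds the out-degrees, so (1 - \<delta>) b disjoint cycles cover at least a share 1 - \<delta> of
  all arcs.\<close>

lemma (in digraph) uncovered_arcs:
  fixes cyc :: "'i \<Rightarrow> 'a list" and \<delta> b :: real
  assumes ne: "verts G \<noteq> {}" and S: "finite S"
    and cyc: "\<And>\<sigma>. \<sigma> \<in> S \<Longrightarrow> distinct (cyc \<sigma>) \<and> set (cyc \<sigma>) = verts G \<and> cyclic_arcs (cyc \<sigma>) \<subseteq> arcs_ends G"
    and dj: "\<And>\<sigma> \<tau>. \<sigma> \<in> S \<Longrightarrow> \<tau> \<in> S \<Longrightarrow> \<sigma> \<noteq> \<tau> \<Longrightarrow> cyclic_arcs (cyc \<sigma>) \<inter> cyclic_arcs (cyc \<tau>) = {}"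
    and b: "\<And>v. v \<in> verts G \<Longrightarrow> real (out_degree G v) \<le> b"
    and many: "(1 - \<delta>) * b \<le> card S" and \<delta>: "\<delta> \<le> 1"
  shows "\<exists>\<C>. (\<forall>c\<in>\<C>. hamilton_cycle G c) \<and> pairwise (\<lambda>c c'. set c \<inter> set c' = {}) \<C> \<and>
    real (card (arcs G - (\<Union>c\<in>\<C>. set c))) \<le> \<delta> * real (card (arcs G))"
proof -
  have "\<exists>c. hamilton_cycle G c \<and> set c \<subseteq> arcs G \<and> arc_to_ends G ` set c = cyclic_arcs (cyc \<sigma>)" if "\<sigma> \<in> S" for \<sigma>
  proof (rule hamilton_cycle_of_vertices)
    show "cyc \<sigma> \<noteq> []" using cyc[OF that] ne by auto
  qed (use cyc[OF that] in auto)
  then obtain c where c: "\<And>\<sigma>. \<sigma> \<in> S \<Longrightarrow> hamilton_cycle G (c \<sigma>) \<and> set (c \<sigma>) \<subseteq> arcs G \<and>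
      arc_to_ends G ` set (c \<sigma>) = cyclic_arcs (cyc \<sigma>)" by metis
  have cdj: "set (c \<sigma>) \<inter> set (c \<tau>) = {}" if "\<sigma> \<in> S" "\<tau> \<in> S" "\<sigma> \<noteq> \<tau>" for \<sigma> \<tau>
  proof -
    have "arc_to_ends G ` (set (c \<sigma>) \<inter> set (c \<tau>)) \<subseteq> cyclic_arcs (cyc \<sigma>) \<inter> cyclic_arcs (cyc \<tau>)"
      using c[OF that(1)] c[OF that(2)] by blast
    then show ?thesis using dj[OF that] by auto
  qed
  have cc: "card (set (c \<sigma>)) = card (verts G)" if "\<sigma> \<in> S" for \<sigma>
  proof -
    have "inj_on (arc_to_ends G) (set (c \<sigma>))" using c[OF that] inj_on_arc_to_ends inj_on_subset by blast
    then have "card (set (c \<sigma>)) = card (cyclic_arcs (cyc \<sigma>))" using c[OF that] card_image by metis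
    also have "\<dots> = card (verts G)" using cyc[OF that] cyclic_arcs_inj(3)[of "cyc \<sigma>"] distinct_card[of "cyc \<sigma>"] by simp
    finally show ?thesis .
  qed
  let ?U = "\<Union>\<sigma>\<in>S. set (c \<sigma>)"
  have U: "?U \<subseteq> arcs G" using c by blast
  have "card ?U = (\<Sum>\<sigma>\<in>S. card (set (c \<sigma>)))" using S cdj by (intro card_UN_disjoint) auto
  then have cU: "card ?U = card S * card (verts G)" using cc by simp
  have "(1 - \<delta>) * card (arcs G) \<le> (1 - \<delta>) * (card (verts G) * b)"
    using \<delta> card_arcs_upper[OF b] by (intro mult_left_mono) auto
  also have "\<dots> = card (verts G) * ((1 - \<delta>) * b)" by simp
  also have "\<dots> \<le> card (verts G) * real (card S)" using many by (intro mult_left_mono) auto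
  finally have "(1 - \<delta>) * card (arcs G) \<le> card ?U" by (simp add: cU mult.commute)
  moreover have "real (card (arcs G - ?U)) = real (card (arcs G)) - real (card ?U)"
  proof -
    have "finite ?U" using U finite_arcs by (rule finite_subset)
    moreover have "card ?U \<le> card (arcs G)" using U by (intro card_mono) auto
    ultimately show ?thesis using U by (simp only: card_Diff_subset of_nat_diff)
  qed
  ultimately have left: "real (card (arcs G - ?U)) \<le> \<delta> * card (arcs G)" by (simp add: algebra_simps)
  show ?thesis
  proof (intro exI[of _ "c ` S"] conjI)
    show "\<forall>c'\<in>c ` S. hamilton_cycle G c'" using c by blast
    show "pairwise (\<lambda>c c'. set c \<inter> set c' = {}) (c ` S)"
      unfolding pairwise_def using cdj by (metis imageE)
    show "real (card (arcs G - (\<Union>c'\<in>c ` S. set c'))) \<le> \<delta> * real (card (arcs G))"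
      using left by (simp only: image_image UN_simps)
  qed
qed

text \<open>B is of order 1/\<delta>, and K at most of order l/(p \<delta>^2), with the logarithm
  coming from the search for a prime. So K^3 B^4 l is at most a constant times l^4/(p^3
  \<delta>^10), while the growth hypothesis gives n p^8 \<delta>^10 \<ge> l^5; the spare factor l
  \<ge> 10^42 absorbs the constant.\<close>

lemma packing_parameters:
  fixes \<epsilon> p n \<delta> l :: real
  assumes p: "0 < p" "p < 1/10" and e: "0 < \<epsilon>" "\<epsilon> < 1/10" and n: "1 < n" and l: "l = ln n"
    and big: "10 ^ 42 \<le> l" and gr: "l ^ 5 \<le> \<epsilon> ^ 11 * n * p ^ 8" and \<delta>: "\<delta> = \<epsilon> powr (1/8)"
  shows "\<exists>K B :: nat. prime K \<and> 8 \<le> K \<and> 6 \<le> B \<and> 40000 * real B ^ 2 \<le> K * p \<and>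
    20000000000 * real K ^ 3 * real B ^ 4 * l \<le> n * p ^ 5 \<and> 24 \<le> B * \<delta> \<and> 3 \<le> \<epsilon>\<^sup>2 * (n * p\<^sup>2) \<and> 100 \<le> \<delta> * (n * p)"
proof -
  have d0: "0 < \<delta>" using e by (simp add: \<delta>)
  have d1: "\<delta> \<le> 1" unfolding \<delta> using e by (intro powr_le1) auto
  have d8: "\<delta> ^ 8 = \<epsilon>" using e by (simp add: \<delta> powr_power)
  have l1: "1 \<le> l" using big by simp
  have l5: "10 ^ 42 \<le> l ^ 5"
  proof -
    have "l ^ 1 \<le> l ^ 5" using l1 by (intro power_increasing) auto
    then show ?thesis using big by simp
  qed
  \<comment> \<open>\<epsilon>^11 is \<delta>^88, and p and \<delta> are at most 1, so lowering
    their exponents from 8 and 88 gives every lower bound on \<open>n\<close> used below.\<close>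
  have weak: "l ^ 5 \<le> n * p ^ i * \<delta> ^ j" if "i \<le> 8" "j \<le> 88" for i j
  proof -
    have "\<epsilon> ^ 11 = \<delta> ^ 88" by (simp flip: d8 power_mult)
    then have "\<epsilon> ^ 11 * p ^ 8 \<le> \<delta> ^ j * p ^ i"
      using that p d0 d1 by (auto intro!: mult_mono power_decreasing)
    then have "n * (\<epsilon> ^ 11 * p ^ 8) \<le> n * (\<delta> ^ j * p ^ i)" using n by (intro mult_left_mono) auto
    then show ?thesis using gr by (simp add: mult_ac)
  qed
  define B where "B = nat \<lceil>24 / \<delta>\<rceil>"
  have q24: "24 \<le> 24 / \<delta>" using d0 d1 by (simp add: pos_le_divide_eq)
  have Blo: "24 / \<delta> \<le> B" unfolding B_def by linarith
  have Bhi: "B \<le> 24 / \<delta> + 1" unfolding B_def using q24 by linarith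
  have B24: "24 \<le> real B" using Blo q24 by linarith
  have Bd: "24 \<le> B * \<delta>" using Blo d0 by (simp add: pos_divide_le_eq)
  have Bd': "B * \<delta> \<le> 25"
  proof -
    have "B * \<delta> \<le> (24 / \<delta> + 1) * \<delta>" using Bhi d0 by (intro mult_right_mono) auto
    also have "\<dots> = 24 + \<delta>" using d0 by (simp add: distrib_right)
    finally show ?thesis using d1 by linarith
  qed
  \<comment> \<open>A prime above this value satisfies the requirement
    \<open>40000 * real B ^ 2 \<le> K * p\<close>.\<close>
  define q where "q = 40000 * real B ^ 2 / p"
  define y where "y = nat \<lceil>q\<rceil>"
  have Bsq: "576 \<le> real B ^ 2" using power_mono[OF B24, of 2] by simp
  have "40000 * 576 * p \<le> 40000 * real B ^ 2" using Bsq p by linarith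
  then have q1: "23040000 \<le> q" unfolding q_def using p by (simp add: pos_le_divide_eq)
  have y: "q \<le> y" "y \<le> q + 1" unfolding y_def using q1 by linarith+
  have y3: "3 \<le> y" using y q1 by linarith
  obtain K where K: "prime K" "y < K" "real K \<le> 8 * y * ln y + 1" using prime_between[OF y3] by blast
  have qp: "q * (p * \<delta>\<^sup>2) \<le> 25000000"
  proof -
    have "q * (p * \<delta>\<^sup>2) = 40000 * (B * \<delta>)\<^sup>2" using p by (simp add: q_def power_mult_distrib)
    also have "\<dots> \<le> 40000 * 25\<^sup>2" using Bd' d0 by (intro mult_left_mono power_mono) auto
    finally show ?thesis by simp
  qed
  have pd: "0 < p * \<delta>\<^sup>2" "p * \<delta>\<^sup>2 \<le> 1" using p d0 d1 by (auto intro!: mult_le_one power_le_one)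
  have yp: "y * (p * \<delta>\<^sup>2) \<le> 25000001"
  proof -
    have "y * (p * \<delta>\<^sup>2) \<le> (q + 1) * (p * \<delta>\<^sup>2)" using y pd by (intro mult_right_mono) auto
    then show ?thesis using qp pd by (simp add: distrib_right)
  qed
  have yn: "real y \<le> n"
  proof -
    have "y * (p * \<delta>\<^sup>2) \<le> n * (p * \<delta>\<^sup>2)" using yp weak[of 1 2] l5 by (simp add: mult_ac)
    then show ?thesis using pd(1) by (simp only: mult_le_cancel_right_pos)
  qed
  have "ln y \<le> l" unfolding l using yn y3 n by (subst ln_le_cancel_iff) auto
  then have "8 * y * ln y \<le> 8 * y * l" by (intro mult_left_mono) auto
  moreover have "1 * 1 \<le> real y * l" using y3 l1 by (intro mult_mono) auto
  ultimately have K9: "real K \<le> 9 * (y * l)" using K(3) by simp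
  have Kp: "K * (p * \<delta>\<^sup>2) \<le> 240000000 * l"
  proof -
    have "K * (p * \<delta>\<^sup>2) \<le> 9 * (y * l) * (p * \<delta>\<^sup>2)" using K9 pd by (intro mult_right_mono) auto
    also have "\<dots> = 9 * l * (y * (p * \<delta>\<^sup>2))" by simp
    also have "\<dots> \<le> 9 * l * 25000001" using yp l1 by (intro mult_left_mono) auto
    finally show ?thesis using l1 by simp
  qed
  have main: "20000000000 * real K ^ 3 * real B ^ 4 * l \<le> n * p ^ 5"
  proof -
    \<comment> \<open>Multiplying by p^3 \<delta>^10 distributes p \<delta>^2 to each factor K and
      \<delta> to each factor B, which turns both into bounded quantities up to powers of
      \<open>l\<close>.\<close>
    have "(20000000000 * real K ^ 3 * real B ^ 4 * l) * (p ^ 3 * \<delta> ^ 10)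
        = 20000000000 * (K * (p * \<delta>\<^sup>2)) ^ 3 * (B * \<delta>) ^ 4 * l"
      by (simp add: power_mult_distrib eval_nat_numeral mult_ac)
    also have "\<dots> \<le> 20000000000 * (240000000 * l) ^ 3 * 25 ^ 4 * l"
    proof (rule mult_right_mono)
      have "(K * (p * \<delta>\<^sup>2)) ^ 3 \<le> (240000000 * l) ^ 3" using Kp pd by (intro power_mono) auto
      moreover have "(B * \<delta>) ^ 4 \<le> 25 ^ 4" using Bd' d0 by (intro power_mono) auto
      ultimately show "20000000000 * (K * (p * \<delta>\<^sup>2)) ^ 3 * (B * \<delta>) ^ 4 \<le> 20000000000 * (240000000 * l) ^ 3 * 25 ^ 4"
        using l1 d0 pd by (intro mult_mono mult_left_mono) auto
    qed (use l1 in simp)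
    also have "\<dots> = (20000000000 * 240000000 ^ 3 * 25 ^ 4) * l ^ 4"
      by (simp add: power_mult_distrib eval_nat_numeral)
    also have "\<dots> \<le> 10 ^ 42 * l ^ 4" using l1 by (intro mult_right_mono) auto
    also have "\<dots> \<le> l * l ^ 4" using big l1 by (intro mult_right_mono) auto
    also have "\<dots> = l ^ 5" by (simp add: eval_nat_numeral)
    also have "\<dots> \<le> n * p ^ 8 * \<delta> ^ 10" by (rule weak) auto
    also have "\<dots> = (n * p ^ 5) * (p ^ 3 * \<delta> ^ 10)" by (simp add: mult_ac flip: power_add)
    finally show ?thesis using p d0 by (simp add: mult_le_cancel_right_pos)
  qed
  have "40000 * real B ^ 2 \<le> K * p"
  proof -
    have "q \<le> K" using y(1) K(2) by linarith
    then show ?thesis unfolding q_def using p by (simp add: pos_divide_le_eq)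
  qed
  moreover have "8 \<le> K" "6 \<le> B" using K(2) y q1 B24 by linarith+
  moreover have "3 \<le> \<epsilon>\<^sup>2 * (n * p\<^sup>2)"
  proof -
    have "\<epsilon>\<^sup>2 = \<delta> ^ 16" by (simp flip: d8 power_mult)
    then show ?thesis using weak[of 2 16] l5 by (simp add: mult_ac)
  qed
  moreover have "100 \<le> \<delta> * (n * p)" using weak[of 1 1] l5 by (simp add: mult_ac)
  ultimately show ?thesis using K(1) main Bd by blast
qed

text \<open>The relative losses are \<delta>/800 from the parts, \<delta>/8 from the reserve, 8/5
  \<delta>^4 from the regular factor and \<delta>/100 from rounding; the excess of the out-degrees
  adds \<epsilon> = \<delta>^8. They sum to at most \<delta> because \<delta> \<le> 3/4, which
  follows from \<epsilon> < 1/10 as (3/4)^8 is just above 1/10.\<close>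

lemma enough_cycles:
  fixes \<epsilon> \<delta> m :: real and r K B :: nat
  assumes e: "0 < \<epsilon>" "\<epsilon> < 1/10" and \<delta>: "\<delta> = \<epsilon> powr (1/8)" and B: "24 \<le> B * \<delta>" and K: "100 * real B \<le> K"
    and m: "100 \<le> \<delta> * m" and r: "r = nat \<lfloor>(1 - 8/5 * sqrt \<epsilon>) * m\<rfloor>"
  shows "(1 - \<delta>) * ((1 + \<epsilon>) * m) \<le> (1 - 1 / K) * ((1 - 3 / B) * r)" "\<delta> \<le> 1"
proof -
  have d0: "0 < \<delta>" using e by (simp add: \<delta>)
  have d8: "\<delta> ^ 8 = \<epsilon>" using e by (simp add: \<delta> powr_power)
  have d34: "\<delta> \<le> 3/4"
  proof (rule power_le_imp_le_base)
    show "\<delta> ^ Suc 7 \<le> (3/4) ^ Suc 7" using d8 e by (simp add: power_divide)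
  qed simp
  then show "\<delta> \<le> 1" by simp
  have d4: "sqrt \<epsilon> = \<delta> ^ 4"
  proof (rule real_sqrt_unique)
    show "(\<delta> ^ 4)\<^sup>2 = \<epsilon>" using d8 by (simp flip: power_mult)
  qed (use d0 in simp)
  have m0: "0 < m" using m d0 by (metis less_le_trans zero_less_mult_pos zero_less_numeral)
  have B0: "0 < real B" using B d0 by (metis less_le_trans zero_less_mult_pos2 zero_less_numeral)
  have a: "3 / B \<le> \<delta> / 8" using B B0 by (simp add: field_simps)
  have b: "1 / K \<le> \<delta> / 800"
  proof -
    have "1 / K \<le> 1 / (100 * real B)" using K B0 by (intro divide_left_mono) auto
    also have "\<dots> \<le> \<delta> / 800" using B B0 by (simp add: field_simps)
    finally show ?thesis .
  qed
  have "(1 - 8/5 * \<delta> ^ 4) * m - 1 \<le> r" unfolding r d4[symmetric] by linarith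
  moreover have "1 \<le> \<delta> / 100 * m" using m by simp
  ultimately have r1: "(1 - 8/5 * \<delta> ^ 4 - \<delta> / 100) * m \<le> r" by (simp add: algebra_simps)
  have d3: "\<delta> ^ 3 \<le> 27/64" using power_mono[OF d34, of 3] d0 by (simp add: power_divide)
  have d7: "\<delta> ^ 7 \<le> 27/64 * (27/64) * (3/4)"
  proof -
    have "\<delta> ^ 7 = \<delta> ^ 3 * \<delta> ^ 3 * \<delta>" by (simp add: eval_nat_numeral)
    also have "\<dots> \<le> 27/64 * (27/64) * (3/4)" using d3 d34 d0 by (intro mult_mono) auto
    finally show ?thesis .
  qed
  have x0: "0 \<le> 1 - 8/5 * \<delta> ^ 4 - \<delta> / 100"
  proof -
    have "\<delta> ^ 4 = \<delta> ^ 3 * \<delta>" by (simp add: eval_nat_numeral)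
    also have "\<dots> \<le> 27/64 * (3/4)" using d3 d34 d0 by (intro mult_mono) auto
    finally show ?thesis using d34 by linarith
  qed
  have prod: "1 - u - v \<le> (1 - u) * (1 - v)" if "0 \<le> u" "0 \<le> v" for u v :: real
    using that by (simp add: algebra_simps)
  have key: "(1 - \<delta>) * (1 + \<epsilon>) \<le> (1 - \<delta> / 800 - \<delta> / 8) - (8/5 * \<delta> ^ 4 + \<delta> / 100)"
  proof -
    have "8/5 * \<delta> ^ 3 + \<delta> ^ 7 + 1/8 + 1/800 + 1/100 \<le> 1" using d3 d7 by simp
    then have "\<delta> * (8/5 * \<delta> ^ 3 + \<delta> ^ 7 + 1/8 + 1/800 + 1/100) \<le> \<delta> * 1" using d0 by (intro mult_left_mono) auto
    moreover have "\<delta> * \<delta> ^ 3 = \<delta> ^ 4" "\<delta> * \<delta> ^ 7 = \<delta> ^ 8" by (simp_all add: eval_nat_numeral)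
    moreover have "0 \<le> \<delta> * \<epsilon>" using d0 e by simp
    ultimately show ?thesis by (simp add: d8 algebra_simps)
  qed
  have "(1 - \<delta>) * (1 + \<epsilon>) \<le> (1 - \<delta> / 800) * (1 - \<delta> / 8) * (1 - (8/5 * \<delta> ^ 4 + \<delta> / 100))"
  proof -
    define u v w where "u = \<delta> / 800" and "v = \<delta> / 8" and "w = 8/5 * \<delta> ^ 4 + \<delta> / 100"
    have nn: "0 \<le> u" "0 \<le> v" "0 \<le> w" "w \<le> 1" using d0 x0 by (auto simp: u_def v_def w_def)
    have "1 - (u + v) - w \<le> (1 - (u + v)) * (1 - w)" using nn by (intro prod) auto
    also have "\<dots> \<le> ((1 - u) * (1 - v)) * (1 - w)" using prod[OF nn(1,2)] nn by (intro mult_right_mono) auto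
    finally show ?thesis using key by (simp add: u_def v_def w_def)
  qed
  then have "(1 - \<delta>) * (1 + \<epsilon>) * m \<le> (1 - \<delta> / 800) * (1 - \<delta> / 8) * (1 - (8/5 * \<delta> ^ 4 + \<delta> / 100)) * m"
    using m0 by (intro mult_right_mono) auto
  also have "\<dots> = (1 - \<delta> / 800) * ((1 - \<delta> / 8) * ((1 - 8/5 * \<delta> ^ 4 - \<delta> / 100) * m))" by simp
  also have "\<dots> \<le> (1 - 1 / K) * ((1 - 3 / B) * r)"
  proof (intro mult_mono)
    show "1 - \<delta> / 800 \<le> 1 - 1 / K" "1 - \<delta> / 8 \<le> 1 - 3 / B" using a b by auto
    show "0 \<le> 1 - 1 / real K" "0 \<le> 1 - 3 / real B" using a b d34 by auto
    show c0: "0 \<le> (1 - 8/5 * \<delta> ^ 4 - \<delta> / 100) * m" using x0 m0 by simp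
    show "0 \<le> (1 - \<delta> / 8) * ((1 - 8/5 * \<delta> ^ 4 - \<delta> / 100) * m)"
      by (rule mult_nonneg_nonneg[OF _ c0]) (use d34 in simp)
  qed (rule r1)
  finally show "(1 - \<delta>) * ((1 + \<epsilon>) * m) \<le> (1 - 1 / K) * ((1 - 3 / B) * r)" by (simp add: mult.assoc)
qed

lemma hamilton_decomposition_large:
  fixes D :: "('a, 'b) pre_digraph" and \<epsilon> p :: real
  assumes D: "digraph D" and u: "uniform_digraph \<epsilon> p D" and n: "n = card (verts D)"
    and p_small: "0 < p" "p < 1/10" and e_small: "0 < \<epsilon>" "\<epsilon> < 1/10"
    and big: "10 ^ 42 \<le> ln (real n)" and gr: "ln (real n) ^ 5 \<le> \<epsilon> ^ 11 * real n * p ^ 8"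
  shows "\<exists>\<C>. (\<forall>c\<in>\<C>. hamilton_cycle D c) \<and> pairwise (\<lambda>c c'. set c \<inter> set c' = {}) \<C> \<and>
    real (card (arcs D - (\<Union>c\<in>\<C>. set c))) \<le> \<epsilon> powr (1/8) * real (card (arcs D))"
proof -
  interpret digraph D by (rule D)
  interpret uniform_relation "verts D" "arcs_ends D" "real n" p \<epsilon>
    unfolding n by (rule uniform_relation_arcs_ends[OF u p_small e_small])
  have n1: "1 < real n"
  proof (rule ccontr)
    assume "\<not> 1 < real n"
    then have "n = 0 \<or> n = 1" by auto
    then show False using big by auto
  qed
  have n20: "20 \<le> real n"
  proof -
    have "ln (real n) \<le> real n - 1" using n1 by (intro ln_le_minus_one) auto
    then show ?thesis using big by simp
  qed
  obtain K B where KB: "prime K" "8 \<le> K" "6 \<le> B" "40000 * real B ^ 2 \<le> K * p"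
    "20000000000 * real K ^ 3 * real B ^ 4 * ln (real n) \<le> n * p ^ 5" "24 \<le> B * \<epsilon> powr (1/8)"
    "3 \<le> \<epsilon>\<^sup>2 * (n * p\<^sup>2)" "100 \<le> \<epsilon> powr (1/8) * (n * p)"
    using packing_parameters[OF p_small e_small n1 refl big gr refl] by blast
  define r where "r = nat \<lfloor>(1 - 8/5 * sqrt \<epsilon>) * (real n * p)\<rfloor>"
  have ln1: "1 \<le> ln (real n)" using big by simp
  obtain S :: "(nat \<times> nat) set" and cyc where S: "finite S" "(1 - 1 / K) * ((1 - 3 / B) * r) \<le> card S"
    and cyc: "\<forall>\<sigma>\<in>S. distinct (cyc \<sigma>) \<and> set (cyc \<sigma>) = verts D \<and> cyclic_arcs (cyc \<sigma>) \<subseteq> arcs_ends D"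
    and dj: "\<forall>\<sigma>\<in>S. \<forall>\<tau>\<in>S. \<sigma> \<noteq> \<tau> \<longrightarrow> cyclic_arcs (cyc \<sigma>) \<inter> cyclic_arcs (cyc \<tau>) = {}"
    using hamilton_packing[OF KB(1-5) ln1 n20 KB(7) r_def] by (elim exE conjE)
  have K100: "100 * real B \<le> K"
  proof -
    have "100 * real B \<le> 40000 * real B ^ 2" using KB(3) by (simp add: power2_eq_square)
    also have "\<dots> \<le> K * p" by (rule KB(4))
    also have "\<dots> \<le> K" using p_small by (intro mult_left_le) auto
    finally show ?thesis .
  qed
  note many = enough_cycles[OF e_small refl KB(6) K100 KB(8) r_def]
  show ?thesis
  proof (rule uncovered_arcs[OF _ S(1), where cyc = cyc and b = "(1 + \<epsilon>) * (n * p)"])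
    show "verts D \<noteq> {}" using n n1 by auto
    show "(1 - \<epsilon> powr (1/8)) * ((1 + \<epsilon>) * (n * p)) \<le> card S" using many(1) S(2) by linarith
    show "\<epsilon> powr (1/8) \<le> 1" by (rule many(2))
    show "real (out_degree D v) \<le> (1 + \<epsilon>) * (n * p)" if "v \<in> verts D" for v
      using out[OF that] by (simp add: out_degree_arcs_ends)
    show "distinct (cyc \<sigma>) \<and> set (cyc \<sigma>) = verts D \<and> cyclic_arcs (cyc \<sigma>) \<subseteq> arcs_ends D" if "\<sigma> \<in> S" for \<sigma>
      using cyc that by blast
    show "cyclic_arcs (cyc \<sigma>) \<inter> cyclic_arcs (cyc \<tau>) = {}" if "\<sigma> \<in> S" "\<tau> \<in> S" "\<sigma> \<noteq> \<tau>" for \<sigma> \<tau>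
      using dj that by blast
  qed
qed

theorem theorem1p6:
  fixes \<epsilon> p :: "nat \<Rightarrow> real"
  assumes small: "\<forall>\<^sub>F n in sequentially. 0 < \<epsilon> n \<and> \<epsilon> n < 1/10 \<and> 0 < p n \<and> p n < 1/10"
    and growth: "filterlim (\<lambda>n. (\<epsilon> n ^ 11 * real n * p n ^ 8) / ln (real n) ^ 5) at_top sequentially"
  shows "\<forall>\<^sub>F n in sequentially. even n \<longrightarrow>
    (\<forall>D :: ('a, 'b) pre_digraph.
       digraph D \<and> card (verts D) = n \<and> uniform_digraph (\<epsilon> n) (p n) D \<longrightarrow>
       (\<exists>\<C> :: 'b awalk set.
          (\<forall>c \<in> \<C>. hamilton_cycle D c) \<and>
          pairwise (\<lambda>c c'. set c \<inter> set c' = {}) \<C> \<and>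
          real (card (arcs D - (\<Union>c \<in> \<C>. set c))) \<le> \<epsilon> n powr (1/8) * real (card (arcs D))))"
proof -
  have "filterlim (\<lambda>n. ln (real n)) at_top sequentially" by real_asymp
  then have "\<forall>\<^sub>F n in sequentially. 10 ^ 42 \<le> ln (real n)" by (simp only: filterlim_at_top)
  moreover have "\<forall>\<^sub>F n in sequentially. 1 \<le> (\<epsilon> n ^ 11 * real n * p n ^ 8) / ln (real n) ^ 5"
    using growth by (simp only: filterlim_at_top)
  ultimately show ?thesis using small
  proof eventually_elim
    case (elim n)
    have "0 < ln (real n)" using elim(1) by (rule less_le_trans[rotated]) simp
    then have "ln (real n) ^ 5 \<le> \<epsilon> n ^ 11 * real n * p n ^ 8" using elim(2) by (simp add: pos_le_divide_eq)
    then show ?case using hamilton_decomposition_large elim(1,3) by blast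
  qed
qed

end
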